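(* Let $G$ be a planar graph. (i) If $g(G)\ge 13$, then $\chi_s(G)\leq 4$. (ii) If $g(G)\ge 9$, then $\chi_s(G)\leq 5$. (iii) If $g(G)\ge 8$, then $\chi_s(G)\leq 6$.
   Context: Graphs are finite and simple. A proper vertex coloring of a graph is a star coloring if the union of every two color classes induces a star forest, i.e. a graph each of whose connected components is a star $K_{1,m}$ with $m\ge 0$ (equivalently, no path on four vertices, as a not necessarily induced subgraph, is colored with only two colors). The star chromatic number $\chi_s(G)$ is the smallest $k$ such that $G$ has a star coloring using $k$ colors. The girth $g(G)$ is the length of a shortest cycle in $G$ (with $g(G)=\infty$ if $G$ has no cycle). *)

theory Defs
  imports "HOL-Analysis.Analysis" "Graph_Theory.Graph_Theory"
begin

text \<open>
  A finite simple graph is a symmetric digraph satisfying \<^locale>\<open>graph\<close>: every undirected edge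
  is a pair of opposite arcs, and the edges are the sets \<open>{u, v}\<close> with \<open>(u, v) \<in> arcs_ends G\<close>.
\<close>

text \<open>
  A plane drawing: \<open>f\<close> places the vertices and \<open>\<gamma> {u, v}\<close> is a simple arc joining the two ends of
  the edge \<open>{u, v}\<close>; drawn edges meet other vertices and other edges only in common ends.
\<close>

definition planar :: "('a, 'b) pre_digraph \<Rightarrow> bool" where
  "planar G \<longleftrightarrow>
    (\<exists>(f :: 'a \<Rightarrow> complex) (\<gamma> :: 'a set \<Rightarrow> real \<Rightarrow> complex).
      inj_on f (verts G) \<and>
      (\<forall>(u, v) \<in> arcs_ends G.
        arc (\<gamma> {u, v}) \<and>
        {pathstart (\<gamma> {u, v}), pathfinish (\<gamma> {u, v})} = {f u, f v} \<and>
        path_image (\<gamma> {u, v}) \<inter> f ` verts G = {f u, f v}) \<and>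
      (\<forall>(u, v) \<in> arcs_ends G. \<forall>(x, y) \<in> arcs_ends G. {u, v} \<noteq> {x, y} \<longrightarrow>
        path_image (\<gamma> {u, v}) \<inter> path_image (\<gamma> {x, y}) \<subseteq> f ` ({u, v} \<inter> {x, y})))"

text \<open>
  In a symmetric digraph the library's directed cycles include the walks \<open>u, v, u\<close> along a single
  edge; the length bound excludes exactly these.
  The infimum of the empty set in \<^typ>\<open>enat\<close> is \<open>\<infinity>\<close>.
\<close>

definition girth :: "('a, 'b) pre_digraph \<Rightarrow> enat" where
  "girth G = (INF p \<in> {p. pre_digraph.cycle G p \<and> 3 \<le> length p}. enat (length p))"

text \<open>
  For a symmetric digraph the strongly connected components are the connected components of the
  undirected graph.
\<close>

definition star_forest :: "('a, 'b) pre_digraph \<Rightarrow> bool" where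
  "star_forest G \<longleftrightarrow> (\<forall>C \<in> pre_digraph.sccs G. \<exists>m. K\<^bsub>1,m\<^esub> C)"

definition proper_coloring :: "('a, 'b) pre_digraph \<Rightarrow> ('a \<Rightarrow> nat) \<Rightarrow> bool" where
  "proper_coloring G c \<longleftrightarrow> (\<forall>(u, v) \<in> arcs_ends G. c u \<noteq> c v)"

definition star_coloring :: "('a, 'b) pre_digraph \<Rightarrow> ('a \<Rightarrow> nat) \<Rightarrow> bool" where
  "star_coloring G c \<longleftrightarrow>
    proper_coloring G c \<and>
    (\<forall>i j. i \<noteq> j \<longrightarrow> star_forest (induce_subgraph G {v \<in> verts G. c v = i \<or> c v = j}))"

text \<open>
  An injective coloring of a finite graph is a star coloring, so for finite graphs the least such
  \<open>k\<close> exists.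
\<close>

definition star_chromatic_number :: "('a, 'b) pre_digraph \<Rightarrow> nat" where
  "star_chromatic_number G = (LEAST k. \<exists>c. star_coloring G c \<and> c ` verts G \<subseteq> {..<k})"

end

theory Submission
  imports Defs "HOL-Complex_Analysis.Complex_Analysis"
begin

text \<open>
  Euler's formula bounds the number of edges of every subgraph: a planar graph of girth at least \<open>g\<close> has fewer
  than \<open>g n / (g - 2)\<close> edges on any \<open>n\<close> vertices. It follows from the Jordan curve theorem by building each
  2-connected plane graph from a cycle by ears, each of which splits one face. A star coloring is the same as a
  proper coloring with an orientation in which every bicolored star points to its center, and in such colorings
  with out-degrees at most two the tree-like parts of a graph can be colored greedily: each colored vertex offers
  all but three colors to a new neighbor. In a minimal counterexample a vertex with too many such parts, that
  is, with too long paths of vertices of degree two at it, is therefore reducible. Discharging shows that a graph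
  without reducible configurations has more edges than Euler's formula permits. For five colors the induction
  also admits vertices restricted to out-degree one, which count less in the density.
\<close>


section \<open>Theta curves\<close>

text \<open>Planarity enters the colorings only through the density of all subgraphs. The edge bound
  has n - 1 where the classical count has n - 2: this form holds for a single vertex and is additive
  when two pieces share a cut vertex.

  A colored vertex excludes its own color and those of its out-neighbors, so k - 3 colors remain:
  three, two or one for k = 6, 5, 4. This shrinking slack dictates the methods. With three, colors
  can be picked greedily. With two, some ends of a configuration must offer a third color, which is
  arranged by restricting their out-degree in the smaller graph; if that would violate the weighted
  density, a nearly tight subgraph together with deleted vertices contradicts sparseness. With one,
  counting is useless, so a branch is summarized by two relations between the color of its root and
  that of the vertex it hangs at, one for each order of coloring. Properties of these relations are
  followed up the tree until enough of them meet at a vertex.\<close>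

definition theta :: "(real \<Rightarrow> complex) \<Rightarrow> (real \<Rightarrow> complex) \<Rightarrow> complex \<Rightarrow> complex \<Rightarrow> bool" where
  "theta c d a b \<longleftrightarrow> arc c \<and> arc d \<and> pathstart c = a \<and> pathfinish c = b \<and> pathstart d = a \<and> pathfinish d = b
     \<and> a \<noteq> b \<and> path_image c \<inter> path_image d = {a, b}"

lemma theta_loop:
  assumes "theta c d a b"
  shows "simple_path (c +++ reversepath d)" "pathfinish (c +++ reversepath d) = pathstart (c +++ reversepath d)"
    "path_image (c +++ reversepath d) = path_image c \<union> path_image d"
  using assms by (auto simp: theta_def simple_path_join_loop_eq path_image_join arc_reversepath)

lemma theta_commute: "theta c d a b \<Longrightarrow> theta d c a b"
  by (auto simp: theta_def)

lemma theta_Jordan: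
  assumes "theta c d a b"
  defines "K \<equiv> path_image c \<union> path_image d"
  shows "inside K \<noteq> {}" "open (inside K)" "topological_space_class.connected (inside K)" "open (outside K)"
    "inside K \<inter> outside K = {}" "inside K \<union> outside K = - K" "frontier (inside K) = K"
  using Jordan_inside_outside[OF theta_loop(1,2)[OF assms(1)]]
  unfolding theta_loop(3)[OF assms(1)] K_def by auto

text \<open>The winding number of the loop is additive over its two arcs, so its value inside, and
  the value zero outside in the next lemma, become statements about the difference of the arcs. This
  lets three arcs with common ends be compared pairwise.\<close>

lemma theta_winding_inside:
  assumes "theta c d a b" "z \<in> inside (path_image c \<union> path_image d)"
  shows "winding_number c z - winding_number d z \<in> {1, -1}"
proof -
  have z: "z \<notin> path_image c" "z \<notin> path_image d"
    using assms(2) inside_no_overlap by blast+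
  have "winding_number (c +++ reversepath d) z \<in> {1, -1}"
    using simple_closed_path_winding_number_inside[OF theta_loop(1)[OF assms(1)]] assms(2)
    unfolding theta_loop(3)[OF assms(1)] by blast
  moreover have "winding_number (c +++ reversepath d) z = winding_number c z - winding_number d z"
    using assms(1) z
    by (subst winding_number_join) (auto simp: theta_def winding_number_reversepath arc_imp_path)
  ultimately show ?thesis by simp
qed

lemma theta_winding_outside:
  assumes "theta c d a b" "z \<in> outside (path_image c \<union> path_image d)"
  shows "winding_number c z = winding_number d z"
proof -
  have z: "z \<notin> path_image c" "z \<notin> path_image d"
    using assms(2) outside_no_overlap by blast+
  have "winding_number (c +++ reversepath d) z = 0"
    using theta_loop(1,2)[OF assms(1)] assms(2) winding_number_zero_in_outside simple_path_imp_path
    unfolding theta_loop(3)[OF assms(1), symmetric] by blast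
  moreover have "winding_number (c +++ reversepath d) z = winding_number c z - winding_number d z"
    using assms(1) z
    by (subst winding_number_join) (auto simp: theta_def winding_number_reversepath arc_imp_path)
  ultimately show ?thesis by simp
qed

lemma connected_in_component:
  assumes "theta c d a b" "topological_space_class.connected T" "T \<inter> (path_image c \<union> path_image d) = {}"
  shows "T \<subseteq> inside (path_image c \<union> path_image d) \<or> T \<subseteq> outside (path_image c \<union> path_image d)"
proof -
  let ?K = "path_image c \<union> path_image d"
  have "open (inside ?K)" "open (outside ?K)" "inside ?K \<inter> outside ?K = {}" "inside ?K \<union> outside ?K = - ?K"
    using theta_Jordan[OF assms(1)] by simp_all
  moreover have "T \<subseteq> inside ?K \<union> outside ?K" using calculation(4) assms(3) by blast
  ultimately have "inside ?K \<inter> T = {} \<or> outside ?K \<inter> T = {}"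
    using connectedD[OF assms(2), of "inside ?K" "outside ?K"] by blast
  then show ?thesis using \<open>T \<subseteq> inside ?K \<union> outside ?K\<close> by blast
qed

text \<open>Of three arcs with common ends some arc meets the inside of the curve formed by the
  other two. If none did, a point inside \<open>c1\<close> and \<open>c2\<close> would be outside
  both other curves, so all three arcs would have the same winding number around it, against the
  difference of plus or minus one for \<open>c1\<close> and \<open>c2\<close>.\<close>

lemma theta_outer:
  assumes 12: "theta c1 c2 a b" and 1: "theta c1 c a b" and 2: "theta c2 c a b"
    and "path_image c \<inter> inside (path_image c1 \<union> path_image c2) = {}"
  shows "path_image c2 \<inter> inside (path_image c1 \<union> path_image c) \<noteq> {} \<or>
         path_image c1 \<inter> inside (path_image c2 \<union> path_image c) \<noteq> {}"
proof (rule ccontr)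
  assume *: "\<not> ?thesis"
  let ?D = "inside (path_image c1 \<union> path_image c2)"
  have D: "topological_space_class.connected ?D" "?D \<noteq> {}" "frontier ?D = path_image c1 \<union> path_image c2"
    using theta_Jordan[OF 12] by simp_all
  have key: "?D \<subseteq> outside (path_image d1 \<union> path_image c)"
    if d: "theta d1 c a b" "path_image d2 \<inter> inside (path_image d1 \<union> path_image c) = {}"
      "theta d2 c a b" "theta d1 d2 a b" "path_image d1 \<union> path_image d2 = path_image c1 \<union> path_image c2" for d1 d2
  proof -
    have "?D \<inter> (path_image d1 \<union> path_image c) = {}"
      using assms(4) inside_no_overlap[of "path_image c1 \<union> path_image c2"] d(5) by blast
    then consider "?D \<subseteq> inside (path_image d1 \<union> path_image c)" | "?D \<subseteq> outside (path_image d1 \<union> path_image c)"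
      using connected_in_component[OF d(1) D(1)] by blast
    then show ?thesis
    proof cases
      \<comment> \<open>The arc \<open>d2\<close> lies in the frontier of \<open>?D\<close>, hence
        in the closure of the inside of \<open>d1\<close> and \<open>c\<close>. Not meeting that
        inside, it would be contained in the curve, which it meets only in its ends.\<close>
      case 1
      have "path_image d2 \<subseteq> closure ?D" using D(3) d(5) by (auto simp: frontier_def)
      also have "\<dots> \<subseteq> closure (inside (path_image d1 \<union> path_image c))" using 1 by (rule closure_mono)
      also have "\<dots> \<subseteq> inside (path_image d1 \<union> path_image c) \<union> frontier (inside (path_image d1 \<union> path_image c))"
        by (auto simp: frontier_def dest: interior_subset[THEN subsetD])
      also have "frontier (inside (path_image d1 \<union> path_image c)) = path_image d1 \<union> path_image c"
        using theta_Jordan[OF d(1)] by blast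
      finally have "path_image d2 \<subseteq> path_image d1 \<union> path_image c" using d(2) by blast
      then have "path_image d2 \<subseteq> {a, b}" using d(3,4) by (auto simp: theta_def)
      moreover have "path_image d2 - {a, b} \<noteq> {}"
        using d(3) nonempty_simple_path_endless[of d2] by (auto simp: theta_def arc_imp_simple_path)
      ultimately show ?thesis by blast
    qed
  qed
  have "?D \<subseteq> outside (path_image c1 \<union> path_image c)" "?D \<subseteq> outside (path_image c2 \<union> path_image c)"
    using key[OF 1 _ 2 12] key[OF 2 _ 1 theta_commute[OF 12]] * by auto
  moreover obtain z where z: "z \<in> ?D" using D(2) by auto
  ultimately have "winding_number c1 z = winding_number c z" "winding_number c2 z = winding_number c z"
    using theta_winding_outside[OF 1] theta_winding_outside[OF 2] by auto
  then show False using theta_winding_inside[OF 12 z] by auto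
qed

lemma theta_split:
  assumes 12: "theta c1 c2 a b" and 1: "theta c1 c a b" and 2: "theta c2 c a b"
    and "path_image c \<inter> inside (path_image c1 \<union> path_image c2) \<noteq> {}"
  shows "inside (path_image c1 \<union> path_image c) \<inter> inside (path_image c2 \<union> path_image c) = {}"
    "inside (path_image c1 \<union> path_image c) \<union> inside (path_image c2 \<union> path_image c) \<union>
      (path_image c - {a, b}) = inside (path_image c1 \<union> path_image c2)"
proof -
  have "simple_path c1" "simple_path c2" "simple_path c" using assms by (auto simp: theta_def arc_imp_simple_path)
  then obtain "inside (path_image c1 \<union> path_image c) \<inter> inside (path_image c2 \<union> path_image c) = {}"
    "inside (path_image c1 \<union> path_image c) \<union> inside (path_image c2 \<union> path_image c) \<union>
      (path_image c - {a, b}) = inside (path_image c1 \<union> path_image c2)"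
    using split_inside_simple_closed_curve[of c1 a b c2 c] assms unfolding theta_def by metis
  then show "inside (path_image c1 \<union> path_image c) \<inter> inside (path_image c2 \<union> path_image c) = {}"
    "inside (path_image c1 \<union> path_image c) \<union> inside (path_image c2 \<union> path_image c) \<union>
      (path_image c - {a, b}) = inside (path_image c1 \<union> path_image c2)" by auto
qed

section \<open>Paths and cycles in a set of edges\<close>

fun ed :: "'a list \<Rightarrow> 'a set set" where
  "ed (x # y # zs) = insert {x, y} (ed (y # zs))"
| "ed _ = {}"

lemma ed_Cons: "zs \<noteq> [] \<Longrightarrow> ed (x # zs) = insert {x, hd zs} (ed zs)"
  by (cases zs) auto

lemma ed_append: "xs \<noteq> [] \<Longrightarrow> ys \<noteq> [] \<Longrightarrow> ed (xs @ ys) = ed xs \<union> insert {last xs, hd ys} (ed ys)"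
  by (induction xs rule: ed.induct) (auto simp: ed_Cons)

lemma ed_overlap: "ed (xs @ [y]) \<union> ed (y # ys) = ed (xs @ y # ys)"
proof (cases "xs = []")
  case False
  then show ?thesis using ed_append[of xs "[y]"] ed_append[of xs "y # ys"] by auto
qed simp

lemma ed_rev: "ed (rev xs) = ed xs"
  by (induction xs rule: ed.induct) (simp_all add: ed_append insert_commute last_rev del: append_assoc)

lemma ed_subset: "e \<in> ed xs \<Longrightarrow> e \<subseteq> set xs"
  by (induction xs rule: ed.induct) auto

lemma finite_ed [simp]: "finite (ed xs)"
  by (induction xs rule: ed.induct) auto

text \<open>A repetition-free list has an edge joining its two ends only if it is that edge. So the
  closing edge of a cycle is new, and internally disjoint paths with common ends share no edge
  unless both are a single edge.\<close>

lemma ed_mid: "e \<in> ed xs \<Longrightarrow> distinct xs \<Longrightarrow> last xs \<in> e \<Longrightarrow> hd xs \<in> e \<Longrightarrow> length xs = 2"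
proof (induction xs rule: ed.induct)
  case (1 x y zs)
  show ?case
  proof (cases "e = {x, y}")
    case True
    then show ?thesis using 1 by (cases zs) (auto split: if_splits)
  next
    case False
    then show ?thesis using 1 ed_subset by fastforce
  qed
qed auto

lemma Union_ed: "2 \<le> length xs \<Longrightarrow> \<Union> (ed xs) = set xs"
proof (induction xs rule: ed.induct)
  case (1 x y zs)
  then show ?case by (cases zs) auto
qed auto

lemma card_ed: "distinct xs \<Longrightarrow> card (ed xs) = length xs - 1"
proof (induction xs rule: ed.induct)
  case (1 x y zs)
  have "{x, y} \<notin> ed (y # zs)" using 1 ed_subset by fastforce
  then show ?case using 1 by auto
qed auto

definition gpath :: "'a set set \<Rightarrow> 'a list \<Rightarrow> bool" where
  "gpath Ed p \<longleftrightarrow> p \<noteq> [] \<and> distinct p \<and> ed p \<subseteq> Ed"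

text \<open>A cycle seen from two of its vertices. Disjointness of the edge sets only excludes that
  both paths are the single edge from \<open>a\<close> to \<open>b\<close>.\<close>

definition cyc2 :: "'a set set \<Rightarrow> 'a \<Rightarrow> 'a \<Rightarrow> 'a list \<Rightarrow> 'a list \<Rightarrow> bool" where
  "cyc2 Ed a b p q \<longleftrightarrow> gpath Ed p \<and> gpath Ed q \<and> hd p = a \<and> hd q = a \<and> last p = b \<and> last q = b \<and> a \<noteq> b
     \<and> set p \<inter> set q = {a, b} \<and> ed p \<inter> ed q = {}"

definition is_cyc :: "'a set set \<Rightarrow> 'a set \<Rightarrow> 'a set set \<Rightarrow> bool" where
  "is_cyc Ed VC EC \<longleftrightarrow> (\<exists>vs. distinct vs \<and> 3 \<le> length vs \<and> VC = set vs \<and> EC = ed (vs @ [hd vs]) \<and> EC \<subseteq> Ed)"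

lemma gpath_ends:
  assumes "gpath Ed p" "hd p \<noteq> last p"
  obtains m where "p = hd p # m @ [last p]"
proof -
  have "tl p \<noteq> []" using assms by (cases p) (auto simp: gpath_def)
  then show ?thesis using assms that[of "butlast (tl p)"]
    by (metis append_butlast_last_id gpath_def last_tl list.collapse)
qed

lemma cyc2_is_cyc:
  assumes "cyc2 Ed a b p q"
  shows "is_cyc Ed (set p \<union> set q) (ed p \<union> ed q)"
proof -
  obtain m where m: "p = a # m @ [b]" using gpath_ends[of Ed p] assms unfolding cyc2_def by metis
  obtain n where n: "q = a # n @ [b]" using gpath_ends[of Ed q] assms unfolding cyc2_def by metis
  let ?vs = "a # m @ b # rev n"
  have d: "distinct p" "distinct q" "set p \<inter> set q = {a, b}" "ed p \<inter> ed q = {}" "ed p \<union> ed q \<subseteq> Ed" "a \<noteq> b"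
    using assms by (auto simp: cyc2_def gpath_def)
  have "m \<noteq> [] \<or> n \<noteq> []" using d(4) m n by auto
  then have "3 \<le> length ?vs" by (cases m; cases n) auto
  moreover have "distinct ?vs" using d m n by auto
  moreover have "set ?vs = set p \<union> set q" using m n by auto
  moreover have "ed (?vs @ [hd ?vs]) = ed p \<union> ed q"
  proof -
    have "ed (?vs @ [hd ?vs]) = ed ((a # m) @ b # (rev n @ [a]))" by simp
    also have "\<dots> = ed ((a # m) @ [b]) \<union> ed (b # (rev n @ [a]))" using ed_overlap by metis
    also have "b # (rev n @ [a]) = rev q" using n by simp
    finally show ?thesis using m by (simp add: ed_rev)
  qed
  ultimately show ?thesis unfolding is_cyc_def using d(5) by metis
qed

lemma is_cyc_cyc2:
  assumes "is_cyc Ed VC EC" "a \<in> VC" "b \<in> VC" "a \<noteq> b"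
  obtains p q where "cyc2 Ed a b p q" "VC = set p \<union> set q" "EC = ed p \<union> ed q"
proof -
  obtain vs where vs: "distinct vs" "3 \<le> length vs" "VC = set vs" "EC = ed (vs @ [hd vs])" "EC \<subseteq> Ed"
    using assms(1) by (auto simp: is_cyc_def)
  obtain ys zs where yz: "vs = ys @ a # zs" using assms(2) vs(3) by (metis split_list)
  \<comment> \<open>The cycle is rotated to start at \<open>a\<close>.\<close>
  define us where "us = zs @ ys"
  have EC: "EC = ed (a # us @ [a])"
  proof (cases "ys = []")
    case False
    then obtain h ys' where ys: "ys = h # ys'" by (cases ys) auto
    have "EC = ed (ys @ [a]) \<union> ed (a # zs @ [h])" using vs(4) yz ys ed_overlap[of ys a "zs @ [h]"] by simp
    moreover have "ed ((a # zs) @ h # (ys' @ [a])) = ed ((a # zs) @ [h]) \<union> ed (h # (ys' @ [a]))"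
      using ed_overlap by metis
    ultimately show ?thesis using ys by (simp add: us_def Un_commute)
  qed (use vs yz us_def in auto)
  have "b \<in> set us" using assms vs yz us_def by auto
  then obtain m n where mn: "us = m @ b # n" by (metis split_list)
  let ?p = "a # m @ [b]" and ?q = "rev (b # n @ [a])"
  have E2: "EC = ed ?p \<union> ed ?q"
    using EC mn ed_overlap[of "a # m" b "n @ [a]"] by (simp only: ed_rev append_Cons append_assoc)
  have d: "distinct (a # m @ b # n)" using vs(1) yz us_def mn by auto
  have len: "3 \<le> length (a # m @ b # n)" using vs(2) yz us_def mn by (metis (no_types, lifting) add.commute length_Cons length_append add_Suc_right)
  \<comment> \<open>A common edge would join \<open>a\<close> and \<open>b\<close>, and then both
    paths would be that edge, leaving fewer than three vertices.\<close>
  have "ed ?p \<inter> ed ?q = {}"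
  proof (rule ccontr)
    assume "ed ?p \<inter> ed ?q \<noteq> {}"
    then obtain e where e: "e \<in> ed ?p" "e \<in> ed ?q" by blast
    have sub: "e \<subseteq> {a, b}" using ed_subset[OF e(1)] ed_subset[OF e(2)] d by auto
    have two: "card e' = 2" if "e' \<in> ed xs" "distinct xs" for e' and xs :: "'a list"
      using that by (induction xs rule: ed.induct) auto
    have "card e = 2" using two[OF e(1)] d by auto
    then have "e = {a, b}" using sub assms(4) by (metis card_2_iff card_subset_eq finite.emptyI finite.insertI)
    then have "length ?p = 2" "length ?q = 2" using ed_mid[OF e(1)] ed_mid[OF e(2)] d by auto
    then show False using len by auto
  qed
  then have "cyc2 Ed a b ?p ?q" unfolding cyc2_def gpath_def using d E2 vs(5) by auto
  moreover have "VC = set ?p \<union> set ?q"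
  proof -
    have "VC = insert a (set us)" using vs(3) yz us_def by auto
    then show ?thesis using mn by auto
  qed
  ultimately show ?thesis using E2 that by blast
qed

lemma is_cyc_card: "is_cyc Ed VC EC \<Longrightarrow> card EC = card VC \<and> 3 \<le> card VC \<and> finite VC \<and> finite EC"
proof -
  assume "is_cyc Ed VC EC"
  then obtain vs where vs: "distinct vs" "3 \<le> length vs" "VC = set vs" "EC = ed (vs @ [hd vs])"
    by (auto simp: is_cyc_def)
  obtain a us where us: "vs = a # us" "us \<noteq> []" using vs(2) by (cases vs; cases "tl vs") auto
  have "ed (vs @ [hd vs]) = insert {last us, a} (ed (a # us))" using us ed_append[of vs "[a]"] by auto
  moreover have "{last us, a} \<notin> ed (a # us)"
    using ed_mid[of "{last us, a}" "a # us"] us vs by auto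
  ultimately have "card EC = length vs" using vs card_ed[of "a # us"] us by auto
  then show ?thesis using vs distinct_card by fastforce
qed

lemma is_cyc_other: "is_cyc Ed VC EC \<Longrightarrow> \<exists>c\<in>VC. c \<noteq> w"
proof (rule ccontr)
  assume C: "is_cyc Ed VC EC" and "\<not> (\<exists>c\<in>VC. c \<noteq> w)"
  then have "VC \<subseteq> {w}" by auto
  then have "card VC \<le> card {w}" by (intro card_mono) auto
  then show False using is_cyc_card[OF C] by auto
qed

lemma reach_gpath:
  assumes "(u, w) \<in> {(s, t). {s, t} \<in> Ed \<and> s \<notin> X \<and> t \<notin> X}\<^sup>*" "u \<notin> X"
  obtains p where "gpath Ed p" "hd p = u" "last p = w" "set p \<inter> X = {}"
proof -
  from assms have "\<exists>p. gpath Ed p \<and> hd p = u \<and> last p = w \<and> set p \<inter> X = {}"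
  proof (induction rule: rtrancl_induct)
    case base
    then show ?case by (intro exI[of _ "[u]"]) (auto simp: gpath_def)
  next
    case (step y z)
    then obtain p where p: "gpath Ed p" "hd p = u" "last p = y" "set p \<inter> X = {}" by auto
    show ?case
    proof (cases "z \<in> set p")
      \<comment> \<open>A walk returning to its path is cut back to the earlier visit, which keeps
        the path simple.\<close>
      case True
      then obtain xs ys where xy: "p = xs @ z # ys" by (metis split_list)
      then have "ed (xs @ [z]) \<subseteq> ed p" using ed_overlap by (metis Un_upper1)
      then show ?thesis using p xy
        by (intro exI[of _ "xs @ [z]"]) (cases xs, auto simp: gpath_def)
    next
      case False
      then show ?thesis using p step
        by (intro exI[of _ "p @ [z]"]) (auto simp: gpath_def ed_append)
    qed
  qed
  then show ?thesis using that by blast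
qed

section \<open>Plane graphs\<close>

text \<open>The drawing is kept apart from the vertex and edge sets, so that subgraphs inherit it
  unchanged.\<close>

locale plane_graph =
  fixes V :: "'a set" and Ed :: "'a set set" and f :: "'a \<Rightarrow> complex" and \<gamma> :: "'a set \<Rightarrow> real \<Rightarrow> complex"
  assumes finite_V: "finite V"
    and edge: "e \<in> Ed \<Longrightarrow> \<exists>u v. e = {u, v} \<and> u \<in> V \<and> v \<in> V \<and> u \<noteq> v"
    and inj_f: "inj_on f V"
    and arc_edge: "e \<in> Ed \<Longrightarrow> arc (\<gamma> e)"
    and ends_edge: "e \<in> Ed \<Longrightarrow> {pathstart (\<gamma> e), pathfinish (\<gamma> e)} = f ` e"
    and edge_verts: "e \<in> Ed \<Longrightarrow> path_image (\<gamma> e) \<inter> f ` V = f ` e"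
    and edge_edge: "e \<in> Ed \<Longrightarrow> e' \<in> Ed \<Longrightarrow> e \<noteq> e' \<Longrightarrow> path_image (\<gamma> e) \<inter> path_image (\<gamma> e') \<subseteq> f ` (e \<inter> e')"
begin

definition img :: "'a set set \<Rightarrow> complex set" where
  "img A = (\<Union>e\<in>A. path_image (\<gamma> e))"

lemma finite_Ed: "finite Ed"
proof -
  have "Ed \<subseteq> Pow V" using edge by fastforce
  then show ?thesis using finite_V finite_subset by blast
qed

lemma edge_subset: "e \<in> Ed \<Longrightarrow> e \<subseteq> V"
  using edge by fastforce

lemma Union_Ed: "A \<subseteq> Ed \<Longrightarrow> \<Union>A \<subseteq> V"
  using edge_subset by blast

lemma gpath_V: "gpath Ed p \<Longrightarrow> 2 \<le> length p \<Longrightarrow> set p \<subseteq> V"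
  using Union_ed Union_Ed unfolding gpath_def by metis

lemma img_V: "A \<subseteq> Ed \<Longrightarrow> img A \<inter> f ` V = f ` \<Union>A"
  using edge_verts by (auto simp: img_def) blast+

lemma img_mem: "A \<subseteq> Ed \<Longrightarrow> v \<in> V \<Longrightarrow> f v \<in> img A \<longleftrightarrow> v \<in> \<Union>A"
proof -
  assume A: "A \<subseteq> Ed" "v \<in> V"
  have "f v \<in> img A \<longleftrightarrow> f v \<in> f ` \<Union>A" using img_V[OF A(1)] A(2) by blast
  then show ?thesis using inj_onD[OF inj_f] Union_Ed[OF A(1)] A(2) by blast
qed

lemma img_disjoint: "A \<subseteq> Ed \<Longrightarrow> B \<subseteq> Ed \<Longrightarrow> A \<inter> B = {} \<Longrightarrow> img A \<inter> img B \<subseteq> f ` (\<Union>A \<inter> \<Union>B)"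
proof
  fix z assume A: "A \<subseteq> Ed" "B \<subseteq> Ed" "A \<inter> B = {}" and "z \<in> img A \<inter> img B"
  then obtain e e' where e: "e \<in> A" "e' \<in> B" "z \<in> path_image (\<gamma> e) \<inter> path_image (\<gamma> e')"
    by (auto simp: img_def)
  then have "z \<in> f ` (e \<inter> e')" using edge_edge[of e e'] A by blast
  then show "z \<in> f ` (\<Union>A \<inter> \<Union>B)" using e by blast
qed

text \<open>The arc of the first edge meets the rest of the path only in their common vertex, so the
  two join to an arc. The edge may have to be traversed backwards, as a drawing fixes no
  direction.\<close>

lemma arc_of_path:
  assumes "gpath Ed p" "2 \<le> length p"
  shows "\<exists>c. arc c \<and> pathstart c = f (hd p) \<and> pathfinish c = f (last p) \<and> path_image c = img (ed p)"
  using assms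
proof (induction p rule: ed.induct)
  case (1 x y zs)
  have e: "{x, y} \<in> Ed" using 1(2) by (auto simp: gpath_def)
  have "\<exists>c. arc c \<and> pathstart c = f x \<and> pathfinish c = f y \<and> path_image c = path_image (\<gamma> {x, y})"
  proof -
    have "f x \<noteq> f y" using edge[OF e] inj_onD[OF inj_f] by (metis doubleton_eq_iff)
    then consider "pathstart (\<gamma> {x, y}) = f x" "pathfinish (\<gamma> {x, y}) = f y" |
      "pathstart (\<gamma> {x, y}) = f y" "pathfinish (\<gamma> {x, y}) = f x"
      using ends_edge[OF e] by (auto simp: doubleton_eq_iff)
    then show ?thesis
    proof cases
      case 1
      then show ?thesis using arc_edge[OF e] by blast
    next
      case 2
      then show ?thesis using arc_edge[OF e]
        by (intro exI[of _ "reversepath (\<gamma> {x, y})"]) (auto simp: arc_reversepath)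
    qed
  qed
  then obtain c where c: "arc c" "pathstart c = f x" "pathfinish c = f y" "path_image c = path_image (\<gamma> {x, y})"
    by blast
  show ?case
  proof (cases zs)
    case Nil
    then show ?thesis using c by (auto simp: img_def)
  next
    case (Cons z zs')
    have g: "gpath Ed (y # zs)" using 1(2) by (auto simp: gpath_def)
    then obtain d where d: "arc d" "pathstart d = f y" "pathfinish d = f (last (y # zs))" "path_image d = img (ed (y # zs))"
      using 1 Cons by auto
    have "path_image c \<inter> path_image d \<subseteq> f ` (\<Union>{{x, y}} \<inter> \<Union>(ed (y # zs)))"
    proof -
      have "{x, y} \<notin> ed (y # zs)" using 1(2) ed_subset[of "{x, y}" "y # zs"] by (auto simp: gpath_def)
      then have "img {{x, y}} \<inter> img (ed (y # zs)) \<subseteq> f ` (\<Union>{{x, y}} \<inter> \<Union>(ed (y # zs)))"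
        using 1(2) by (intro img_disjoint) (auto simp: gpath_def)
      then show ?thesis using c(4) d(4) by (simp add: img_def)
    qed
    also have "\<dots> \<subseteq> {f y}" using 1(2) Union_ed[of "y # zs"] Cons by (auto simp: gpath_def)
    finally have "path_image c \<inter> path_image d \<subseteq> {pathstart d}" using d by simp
    then have "arc (c +++ d)" using arc_join c d by metis
    then show ?thesis using c d Cons
      by (intro exI[of _ "c +++ d"]) (auto simp: path_image_join img_def)
  qed
qed auto

definition parc :: "'a list \<Rightarrow> real \<Rightarrow> complex" where
  "parc p = (SOME c. arc c \<and> pathstart c = f (hd p) \<and> pathfinish c = f (last p) \<and> path_image c = img (ed p))"

lemma gpath_length: "gpath Ed p \<Longrightarrow> hd p \<noteq> last p \<Longrightarrow> 2 \<le> length p"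
  by (cases p; cases "tl p") (auto simp: gpath_def)

lemma parc:
  assumes "gpath Ed p" "hd p \<noteq> last p"
  shows "arc (parc p)" "pathstart (parc p) = f (hd p)" "pathfinish (parc p) = f (last p)" "path_image (parc p) = img (ed p)"
  using someI_ex[OF arc_of_path[OF assms(1) gpath_length[OF assms]]] by (auto simp: parc_def)

lemma theta_paths:
  assumes "cyc2 Ed a b p q"
  shows "theta (parc p) (parc q) (f a) (f b)"
proof -
  have h: "gpath Ed p" "gpath Ed q" "hd p \<noteq> last p" "hd q \<noteq> last q" "ed p \<subseteq> Ed" "ed q \<subseteq> Ed"
    and ends: "hd p = a" "last p = b" "hd q = a" "last q = b" "set p \<inter> set q = {a, b}" "a \<noteq> b" "ed p \<inter> ed q = {}"
    using assms by (auto simp: cyc2_def gpath_def)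
  note len = gpath_length[OF h(1,3)] gpath_length[OF h(2,4)]
  note c = parc[OF h(1,3)] and d = parc[OF h(2,4)]
  have ab: "a \<in> V" "b \<in> V" using ends gpath_V[OF h(1) len(1)] by auto
  have "path_image (parc p) \<inter> path_image (parc q) \<subseteq> f ` (\<Union>(ed p) \<inter> \<Union>(ed q))"
    unfolding c(4) d(4) using h ends by (intro img_disjoint) auto
  also have "\<dots> = {f a, f b}" using ends by (auto simp: Union_ed len)
  finally have "path_image (parc p) \<inter> path_image (parc q) \<subseteq> {f a, f b}" .
  moreover have "f a \<in> path_image (parc p)" "f b \<in> path_image (parc p)" "f a \<in> path_image (parc q)" "f b \<in> path_image (parc q)"
    using c(2,3) d(2,3) ends pathstart_in_path_image[of "parc p"] pathfinish_in_path_image[of "parc p"]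
      pathstart_in_path_image[of "parc q"] pathfinish_in_path_image[of "parc q"] by auto
  ultimately have "path_image (parc p) \<inter> path_image (parc q) = {f a, f b}" by auto
  moreover have "f a \<noteq> f b" using ab ends inj_onD[OF inj_f] by blast
  ultimately show ?thesis using c d ends unfolding theta_def by simp
qed

lemma theta_img: "cyc2 Ed a b p q \<Longrightarrow> path_image (parc p) \<union> path_image (parc q) = img (ed p \<union> ed q)"
  using parc(4)[of p] parc(4)[of q] by (auto simp: cyc2_def img_def)

abbreviation "is_C VC EC \<equiv> is_cyc Ed VC EC"

lemma is_C_sub: "is_C VC EC \<Longrightarrow> EC \<subseteq> Ed \<and> \<Union>EC = VC \<and> VC \<subseteq> V"
proof -
  assume C: "is_C VC EC"
  then obtain vs where vs: "distinct vs" "3 \<le> length vs" "VC = set vs" "EC = ed (vs @ [hd vs])" "EC \<subseteq> Ed"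
    by (auto simp: is_cyc_def)
  then have "\<Union>EC = VC" using Union_ed[of "vs @ [hd vs]"] by (cases vs) auto
  then show ?thesis using vs Union_Ed by blast
qed

lemma C_region:
  assumes "is_C VC EC"
  shows "open (inside (img EC))" "open (outside (img EC))" "inside (img EC) \<inter> outside (img EC) = {}"
    "inside (img EC) \<union> outside (img EC) = - img EC"
    "topological_space_class.connected T \<Longrightarrow> T \<inter> img EC = {} \<Longrightarrow> T \<subseteq> inside (img EC) \<or> T \<subseteq> outside (img EC)"
proof -
  obtain a b where ab: "a \<in> VC" "b \<in> VC" "a \<noteq> b" using is_cyc_other[OF assms] by metis
  obtain p q where pq: "cyc2 Ed a b p q" "EC = ed p \<union> ed q" using is_cyc_cyc2[OF assms ab] by metis
  note cd = theta_paths[OF pq(1)]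
  have "img EC = path_image (parc p) \<union> path_image (parc q)" using theta_img[OF pq(1)] pq by simp
  then show "open (inside (img EC))" "open (outside (img EC))" "inside (img EC) \<inter> outside (img EC) = {}"
    "inside (img EC) \<union> outside (img EC) = - img EC"
    "topological_space_class.connected T \<Longrightarrow> T \<inter> img EC = {} \<Longrightarrow> T \<subseteq> inside (img EC) \<or> T \<subseteq> outside (img EC)"
    using theta_Jordan[OF cd(1)] connected_in_component[OF cd(1)] by simp_all
qed

definition oarc :: "'a set \<Rightarrow> complex set" where
  "oarc e = path_image (\<gamma> e) - f ` e"

text \<open>Density of the open arc in the closed one comes from continuity on the closure of the
  open unit interval. It allows an end of an edge to be approached from the region that contains its
  interior.\<close>

lemma oarc: "e \<in> Ed \<Longrightarrow> topological_space_class.connected (oarc e) \<and> oarc e \<noteq> {} \<and> path_image (\<gamma> e) \<subseteq> closure (oarc e)"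
proof -
  assume e: "e \<in> Ed"
  have s: "simple_path (\<gamma> e)" using arc_edge[OF e] arc_imp_simple_path by blast
  have o: "oarc e = path_image (\<gamma> e) - {pathstart (\<gamma> e), pathfinish (\<gamma> e)}"
    using ends_edge[OF e] by (auto simp: oarc_def)
  have "path_image (\<gamma> e) = \<gamma> e ` closure {0<..<1}" by (simp add: path_image_def)
  also have "\<dots> \<subseteq> closure (\<gamma> e ` {0<..<1})"
    using simple_path_imp_path[OF s]
    by (intro image_closure_subset) (auto simp: path_def intro: closure_subset[THEN subsetD])
  finally have "path_image (\<gamma> e) \<subseteq> closure (oarc e)"
    using simple_path_endless[OF s] o by simp
  then show ?thesis unfolding o
    using connected_simple_path_endless[OF s] nonempty_simple_path_endless[OF s] by auto
qed

lemma closure_inside: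
  assumes "is_C VC EC"
  shows "closure (inside (img EC)) \<subseteq> inside (img EC) \<union> img EC"
    "closure (outside (img EC)) \<subseteq> outside (img EC) \<union> img EC"
proof -
  have "inside (img EC) \<union> img EC = - outside (img EC)" "outside (img EC) \<union> img EC = - inside (img EC)"
    using C_region(3,4)[OF assms] by blast+
  then have "closed (inside (img EC) \<union> img EC)" "closed (outside (img EC) \<union> img EC)"
    using C_region(1,2)[OF assms] by (simp_all add: closed_def)
  then show "closure (inside (img EC)) \<subseteq> inside (img EC) \<union> img EC"
    "closure (outside (img EC)) \<subseteq> outside (img EC) \<union> img EC" by (meson Un_upper1 closure_minimal)+
qed

text \<open>\<open>R\<close> is one of the two regions of a cycle; treating both at once saves repeating the ear argument.\<close>

definition region :: "'a set set \<Rightarrow> complex set \<Rightarrow> bool" where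
  "region EC R \<longleftrightarrow> R = inside (img EC) \<or> R = outside (img EC)"

lemma region_connected:
  assumes "is_C VC EC" "region EC R" "topological_space_class.connected T" "T \<inter> img EC = {}" "T \<inter> R \<noteq> {}"
  shows "T \<subseteq> R"
  using C_region(3)[OF assms(1)] C_region(5)[OF assms(1,3,4)] assms(2,5) unfolding region_def by blast

lemma region_disjoint: "is_C VC EC \<Longrightarrow> region EC R \<Longrightarrow> R \<inter> img EC = {}"
  using C_region(4) unfolding region_def by blast

definition e_reg :: "complex set \<Rightarrow> 'a set set" where
  "e_reg R = {e \<in> Ed. path_image (\<gamma> e) \<inter> R \<noteq> {}}"

definition v_reg :: "complex set \<Rightarrow> 'a set" where
  "v_reg R = {v \<in> V. f v \<in> R}"

lemma oarc_img: "e \<in> Ed \<Longrightarrow> EC \<subseteq> Ed \<Longrightarrow> e \<notin> EC \<Longrightarrow> oarc e \<inter> img EC = {}"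
proof -
  assume a: "e \<in> Ed" "EC \<subseteq> Ed" "e \<notin> EC"
  have "path_image (\<gamma> e) \<inter> img EC \<subseteq> f ` e"
    using img_disjoint[of "{e}" EC] a by (auto simp: img_def)
  then show ?thesis by (auto simp: oarc_def)
qed

text \<open>The region is open and the open arc is dense in the edge, so an edge meeting the region
  has an interior point there. Its interior is connected and avoids the cycle, hence stays in the
  region.\<close>

lemma e_reg_iff:
  assumes "is_C VC EC" "region EC R"
  shows "e \<in> e_reg R \<longleftrightarrow> e \<in> Ed \<and> e \<notin> EC \<and> oarc e \<subseteq> R"
proof
  assume "e \<in> e_reg R"
  then have e: "e \<in> Ed" "path_image (\<gamma> e) \<inter> R \<noteq> {}" by (auto simp: e_reg_def)
  have "e \<notin> EC" using e(2) region_disjoint[OF assms] by (auto simp: img_def)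
  moreover have "open R" using C_region(1,2)[OF assms(1)] assms(2) by (auto simp: region_def)
  then have "oarc e \<inter> R \<noteq> {}"
    using e oarc[OF e(1)] open_Int_closure_eq_empty[of R "oarc e"] by blast
  ultimately show "e \<in> Ed \<and> e \<notin> EC \<and> oarc e \<subseteq> R"
    using region_connected[OF assms] oarc[OF e(1)] oarc_img[OF e(1)] is_C_sub[OF assms(1)] e(1) by blast
next
  assume "e \<in> Ed \<and> e \<notin> EC \<and> oarc e \<subseteq> R"
  then show "e \<in> e_reg R" using oarc[of e] by (auto simp: e_reg_def oarc_def)
qed

lemma v_reg_VC: "is_C VC EC \<Longrightarrow> region EC R \<Longrightarrow> v_reg R \<inter> VC = {}"
proof -
  assume C: "is_C VC EC" "region EC R"
  have "f v \<notin> R" if "v \<in> VC" for v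
    using that is_C_sub[OF C(1)] img_mem[of EC v] region_disjoint[OF C] by blast
  then show ?thesis by (auto simp: v_reg_def)
qed

lemma region_ends:
  assumes "is_C VC EC" "region EC R" "e \<in> e_reg R" "x \<in> e" "x \<notin> VC"
  shows "x \<in> v_reg R"
proof -
  have e: "e \<in> Ed" "oarc e \<subseteq> R" using e_reg_iff[OF assms(1,2)] assms(3) by auto
  have x: "x \<in> V" using edge_subset e assms(4) by blast
  have "f x \<in> path_image (\<gamma> e)" using edge_verts[OF e(1)] assms(4) by blast
  then have "f x \<in> closure R" using oarc[OF e(1)] closure_mono[OF e(2)] by blast
  then have "f x \<in> R \<union> img EC" using closure_inside[OF assms(1)] assms(2) by (auto simp: region_def)
  then show ?thesis using img_mem[of EC x] x is_C_sub[OF assms(1)] assms(5) by (auto simp: v_reg_def)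
qed

lemma region_step:
  assumes "is_C VC EC" "region EC R" "e \<in> Ed" "x \<in> e" "x \<in> v_reg R"
  shows "e \<in> e_reg R"
  using assms edge_verts[of e] by (auto simp: e_reg_def v_reg_def)

lemma cover:
  assumes "is_C VC EC"
  shows "Ed = EC \<union> e_reg (inside (img EC)) \<union> e_reg (outside (img EC))"
    "V = VC \<union> v_reg (inside (img EC)) \<union> v_reg (outside (img EC))"
    "e_reg (inside (img EC)) \<inter> e_reg (outside (img EC)) = {}"
proof -
  have r: "region EC (inside (img EC))" "region EC (outside (img EC))" by (auto simp: region_def)
  have "e \<in> EC \<or> oarc e \<subseteq> inside (img EC) \<or> oarc e \<subseteq> outside (img EC)" if "e \<in> Ed" for e
    using C_region(5)[OF assms] oarc[OF that] oarc_img[OF that] is_C_sub[OF assms] by blast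
  then have "e \<in> EC \<or> e \<in> e_reg (inside (img EC)) \<or> e \<in> e_reg (outside (img EC))" if "e \<in> Ed" for e
    using that e_reg_iff[OF assms r(1)] e_reg_iff[OF assms r(2)] by blast
  then show "Ed = EC \<union> e_reg (inside (img EC)) \<union> e_reg (outside (img EC))"
    using is_C_sub[OF assms] by (auto simp: e_reg_def)
  have "v \<in> VC \<or> f v \<in> inside (img EC) \<or> f v \<in> outside (img EC)" if "v \<in> V" for v
  proof -
    have "f v \<in> - img EC \<or> f v \<in> img EC" by blast
    then have "f v \<in> inside (img EC) \<or> f v \<in> outside (img EC) \<or> f v \<in> img EC"
      unfolding C_region(4)[OF assms, symmetric] by blast
    then show ?thesis using img_mem[of EC v] is_C_sub[OF assms] that by auto
  qed
  then show "V = VC \<union> v_reg (inside (img EC)) \<union> v_reg (outside (img EC))"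
    using is_C_sub[OF assms] by (auto simp: v_reg_def)
  have False if "e \<in> e_reg (inside (img EC))" "e \<in> e_reg (outside (img EC))" for e
  proof -
    have "oarc e \<subseteq> inside (img EC)" "oarc e \<subseteq> outside (img EC)" "e \<in> Ed"
      using that e_reg_iff[OF assms r(1)] e_reg_iff[OF assms r(2)] by auto
    then show False using oarc[of e] C_region(3)[OF assms] by blast
  qed
  then show "e_reg (inside (img EC)) \<inter> e_reg (outside (img EC)) = {}" by auto
qed

section \<open>Ears\<close>

definition conn2 :: bool where
  "conn2 \<longleftrightarrow> (\<forall>x\<in>V. \<forall>u\<in>V - {x}. \<forall>w\<in>V - {x}. (u, w) \<in> {(s, t). {s, t} \<in> Ed \<and> s \<notin> {x} \<and> t \<notin> {x}}\<^sup>*)"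

text \<open>A chord in the region is an ear. Otherwise an edge of the region has an end off the
  cycle, whose component after removal of the cycle stays in the region. By 2-connectivity this
  component is attached to the cycle at two different vertices, and a path through it joins
  them.\<close>

lemma ear:
  assumes conn2 and C: "is_C VC EC" and R: "region EC R" and e0: "e_reg R \<noteq> {}"
  obtains r a b where "gpath Ed r" "hd r = a" "last r = b" "a \<noteq> b" "set r \<inter> VC = {a, b}" "ed r \<inter> EC = {}"
    "ed r \<inter> e_reg R \<noteq> {}"
proof -
  obtain e where e: "e \<in> e_reg R" using e0 by auto
  then have eE: "e \<in> Ed" "e \<notin> EC" using e_reg_iff[OF C R] by auto
  obtain x y where xy: "e = {x, y}" "x \<noteq> y" "x \<in> V" "y \<in> V" using edge[OF eE(1)] by auto
  show thesis
  proof (cases "x \<in> VC \<and> y \<in> VC")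
    case True
    then show ?thesis using that[of "[x, y]" x y] e eE xy by (auto simp: gpath_def)
  next
    case False
    then obtain z where z: "z \<in> e" "z \<notin> VC" using xy by auto
    then have zR: "z \<in> v_reg R" "z \<in> V" using region_ends[OF C R e] xy by auto
    define Re where "Re = {(s, t). {s, t} \<in> Ed \<and> s \<notin> VC \<and> t \<notin> VC}"
    define K where "K = {t. (z, t) \<in> Re\<^sup>*}"
    have K: "t \<in> v_reg R \<and> t \<notin> VC" if "t \<in> K" for t
    proof -
      have "(z, t) \<in> Re\<^sup>*" using that by (simp add: K_def)
      then show ?thesis
      proof (induction rule: rtrancl_induct)
        case (step s t)
        then have "{s, t} \<in> e_reg R" using region_step[OF C R, of "{s, t}" s] by (auto simp: Re_def)
        then show ?case using region_ends[OF C R, of "{s, t}" t] step by (auto simp: Re_def)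
      qed (use z zR in auto)
    qed
    \<comment> \<open>A walk from \<open>z\<close> to a cycle vertex \<open>c\<close> that avoids
      \<open>w\<close> must leave \<open>K\<close>, which is possible only through a cycle vertex
      other than \<open>w\<close>.\<close>
    have att: "\<exists>a\<in>VC - {w}. \<exists>k\<in>K. {k, a} \<in> Ed" if w: "w \<in> VC" for w
    proof -
      obtain c where c: "c \<in> VC" "c \<noteq> w" using is_cyc_other[OF C] by blast
      have "w \<in> V" "c \<in> V" using is_C_sub[OF C] w c by auto
      then have "(z, c) \<in> {(s, t). {s, t} \<in> Ed \<and> s \<notin> {w} \<and> t \<notin> {w}}\<^sup>*"
        using assms(1) zR c z w unfolding conn2_def by blast
      then have "c \<in> K \<or> (\<exists>a\<in>VC - {w}. \<exists>k\<in>K. {k, a} \<in> Ed)"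
      proof (induction rule: rtrancl_induct)
        case base
        then show ?case by (simp add: K_def)
      next
        case (step s t)
        then show ?case
        proof (cases "s \<in> K \<and> t \<notin> VC")
          case True
          then have "(s, t) \<in> Re" using step K by (auto simp: Re_def)
          then show ?thesis using True by (auto simp: K_def)
        qed (use step in blast)
      qed
      then show ?thesis using K c by blast
    qed
    obtain w where "w \<in> VC" using is_cyc_card[OF C] by fastforce
    then obtain a k where a: "a \<in> VC" "k \<in> K" "{k, a} \<in> Ed" using att by blast
    obtain b l where b: "b \<in> VC" "b \<noteq> a" "l \<in> K" "{l, b} \<in> Ed" using att[OF a(1)] by blast
    have "sym Re" by (auto simp: Re_def sym_def insert_commute)
    then have "(k, z) \<in> Re\<^sup>*" using a(2) unfolding K_def by (blast dest: sym_rtrancl symD)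
    then have "(k, l) \<in> Re\<^sup>*" using b(3) unfolding K_def by simp
    then obtain q where q: "gpath Ed q" "hd q = k" "last q = l" "set q \<inter> VC = {}"
      using reach_gpath[of k l Ed VC] K[OF a(2)] unfolding Re_def by blast
    have qn: "q \<noteq> []" using q(1) by (auto simp: gpath_def)
    let ?r = "a # q @ [b]"
    have ed: "ed ?r = insert {k, a} (insert {l, b} (ed q))"
      using q qn by (simp add: ed_Cons ed_append insert_commute)
    have "gpath Ed ?r" using q a b ed by (auto simp: gpath_def)
    moreover have "set ?r \<inter> VC = {a, b}" using q a b by auto
    moreover have "ed ?r \<inter> EC = {}"
    proof -
      have "\<not> g \<subseteq> VC" if "g \<in> ed q" for g
      proof -
        have "g \<in> Ed" using that q by (auto simp: gpath_def)
        then have "g \<noteq> {}" using edge by blast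
        then show ?thesis using ed_subset[OF that] q(4) by blast
      qed
      moreover have "\<not> {k, a} \<subseteq> VC" "\<not> {l, b} \<subseteq> VC" using K a b by auto
      moreover have "g \<subseteq> VC" if "g \<in> EC" for g using is_C_sub[OF C] that by blast
      ultimately show ?thesis using ed by blast
    qed
    moreover have "{k, a} \<in> e_reg R" using region_step[OF C R a(3), of k] K[OF a(2)] by auto
    then have "ed ?r \<inter> e_reg R \<noteq> {}" using ed by blast
    ultimately show ?thesis using that[of ?r a b] b by auto
  qed
qed
end

section \<open>Splitting the regions of a cycle by an ear\<close>

context plane_graph begin

lemma ear_cycles:
  assumes "cyc2 Ed a b p q" "gpath Ed r" "hd r = a" "last r = b" "set r \<inter> (set p \<union> set q) = {a, b}"
    "ed r \<inter> (ed p \<union> ed q) = {}"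
  shows "cyc2 Ed a b p r" "cyc2 Ed a b q r"
proof -
  have "a \<in> set p" "a \<in> set q" "b \<in> set p" "b \<in> set q" using assms(1) by (auto simp: cyc2_def)
  then have "set p \<inter> set r = {a, b}" "set q \<inter> set r = {a, b}" using assms(5) by auto
  then show "cyc2 Ed a b p r" "cyc2 Ed a b q r" using assms by (auto simp: cyc2_def)
qed

lemma oarc_V: "e \<in> Ed \<Longrightarrow> oarc e \<inter> f ` V = {}"
  using edge_verts[of e] by (auto simp: oarc_def)

text \<open>The bookkeeping form of splitting a disk: the edges and inner vertices of the ear are
  inside the large disk but in neither of the small ones, and everything else inside lies in exactly
  one of them.\<close>

lemma split_counts:
  assumes pq: "cyc2 Ed a b p q" and pr: "cyc2 Ed a b p r" and qr: "cyc2 Ed a b q r"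
    and meet: "ed r \<inter> e_reg (inside (img (ed p \<union> ed q))) \<noteq> {}"
  defines "I \<equiv> inside (img (ed p \<union> ed q))" and "I1 \<equiv> inside (img (ed p \<union> ed r))"
    and "I2 \<equiv> inside (img (ed q \<union> ed r))"
  shows "e_reg I = e_reg I1 \<union> e_reg I2 \<union> ed r" "e_reg I1 \<inter> e_reg I2 = {}" "(e_reg I1 \<union> e_reg I2) \<inter> ed r = {}"
    "v_reg I = v_reg I1 \<union> v_reg I2 \<union> (set r - {a, b})" "v_reg I1 \<inter> v_reg I2 = {}"
    "(v_reg I1 \<union> v_reg I2) \<inter> (set r - {a, b}) = {}"
proof -
  have gr: "gpath Ed r" "hd r = a" "last r = b" "a \<noteq> b" "ed r \<subseteq> Ed" using pr by (auto simp: cyc2_def gpath_def)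
  have pimg: "path_image (parc r) = img (ed r)" using parc(4)[of r] gr by simp
  have len: "2 \<le> length r" using gpath_length[OF gr(1)] gr by simp
  have rV: "set r \<subseteq> V" "\<Union>(ed r) = set r" using gpath_V[OF gr(1) len] Union_ed[OF len] by auto
  have "path_image (parc r) \<inter> inside (path_image (parc p) \<union> path_image (parc q)) \<noteq> {}"
    using meet unfolding theta_img[OF pq] pimg by (auto simp: e_reg_def img_def)
  note sp = theta_split[OF theta_paths[OF pq] theta_paths[OF pr] theta_paths[OF qr] this]
  have s1: "I1 \<inter> I2 = {}" and s2: "I1 \<union> I2 \<union> (img (ed r) - {f a, f b}) = I"
    using sp[unfolded theta_img[OF pq] theta_img[OF pr] theta_img[OF qr]]
    unfolding pimg I_def I1_def I2_def by auto
  note C = cyc2_is_cyc[OF pq] and C1 = cyc2_is_cyc[OF pr] and C2 = cyc2_is_cyc[OF qr]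
  have R: "region (ed p \<union> ed q) I" "region (ed p \<union> ed r) I1" "region (ed q \<union> ed r) I2"
    by (auto simp: region_def I_def I1_def I2_def)
  have I1r: "I1 \<inter> img (ed r) = {}" "I2 \<inter> img (ed r) = {}"
    using region_disjoint[OF C1 R(2)] region_disjoint[OF C2 R(3)] by (auto simp: img_def)
  have edr: "ed r \<subseteq> e_reg I"
  proof
    fix e assume e: "e \<in> ed r"
    then have eE: "e \<in> Ed" using gr by auto
    have "a \<in> set r" "b \<in> set r" using gr by (auto simp: gpath_def)
    then have "f a \<in> f ` V" "f b \<in> f ` V" using rV by auto
    then have "oarc e \<subseteq> img (ed r) - {f a, f b}"
      using oarc_V[OF eE] e by (auto simp: img_def oarc_def)
    then show "e \<in> e_reg I" using oarc[OF eE] s2 eE by (auto simp: e_reg_def oarc_def)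
  qed
  show "e_reg I = e_reg I1 \<union> e_reg I2 \<union> ed r"
  proof
    show "e_reg I \<subseteq> e_reg I1 \<union> e_reg I2 \<union> ed r"
    proof
      fix e assume e: "e \<in> e_reg I"
      then have eE: "e \<in> Ed" "oarc e \<subseteq> I" using e_reg_iff[OF C R(1)] by auto
      obtain z where z: "z \<in> oarc e" using oarc[OF eE(1)] by auto
      show "e \<in> e_reg I1 \<union> e_reg I2 \<union> ed r"
      proof (cases "e \<in> ed r")
        case False
        then have "z \<notin> img (ed r)" using oarc_img[OF eE(1) gr(5)] z by auto
        then have "z \<in> I1 \<union> I2" using s2 eE z by auto
        then show ?thesis using z eE by (auto simp: e_reg_def oarc_def)
      qed auto
    qed
    show "e_reg I1 \<union> e_reg I2 \<union> ed r \<subseteq> e_reg I" using edr s2 unfolding e_reg_def by blast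
  qed
  show "e_reg I1 \<inter> e_reg I2 = {}"
    using e_reg_iff[OF C1 R(2)] e_reg_iff[OF C2 R(3)] s1 oarc by blast
  show "(e_reg I1 \<union> e_reg I2) \<inter> ed r = {}"
    using e_reg_iff[OF C1 R(2)] e_reg_iff[OF C2 R(3)] by auto
  have mem: "f v \<in> img (ed r) \<longleftrightarrow> v \<in> set r" if "v \<in> V" for v
    using img_mem[OF gr(5) that] rV by simp
  have ab: "a \<in> V" "b \<in> V" using rV gr by (auto simp: gpath_def)
  have ne: "f v \<noteq> f a \<longleftrightarrow> v \<noteq> a" "f v \<noteq> f b \<longleftrightarrow> v \<noteq> b" if "v \<in> V" for v
    using inj_f that ab by (auto dest: inj_onD)
  show "v_reg I = v_reg I1 \<union> v_reg I2 \<union> (set r - {a, b})"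
  proof -
    have "f v \<in> I \<longleftrightarrow> f v \<in> I1 \<or> f v \<in> I2 \<or> v \<in> set r - {a, b}" if "v \<in> V" for v
      using s2 mem[OF that] ne[OF that] by blast
    then show ?thesis using rV by (auto simp: v_reg_def)
  qed
  show "v_reg I1 \<inter> v_reg I2 = {}" using s1 by (auto simp: v_reg_def)
  show "(v_reg I1 \<union> v_reg I2) \<inter> (set r - {a, b}) = {}"
    using I1r mem by (auto simp: v_reg_def)
qed

lemma vertex_edge:
  assumes conn2 "is_C VC EC" "v \<in> V"
  shows "\<exists>e\<in>Ed. v \<in> e"
proof (cases "v \<in> VC")
  case True
  then show ?thesis using is_C_sub[OF assms(2)] by blast
next
  case False
  obtain c where c: "c \<in> VC" using is_cyc_other[OF assms(2)] by blast
  obtain d where d: "d \<in> VC" "d \<noteq> c" using is_cyc_other[OF assms(2)] by blast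
  have "c \<in> V" "d \<in> V" using is_C_sub[OF assms(2)] c d by auto
  then have "(v, c) \<in> {(s, t). {s, t} \<in> Ed \<and> s \<notin> {d} \<and> t \<notin> {d}}\<^sup>*"
    using assms(1,3) False c d unfolding conn2_def by blast
  then show ?thesis using False c by (cases rule: converse_rtranclE) auto
qed

text \<open>Euler's formula for a disk without mention of faces: with e edges and v vertices inside
  there are e - v + 1 faces, each bounded by at least \<open>g\<close> edges, where an inner edge
  counts twice and an edge of the cycle once. The inequalities of the two disks separated by an ear
  add up.\<close>

lemma inside_count:
  assumes conn2 and girth: "\<And>VC EC. is_C VC EC \<Longrightarrow> g \<le> card EC" and "is_C VC EC"
  defines "I \<equiv> inside (img EC)"
  shows "g * (card (e_reg I) + 1) \<le> 2 * card (e_reg I) + card EC + g * card (v_reg I)"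
  using assms(3) unfolding I_def
proof (induction "card (e_reg (inside (img EC)))" arbitrary: VC EC rule: less_induct)
  case less
  note C = less(2)
  have R: "region EC (inside (img EC))" by (simp add: region_def)
  show ?case
  proof (cases "e_reg (inside (img EC)) = {}")
    case True
    then show ?thesis using girth[OF C] by simp
  next
    case False
    then obtain r a b where r: "gpath Ed r" "hd r = a" "last r = b" "a \<noteq> b" "set r \<inter> VC = {a, b}" "ed r \<inter> EC = {}"
      "ed r \<inter> e_reg (inside (img EC)) \<noteq> {}" using ear[OF assms(1) C R] by metis
    have "a \<in> VC" "b \<in> VC" using r(5) by auto
    then obtain p q where pq: "cyc2 Ed a b p q" "VC = set p \<union> set q" "EC = ed p \<union> ed q"
      using is_cyc_cyc2[OF C] r(4) by metis
    note prqr = ear_cycles[OF pq(1) r(1-3)]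
    have pr: "cyc2 Ed a b p r" and qr: "cyc2 Ed a b q r" using prqr r(5,6) pq by auto
    let ?I1 = "inside (img (ed p \<union> ed r))" and ?I2 = "inside (img (ed q \<union> ed r))" and ?I = "inside (img EC)"
    note sc = split_counts[OF pq(1) pr qr, folded pq(3), OF r(7)]
    have fin: "finite (e_reg R)" "finite (v_reg R)" for R
      using finite_Ed finite_V by (auto simp: e_reg_def v_reg_def)
    have len: "2 \<le> length r" using gpath_length[OF r(1)] r by simp
    have cr: "card (ed r) = length r - 1" "card (set r - {a, b}) = length r - 2"
    proof -
      have "distinct r" "a \<in> set r" "b \<in> set r" using r by (auto simp: gpath_def)
      then show "card (ed r) = length r - 1" "card (set r - {a, b}) = length r - 2"
        using card_ed r(4) by (auto simp: card_Diff_subset distinct_card)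
    qed
    have ce: "card (e_reg ?I) = card (e_reg ?I1) + card (e_reg ?I2) + card (ed r)"
      unfolding sc(1) using sc(2,3) fin by (simp add: card_Un_disjoint)
    have cv: "card (v_reg ?I) = card (v_reg ?I1) + card (v_reg ?I2) + card (set r - {a, b})"
      unfolding sc(4) using sc(5,6) fin by (simp add: card_Un_disjoint)
    have d: "ed p \<inter> ed q = {}" "ed p \<inter> ed r = {}" "ed q \<inter> ed r = {}"
      using pq(1) pr qr by (auto simp: cyc2_def)
    have c3: "card EC = card (ed p) + card (ed q)" "card (ed p \<union> ed r) = card (ed p) + card (ed r)"
      "card (ed q \<union> ed r) = card (ed q) + card (ed r)"
      using d unfolding pq(3) by (simp_all add: card_Un_disjoint)
    have i1: "g * (card (e_reg ?I1) + 1) \<le> 2 * card (e_reg ?I1) + card (ed p \<union> ed r) + g * card (v_reg ?I1)"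
      using less(1)[OF _ cyc2_is_cyc[OF pr]] ce cr len by linarith
    have i2: "g * (card (e_reg ?I2) + 1) \<le> 2 * card (e_reg ?I2) + card (ed q \<union> ed r) + g * card (v_reg ?I2)"
      using less(1)[OF _ cyc2_is_cyc[OF qr]] ce cr len by linarith
    \<comment> \<open>The ear has \<open>l\<close> inner vertices and l + 1 edges; as its edges
      belong to both smaller cycles, they are counted twice.\<close>
    obtain l where l: "length r = l + 2" using len by (metis add.commute le_Suc_ex)
    show ?thesis using i1 i2 unfolding ce cv c3 cr l by (simp add: algebra_simps)
  qed
qed

text \<open>If edges remain outside, an ear there forms a theta curve with the cycle, and one half
  of the cycle meets the inside of the curve formed by the other half and the ear. That curve has
  fewer edges outside, as an edge of the ear is lost.\<close>

lemma outer_cycle: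
  assumes conn2 "is_C VC EC"
  shows "\<exists>VC EC. is_C VC EC \<and> e_reg (outside (img EC)) = {}"
  using assms(2)
proof (induction "card (e_reg (outside (img EC)))" arbitrary: VC EC rule: less_induct)
  case less
  note C = less(2)
  have R: "region EC (outside (img EC))" by (simp add: region_def)
  have fin: "finite (e_reg R)" for R using finite_Ed by (auto simp: e_reg_def)
  have big: "card (e_reg (outside (img (ed p \<union> ed r)))) < card (e_reg (outside (img EC)))"
    if pq: "cyc2 Ed a b p q" "EC = ed p \<union> ed q" and pr: "cyc2 Ed a b p r" and qr: "cyc2 Ed a b q r"
      and ro: "ed r \<inter> e_reg (outside (img EC)) \<noteq> {}"
      and m: "path_image (parc q) \<inter> inside (path_image (parc p) \<union> path_image (parc r)) \<noteq> {}" for a b p q r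
  proof (rule psubset_card_mono[OF fin])
    have qimg: "path_image (parc q) = img (ed q)" using parc(4)[of q] qr by (auto simp: cyc2_def)
    note split = theta_split(2)[OF theta_paths[OF pr] theta_paths[OF pq(1)] theta_commute[OF theta_paths[OF qr]] m]
    have sub: "inside (img EC) \<union> (img (ed q) - {f a, f b}) \<subseteq> inside (img (ed p \<union> ed r))"
      using split[unfolded theta_img[OF pr] theta_img[OF pq(1)]] unfolding pq(2) qimg by auto
    note C1 = cyc2_is_cyc[OF pr]
    have R1: "region (ed p \<union> ed r) (outside (img (ed p \<union> ed r)))" by (simp add: region_def)
    have RI: "region EC (inside (img EC))" by (simp add: region_def)
    have "e_reg (outside (img (ed p \<union> ed r))) \<subseteq> e_reg (outside (img EC))"
    proof
      fix e assume "e \<in> e_reg (outside (img (ed p \<union> ed r)))"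
      then have e: "e \<in> Ed" "e \<notin> ed p \<union> ed r" "oarc e \<subseteq> outside (img (ed p \<union> ed r))"
        using e_reg_iff[OF C1 R1] by auto
      have dis: "oarc e \<inter> inside (img (ed p \<union> ed r)) = {}" using e(3) C_region(3)[OF C1] by blast
      have "e \<notin> ed q"
      proof
        assume eq: "e \<in> ed q"
        have "set q \<subseteq> V" "a \<in> set q" "b \<in> set q"
          using gpath_V[of q] gpath_length[of q] pq(1) by (auto simp: cyc2_def)
        then have "oarc e \<subseteq> img (ed q) - {f a, f b}"
          using oarc_V[OF e(1)] eq by (auto simp: img_def oarc_def)
        then show False using sub dis oarc[OF e(1)] by auto
      qed
      moreover have "e \<notin> e_reg (inside (img EC))"
        using e_reg_iff[OF C RI] sub dis oarc[OF e(1)] by auto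
      ultimately show "e \<in> e_reg (outside (img EC))" using cover(1)[OF C] e pq(2) by auto
    qed
    moreover have "ed r \<inter> e_reg (outside (img (ed p \<union> ed r))) = {}" using e_reg_iff[OF C1 R1] by auto
    ultimately show "e_reg (outside (img (ed p \<union> ed r))) \<subset> e_reg (outside (img EC))" using ro by auto
  qed
  show ?case
  proof (cases "e_reg (outside (img EC)) = {}")
    case True
    then show ?thesis using C by blast
  next
    case False
    then obtain r a b where r: "gpath Ed r" "hd r = a" "last r = b" "a \<noteq> b" "set r \<inter> VC = {a, b}" "ed r \<inter> EC = {}"
      "ed r \<inter> e_reg (outside (img EC)) \<noteq> {}" using ear[OF assms(1) C R] by metis
    have "a \<in> VC" "b \<in> VC" using r(5) by auto
    then obtain p q where pq: "cyc2 Ed a b p q" "VC = set p \<union> set q" "EC = ed p \<union> ed q"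
      using is_cyc_cyc2[OF C] r(4) by metis
    note prqr = ear_cycles[OF pq(1) r(1-3)]
    have pr: "cyc2 Ed a b p r" and qr: "cyc2 Ed a b q r" using prqr r(5,6) pq by auto
    have qp: "cyc2 Ed a b q p" using pq(1) by (auto simp: cyc2_def)
    have rimg: "path_image (parc r) = img (ed r)" using parc(4)[of r] qr by (auto simp: cyc2_def)
    \<comment> \<open>An ear that met the inside would be entirely inside by
      \<open>split_counts\<close>, but one of its edges is outside.\<close>
    have "img (ed r) \<inter> inside (img EC) = {}"
    proof (rule ccontr)
      assume "img (ed r) \<inter> inside (img EC) \<noteq> {}"
      then have "ed r \<inter> e_reg (inside (img EC)) \<noteq> {}" using r(1) by (auto simp: e_reg_def img_def gpath_def)
      then have "ed r \<subseteq> e_reg (inside (img EC))" using split_counts(1)[OF pq(1) pr qr, folded pq(3)] by auto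
      then show False using r(7) cover(3)[OF C] by auto
    qed
    then consider "path_image (parc q) \<inter> inside (path_image (parc p) \<union> path_image (parc r)) \<noteq> {}" |
      "path_image (parc p) \<inter> inside (path_image (parc q) \<union> path_image (parc r)) \<noteq> {}"
      using theta_outer[OF theta_paths[OF pq(1)] theta_paths[OF pr] theta_paths[OF qr]]
      unfolding theta_img[OF pq(1)] rimg pq(3) by auto
    then show ?thesis
    proof cases
      case 1
      then show ?thesis using less(1)[OF _ cyc2_is_cyc[OF pr]] big[OF pq(1,3) pr qr r(7)] by blast
    next
      case 2
      have "EC = ed q \<union> ed p" using pq by auto
      then show ?thesis using less(1)[OF _ cyc2_is_cyc[OF qr]] big[OF qp _ qr pr r(7) 2] by blast
    qed
  qed
qed

text \<open>A vertex has two neighbors, since removing one vertex must not isolate it; a path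
  between them that avoids it closes a cycle.\<close>

lemma conn2_cycle:
  assumes conn2 "3 \<le> card V"
  shows "\<exists>VC EC. is_C VC EC"
proof -
  have nb: "\<exists>z. {x, z} \<in> Ed \<and> z \<noteq> y" if "x \<in> V" "y \<in> V" "x \<noteq> y" for x y
  proof -
    have "V - {x, y} \<noteq> {}" using assms(2) finite_V card_mono[of "{x, y}" V] that by fastforce
    then obtain w where w: "w \<in> V" "w \<noteq> x" "w \<noteq> y" by auto
    then have "(x, w) \<in> {(s, t). {s, t} \<in> Ed \<and> s \<notin> {y} \<and> t \<notin> {y}}\<^sup>*"
      using assms(1) that unfolding conn2_def by blast
    then show ?thesis using w by (cases rule: converse_rtranclE) auto
  qed
  have "V \<noteq> {}" using assms(2) by auto
  then obtain x where x: "x \<in> V" by auto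
  have "V \<noteq> {x}" using assms(2) by auto
  then obtain x' where x': "x' \<in> V" "x' \<noteq> x" using x by auto
  obtain y where y: "{x, y} \<in> Ed" using nb[OF x x'(1)] x' by auto
  have yV: "y \<in> V" "y \<noteq> x" using edge[OF y] by (auto simp: doubleton_eq_iff)
  obtain z where z: "{x, z} \<in> Ed" "z \<noteq> y" using nb[OF x yV(1)] yV by auto
  have zV: "z \<in> V" "z \<noteq> x" using edge[OF z(1)] by (auto simp: doubleton_eq_iff)
  have "(y, z) \<in> {(s, t). {s, t} \<in> Ed \<and> s \<notin> {x} \<and> t \<notin> {x}}\<^sup>*"
    using assms(1) x yV zV unfolding conn2_def by blast
  then obtain p where p: "gpath Ed p" "hd p = y" "last p = z" "set p \<inter> {x} = {}"
    using reach_gpath[of y z Ed "{x}"] yV by blast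
  let ?vs = "x # p"
  have "2 \<le> length p" using gpath_length[OF p(1)] p z by auto
  moreover have "ed (?vs @ [hd ?vs]) \<subseteq> Ed"
    using p y z by (cases "p = []") (auto simp: ed_Cons ed_append gpath_def insert_commute)
  moreover have "distinct ?vs" using p by (auto simp: gpath_def)
  ultimately have "is_C (set ?vs) (ed (?vs @ [hd ?vs]))" unfolding is_cyc_def by (intro exI[of _ ?vs]) simp
  then show ?thesis by blast
qed

section \<open>From 2-connected plane graphs to all plane graphs\<close>

lemma sub_plane:
  assumes a: "V' \<subseteq> V" "Ed' \<subseteq> Ed" "\<Union>Ed' \<subseteq> V'"
  shows "plane_graph V' Ed' f \<gamma>"
proof -
  have 1: "finite V'" using a(1) finite_V by (rule finite_subset)
  have 2: "inj_on f V'" using inj_f a(1) by (rule inj_on_subset)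
  have E: "e \<in> Ed" "e \<subseteq> V'" if "e \<in> Ed'" for e using that a(2,3) by auto
  have 3: "\<exists>u v. e = {u, v} \<and> u \<in> V' \<and> v \<in> V' \<and> u \<noteq> v" if "e \<in> Ed'" for e
  proof -
    have e: "e \<in> Ed" "e \<subseteq> V'" using that E by auto
    show ?thesis using edge[OF e(1)] e(2) by auto
  qed
  have 4: "path_image (\<gamma> e) \<inter> f ` V' = f ` e" if "e \<in> Ed'" for e
    using edge_verts[OF E(1)[OF that]] E(2)[OF that] a(1) by blast
  show ?thesis
    by (rule plane_graph.intro[OF 1 3 2]) (simp_all add: arc_edge ends_edge E 4 edge_edge)
qed

text \<open>The outer cycle has as many edges as vertices, so it contributes equally to both sides
  when the bound for its disk is extended to the whole graph.\<close>

lemma Euler_2connected: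
  assumes conn2 and girth: "\<And>VC EC. is_C VC EC \<Longrightarrow> g \<le> card EC" and C: "is_C VC EC"
  shows "g * card Ed + g \<le> 2 * card Ed + g * card V"
proof -
  obtain VC EC where C: "is_C VC EC" and out: "e_reg (outside (img EC)) = {}"
    using outer_cycle[OF assms(1) C] by blast
  let ?I = "inside (img EC)"
  have RO: "region EC (outside (img EC))" and RI: "region EC ?I" by (auto simp: region_def)
  have "v_reg (outside (img EC)) = {}"
  proof (rule ccontr)
    assume "v_reg (outside (img EC)) \<noteq> {}"
    then obtain v where v: "v \<in> v_reg (outside (img EC))" by auto
    then obtain e where "e \<in> Ed" "v \<in> e" using vertex_edge[OF assms(1) C, of v] by (auto simp: v_reg_def)
    then show False using region_step[OF C RO _ _ v] out by auto
  qed
  then have V: "V = VC \<union> v_reg ?I" and Ed: "Ed = EC \<union> e_reg ?I" using cover[OF C] out by auto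
  have "EC \<inter> e_reg ?I = {}" using e_reg_iff[OF C RI] by auto
  then have cE: "card Ed = card EC + card (e_reg ?I)"
    using card_Un_disjoint[of EC "e_reg ?I"] finite_Ed Ed by (metis finite_Un)
  have cV: "card V = card VC + card (v_reg ?I)"
    using card_Un_disjoint[of VC "v_reg ?I"] finite_V V v_reg_VC[OF C RI] by (metis finite_Un inf_commute)
  have "card EC = card VC" using is_cyc_card[OF C] by simp
  moreover have "g * (card (e_reg ?I) + 1) \<le> 2 * card (e_reg ?I) + card EC + g * card (v_reg ?I)"
    using assms(1) girth C by (rule inside_count)
  ultimately show ?thesis unfolding cE cV by (simp add: algebra_simps)
qed

end

text \<open>Splitting at a cut vertex (or between components) reduces the edge bound to 2-connected graphs.\<close>

theorem planar_edge_bound: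
  assumes "plane_graph V Ed f \<gamma>" "V \<noteq> {}" and girth: "\<And>VC EC. is_cyc Ed VC EC \<Longrightarrow> g \<le> card EC"
  shows "g * card Ed + g \<le> 2 * card Ed + g * card V"
  using assms
proof (induction "card V" arbitrary: V Ed rule: less_induct)
  case less
  interpret plane_graph V Ed f \<gamma> by (rule less(2))
  note girth = less(4)
  consider "card V \<le> 2" | "3 \<le> card V" conn2 | "3 \<le> card V" "\<not> conn2" by linarith
  then show ?case
  proof cases
    case 1
    have "Ed \<subseteq> {V}"
    proof
      fix e assume e: "e \<in> Ed"
      then obtain u v where uv: "e = {u, v}" "u \<in> V" "v \<in> V" "u \<noteq> v" using edge by blast
      then show "e \<in> {V}" using 1 card_seteq[OF finite_V, of e] by auto
    qed
    then have cE: "card Ed \<le> 1" using card_mono[of "{V}" Ed] by simp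
    have cV: "1 \<le> card V" using less(3) finite_V by (simp add: Suc_leI card_gt_0_iff)
    show ?thesis
    proof (cases "Ed = {}")
      case True
      then show ?thesis using cV by simp
    next
      case False
      then obtain e where "e \<in> Ed" by auto
      then obtain u v where "u \<in> V" "v \<in> V" "u \<noteq> v" using edge by blast
      then have "2 \<le> card V" using card_mono[OF finite_V, of "{u, v}"] by auto
      then have "g * 2 \<le> g * card V" by (rule mult_le_mono2)
      moreover have c1: "card Ed = 1" using False cE finite_Ed by (simp add: Suc_leI card_gt_0_iff le_antisym)
      ultimately show ?thesis unfolding c1 by linarith
    qed
  next
    case 2
    obtain VC EC where C: "is_C VC EC" using conn2_cycle[OF 2(2,1)] by blast
    show ?thesis using 2(2) girth C by (rule Euler_2connected)
  next
    case 3
    then have "\<exists>x\<in>V. \<exists>u\<in>V - {x}. \<exists>w\<in>V - {x}. (u, w) \<notin> {(s, t). {s, t} \<in> Ed \<and> s \<notin> {x} \<and> t \<notin> {x}}\<^sup>*"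
      by (simp add: conn2_def)
    then obtain x u w where x: "x \<in> V" and uw: "u \<in> V - {x}" "w \<in> V - {x}"
      and nr: "(u, w) \<notin> {(s, t). {s, t} \<in> Ed \<and> s \<notin> {x} \<and> t \<notin> {x}}\<^sup>*"
      by blast
    \<comment> \<open>Removing \<open>x\<close>, which exists also when the graph is disconnected,
      leaves the component \<open>A\<close> of \<open>u\<close> and a nonempty rest
      \<open>B\<close>, with no edge between them.\<close>
    define Re where "Re = {(s, t). {s, t} \<in> Ed \<and> s \<notin> {x} \<and> t \<notin> {x}}"
    define A where "A = {z \<in> V - {x}. (u, z) \<in> Re\<^sup>*}"
    define B where "B = V - {x} - A"
    have u: "u \<in> A" using uw by (simp add: A_def)
    have w: "w \<in> B" using nr uw by (auto simp: A_def B_def Re_def)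
    have AB: "A \<inter> B = {}" "A \<union> B = V - {x}" "x \<notin> A" "x \<notin> B" "finite A" "finite B"
      using finite_V by (auto simp: A_def B_def)
    have sep: "e \<subseteq> insert x A \<or> e \<subseteq> insert x B" if "e \<in> Ed" for e
    proof (rule ccontr)
      assume n: "\<not> ?thesis"
      have eV: "e \<subseteq> insert x (A \<union> B)" using edge_subset[OF that] AB(2) by auto
      obtain s t where st: "s \<in> e" "t \<in> e" "s \<in> A" "t \<in> B" using n eV by blast
      then have "e = {s, t}" using edge[OF that] AB(1) by auto
      then have "(s, t) \<in> Re" using that st AB by (auto simp: Re_def)
      then have "t \<in> A" using st AB(2) unfolding A_def by (auto intro: rtrancl_into_rtrancl)
      then show False using st AB by auto
    qed
    define E1 where "E1 = {e \<in> Ed. e \<subseteq> insert x A}"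
    define E2 where "E2 = {e \<in> Ed. e \<subseteq> insert x B}"
    have E12: "Ed = E1 \<union> E2" using sep by (auto simp: E1_def E2_def)
    have "E1 \<inter> E2 = {}"
    proof (rule ccontr)
      assume "E1 \<inter> E2 \<noteq> {}"
      then obtain e where e: "e \<in> Ed" "e \<subseteq> insert x A" "e \<subseteq> insert x B" by (auto simp: E1_def E2_def)
      then have "e \<subseteq> {x}" using AB(1) by blast
      then show False using edge[OF e(1)] by auto
    qed
    then have cE: "card Ed = card E1 + card E2"
      using E12 finite_Ed card_Un_disjoint[of E1 E2] by simp
    have cV: "card V + 1 = card (insert x A) + card (insert x B)"
    proof -
      have "card (V - {x}) = card A + card B" using AB card_Un_disjoint[of A B] by simp
      then show ?thesis using AB x finite_V card_gt_0_iff[of V] by (auto simp: card_Diff_singleton)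
    qed
    have lt: "card (insert x A) < card V" "card (insert x B) < card V"
    proof -
      have "insert x A \<subset> V" "insert x B \<subset> V" using AB u w x by blast+
      then show "card (insert x A) < card V" "card (insert x B) < card V"
        using finite_V by (auto intro: psubset_card_mono)
    qed
    have sub: "insert x A \<subseteq> V" "insert x B \<subseteq> V" using AB x by auto
    have mono: "is_cyc Ed VC EC" if "is_cyc E VC EC" "E \<subseteq> Ed" for E VC EC
      using that unfolding is_cyc_def by blast
    have "g * card E1 + g \<le> 2 * card E1 + g * card (insert x A)"
    proof (rule less(1)[OF lt(1)])
      show "plane_graph (insert x A) E1 f \<gamma>" using sub(1) by (intro sub_plane) (auto simp: E1_def)
      show "insert x A \<noteq> {}" by simp
      show "g \<le> card EC" if "is_cyc E1 VC EC" for VC EC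
        using girth[OF mono[OF that]] by (auto simp: E1_def)
    qed
    moreover have "g * card E2 + g \<le> 2 * card E2 + g * card (insert x B)"
    proof (rule less(1)[OF lt(2)])
      show "plane_graph (insert x B) E2 f \<gamma>" using sub(2) by (intro sub_plane) (auto simp: E2_def)
      show "insert x B \<noteq> {}" by simp
      show "g \<le> card EC" if "is_cyc E2 VC EC" for VC EC
        using girth[OF mono[OF that]] by (auto simp: E2_def)
    qed
    \<comment> \<open>Both parts contain \<open>x\<close>; one of the two summands \<open>g\<close>
      pays for counting it twice.\<close>
    ultimately have "g * card Ed + 2 * g \<le> 2 * card Ed + g * (card V + 1)"
      unfolding cE cV by (simp add: algebra_simps)
    then show ?thesis by (simp add: algebra_simps)
  qed
qed

section \<open>Finite graphs as symmetric relations\<close>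

definition nb :: "('a \<times> 'a) set \<Rightarrow> 'a set \<Rightarrow> 'a \<Rightarrow> 'a set" where
  "nb E W v = {w \<in> W. (v, w) \<in> E}"

text \<open>Every edge inside \<open>W\<close> is counted twice.\<close>

definition ar :: "('a \<times> 'a) set \<Rightarrow> 'a set \<Rightarrow> nat" where
  "ar E W = card (E \<inter> W \<times> W)"

definition girth_ge :: "('a \<times> 'a) set \<Rightarrow> nat \<Rightarrow> bool" where
  "girth_ge E g \<longleftrightarrow> (\<forall>vs. distinct vs \<and> 3 \<le> length vs \<and> successively (\<lambda>x y. (x, y) \<in> E) vs
     \<and> (last vs, hd vs) \<in> E \<longrightarrow> g \<le> length vs)"

text \<open>Walks that never turn back along the edge just used. They can be glued by looking at two
  neighbors of the common vertex only, and large girth makes short ones simple.\<close>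

fun nbw :: "('a \<times> 'a) set \<Rightarrow> 'a list \<Rightarrow> bool" where
  "nbw E (x # y # z # zs) \<longleftrightarrow> (x, y) \<in> E \<and> x \<noteq> z \<and> nbw E (y # z # zs)"
| "nbw E [x, y] \<longleftrightarrow> (x, y) \<in> E"
| "nbw E _ \<longleftrightarrow> True"

lemma nbw_tl: "nbw E (x # xs) \<Longrightarrow> nbw E xs"
  by (cases xs; cases "tl xs") auto

lemma nbw_butlast: "nbw E xs \<Longrightarrow> nbw E (butlast xs)"
proof (induction E xs rule: nbw.induct)
  case (1 E x y z zs)
  then show ?case by (cases zs) auto
qed auto

lemma nbw_successively: "nbw E xs \<Longrightarrow> successively (\<lambda>x y. (x, y) \<in> E) xs"
  by (induction E xs rule: nbw.induct) auto

lemma nbw_last: "nbw E (xs @ [y]) \<Longrightarrow> xs \<noteq> [] \<Longrightarrow> (last xs, y) \<in> E"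
proof (induction E xs rule: nbw.induct)
  case (1 E x y z zs)
  then show ?case by (cases zs) auto
qed auto

text \<open>In a shortest counterexample only the first and the last vertex coincide. Dropping the
  last gives a cycle on fewer than \<open>g\<close> vertices; it has at least three because there
  are no loops and no backtracking.\<close>

lemma nbw_distinct:
  assumes "girth_ge E g" "irrefl E" "nbw E xs" "length xs \<le> g"
  shows "distinct xs"
  using assms(3,4)
proof (induction "length xs" arbitrary: xs rule: less_induct)
  case less
  show ?case
  proof (cases xs)
    case (Cons x ys)
    have dt: "distinct ys" using less(1)[of ys] less(2,3) Cons nbw_tl by fastforce
    show ?thesis
    proof (cases "x \<in> set ys")
      case True
      have "distinct (butlast xs)" using less(1)[of "butlast xs"] less(2,3) Cons nbw_butlast by fastforce
      moreover have "ys \<noteq> []" using True by auto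
      ultimately have "x \<notin> set (butlast ys)" using Cons by auto
      then have xl: "last ys = x" using True \<open>ys \<noteq> []\<close> by (metis append_butlast_last_id in_set_conv_decomp_last rotate1.simps(2) set_ConsD set_rotate1)
      obtain y zs where yz: "ys = y # zs" using \<open>ys \<noteq> []\<close> by (cases ys) auto
      have xy: "(x, y) \<in> E" using nbw_successively[OF less(2)] Cons yz by auto
      have "zs \<noteq> []" using xl yz xy assms(2) by (auto simp: irrefl_def)
      then obtain z ws where zw: "zs = z # ws" by (cases zs) auto
      have "x \<noteq> z" using less(2) Cons yz zw by simp
      then have "ws \<noteq> []" using xl yz zw by auto
      let ?vs = "butlast xs"
      have "3 \<le> length ?vs" using Cons yz zw \<open>ws \<noteq> []\<close> by (cases ws) auto
      moreover have "(last ?vs, hd ?vs) \<in> E"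
      proof -
        have "xs = ?vs @ [x]" using Cons xl \<open>ys \<noteq> []\<close> by (metis append_butlast_last_id last_ConsR list.distinct(1))
        then have "(last ?vs, x) \<in> E" using nbw_last[of E ?vs x] less(2) Cons \<open>ys \<noteq> []\<close> by auto
        then show ?thesis using Cons \<open>ys \<noteq> []\<close> by auto
      qed
      moreover have "successively (\<lambda>x y. (x, y) \<in> E) ?vs" using nbw_successively nbw_butlast less(2) by blast
      ultimately have "g \<le> length ?vs" using assms(1) \<open>distinct (butlast xs)\<close> unfolding girth_ge_def by blast
      then have "g \<le> length xs - 1" by simp
      then show ?thesis using less(3) Cons by simp
    qed (use dt Cons in auto)
  qed auto
qed

lemma finite_nb [simp]: "finite W \<Longrightarrow> finite (nb E W v)"
  by (auto simp: nb_def)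

lemma ar_sum: "finite W \<Longrightarrow> ar E W = (\<Sum>v\<in>W. card (nb E W v))"
proof -
  assume f: "finite W"
  have "E \<inter> W \<times> W = Sigma W (nb E W)" by (auto simp: nb_def)
  then show ?thesis using f by (simp add: ar_def card_SigmaI)
qed

section \<open>Star colorings\<close>

text \<open>
  In a star coloring every bicolored star can be oriented towards its center. Conversely, an orientation
  in which each out-neighbor has a color of its own in the neighborhood certifies a star coloring.
\<close>

definition star_orient :: "('a \<times> 'a) set \<Rightarrow> 'a set \<Rightarrow> ('a \<Rightarrow> nat) \<Rightarrow> ('a \<Rightarrow> 'a set) \<Rightarrow> bool" where
  "star_orient E W c D \<longleftrightarrow> (\<forall>u\<in>W. \<forall>v\<in>nb E W u. c u \<noteq> c v \<and> (v \<in> D u \<or> u \<in> D v) \<and>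
     (v \<in> D u \<longrightarrow> (\<forall>w\<in>nb E W u. w \<noteq> v \<longrightarrow> c w \<noteq> c v)))"

lemma induced_sub_arcs_ends:
  assumes "induced_subgraph C G"
  shows "arcs_ends C = arcs_ends G \<inter> verts C \<times> verts C"
proof -
  have "tail C = tail G" "head C = head G" "arcs C = {e \<in> arcs G. tail G e \<in> verts C \<and> head G e \<in> verts C}"
    using assms by (auto simp: induced_subgraph_def subgraph_def compatible_def)
  then show ?thesis by (auto simp: arcs_ends_conv)
qed

lemma induced_sub_graph:
  assumes "induced_subgraph C G" "graph G"
  shows "graph C"
proof -
  interpret G: graph G by fact
  have c: "tail C = tail G" "head C = head G" "arcs C \<subseteq> arcs G" "verts C \<subseteq> verts G" "wf_digraph C"
    using assms(1) by (auto simp: induced_subgraph_def subgraph_def compatible_def)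
  interpret C: wf_digraph C by fact
  show ?thesis
  proof
    show "finite (verts C)" "finite (arcs C)" using c finite_subset G.finite_verts G.finite_arcs by blast+
    show "tail C e \<noteq> head C e" if "e \<in> arcs C" for e using that c G.no_loops by auto
    show "e1 = e2" if "e1 \<in> arcs C" "e2 \<in> arcs C" "arc_to_ends C e1 = arc_to_ends C e2" for e1 e2
      using that c G.no_multi_arcs[of e1 e2] by (auto simp: arc_to_ends_def)
    show "symmetric C" using induced_graph_imp_symmetric[OF G.sym_arcs assms(1)] .
  qed
qed

text \<open>Every edge has an end of degree one. The center \<open>z\<close> is the neighbor of such
  an end, or the only vertex if there is no edge. Every neighbor of \<open>z\<close> is then a leaf,
  and connectivity leaves nothing else.\<close>

lemma star_component:
  assumes C: "graph C" "strongly_connected C"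
    and u1: "\<And>u v. (u, v) \<in> arcs_ends C \<Longrightarrow> (\<forall>w. (u, w) \<in> arcs_ends C \<longrightarrow> w = v) \<or> (\<forall>w. (v, w) \<in> arcs_ends C \<longrightarrow> w = u)"
  shows "\<exists>m. K\<^bsub>1,m\<^esub> C"
proof -
  interpret graph C by fact
  have sym: "(v, u) \<in> arcs_ends C" if "(u, v) \<in> arcs_ends C" for u v using that graph_symmetric by blast
  have irr: "u \<noteq> v" if "(u, v) \<in> arcs_ends C" for u v using that no_loops by (auto simp: arcs_ends_conv)
  have inV: "u \<in> verts C \<and> v \<in> verts C" if "(u, v) \<in> arcs_ends C" for u v using that by (auto simp: arcs_ends_conv)
  obtain x where x: "x \<in> verts C" using C(2) by (auto simp: strongly_connected_def)
  obtain z where z: "z \<in> verts C" and zz: "\<And>w y. (z, w) \<in> arcs_ends C \<Longrightarrow> (w, y) \<in> arcs_ends C \<Longrightarrow> y = z"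
  proof (cases "arcs_ends C = {}")
    case True
    then show ?thesis using that x by blast
  next
    case False
    then obtain u v where uv: "(u, v) \<in> arcs_ends C" by auto
    have "\<exists>u z. (u, z) \<in> arcs_ends C \<and> (\<forall>w. (u, w) \<in> arcs_ends C \<longrightarrow> w = z)"
      using u1[OF uv] uv sym[OF uv] by auto
    then obtain u z where u: "(u, z) \<in> arcs_ends C" "\<And>w. (u, w) \<in> arcs_ends C \<Longrightarrow> w = z" by blast
    have "y = z" if "(z, w) \<in> arcs_ends C" "(w, y) \<in> arcs_ends C" for w y
    proof (rule ccontr)
      assume "y \<noteq> z"
      then have "\<forall>w'. (z, w') \<in> arcs_ends C \<longrightarrow> w' = w" using u1[OF that(1)] that(2) by auto
      then have "u = w" using sym[OF u(1)] by auto
      then show False using u(2) that(2) \<open>y \<noteq> z\<close> by auto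
    qed
    then show ?thesis using that[of z] inV[OF u(1)] by blast
  qed
  define N where "N = {w. (z, w) \<in> arcs_ends C}"
  have VC: "verts C = {z} \<union> N"
  proof
    show "verts C \<subseteq> {z} \<union> N"
    proof
      fix y assume "y \<in> verts C"
      then have "z \<rightarrow>\<^sup>*\<^bsub>C\<^esub> y" using C(2) z by (auto simp: strongly_connected_def)
      then have "(z, y) \<in> rtrancl_on (verts C) (arcs_ends C)" by (simp add: reachable_def)
      then show "y \<in> {z} \<union> N"
      proof (induction rule: rtrancl_on_induct)
        case (step y y')
        then show ?case using zz by (auto simp: N_def)
      qed auto
    qed
    show "{z} \<union> N \<subseteq> verts C" using z inV by (auto simp: N_def)
  qed
  have zN: "z \<notin> N" using irr by (auto simp: N_def)
  have "arcs_ends C = {z} \<times> N \<union> N \<times> {z}"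
  proof
    show "arcs_ends C \<subseteq> {z} \<times> N \<union> N \<times> {z}"
    proof
      fix p assume p: "p \<in> arcs_ends C"
      obtain u v where uv: "p = (u, v)" by (cases p)
      then have "u = z \<or> u \<in> N" using inV[of u v] p VC by auto
      then show "p \<in> {z} \<times> N \<union> N \<times> {z}" using uv p zz by (auto simp: N_def)
    qed
    show "{z} \<times> N \<union> N \<times> {z} \<subseteq> arcs_ends C" using sym by (auto simp: N_def)
  qed
  then have "verts C = {z} \<union> N \<and> {z} \<inter> N = {} \<and> card {z} = 1 \<and> card N = card N \<and>
      arcs_ends C = {z} \<times> N \<union> N \<times> {z}"
    using VC zN by simp
  then have "\<exists>U V. verts C = U \<union> V \<and> U \<inter> V = {} \<and> card U = 1 \<and> card V = card N \<and>
      arcs_ends C = U \<times> V \<union> V \<times> U"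
    by (rule_tac x = "{z}" in exI, rule_tac x = N in exI)
  then have "K\<^bsub>1,card N\<^esub> C"
    unfolding complete_bipartite_digraph_def using C(1) by simp
  then show ?thesis by (rule exI)
qed

text \<open>Inside two color classes all neighbors of a vertex have the same color, while an
  out-neighbor has a color of its own among them. So the tail of an oriented edge has no other
  neighbor there, and each edge has an end of degree one.\<close>

lemma star_orient_coloring:
  assumes G: "graph G" and so: "star_orient (arcs_ends G) (verts G) c D"
  shows "star_coloring G c"
proof -
  interpret G: graph G by fact
  let ?E = "arcs_ends G"
  have inV: "u \<in> verts G \<and> v \<in> verts G" if "(u, v) \<in> ?E" for u v using that by (auto simp: arcs_ends_conv)
  have sym: "(v, u) \<in> ?E" if "(u, v) \<in> ?E" for u v using that G.graph_symmetric by blast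
  have so1: "c u \<noteq> c v" "v \<in> D u \<or> u \<in> D v" and so2: "v \<in> D u \<Longrightarrow> (u, w) \<in> ?E \<Longrightarrow> w \<noteq> v \<Longrightarrow> c w \<noteq> c v"
    if "(u, v) \<in> ?E" for u v w
  proof -
    have "u \<in> verts G" "v \<in> nb ?E (verts G) u" using inV[OF that] that by (auto simp: nb_def)
    then have *: "c u \<noteq> c v \<and> (v \<in> D u \<or> u \<in> D v) \<and> (v \<in> D u \<longrightarrow> (\<forall>w\<in>nb ?E (verts G) u. w \<noteq> v \<longrightarrow> c w \<noteq> c v))"
      using so unfolding star_orient_def by blast
    then show "c u \<noteq> c v" "v \<in> D u \<or> u \<in> D v" by auto
    show "c w \<noteq> c v" if "v \<in> D u" "(u, w) \<in> ?E" "w \<noteq> v"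
      using * that inV[of u w] by (auto simp: nb_def)
  qed
  have "star_forest (induce_subgraph G {v \<in> verts G. c v = i \<or> c v = j})" if ij: "i \<noteq> j" for i j
  proof -
    let ?S = "{v \<in> verts G. c v = i \<or> c v = j}"
    let ?H = "induce_subgraph G ?S"
    have H: "induced_subgraph ?H G" by (intro G.induced_induce) auto
    have gH: "graph ?H" using induced_sub_graph[OF H G] .
    show ?thesis unfolding star_forest_def
    proof
      fix C assume "C \<in> pre_digraph.sccs ?H"
      then have C: "induced_subgraph C ?H" "strongly_connected C" by (auto simp: pre_digraph.sccs_def)
      have ae: "arcs_ends C \<subseteq> ?E" "verts C \<subseteq> ?S"
        using induced_sub_arcs_ends[OF C(1)] induced_sub_arcs_ends[OF H] C(1)
        by (auto simp: induced_subgraph_def subgraph_def)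
      have gC: "graph C" using induced_sub_graph[OF C(1) gH] .
      interpret C: graph C by fact
      have col: "c u = i \<or> c u = j" "c v = i \<or> c v = j" if "(u, v) \<in> arcs_ends C" for u v
      proof -
        have "u \<in> verts C" "v \<in> verts C" using that by (auto simp: arcs_ends_conv)
        then show "c u = i \<or> c u = j" "c v = i \<or> c v = j" using ae(2) by auto
      qed
      have one: "w = v" if "(u, v) \<in> arcs_ends C" "v \<in> D u" "(u, w) \<in> arcs_ends C" for u v w
      proof -
        have "c w = c v" using col[OF that(1)] col[OF that(3)] so1(1)[of u v] so1(1)[of u w] that ae(1) by auto
        then show ?thesis using so2[of u v w] that ae(1) by auto
      qed
      have "(\<forall>w. (u, w) \<in> arcs_ends C \<longrightarrow> w = v) \<or> (\<forall>w. (v, w) \<in> arcs_ends C \<longrightarrow> w = u)"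
        if "(u, v) \<in> arcs_ends C" for u v
      proof -
        have vu: "(v, u) \<in> arcs_ends C" using C.graph_symmetric[OF that] .
        have "v \<in> D u \<or> u \<in> D v" using so1(2)[of u v] that ae(1) by auto
        then show ?thesis using one[OF that] one[OF vu] by auto
      qed
      then show "\<exists>m. K\<^bsub>1,m\<^esub> C" by (rule star_component[OF gC C(2)])
    qed
  qed
  moreover have "proper_coloring G c" using so1 by (auto simp: proper_coloring_def)
  ultimately show ?thesis by (simp add: star_coloring_def)
qed

lemma star_chromatic_le:
  assumes "graph G" "star_orient (arcs_ends G) (verts G) c D" "\<And>v. v \<in> verts G \<Longrightarrow> c v < k"
  shows "star_chromatic_number G \<le> k"
proof -
  have "star_coloring G c \<and> c ` verts G \<subseteq> {..<k}"
    using star_orient_coloring[OF assms(1,2)] assms(3) by auto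
  then show ?thesis unfolding star_chromatic_number_def by (intro Least_le exI)
qed

section \<open>Density of planar graphs of large girth\<close>

lemma walk_arcs:
  assumes "graph G" "successively (\<lambda>x y. (x, y) \<in> arcs_ends G) vs" "vs \<noteq> []" "hd vs \<in> verts G"
  shows "\<exists>p. pre_digraph.awalk G (hd vs) p (last vs) \<and> pre_digraph.awalk_verts G (hd vs) p = vs"
  using assms(2-)
proof (induction vs rule: induct_list012)
  case (2 x)
  interpret graph G by fact
  show ?case using 2 by (intro exI[of _ "[]"]) (auto simp: awalk_Nil_iff)
next
  case (3 x y zs)
  interpret graph G by fact
  obtain a where a: "a \<in> arcs G" "tail G a = x" "head G a = y" using 3(3) by (auto simp: arcs_ends_conv)
  then have "y \<in> verts G" by auto
  then obtain p where p: "awalk y p (last (y # zs))" "awalk_verts y p = y # zs" using 3(2,3) by auto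
  show ?case using a p by (intro exI[of _ "a # p"]) (auto simp: awalk_Cons_iff)
qed auto

lemma girth_list:
  assumes G: "graph G" and "enat g \<le> girth G"
  shows "girth_ge (arcs_ends G) g"
  unfolding girth_ge_def
proof (intro allI impI, elim conjE)
  fix vs assume vs: "distinct vs" "3 \<le> length vs" "successively (\<lambda>x y. (x, y) \<in> arcs_ends G) vs"
    "(last vs, hd vs) \<in> arcs_ends G"
  interpret graph G by fact
  have ne: "vs \<noteq> []" using vs(2) by auto
  have hv: "hd vs \<in> verts G" using vs(4) by (auto simp: arcs_ends_conv)
  let ?ws = "vs @ [hd vs]"
  have "successively (\<lambda>x y. (x, y) \<in> arcs_ends G) ?ws" using vs(3,4) ne by (simp add: successively_append_iff)
  then obtain p where p: "awalk (hd vs) p (hd vs)" "awalk_verts (hd vs) p = ?ws"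
    using walk_arcs[OF G, of ?ws] ne hv by auto
  have lp: "length p = length vs" using p(2) length_awalk_verts[of "hd vs" p] by simp
  have "distinct (tl ?ws)" using vs(1) ne by (cases vs) auto
  then have "cycle p" unfolding cycle_def using p lp vs(2) by (intro exI[of _ "hd vs"]) auto
  then have "girth G \<le> enat (length p)" unfolding girth_def using lp vs(2) by (intro INF_lower) auto
  then show "g \<le> length vs" using assms(2) lp by (metis enat_ord_simps(1) order_trans)
qed

lemma ed_successively:
  assumes "ed vs \<subseteq> {{u, v} | u v. (u, v) \<in> E}" "sym E"
  shows "successively (\<lambda>x y. (x, y) \<in> E) vs"
  using assms(1)
proof (induction vs rule: induct_list012)
  case (3 x y zs)
  then have "\<exists>u v. {x, y} = {u, v} \<and> (u, v) \<in> E" by auto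
  then have "(x, y) \<in> E" using symD[OF assms(2)] by (auto simp: doubleton_eq_iff)
  then show ?case using 3 by auto
qed auto

lemma graph_rel:
  assumes "graph G"
  shows "finite (verts G)" "sym (arcs_ends G)" "irrefl (arcs_ends G)" "arcs_ends G \<subseteq> verts G \<times> verts G"
proof -
  interpret graph G by fact
  show "finite (verts G)" by simp
  show "sym (arcs_ends G)" using sym_arcs by (simp add: symmetric_def)
  show "irrefl (arcs_ends G)" using no_loops by (auto simp: arcs_ends_conv irrefl_def)
  show "arcs_ends G \<subseteq> verts G \<times> verts G" by (auto simp: arcs_ends_conv)
qed

text \<open>\<open>ar\<close> is twice the number of edges, whence the doubled coefficients. For
  girth 8, 9 and 13 this gives 3 ar < 8 n, 7 ar < 18 n and 11 ar < 26 n.\<close>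

theorem planar_density:
  assumes G: "graph G" and "planar G" and gi: "enat g \<le> girth G" and H: "H \<subseteq> verts G" "H \<noteq> {}"
  shows "g * ar (arcs_ends G) H + 2 * g \<le> 2 * ar (arcs_ends G) H + 2 * g * card H"
proof -
  let ?E = "arcs_ends G"
  note sym = graph_rel(2)[OF G]
  have irr: "u \<noteq> v" if "(u, v) \<in> ?E" for u v using that graph_rel(3)[OF G] by (auto simp: irrefl_def)
  have finH: "finite H" using H(1) graph_rel(1)[OF G] by (rule finite_subset)
  obtain f :: "'a \<Rightarrow> complex" and \<gamma> :: "'a set \<Rightarrow> real \<Rightarrow> complex" where f: "inj_on f (verts G)"
    and p1: "\<forall>(u, v)\<in>?E. arc (\<gamma> {u, v}) \<and> {pathstart (\<gamma> {u, v}), pathfinish (\<gamma> {u, v})} = {f u, f v} \<and>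
        path_image (\<gamma> {u, v}) \<inter> f ` verts G = {f u, f v}"
    and p2: "\<forall>(u, v)\<in>?E. \<forall>(x, y)\<in>?E. {u, v} \<noteq> {x, y} \<longrightarrow>
        path_image (\<gamma> {u, v}) \<inter> path_image (\<gamma> {x, y}) \<subseteq> f ` ({u, v} \<inter> {x, y})"
    using assms(2) unfolding planar_def by (elim exE conjE)
  have e1: "arc (\<gamma> {u, v})" "{pathstart (\<gamma> {u, v}), pathfinish (\<gamma> {u, v})} = {f u, f v}"
      "path_image (\<gamma> {u, v}) \<inter> f ` verts G = {f u, f v}" if "(u, v) \<in> ?E" for u v
    using bspec[OF p1 that] by simp_all
  have e2: "path_image (\<gamma> {u, v}) \<inter> path_image (\<gamma> {x, y}) \<subseteq> f ` ({u, v} \<inter> {x, y})"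
    if "(u, v) \<in> ?E" "(x, y) \<in> ?E" "{u, v} \<noteq> {x, y}" for u v x y
    using bspec[OF p2 that(1)] that(2,3) by auto
  define Ed where "Ed = {{u, v} | u v. (u, v) \<in> ?E \<inter> H \<times> H}"
  have Ed: "\<exists>u v. e = {u, v} \<and> (u, v) \<in> ?E \<and> u \<in> H \<and> v \<in> H" if "e \<in> Ed" for e
    using that by (auto simp: Ed_def)
  have pg: "plane_graph H Ed f \<gamma>"
  proof (rule plane_graph.intro)
    show "finite H" by fact
    show "inj_on f H" using f H(1) by (rule inj_on_subset)
    fix e assume "e \<in> Ed"
    then obtain u v where e: "e = {u, v}" "(u, v) \<in> ?E" "u \<in> H" "v \<in> H" using Ed by blast
    show "\<exists>u v. e = {u, v} \<and> u \<in> H \<and> v \<in> H \<and> u \<noteq> v" using e irr by blast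
    show "arc (\<gamma> e)" "{pathstart (\<gamma> e), pathfinish (\<gamma> e)} = f ` e" using e1[OF e(2)] e(1) by auto
    have "path_image (\<gamma> e) \<inter> f ` verts G = {f u, f v}" unfolding e(1) by (rule e1(3)[OF e(2)])
    then show "path_image (\<gamma> e) \<inter> f ` H = f ` e" using e H(1) by blast
    fix e' assume "e' \<in> Ed" "e \<noteq> e'"
    then obtain x y where xy: "e' = {x, y}" "(x, y) \<in> ?E" using Ed by blast
    show "path_image (\<gamma> e) \<inter> path_image (\<gamma> e') \<subseteq> f ` (e \<inter> e')"
      using e2[OF e(2) xy(2)] \<open>e \<noteq> e'\<close> unfolding e(1) xy(1) by simp
  qed
  have gc: "g \<le> card EC" if C: "is_cyc Ed VC EC" for VC EC
  proof -
    obtain vs where vs: "distinct vs" "3 \<le> length vs" "VC = set vs" "EC = ed (vs @ [hd vs])" "EC \<subseteq> Ed"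
      using C by (auto simp: is_cyc_def)
    have ne: "vs \<noteq> []" using vs(2) by auto
    have "Ed \<subseteq> {{u, v} | u v. (u, v) \<in> ?E}" unfolding Ed_def by blast
    then have "ed (vs @ [hd vs]) \<subseteq> {{u, v} | u v. (u, v) \<in> ?E}" using vs(4,5) by simp
    then have "successively (\<lambda>x y. (x, y) \<in> ?E) (vs @ [hd vs])" using sym by (rule ed_successively)
    then have "successively (\<lambda>x y. (x, y) \<in> ?E) vs" "(last vs, hd vs) \<in> ?E" using ne by (auto simp: successively_append_iff)
    then have "g \<le> length vs" using girth_list[OF G gi] vs(1,2) unfolding girth_ge_def by simp
    moreover have "card EC = length vs" using is_cyc_card[OF C] distinct_card[OF vs(1)] unfolding vs(3) by simp
    ultimately show ?thesis by simp
  qed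
  have bound: "g * card Ed + g \<le> 2 * card Ed + g * card H"
    using pg H(2) gc by (rule planar_edge_bound)
  have "ar ?E H = 2 * card Ed"
  proof -
    let ?A = "?E \<inter> H \<times> H"
    have fA: "finite ?A" using finH by (auto intro: finite_subset[of _ "H \<times> H"])
    have im: "(\<lambda>(u, v). {u, v}) ` ?A = Ed" by (auto simp: Ed_def)
    have two: "card {p \<in> ?A. (case p of (u, v) \<Rightarrow> {u, v}) = e} = 2" if "e \<in> Ed" for e
    proof -
      obtain u v where e: "e = {u, v}" "(u, v) \<in> ?E" "u \<in> H" "v \<in> H" using Ed \<open>e \<in> Ed\<close> by blast
      have "{p \<in> ?A. (case p of (u, v) \<Rightarrow> {u, v}) = e} = {(u, v), (v, u)}"
        using e symD[OF sym] by (auto simp: doubleton_eq_iff)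
      then show ?thesis using irr[OF e(2)] by simp
    qed
    have "card ?A = (\<Sum>e\<in>(\<lambda>(u, v). {u, v}) ` ?A. \<Sum>p\<in>{p \<in> ?A. (case p of (u, v) \<Rightarrow> {u, v}) = e}. 1)"
      using sum.image_gen[OF fA, of "\<lambda>_. 1::nat" "\<lambda>(u, v). {u, v}"] by simp
    also have "\<dots> = (\<Sum>e\<in>Ed. 2)" unfolding im using two by simp
    finally show ?thesis by (simp add: ar_def)
  qed
  then show ?thesis using bound by (simp add: algebra_simps)
qed

section \<open>Extending colorings vertex by vertex\<close>

text \<open>
  The invariant of all inductions below: a coloring \<open>c\<close> of \<open>R\<close> with \<open>k\<close> colors and an orientation as
  in \<^const>\<open>star_orient\<close> with out-degrees at most \<open>q\<close>. \<open>A u\<close> are the colors that a new vertex may take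
  when it is attached to \<open>u\<close> by an edge oriented towards \<open>u\<close>.
\<close>

definition good :: "nat \<Rightarrow> ('a \<times> 'a) set \<Rightarrow> ('a \<Rightarrow> nat) \<Rightarrow> 'a set \<Rightarrow> ('a \<Rightarrow> nat) \<Rightarrow> ('a \<Rightarrow> nat set) \<Rightarrow> bool" where
  "good k E q R c A \<longleftrightarrow> (\<exists>D. star_orient E R c D \<and>
     (\<forall>u\<in>R. c u < k \<and> D u \<subseteq> nb E R u \<and> card (D u) \<le> q u \<and> A u = {x. x < k \<and> x \<noteq> c u \<and> x \<notin> c ` D u}))"

lemma good_empty: "good k E q {} c A"
  by (auto simp: good_def star_orient_def)

text \<open>Only the color of \<open>u\<close> and the colors of its out-neighbors are excluded;
  in-neighbors cost nothing. So the out-degree, not the degree, controls how many colors a vertex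
  offers.\<close>

lemma good_avail:
  assumes "good k E q R c A" "finite R" "u \<in> R"
  shows "A u \<subseteq> {..<k}" "finite (A u)" "c u \<notin> A u" "c u < k" "k \<le> card (A u) + 1 + q u"
proof -
  obtain D where D: "c u < k" "D u \<subseteq> nb E R u" "card (D u) \<le> q u" "A u = {x. x < k \<and> x \<noteq> c u \<and> x \<notin> c ` D u}"
    using assms unfolding good_def by auto
  show "A u \<subseteq> {..<k}" "finite (A u)" "c u \<notin> A u" "c u < k" using D by auto
  have f: "finite (D u)" using D(2) finite_nb[OF assms(2)] by (rule finite_subset)
  have "finite (A u)" unfolding D(4) by simp
  moreover have "{..<k} \<subseteq> A u \<union> insert (c u) (c ` D u)" unfolding D(4) by blast
  ultimately have "card {..<k} \<le> card (A u \<union> insert (c u) (c ` D u))"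
    using f by (intro card_mono) simp_all
  also have "\<dots> \<le> card (A u) + card (insert (c u) (c ` D u))" by (rule card_Un_le)
  also have "card (insert (c u) (c ` D u)) \<le> Suc (card (c ` D u))" using f by (simp add: card_insert_if)
  also have "card (c ` D u) \<le> q u" using card_image_le[OF f, of c] D(3) by linarith
  finally show "k \<le> card (A u) + 1 + q u" by simp
qed

lemma good_mono:
  assumes "good k E q R c A" "\<And>u. u \<in> R \<Longrightarrow> q u \<le> q' u"
  shows "good k E q' R c A"
proof -
  obtain D where "star_orient E R c D" and D: "\<And>u. u \<in> R \<Longrightarrow> c u < k \<and> D u \<subseteq> nb E R u \<and> card (D u) \<le> q u
      \<and> A u = {x. x < k \<and> x \<noteq> c u \<and> x \<notin> c ` D u}"
    using assms(1) unfolding good_def by auto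
  moreover have "card (D u) \<le> q' u" if "u \<in> R" for u using D[OF that] assms(2)[OF that] by simp
  ultimately show ?thesis unfolding good_def by blast
qed

lemma good_star_orient: "good k E q R c A \<Longrightarrow> \<exists>D. star_orient E R c D \<and> (\<forall>u\<in>R. c u < k)"
  by (auto simp: good_def)

text \<open>All edges from the new vertex to \<open>R\<close> are oriented away from it, so the
  out-sets and available colors of old vertices do not change. A color available at each neighbor
  respects their out-neighbors, and injectivity on \<open>N\<close> gives the new out-neighbors
  colors of their own.\<close>

lemma good_add:
  assumes g: "good k E q R c A" and sym: "sym E" and irr: "irrefl E" and x: "x \<notin> R"
    and N: "nb E R x = N" and y: "y < k" "\<And>n. n \<in> N \<Longrightarrow> y \<in> A n" and q: "card N \<le> q x" and inj: "inj_on c N"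
  shows "good k E q (insert x R) (c(x := y)) (A(x := {z. z < k \<and> z \<noteq> y \<and> z \<notin> c ` N}))"
proof -
  obtain D where so: "star_orient E R c D" and D: "\<And>u. u \<in> R \<Longrightarrow> c u < k \<and> D u \<subseteq> nb E R u \<and> card (D u) \<le> q u
      \<and> A u = {x. x < k \<and> x \<noteq> c u \<and> x \<notin> c ` D u}"
    using g unfolding good_def by auto
  have NR: "N \<subseteq> R" using N by (auto simp: nb_def)
  have nbx: "nb E (insert x R) x = N" using N irr by (auto simp: nb_def irrefl_def)
  have nbu: "nb E (insert x R) u = (if u \<in> N then insert x (nb E R u) else nb E R u)" if "u \<in> R" for u
    using that N symD[OF sym] by (auto simp: nb_def)
  let ?c = "c(x := y)" and ?D = "D(x := N)"
  have cN: "?c ` N = c ` N" using x NR by (auto simp: image_iff)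
  have cD: "?c ` D u = c ` D u" if "u \<in> R" for u
    using D[OF that] x by (auto simp: nb_def image_iff)
  have yN: "y \<noteq> c n \<and> y \<notin> c ` D n" if "n \<in> N" for n using y(2)[OF that] D[of n] NR that by auto
  have "star_orient E (insert x R) ?c ?D" unfolding star_orient_def
  proof (intro ballI)
    fix u v assume u: "u \<in> insert x R" and v: "v \<in> nb E (insert x R) u"
    show "?c u \<noteq> ?c v \<and> (v \<in> ?D u \<or> u \<in> ?D v) \<and>
       (v \<in> ?D u \<longrightarrow> (\<forall>w\<in>nb E (insert x R) u. w \<noteq> v \<longrightarrow> ?c w \<noteq> ?c v))"
    proof (cases "u = x")
      case True
      then have vN: "v \<in> N" "v \<noteq> x" using v nbx x NR by auto
      have "?c w \<noteq> ?c v" if "w \<in> N" "w \<noteq> v" for w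
        using inj_onD[OF inj] that vN x NR by auto
      then show ?thesis using True vN yN nbx by auto
    next
      case False
      then have uR: "u \<in> R" using u by simp
      have old: "c u \<noteq> c v \<and> (v \<in> D u \<or> u \<in> D v) \<and> (v \<in> D u \<longrightarrow> (\<forall>w\<in>nb E R u. w \<noteq> v \<longrightarrow> c w \<noteq> c v))"
        if "v \<in> nb E R u" using so uR that unfolding star_orient_def by blast
      show ?thesis
      proof (cases "v = x")
        case True
        then have "u \<in> N" using v nbu[OF uR] x by (auto simp: nb_def split: if_splits)
        moreover have "x \<notin> D u" using D[OF uR] x by (auto simp: nb_def)
        ultimately show ?thesis using True False yN[of u] by auto
      next
        case False
        then have vR: "v \<in> nb E R u" using v nbu[OF uR] by (auto split: if_splits)
        have "?c w \<noteq> ?c v" if "v \<in> D u" "w \<in> nb E (insert x R) u" "w \<noteq> v" for w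
        proof (cases "w = x")
          case True
          then have "u \<in> N" using that(2) nbu[OF uR] x by (auto simp: nb_def split: if_splits)
          then show ?thesis using yN[of u] that True \<open>v \<noteq> x\<close> by auto
        next
          case False
          then have "w \<in> nb E R u" using that(2) nbu[OF uR] by (auto split: if_splits)
          then show ?thesis using old[OF vR] that False \<open>v \<noteq> x\<close> by auto
        qed
        then show ?thesis using old[OF vR] False \<open>u \<noteq> x\<close> vR by (auto simp: nb_def)
      qed
    qed
  qed
  moreover have "?c u < k \<and> ?D u \<subseteq> nb E (insert x R) u \<and> card (?D u) \<le> q u \<and>
      (A(x := {z. z < k \<and> z \<noteq> y \<and> z \<notin> c ` N})) u = {z. z < k \<and> z \<noteq> ?c u \<and> z \<notin> ?c ` ?D u}" if "u \<in> insert x R" for u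
  proof (cases "u = x")
    case True
    then show ?thesis using y(1) q nbx cN by auto
  next
    case False
    then show ?thesis using that D[of u] cD[of u] nbu[of u] by auto
  qed
  ultimately show ?thesis unfolding good_def by blast
qed

lemma good_add_ex:
  assumes "good k E q R c A" "sym E" "irrefl E" "x \<notin> R" "nb E R x = N" "y < k" "\<And>n. n \<in> N \<Longrightarrow> y \<in> A n"
    "card N \<le> q x" "inj_on c N"
  shows "\<exists>c A. good k E q (insert x R) c A"
  by (rule exI, rule exI, rule good_add[OF assms])

lemma pick: "finite A \<Longrightarrow> length bs < card A \<Longrightarrow> \<exists>x\<in>A. x \<notin> set bs"
proof (rule ccontr)
  assume "finite A" "length bs < card A" "\<not> (\<exists>x\<in>A. x \<notin> set bs)"
  then have "card A \<le> card (set bs)" by (intro card_mono) auto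
  then show False using card_length[of bs] \<open>length bs < card A\<close> by simp
qed

lemma pick_lt: "length bs < k \<Longrightarrow> \<exists>x<k. x \<notin> set bs"
  using pick[of "{..<k}" bs] by auto

section \<open>Discharging and density\<close>

text \<open>With \<open>g v w\<close> as the charge sent from \<open>v\<close> to \<open>w\<close>,
  the total sent equals the total received, so a redistribution preserves the sum over all
  vertices.\<close>

lemma discharge:
  fixes g :: "'a \<Rightarrow> 'a \<Rightarrow> int"
  assumes "sym E" "finite W"
  shows "(\<Sum>v\<in>W. \<Sum>w\<in>nb E W v. g v w) = (\<Sum>v\<in>W. \<Sum>w\<in>nb E W v. g w v)"
proof -
  have "(\<Sum>v\<in>W. \<Sum>w\<in>nb E W v. g v w) = (\<Sum>v\<in>W. \<Sum>w\<in>W. if (v, w) \<in> E then g v w else 0)"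
    using assms(2) by (simp add: nb_def sum.inter_filter)
  also have "\<dots> = (\<Sum>w\<in>W. \<Sum>v\<in>W. if (v, w) \<in> E then g v w else 0)" by (rule sum.swap)
  also have "\<dots> = (\<Sum>w\<in>W. \<Sum>v\<in>W. if (w, v) \<in> E then g v w else 0)"
    using symD[OF assms(1)] by (intro sum.cong refl) auto
  also have "\<dots> = (\<Sum>w\<in>W. \<Sum>v\<in>nb E W w. g v w)"
    using assms(2) by (simp add: nb_def sum.inter_filter)
  finally show ?thesis .
qed

lemma sum_cases:
  "finite N \<Longrightarrow> (\<Sum>w\<in>N. if P w then (a::int) else 0) = a * int (card {w\<in>N. P w})"
  by (simp add: sum.If_cases Int_def)

lemma nb_sub: "R \<subseteq> W \<Longrightarrow> nb E R v = nb E W v \<inter> R"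
  by (auto simp: nb_def)

lemma nb_sym: "sym E \<Longrightarrow> v \<in> W \<Longrightarrow> w \<in> nb E W v \<Longrightarrow> v \<in> nb E W w"
  by (auto simp: nb_def dest: symD)

lemma nb_irrefl: "irrefl E \<Longrightarrow> v \<notin> nb E W v"
  by (auto simp: nb_def irrefl_def)

lemma nb_in: "w \<in> nb E W v \<Longrightarrow> w \<in> W"
  by (auto simp: nb_def)

lemma nb_memD: "irrefl E \<Longrightarrow> x \<in> nb E W a \<Longrightarrow> x \<in> W \<and> x \<noteq> a"
  by (auto simp: nb_def irrefl_def)

lemma card2_other:
  assumes "card N = 2" "v \<in> N"
  obtains u where "N = {v, u}" "u \<noteq> v"
  using assms by (auto simp: card_2_iff)

lemma card3_other:
  assumes "card N = 3" "a \<in> N" "b \<in> N" "a \<noteq> b"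
  obtains x where "N = {a, b, x}" "x \<noteq> a" "x \<noteq> b"
proof -
  have "finite N" using assms(1) card.infinite by fastforce
  then have "card (N - {a, b}) = 1" using assms by (simp add: card_Diff_subset)
  then obtain x where "N - {a, b} = {x}" by (auto simp: card_1_singleton_iff)
  then show ?thesis using that[of x] assms by auto
qed

section \<open>Six colors\<close>

text \<open>A nonempty graph of minimum degree two without adjacent vertices of degree two and
  without a vertex of degree three having two such neighbors is too dense: with initial charge 3 deg
  - 8 and one unit sent to each neighbor of degree two, no charge is negative. The excluded
  configurations are colored greedily, since each colored vertex offers three colors.\<close>

lemma six_colors:
  assumes sym: "sym E" and irr: "irrefl E" and "finite W"
    and "\<And>H. H \<subseteq> W \<Longrightarrow> H \<noteq> {} \<Longrightarrow> 3 * ar E H < 8 * card H"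
  shows "\<exists>c A. good 6 E (\<lambda>_. 2) W c A"
  using assms(3,4)
proof (induction "card W" arbitrary: W rule: less_induct)
  case (less W)
  note fin = less(2)
  let ?q = "\<lambda>_. 2 :: nat" and ?deg = "\<lambda>v. card (nb E W v)"
  have IH: "\<exists>c A. good 6 E ?q R c A" if "R \<subset> W" for R
  proof (rule less(1))
    show "card R < card W" using that fin by (rule psubset_card_mono[rotated])
    show "finite R" using that fin finite_subset by blast
    show "3 * ar E H < 8 * card H" if "H \<subseteq> R" "H \<noteq> {}" for H
      using less(3)[of H] that \<open>R \<subset> W\<close> by auto
  qed
  have size: "3 \<le> card (A u)" if "good 6 E ?q R c A" "u \<in> R" "R \<subseteq> W" for R c A u
    using good_avail(5)[OF that(1) finite_subset[OF that(3) fin] that(2)] by simp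
  consider (low) v where "v \<in> W" "?deg v \<le> 1"
    | (thread) a b where "a \<in> W" "b \<in> nb E W a" "?deg a = 2" "?deg b = 2"
    | (two) v a1 a2 where "v \<in> W" "?deg v = 3" "a1 \<in> nb E W v" "a2 \<in> nb E W v" "a1 \<noteq> a2" "?deg a1 = 2" "?deg a2 = 2"
        "\<And>a b. a \<in> W \<Longrightarrow> b \<in> nb E W a \<Longrightarrow> ?deg a = 2 \<Longrightarrow> ?deg b \<noteq> 2"
    | (rest) "\<And>v. v \<in> W \<Longrightarrow> 2 \<le> ?deg v" "\<And>a b. a \<in> W \<Longrightarrow> b \<in> nb E W a \<Longrightarrow> ?deg a = 2 \<Longrightarrow> ?deg b \<noteq> 2"
        "\<And>v. v \<in> W \<Longrightarrow> ?deg v = 3 \<Longrightarrow> card {a \<in> nb E W v. ?deg a = 2} \<le> 1"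
  proof -
    show ?thesis
    proof (cases "(\<exists>v\<in>W. ?deg v \<le> 1) \<or> (\<exists>a\<in>W. \<exists>b\<in>nb E W a. ?deg a = 2 \<and> ?deg b = 2)")
      case True
      then show ?thesis using that(1,2) by blast
    next
      case False
      then have 3: "\<And>v. v \<in> W \<Longrightarrow> 2 \<le> ?deg v" "\<And>a b. a \<in> W \<Longrightarrow> b \<in> nb E W a \<Longrightarrow> ?deg a = 2 \<Longrightarrow> ?deg b \<noteq> 2"
        by force+
      show ?thesis
      proof (cases "\<forall>v\<in>W. ?deg v = 3 \<longrightarrow> card {a \<in> nb E W v. ?deg a = 2} \<le> 1")
        case True
        then show ?thesis using that(4)[OF 3] by simp
      next
        case False
        then obtain v where v: "v \<in> W" "?deg v = 3" "\<not> card {a \<in> nb E W v. ?deg a = 2} \<le> Suc 0" by auto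
        have "finite {a \<in> nb E W v. ?deg a = 2}" using finite_nb[OF fin] by simp
        then obtain a1 a2 where "a1 \<in> nb E W v" "a2 \<in> nb E W v" "a1 \<noteq> a2" "?deg a1 = 2" "?deg a2 = 2"
          using v(3) card_le_Suc0_iff_eq by blast
        then show ?thesis using that(3)[OF v(1,2)] 3(2) by simp
      qed
    qed
  qed
  then show ?case
  proof cases
    case low
    let ?R = "W - {v}"
    obtain c A where g: "good 6 E ?q ?R c A" using IH[of ?R] low by auto
    have nbv: "nb E ?R v = nb E W v" using nb_irrefl[OF irr] by (auto simp: nb_def)
    have "\<exists>y<6. (\<forall>n\<in>nb E W v. y \<in> A n) \<and> inj_on c (nb E W v)"
    proof (cases "nb E W v = {}")
      case False
      then have "?deg v = 1" using low(2) finite_nb[OF fin, of E v] card_0_eq by fastforce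
      then obtain u where u: "nb E W v = {u}" by (auto simp: card_1_singleton_iff)
      then have uR: "u \<in> ?R" using nb_memD[OF irr, of u W v] by auto
      then have "3 \<le> card (A u)" using size[OF g] by auto
      then obtain y where y: "y \<in> A u" by fastforce
      then have "y < 6" using good_avail(1)[OF g _ uR] fin by auto
      then show ?thesis using u y by auto
    qed (auto intro: exI[of _ 0])
    then obtain y where y: "y < 6" "\<forall>n\<in>nb E W v. y \<in> A n" "inj_on c (nb E W v)" by blast
    have "good 6 E ?q (insert v ?R) (c(v := y)) (A(v := {z. z < 6 \<and> z \<noteq> y \<and> z \<notin> c ` nb E W v}))"
      using low y by (intro good_add[OF g sym irr _ nbv]) auto
    moreover have "insert v ?R = W" using low by auto
    ultimately show ?thesis by auto
  next
    case thread
    have bW: "b \<in> W" "b \<noteq> a" using nb_memD[OF irr thread(2)] by auto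
    have "a \<in> nb E W b" using nb_sym[OF sym thread(1,2)] .
    obtain u where u: "nb E W a = {b, u}" "u \<noteq> b" using card2_other[OF thread(3,2)] .
    obtain w where w: "nb E W b = {a, w}" "w \<noteq> a" using card2_other[OF thread(4) \<open>a \<in> nb E W b\<close>] .
    have uw: "u \<in> W" "u \<noteq> a" "w \<in> W" "w \<noteq> b"
      using nb_memD[OF irr, of u W a] nb_memD[OF irr, of w W b] u w by auto
    let ?R = "W - {a, b}"
    obtain c A where g: "good 6 E ?q ?R c A" using IH[of ?R] thread(1) by auto
    have uR: "u \<in> ?R" "w \<in> ?R" using uw u w by auto
    have sz: "3 \<le> card (A u)" "3 \<le> card (A w)" using size[OF g] uR by auto
    have fA: "finite (A u)" "finite (A w)" using good_avail(2)[OF g] fin uR by auto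
    have lt: "A u \<subseteq> {..<6}" "A w \<subseteq> {..<6}" using good_avail(1)[OF g] fin uR by auto
    \<comment> \<open>\<open>b\<close> is oriented only to \<open>w\<close>, then \<open>a\<close>
      to both of its neighbors, which therefore need different colors; \<open>b\<close> will offer
      the colors other than \<open>y\<close> and \<open>c w\<close>.\<close>
    obtain y where y: "y \<in> A w" "y \<noteq> c u" using pick[OF fA(2), of "[c u]"] sz by auto
    obtain z where z: "z \<in> A u" "z \<noteq> c w" "z \<noteq> y" using pick[OF fA(1), of "[c w, y]"] sz by auto
    have "nb E ?R b = {w}" using w uR nb_sub[of ?R W E b] by auto
    then have g1: "good 6 E ?q (insert b ?R) (c(b := y)) (A(b := {z. z < 6 \<and> z \<noteq> y \<and> z \<notin> c ` {w}}))"
      using y lt by (intro good_add[OF g sym irr]) auto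
    have n: "nb E (insert b ?R) a = {b, u}" using u uR bW nb_sub[of "insert b ?R" W E a] by auto
    have "\<exists>c A. good 6 E ?q (insert a (insert b ?R)) c A"
      using y z lt uR bW u by (intro good_add_ex[OF g1 sym irr _ n, of z]) auto
    moreover have "insert a (insert b ?R) = W" using thread bW by auto
    ultimately show ?thesis by simp
  next
    case two
    obtain x where x: "nb E W v = {a1, a2, x}" "x \<noteq> a1" "x \<noteq> a2" using card3_other[OF two(2-5)] .
    have aW: "a1 \<in> W" "a2 \<in> W" "x \<in> W" "a1 \<noteq> v" "a2 \<noteq> v" "x \<noteq> v"
      using nb_memD[OF irr, of _ W v] x by auto
    have va: "v \<in> nb E W a1" "v \<in> nb E W a2" using nb_sym[OF sym two(1)] two(3,4) by auto
    obtain u1 where u1: "nb E W a1 = {v, u1}" "u1 \<noteq> v" using card2_other[OF two(6) va(1)] .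
    obtain u2 where u2: "nb E W a2 = {v, u2}" "u2 \<noteq> v" using card2_other[OF two(7) va(2)] .
    note u = u1 u2
    have uW: "u1 \<in> W" "u2 \<in> W" "u1 \<noteq> a1" "u2 \<noteq> a2"
      using nb_memD[OF irr, of u1 W a1] nb_memD[OF irr, of u2 W a2] u by auto
    \<comment> \<open>Neither leg ends in the other, since vertices of degree two are not adjacent
      here.\<close>
    have ua: "u1 \<noteq> a2" "u2 \<noteq> a1"
      using two(8)[OF aW(1) _ two(6), of a2] two(8)[OF aW(2) _ two(7), of a1] two(6,7) u1(1) u2(1) by blast+
    let ?R = "W - {v, a1, a2}"
    obtain c A where g: "good 6 E ?q ?R c A" using IH[of ?R] two(1) by auto
    have R: "u1 \<in> ?R" "u2 \<in> ?R" "x \<in> ?R" using uW ua u x aW by auto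
    have sz: "3 \<le> card (A u1)" "3 \<le> card (A u2)" "3 \<le> card (A x)" using size[OF g] R by auto
    have fA: "finite (A u1)" "finite (A u2)" "finite (A x)" using good_avail(2)[OF g] fin R by auto
    have lt: "A u1 \<subseteq> {..<6}" "A u2 \<subseteq> {..<6}" "A x \<subseteq> {..<6}" using good_avail(1)[OF g] fin R by auto
    \<comment> \<open>The center comes first, oriented to \<open>x\<close>, in a color different
      from both far ends. Each leg is then oriented to both of its neighbors and has to avoid just
      two of the three colors offered by its far end.\<close>
    obtain y where y: "y \<in> A x" "y \<noteq> c u1" "y \<noteq> c u2" using pick[OF fA(3), of "[c u1, c u2]"] sz by auto
    obtain z1 where z1: "z1 \<in> A u1" "z1 \<noteq> y" "z1 \<noteq> c x" using pick[OF fA(1), of "[y, c x]"] sz by auto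
    obtain z2 where z2: "z2 \<in> A u2" "z2 \<noteq> y" "z2 \<noteq> c x" using pick[OF fA(2), of "[y, c x]"] sz by auto
    have "nb E ?R v = {x}" using x R nb_sub[of ?R W E v] by auto
    then have g1: "good 6 E ?q (insert v ?R) (c(v := y)) (A(v := {z. z < 6 \<and> z \<noteq> y \<and> z \<notin> c ` {x}}))"
      using y lt by (intro good_add[OF g sym irr]) auto
    have "nb E (insert v ?R) a1 = {v, u1}" using u uW ua two(1) R nb_sub[of "insert v ?R" W E a1] by auto
    then have g2: "good 6 E ?q (insert a1 (insert v ?R)) (c(v := y, a1 := z1))
       (A(v := {z. z < 6 \<and> z \<noteq> y \<and> z \<notin> c ` {x}}, a1 := {z. z < 6 \<and> z \<noteq> z1 \<and> z \<notin> (c(v := y)) ` {v, u1}}))"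
      using y z1 lt u aW R by (intro good_add[OF g1 sym irr]) auto
    have n: "nb E (insert a1 (insert v ?R)) a2 = {v, u2}"
      using u uW ua two(1) R aW nb_sub[of "insert a1 (insert v ?R)" W E a2] by auto
    have "\<exists>c A. good 6 E ?q (insert a2 (insert a1 (insert v ?R))) c A"
      using y z2 lt u aW R two(5) by (intro good_add_ex[OF g2 sym irr _ n, of z2]) auto
    moreover have "insert a2 (insert a1 (insert v ?R)) = W" using two(1) aW by auto
    ultimately show ?thesis by simp
  next
    case rest
    show ?thesis
    proof (cases "W = {}")
      case True
      then show ?thesis using good_empty by blast
    next
      case False
      define g :: "'a \<Rightarrow> 'a \<Rightarrow> int" where "g v w = (if ?deg w = 2 then 1 else 0)" for v w
      \<comment> \<open>Degree two: -2 + 2. Degree three: 1 minus at most 1. Degree d at least four: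
        3 d - 8 minus at most d.\<close>
      have fin': "0 \<le> 3 * int (?deg v) - 8 + (\<Sum>w\<in>nb E W v. g w v) - (\<Sum>w\<in>nb E W v. g v w)" if v: "v \<in> W" for v
      proof -
        have out: "(\<Sum>w\<in>nb E W v. g v w) = int (card {w \<in> nb E W v. ?deg w = 2})"
          unfolding g_def using sum_cases[OF finite_nb[OF fin], of "\<lambda>w. ?deg w = 2" 1] by simp
        have inn: "(\<Sum>w\<in>nb E W v. g w v) = (if ?deg v = 2 then int (?deg v) else 0)"
          by (simp add: g_def)
        have le: "card {w \<in> nb E W v. ?deg w = 2} \<le> ?deg v"
          by (intro card_mono finite_nb[OF fin]) auto
        consider "?deg v = 2" | "?deg v = 3" | "4 \<le> ?deg v" using rest(1)[OF v] by linarith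
        then show ?thesis
        proof cases
          case 1
          then have "{w \<in> nb E W v. ?deg w = 2} = {}" using rest(2)[OF v] by blast
          then have "card {w \<in> nb E W v. ?deg w = 2} = 0" by (simp only: card.empty)
          then show ?thesis unfolding out inn using 1 by simp
        next
          case 2
          then show ?thesis unfolding out inn using rest(3)[OF v] by simp
        next
          case 3
          then show ?thesis unfolding out inn using le by simp
        qed
      qed
      have "0 \<le> (\<Sum>v\<in>W. 3 * int (?deg v) - 8 + (\<Sum>w\<in>nb E W v. g w v) - (\<Sum>w\<in>nb E W v. g v w))"
        using fin' by (rule sum_nonneg)
      also have "\<dots> = 3 * int (ar E W) - 8 * int (card W)"
        using discharge[OF sym fin, of g] by (simp add: sum.distrib sum_subtractf ar_sum[OF fin] sum_distrib_left)
      finally show ?thesis using less(3)[of W] False by simp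
    qed
  qed
qed

section \<open>Weighted density\<close>

definition rho :: "('a \<Rightarrow> int) \<Rightarrow> int \<Rightarrow> ('a \<times> 'a) set \<Rightarrow> 'a set \<Rightarrow> int" where
  "rho w b E H = (\<Sum>x\<in>H. w x) - b * int (ar E H)"

lemma rho_empty [simp]: "rho w b E {} = 0"
  by (simp add: rho_def ar_def)

lemma ar_insert:
  assumes "sym E" "irrefl E" "finite H" "x \<notin> H"
  shows "ar E (insert x H) = ar E H + 2 * card (nb E H x)"
proof -
  have "E \<inter> insert x H \<times> insert x H = (E \<inter> H \<times> H) \<union> ({x} \<times> nb E H x \<union> nb E H x \<times> {x})"
    using symD[OF assms(1)] assms(2) by (auto simp: nb_def irrefl_def)
  moreover have "(E \<inter> H \<times> H) \<inter> ({x} \<times> nb E H x \<union> nb E H x \<times> {x}) = {}"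
    using assms(4) by (auto simp: nb_def)
  moreover have "({x} \<times> nb E H x) \<inter> (nb E H x \<times> {x}) = {}"
    using assms(4) by (auto simp: nb_def)
  moreover have "finite (E \<inter> H \<times> H)" using assms(3) by (intro finite_Int) auto
  ultimately show ?thesis
    using assms(3) by (simp add: ar_def card_Un_disjoint card_cartesian_product)
qed

lemma even_ar:
  assumes "finite H" "sym E" "irrefl E"
  shows "even (ar E H)"
  using assms(1)
proof induction
  case empty
  then show ?case by (simp add: ar_def)
next
  case (insert x F)
  then show ?case using ar_insert[OF assms(2,3) insert(1,2)] by simp
qed

lemma rho_insert_le:
  assumes "sym E" "irrefl E" "finite H" "x \<notin> H" "T \<subseteq> nb E H x" "card T = n" "0 \<le> b"
  shows "rho w b E (insert x H) \<le> rho w b E H + w x - 2 * b * int n"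
proof -
  have "n \<le> card (nb E H x)" using assms by (metis card_mono finite_nb)
  then have "b * int n \<le> b * int (card (nb E H x))" using assms(7) by (intro mult_left_mono) auto
  then show ?thesis
    using assms by (simp add: rho_def ar_insert algebra_simps)
qed

text \<open>Submodularity: an arc inside \<open>A\<close> or \<open>B\<close> is inside the union,
  and one inside both is inside the intersection. As the intersection has nonnegative weight, nearly
  tight sets can be merged.\<close>

lemma rho_union:
  assumes "finite A" "finite B" "0 \<le> b" "0 \<le> rho w b E (A \<inter> B)"
  shows "rho w b E (A \<union> B) \<le> rho w b E A + rho w b E B"
proof -
  have f: "finite (E \<inter> A \<times> A)" "finite (E \<inter> B \<times> B)" "finite (E \<inter> (A \<union> B) \<times> (A \<union> B))"
    using assms by auto
  have "card ((E \<inter> A \<times> A) \<union> (E \<inter> B \<times> B)) + card ((E \<inter> A \<times> A) \<inter> (E \<inter> B \<times> B)) = ar E A + ar E B"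
    using card_Un_Int[OF f(1,2)] by (simp add: ar_def)
  moreover have "(E \<inter> A \<times> A) \<inter> (E \<inter> B \<times> B) = E \<inter> (A \<inter> B) \<times> (A \<inter> B)" by auto
  moreover have "card ((E \<inter> A \<times> A) \<union> (E \<inter> B \<times> B)) \<le> ar E (A \<union> B)"
    unfolding ar_def using f(3) by (intro card_mono) auto
  ultimately have "int (ar E A) + int (ar E B) \<le> int (ar E (A \<union> B)) + int (ar E (A \<inter> B))" by (simp add: ar_def)
  then have "b * (int (ar E A) + int (ar E B)) \<le> b * (int (ar E (A \<union> B)) + int (ar E (A \<inter> B)))"
    using assms(3) by (rule mult_left_mono)
  moreover have "(\<Sum>x\<in>A \<union> B. w x) + (\<Sum>x\<in>A \<inter> B. w x) = (\<Sum>x\<in>A. w x) + (\<Sum>x\<in>B. w x)"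
    using sum.union_inter[OF assms(1,2)] .
  ultimately show ?thesis using assms(4) by (simp add: rho_def algebra_simps)
qed

section \<open>Choosing colors\<close>

lemma good_step:
  assumes g: "good k E q R c A" "sym E" "irrefl E" "x \<notin> R" "nb E R x = N" "y < k" "\<And>n. n \<in> N \<Longrightarrow> y \<in> A n"
    "card N \<le> q x" "inj_on c N"
  shows "\<exists>c' A'. good k E q (insert x R) c' A' \<and> (\<forall>n\<in>R. c' n = c n \<and> A' n = A n) \<and> c' x = y
    \<and> A' x = {z. z < k \<and> z \<noteq> y \<and> z \<notin> c ` N}"
  using good_add[OF g] assms(4)
  by (intro exI[of _ "c(x := y)"] exI[of _ "A(x := {z. z < k \<and> z \<noteq> y \<and> z \<notin> c ` N})"]) auto

lemma two_elements:
  assumes "2 \<le> card A"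
  obtains p q where "p \<in> A" "q \<in> A" "p \<noteq> q"
proof -
  obtain T where "T \<subseteq> A" "card T = 2" using obtain_subset_with_card_n[OF assms] by blast
  then show ?thesis using that by (auto simp: card_2_iff)
qed

lemma card_ge_2:
  assumes "2 \<le> card (A :: nat set)" "b \<notin> A"
  obtains p q where "p \<in> A" "q \<in> A" "distinct [b, p, q]"
proof -
  obtain p q where "p \<in> A" "q \<in> A" "p \<noteq> q" using two_elements[OF assms(1)] .
  then show ?thesis using that assms(2) by auto
qed

lemma five_distinct: "{..<5::nat} \<subseteq> set [a, b, c, d, e] \<Longrightarrow> distinct [a, b, c, d, e]"
proof -
  assume "{..<5::nat} \<subseteq> set [a, b, c, d, e]"
  then have "card {..<5::nat} \<le> card (set [a, b, c, d, e])" by (intro card_mono) auto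
  then have "length [a, b, c, d, e] \<le> card (set [a, b, c, d, e])" by simp
  then show ?thesis using card_length[of "[a, b, c, d, e]"] card_distinct by (metis le_antisym)
qed

text \<open>
  A vertex of degree three with two pendant legs, whose far ends have the colors \<open>b1\<close>, \<open>b2\<close> and the available
  colors \<open>A1\<close>, \<open>A2\<close>, can be colored for all but one color \<open>c\<close> of its third neighbor.
\<close>

lemma Z_color:
  assumes "2 \<le> card A1" "2 \<le> card (A2 :: nat set)"
  shows "\<exists>bad. \<forall>c. c \<noteq> bad \<longrightarrow> (\<exists>y<5. y \<notin> {c, b1, b2} \<and> \<not> A1 \<subseteq> {y, c} \<and> \<not> A2 \<subseteq> {y, c})"
proof -
  have pair: "A = {y, c}" if "A \<subseteq> {y, c}" "2 \<le> card A" for A and y c :: nat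
  proof -
    have "card {y, c} \<le> 2" by (simp add: card_insert_if)
    then show ?thesis using that card_seteq[of "{y, c}" A] by simp
  qed
  \<comment> \<open>If \<open>c\<close> is bad, there are two colors outside \<open>c\<close>,
    \<open>b1\<close>, \<open>b2\<close>, and each is blocked by a leg offering just that color and
    \<open>c\<close>. The legs block different colors, so \<open>c\<close> is their only common
    color.\<close>
  have key: "\<exists>p1 p2. A1 = {p1, c} \<and> A2 = {p2, c} \<and> p1 \<noteq> p2 \<and> p1 \<noteq> c \<and> p2 \<noteq> c"
    if n: "\<not> (\<exists>y<5. y \<notin> {c, b1, b2} \<and> \<not> A1 \<subseteq> {y, c} \<and> \<not> A2 \<subseteq> {y, c})" for c
  proof -
    have cov: "y \<in> {c, b1, b2} \<or> A1 = {y, c} \<or> A2 = {y, c}" if "y < 5" for y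
      using n that pair[of A1 y c] pair[of A2 y c] assms by blast
    obtain y1 where y1: "y1 < 5" "y1 \<notin> set [c, b1, b2]" using pick_lt[of "[c, b1, b2]" 5] by auto
    obtain y2 where y2: "y2 < 5" "y2 \<notin> set [c, b1, b2, y1]" using pick_lt[of "[c, b1, b2, y1]" 5] by auto
    have "A1 = {y1, c} \<or> A2 = {y1, c}" "A1 = {y2, c} \<or> A2 = {y2, c}" using cov[of y1] cov[of y2] y1 y2 by auto
    moreover have "y1 \<noteq> y2" "y1 \<noteq> c" "y2 \<noteq> c" using y1 y2 by auto
    ultimately show ?thesis by (metis doubleton_eq_iff)
  qed
  show ?thesis
  proof (cases "\<exists>c. \<not> (\<exists>y<5. y \<notin> {c, b1, b2} \<and> \<not> A1 \<subseteq> {y, c} \<and> \<not> A2 \<subseteq> {y, c})")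
    case True
    then obtain c where c: "\<not> (\<exists>y<5. y \<notin> {c, b1, b2} \<and> \<not> A1 \<subseteq> {y, c} \<and> \<not> A2 \<subseteq> {y, c})" by blast
    have "c' = c" if "\<not> (\<exists>y<5. y \<notin> {c', b1, b2} \<and> \<not> A1 \<subseteq> {y, c'} \<and> \<not> A2 \<subseteq> {y, c'})" for c'
      using key[OF c] key[OF that] by (metis doubleton_eq_iff)
    then show ?thesis by blast
  qed blast
qed

text \<open>The third neighbor is itself uncolored, with available colors \<open>X\<close> and the
  color \<open>s\<close> beyond it. A choice in \<open>X\<close> outside the pair of the first leg
  can fail only through the second leg, and then the five colors are exactly this choice,
  \<open>s\<close>, \<open>b1\<close>, \<open>b2\<close> and the other color of the second pair. The
  symmetric list for the first leg cannot contain the same choice.\<close>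

lemma Z_color_root:
  assumes A: "2 \<le> card A1" "2 \<le> card (A2 :: nat set)" "b1 \<notin> A1" "b2 \<notin> A2"
    and X: "3 \<le> card X" "s \<notin> X" "X \<subseteq> {..<5}"
  shows "\<exists>t\<in>X. \<exists>y<5. y \<notin> {t, s, b1, b2} \<and> \<not> A1 \<subseteq> {y, t} \<and> \<not> A2 \<subseteq> {y, t}"
proof (rule ccontr)
  assume n: "\<not> ?thesis"
  have fX: "finite X" using X(3) finite_subset by blast
  obtain p1 q1 where 1: "p1 \<in> A1" "q1 \<in> A1" "distinct [b1, p1, q1]" using card_ge_2[OF A(1,3)] .
  obtain p2 q2 where 2: "p2 \<in> A2" "q2 \<in> A2" "distinct [b2, p2, q2]" using card_ge_2[OF A(2,4)] .
  have cov: "y \<in> {t, s, b1, b2} \<or> {p1, q1} \<subseteq> {y, t} \<or> {p2, q2} \<subseteq> {y, t}" if "t \<in> X" "y < 5" for t y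
    using n that 1 2 by blast
  have X1: "\<exists>t\<in>X. t \<notin> {p1, q1}" "\<exists>t\<in>X. t \<notin> {p2, q2}"
    using pick[OF fX, of "[p1, q1]"] pick[OF fX, of "[p2, q2]"] X(1) by auto
  have one: "distinct [t, s, b', b, if t = p then q else p] \<and> t \<in> {p, q}"
    if t: "t \<in> X" "t \<notin> {p', q'}" and c: "\<And>y. y < 5 \<Longrightarrow> y \<in> {t, s, b', b} \<or> {p, q} \<subseteq> {y, t} \<or> {p', q'} \<subseteq> {y, t}"
      and d: "p \<noteq> q" "p' \<noteq> q'" for t p q p' q' b b'
  proof -
    have c': "y \<in> {t, s, b', b} \<or> {p, q} \<subseteq> {y, t}" if "y < 5" for y using c[OF that] t(2) d(2) by auto
    obtain y where y: "y < 5" "y \<notin> set [t, s, b', b]" using pick_lt[of "[t, s, b', b]" 5] by auto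
    then have "{p, q} \<subseteq> {y, t}" using c' by auto
    then have tp: "t \<in> {p, q}" using d by auto
    have "{..<5} \<subseteq> set [t, s, b', b, if t = p then q else p]"
    proof
      fix y :: nat assume "y \<in> {..<5}"
      then show "y \<in> set [t, s, b', b, if t = p then q else p]" using c'[of y] tp d by auto
    qed
    then show ?thesis using five_distinct tp by blast
  qed
  obtain z where z: "z \<in> X" "z \<notin> {p1, q1}" using X1 by auto
  obtain y where y: "y \<in> X" "y \<notin> {p2, q2}" using X1 by auto
  have "distinct [z, s, b1, b2, if z = p2 then q2 else p2] \<and> z \<in> {p2, q2}"
    by (rule one[OF z]) (use cov[OF z(1)] 1(3) 2(3) in \<open>blast | simp\<close>)+
  then have dz: "distinct [z, s, b1, b2, if z = p2 then q2 else p2]" "z \<in> {p2, q2}" by blast+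
  have "distinct [y, s, b1, b2, if y = p1 then q1 else p1] \<and> y \<in> {p1, q1}"
    by (rule one[OF y]) (use cov[OF y(1)] 1(3) 2(3) in \<open>blast | simp\<close>)+
  then have dy: "distinct [y, s, b1, b2, if y = p1 then q1 else p1]" "y \<in> {p1, q1}" by blast+
  have "{..<5} \<subseteq> {y, s, b1, b2, if y = p1 then q1 else p1}"
  proof
    fix x :: nat assume "x \<in> {..<5}"
    then show "x \<in> {y, s, b1, b2, if y = p1 then q1 else p1}" using cov[OF y(1), of x] y(2) dy(2) 2(3) 1(3) by auto
  qed
  moreover have "z < 5" using z(1) X(3) by auto
  ultimately have "z \<in> {y, s, b1, b2, if y = p1 then q1 else p1}" by blast
  then show False using dz dy z(2) X(2) z(1) by (auto split: if_splits)
qed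

text \<open>
  The configuration of a root \<open>t\<close> of degree two next to a vertex \<open>w\<close> with one leg (far end color \<open>b\<close>, available
  colors \<open>A\<close>) and one neighbor \<open>y\<close> with two legs; \<open>s\<close> is the color of the other neighbor of \<open>t\<close>.
\<close>

lemma PZ_color_leg:
  assumes A: "2 \<le> card (A :: nat set)" and A1: "3 \<le> card A1" and A2: "2 \<le> card (A2 :: nat set)" "b2 \<notin> A2"
    and X: "2 \<le> card X" "s \<notin> X" "X \<subseteq> {..<5}"
  shows "\<exists>t\<in>X. \<exists>w<5. w \<notin> {t, s, b} \<and> \<not> A \<subseteq> {w, t} \<and>
    (\<exists>y<5. y \<notin> {w, t, b1, b2} \<and> \<not> A1 \<subseteq> {y, w} \<and> \<not> A2 \<subseteq> {y, w})"
proof -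
  obtain p q where pq: "p \<in> A" "q \<in> A" "p \<noteq> q" using two_elements[OF A] .
  obtain p2 q2 where 2: "p2 \<in> A2" "q2 \<in> A2" "distinct [b2, p2, q2]" using card_ge_2[OF A2] .
  have A1': "\<not> A1 \<subseteq> {y, w}" for y w
  proof
    assume "A1 \<subseteq> {y, w}"
    then have "card A1 \<le> card {y, w}" by (intro card_mono) auto
    also have "\<dots> \<le> 2" by (simp add: card_insert_if)
    finally show False using A1 by simp
  qed
  \<comment> \<open>A leg with three colors never blocks. If the inner vertex has no color,
    \<open>w\<close> is one of \<open>p2\<close>, \<open>q2\<close>, and \<open>t\<close>,
    \<open>b1\<close>, \<open>b2\<close>, \<open>p2\<close>, \<open>q2\<close> are all five colors,
    whichever \<open>w\<close> is. This happens for at most one \<open>t\<close>, while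
    \<open>X\<close> has two.\<close>
  have bad: "{..<5} \<subseteq> set [t, b1, b2, p2, q2] \<and> distinct [t, b1, b2, p2, q2]"
    if w: "\<not> (\<exists>y<5. y \<notin> {w, t, b1, b2} \<and> \<not> {p2, q2} \<subseteq> {y, w})" for t w
  proof -
    obtain y where "y < 5" "y \<notin> set [w, t, b1, b2]" using pick_lt[of "[w, t, b1, b2]" 5] by auto
    then have "w \<in> {p2, q2}" using w 2(3) by auto
    then have "{..<5} \<subseteq> set [t, b1, b2, p2, q2]" using w 2(3) by auto
    then show ?thesis using five_distinct by blast
  qed
  obtain t1 t2 where t12: "t1 \<in> X" "t2 \<in> X" "t1 \<noteq> t2" using two_elements[OF X(1)] .
  have "\<exists>t\<in>X. \<not> ({..<5} \<subseteq> set [t, b1, b2, p2, q2] \<and> distinct [t, b1, b2, p2, q2])"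
  proof (rule ccontr)
    assume "\<not> ?thesis"
    then have d: "{..<5} \<subseteq> set [t1, b1, b2, p2, q2]" "distinct [t2, b1, b2, p2, q2]" using t12 by blast+
    have "t2 \<in> {..<5}" using t12(2) X(3) by blast
    then have "t2 \<in> set [t1, b1, b2, p2, q2]" using d(1) by blast
    then show False using d(2) t12(3) by auto
  qed
  then obtain t where t: "t \<in> X" "\<not> ({..<5} \<subseteq> set [t, b1, b2, p2, q2] \<and> distinct [t, b1, b2, p2, q2])" by blast
  \<comment> \<open>Avoiding one color of \<open>A\<close> other than \<open>t\<close> keeps that
    color free for the leg.\<close>
  obtain w where w: "w < 5" "w \<notin> set [t, s, b, if t = p then q else p]"
    using pick_lt[of "[t, s, b, if t = p then q else p]" 5] by auto
  have "\<not> A \<subseteq> {w, t}" using w(2) pq by (auto split: if_splits)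
  moreover obtain y where "y < 5" "y \<notin> {w, t, b1, b2}" "\<not> {p2, q2} \<subseteq> {y, w}" using bad[of w t] t(2) by blast
  then have "\<exists>y<5. y \<notin> {w, t, b1, b2} \<and> \<not> A1 \<subseteq> {y, w} \<and> \<not> A2 \<subseteq> {y, w}" using A1' 2(1,2) by blast
  ultimately show ?thesis using t(1) w by auto
qed

text \<open>Suppose that no choice works. A color for \<open>w\<close> in just one of the pairs
  \<open>{p1, q1}\<close>, \<open>{p2, q2}\<close> and outside \<open>{s, b}\<close> must lie in
  \<open>{p, q}\<close>: otherwise two different \<open>t\<close> would complete the same four
  colors to a list of all five. As the pairs, \<open>s\<close> and \<open>b\<close> cover all
  colors, each way in which the pairs can overlap is refuted.\<close>

lemma PZ_color_root:
  assumes A: "2 \<le> card (A :: nat set)" and A12: "2 \<le> card A1" "2 \<le> card (A2 :: nat set)" "b1 \<notin> A1" "b2 \<notin> A2"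
      "A1 \<subseteq> {..<5}" "A2 \<subseteq> {..<5}"
    and X: "3 \<le> card X" "s \<notin> X" "X \<subseteq> {..<5}"
  shows "\<exists>t\<in>X. \<exists>w<5. w \<notin> {t, s, b} \<and> \<not> A \<subseteq> {w, t} \<and>
    (\<exists>y<5. y \<notin> {w, t, b1, b2} \<and> \<not> A1 \<subseteq> {y, w} \<and> \<not> A2 \<subseteq> {y, w})"
proof (rule ccontr)
  assume n: "\<not> ?thesis"
  have fX: "finite X" using X(3) finite_subset by blast
  obtain p q where pq: "p \<in> A" "q \<in> A" "p \<noteq> q" using two_elements[OF A] .
  obtain p1 q1 where 1: "p1 \<in> A1" "q1 \<in> A1" "distinct [b1, p1, q1]" using card_ge_2[OF A12(1,3)] .
  obtain p2 q2 where 2: "p2 \<in> A2" "q2 \<in> A2" "distinct [b2, p2, q2]" using card_ge_2[OF A12(2,4)] .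
  define conf where "conf w t \<longleftrightarrow> (\<forall>y<5. y \<in> {w, t, b1, b2} \<or> {p1, q1} \<subseteq> {y, w} \<or> {p2, q2} \<subseteq> {y, w})" for w t
  have C: "conf w t" if "t \<in> X" "w < 5" "w \<notin> {t, s, b}" "\<not> {p, q} \<subseteq> {w, t}" for w t
    unfolding conf_def using n that pq 1 2 by blast
  have cov: "{..<5} \<subseteq> {p1, q1, p2, q2, s, b}"
  proof (rule ccontr)
    assume "\<not> ?thesis"
    then obtain w where w: "w < 5" "w \<notin> {p1, q1, p2, q2, s, b}" by auto
    obtain t where t: "t \<in> X" "t \<notin> set [w, if w = p then q else p]" using pick[OF fX, of "[w, if w = p then q else p]"] X(1) by auto
    have "\<not> {p, q} \<subseteq> {w, t}" using t(2) pq(3) by (auto split: if_splits)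
    then have "conf w t" using C[OF t(1) w(1)] w(2) t(2) by auto
    moreover obtain y where "y < 5" "y \<notin> set [w, t, b1, b2]" using pick_lt[of "[w, t, b1, b2]" 5] by auto
    ultimately show False using w(2) 1(3) 2(3) unfolding conf_def by auto
  qed
  have one: "{..<5} \<subseteq> set [t, w, b1, b2, w']"
    if "conf w t" "{w, w'} = {p', q'}" "w \<notin> {p'', q''}" "p' \<noteq> q'" "p'' \<noteq> q''"
      "{{p', q'}, {p'', q''}} = {{p1, q1}, {p2, q2}}" for t w w' p' q' p'' q''
  proof
    fix y :: nat assume "y \<in> {..<5}"
    then have "y \<in> {w, t, b1, b2} \<or> {p', q'} \<subseteq> {y, w} \<or> {p'', q''} \<subseteq> {y, w}"
      using that(1,6) unfolding conf_def by (auto simp: doubleton_eq_iff)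
    then show "y \<in> set [t, w, b1, b2, w']" using that(2-5) by (auto simp: doubleton_eq_iff)
  qed
  have K: "w \<in> {p, q} \<and> (\<exists>t\<in>X - {p, q}. conf w t)"
    if w: "{w, w'} = {p', q'}" "w \<notin> {p'', q''}" "p' \<noteq> q'" "p'' \<noteq> q''"
      "{{p', q'}, {p'', q''}} = {{p1, q1}, {p2, q2}}" "w < 5" "w \<notin> {s, b}" for w w' p' q' p'' q''
  proof (rule ccontr)
    assume no: "\<not> ?thesis"
    define o' where "o' = (if w = p then q else p)"
    obtain t where t: "t \<in> X" "t \<notin> set [w, o']" using pick[OF fX, of "[w, o']"] X(1) by auto
    have "\<not> {p, q} \<subseteq> {w, t}" using t(2) pq(3) by (auto simp: o'_def split: if_splits)
    then have c: "conf w t" using C[OF t(1) w(6)] w(7) t(2) by auto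
    have d: "distinct [t, w, b1, b2, w']" using one[OF c w(1-5)] by (rule five_distinct)
    show False
    proof (cases "w \<in> {p, q}")
      case True
      then show False using no t c by (auto simp: o'_def split: if_splits)
    next
      case False
      obtain t' where t': "t' \<in> X" "t' \<notin> set [w, t]" using pick[OF fX, of "[w, t]"] X(1) by auto
      have "conf w t'" using C[OF t'(1) w(6)] w(7) t'(2) False pq(3) by auto
      then have "distinct [t', w, b1, b2, w']" using one[OF _ w(1-5)] five_distinct by blast
      moreover have "t' < 5" using t'(1) X(3) by auto
      ultimately show False using one[OF c w(1-5)] t'(2) by auto
    qed
  qed
  have four: "\<not> {..<5::nat} \<subseteq> set [u1, u2, u3, u4]" for u1 u2 u3 u4
    using pick_lt[of "[u1, u2, u3, u4]" 5] by fastforce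
  have lt: "p1 < 5" "q1 < 5" "p2 < 5" "q2 < 5" using 1 2 A12(5,6) by auto
  have ne: "p1 \<noteq> q1" "p2 \<noteq> q2" using 1(3) 2(3) by auto
  consider (same) "{p1, q1} = {p2, q2}" | (disj) "{p1, q1} \<inter> {p2, q2} = {}"
    | (share) x y z where "{y, x} = {p1, q1}" "{z, x} = {p2, q2}" "y \<noteq> z" "x \<noteq> y" "x \<noteq> z"
  proof -
    consider "{p1, q1} = {p2, q2}" | "{p1, q1} \<inter> {p2, q2} = {}" | "p1 = p2" "q1 \<noteq> q2" | "p1 = q2" "q1 \<noteq> p2"
      | "q1 = p2" "p1 \<noteq> q2" | "q1 = q2" "p1 \<noteq> p2" by blast
    then show ?thesis
      by cases (use that ne in \<open>blast | metis insert_commute\<close>)+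
  qed
  then show False
  proof cases
    case same
    then have "{..<5} \<subseteq> set [p1, q1, s, b]" using cov by (auto simp: doubleton_eq_iff)
    then show False using four by blast
  next
    case disj
    have "p1 \<in> {p, q, s, b}" using K[of p1 q1 p1 q1 p2 q2] lt ne disj by blast
    moreover have "q1 \<in> {p, q, s, b}" using K[of q1 p1 p1 q1 p2 q2] lt ne disj by blast
    moreover have "p2 \<in> {p, q, s, b}" using K[of p2 q2 p2 q2 p1 q1] lt ne disj by blast
    moreover have "q2 \<in> {p, q, s, b}" using K[of q2 p2 p2 q2 p1 q1] lt ne disj by blast
    ultimately have "{p1, q1, p2, q2, s, b} \<subseteq> set [p, q, s, b]" by auto
    with cov have "{..<5} \<subseteq> set [p, q, s, b]" by (rule subset_trans)
    then show False using four by simp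
  next
    case share
    have "{p1, q1, p2, q2, s, b} = set [x, y, z, s, b]" using share(1,2) by auto
    then have "{..<5} \<subseteq> set [x, y, z, s, b]" using cov by simp
    then have xyz: "distinct [x, y, z, s, b]" by (rule five_distinct)
    have y5: "y < 5" "z < 5" using share(1,2) lt by (auto simp: doubleton_eq_iff)
    have yn: "y \<notin> {p2, q2}" "z \<notin> {p1, q1}" using share by auto
    obtain t where t: "y \<in> {p, q}" "t \<in> X - {p, q}" "conf y t"
      using K[OF share(1) yn(1) ne refl y5(1)] xyz by auto
    obtain t' where t': "z \<in> {p, q}" "t' \<in> X - {p, q}" "conf z t'"
      using K[OF share(2) yn(2) ne(2,1) insert_commute y5(2)] xyz by auto
    have c: "{..<5} \<subseteq> set [t, y, b1, b2, x]" using one[OF t(3) share(1) yn(1) ne refl] .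
    have "{..<5} \<subseteq> set [t', z, b1, b2, x]" using one[OF t'(3) share(2) yn(2) ne(2,1) insert_commute] .
    then have "distinct [t', z, b1, b2, x]" by (rule five_distinct)
    moreover have "z \<in> set [t, y, b1, b2, x]" using c y5(2) by blast
    ultimately show False using t(2) t'(1) share(3) by auto
  qed
qed

section \<open>Five colors\<close>

text \<open>Together with \<open>nbw_distinct\<close> this separates whatever is reached from
  \<open>x\<close> by short walks in different directions.\<close>

lemma nbw_rev_append:
  assumes "sym E"
  shows "nbw E (x # xs) \<Longrightarrow> nbw E (x # ys) \<Longrightarrow> (xs \<noteq> [] \<Longrightarrow> ys \<noteq> [] \<Longrightarrow> hd xs \<noteq> hd ys) \<Longrightarrow> nbw E (rev xs @ x # ys)"
proof (induction xs arbitrary: x ys)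
  case (Cons z xs)
  have xz: "(x, z) \<in> E" using Cons(2) by (cases xs) auto
  have "nbw E (rev xs @ z # x # ys)"
  proof (rule Cons(1))
    show "nbw E (z # xs)" using Cons(2) by (rule nbw_tl)
    show "nbw E (z # x # ys)" using Cons(3,4) symD[OF assms xz] by (cases ys) auto
    show "xs \<noteq> [] \<Longrightarrow> x # ys \<noteq> [] \<Longrightarrow> hd xs \<noteq> hd (x # ys)" using Cons(2) by (cases xs) auto
  qed
  then show ?case by simp
qed simp

definition w5 :: "'a set \<Rightarrow> 'a \<Rightarrow> int" where
  "w5 Q x = (if x \<in> Q then 14 else 18)"

definition cap :: "'a set \<Rightarrow> 'a \<Rightarrow> nat" where
  "cap Q u = (if u \<in> Q then 1 else 2)"

text \<open>
  The vertices in \<open>Q\<close> are restricted to one out-edge, so that they offer one more color. Edges count twice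
  in \<^const>\<open>ar\<close>, so the weights are those of \<open>9 |H| - 2 |H \<inter> Q| - 7 e(H)\<close>, doubled.
\<close>

definition dense5 :: "('a \<times> 'a) set \<Rightarrow> 'a set \<Rightarrow> 'a set \<Rightarrow> bool" where
  "dense5 E Q W \<longleftrightarrow> (\<forall>H\<subseteq>W. 0 \<le> rho (w5 Q) 7 E H \<and> (H \<noteq> {} \<and> H \<inter> Q = {} \<longrightarrow> 0 < rho (w5 Q) 7 E H))"

lemma w5_Un:
  assumes "finite H"
  shows "rho (w5 (Q \<union> M)) 7 E H = rho (w5 Q) 7 E H - 4 * int (card (H \<inter> (M - Q)))"
proof -
  have "w5 (Q \<union> M) x = w5 Q x - (if x \<in> M - Q then 4 else 0)" for x by (auto simp: w5_def)
  then have "(\<Sum>x\<in>H. w5 (Q \<union> M) x) = (\<Sum>x\<in>H. w5 Q x) - (\<Sum>x\<in>H. if x \<in> M - Q then 4 else 0)"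
    by (simp add: sum_subtractf)
  also have "(\<Sum>x\<in>H. if x \<in> M - Q then 4 else 0) = 4 * int (card (H \<inter> (M - Q)))"
    using assms by (simp add: sum.If_cases Int_def)
  finally show ?thesis by (simp add: rho_def)
qed

text \<open>\<open>IH\<close> is available for every restricted set, since a reduction deletes some
  vertices and restricts others.\<close>

locale sparse5 =
  fixes E :: "('a \<times> 'a) set" and Q W :: "'a set"
  assumes sym: "sym E" and irr: "irrefl E" and fin: "finite W" and girth: "girth_ge E 9"
    and dense: "dense5 E Q W"
    and IH: "\<And>R Q'. R \<subset> W \<Longrightarrow> dense5 E Q' R \<Longrightarrow> \<exists>c A. good 5 E (cap Q') R c A"
begin

abbreviation "deg v \<equiv> card (nb E W v)"
abbreviation "\<rho> \<equiv> rho (w5 Q) 7 E"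
abbreviation "col \<equiv> good 5 E (cap Q)"
abbreviation "colorable \<equiv> \<exists>c A. col W c A"

lemma dist: "nbw E xs \<Longrightarrow> length xs \<le> 9 \<Longrightarrow> distinct xs"
  using nbw_distinct[OF girth irr] .

lemma finH: "H \<subseteq> W \<Longrightarrow> finite H"
  using fin finite_subset by blast

lemma rho_nonneg: "H \<subseteq> W \<Longrightarrow> 0 \<le> \<rho> H"
  using dense unfolding dense5_def by blast

lemma rho_even: "H \<subseteq> W \<Longrightarrow> even (\<rho> H)"
proof -
  assume "H \<subseteq> W"
  then have "even (ar E H)" using even_ar[OF finH sym irr] by blast
  moreover have "even (\<Sum>x\<in>H. w5 Q x)" by (intro dvd_sum) (auto simp: w5_def)
  ultimately show ?thesis by (simp add: rho_def)
qed

lemma add_rho: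
  assumes "insert x H \<subseteq> W" "x \<notin> H" "T \<subseteq> nb E W x" "T \<subseteq> H" "card T = n"
  shows "\<rho> (insert x H) \<le> \<rho> H + w5 Q x - 14 * int n"
proof -
  have "T \<subseteq> nb E H x" using assms(3,4) by (auto simp: nb_def)
  then show ?thesis
    using rho_insert_le[OF sym irr finH assms(2) _ assms(5), of 7 "w5 Q"] assms(1) by auto
qed

lemma union_rho: "A \<subseteq> W \<Longrightarrow> B \<subseteq> W \<Longrightarrow> \<rho> (A \<union> B) \<le> \<rho> A + \<rho> B"
  by (intro rho_union finH) (auto intro: rho_nonneg)

lemma w5_le: "w5 Q x \<le> 18" "x \<in> Q \<Longrightarrow> w5 Q x = 14"
  by (auto simp: w5_def)

text \<open>Restricting a vertex lowers the weight of each set containing it by 4. If all subsets of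
  \<open>R\<close> can afford this, the smaller graph has a coloring in which the vertices of
  \<open>M\<close> have out-degree at most one and hence offer three colors.\<close>

lemma marked:
  assumes R: "R \<subset> W" and M: "M \<subseteq> R" and H: "\<And>H. H \<subseteq> R \<Longrightarrow> 4 * int (card (H \<inter> (M - Q))) \<le> \<rho> H"
  shows "\<exists>c A. col R c A \<and> (\<forall>u\<in>R \<inter> (Q \<union> M). 3 \<le> card (A u))"
proof -
  have "dense5 E (Q \<union> M) R" unfolding dense5_def
  proof (intro allI impI)
    fix H assume HR: "H \<subseteq> R"
    then have HW: "H \<subseteq> W" using R by blast
    have eq: "rho (w5 (Q \<union> M)) 7 E H = \<rho> H - 4 * int (card (H \<inter> (M - Q)))" using w5_Un[OF finH[OF HW]] .
    moreover have "0 < \<rho> H - 4 * int (card (H \<inter> (M - Q)))" if "H \<noteq> {}" "H \<inter> (Q \<union> M) = {}"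
    proof -
      have "H \<inter> (M - Q) = {}" "H \<inter> Q = {}" using that by blast+
      moreover have "0 < \<rho> H" using dense that(1) HW \<open>H \<inter> Q = {}\<close> unfolding dense5_def by blast
      ultimately show ?thesis by simp
    qed
    ultimately show "0 \<le> rho (w5 (Q \<union> M)) 7 E H \<and> (H \<noteq> {} \<and> H \<inter> (Q \<union> M) = {} \<longrightarrow> 0 < rho (w5 (Q \<union> M)) 7 E H)"
      using H[OF HR] by simp
  qed
  then obtain c A where g: "good 5 E (cap (Q \<union> M)) R c A" using IH[OF R] by blast
  have "3 \<le> card (A u)" if "u \<in> R" "u \<in> Q \<union> M" for u
    using good_avail(5)[OF g finH that(1)] R that(2) by (auto simp: cap_def)
  moreover have "col R c A" using g by (rule good_mono) (auto simp: cap_def)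
  ultimately show ?thesis by blast
qed

text \<open>Weights are even, so a set that cannot afford 4 has weight at most 2. Such a nearly
  tight set will be combined with deleted vertices into a set of negative weight.\<close>

lemma marked1:
  assumes R: "R \<subset> W" and u: "u \<in> R"
  shows "(\<exists>c A. col R c A \<and> 3 \<le> card (A u)) \<or> (\<exists>H\<subseteq>R. u \<in> H \<and> \<rho> H \<le> 2)"
proof (rule disjCI)
  assume n: "\<not> (\<exists>H\<subseteq>R. u \<in> H \<and> \<rho> H \<le> 2)"
  have "\<exists>c A. col R c A \<and> (\<forall>v\<in>R \<inter> (Q \<union> {u}). 3 \<le> card (A v))"
  proof (rule marked[OF R])
    fix H assume H: "H \<subseteq> R"
    then have HW: "H \<subseteq> W" using R by blast
    show "4 * int (card (H \<inter> ({u} - Q))) \<le> \<rho> H"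
    proof (cases "u \<in> H \<and> u \<notin> Q")
      case True
      then have "\<not> \<rho> H \<le> 2" using n H by blast
      then have "4 \<le> \<rho> H" using rho_even[OF HW] by presburger
      moreover have "H \<inter> ({u} - Q) = {u}" using True by auto
      ultimately show ?thesis by simp
    next
      case False
      then have "H \<inter> ({u} - Q) = {}" by auto
      then show ?thesis using rho_nonneg[OF HW] by simp
    qed
  qed (use u in auto)
  then show "\<exists>c A. col R c A \<and> 3 \<le> card (A u)" using u by blast
qed

text \<open>A set containing both vertices has to afford 8, hence the bound 6 in the last
  alternative.\<close>

lemma marked2:
  assumes R: "R \<subset> W" and u: "u1 \<in> R" "u2 \<in> R"
  shows "(\<exists>c A. col R c A \<and> 3 \<le> card (A u1) \<and> 3 \<le> card (A u2))
    \<or> (\<exists>H\<subseteq>R. u1 \<in> H \<and> \<rho> H \<le> 2) \<or> (\<exists>H\<subseteq>R. u2 \<in> H \<and> \<rho> H \<le> 2) \<or> (\<exists>H\<subseteq>R. u1 \<in> H \<and> u2 \<in> H \<and> \<rho> H \<le> 6)"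
proof (rule disjCI)
  assume n: "\<not> ((\<exists>H\<subseteq>R. u1 \<in> H \<and> \<rho> H \<le> 2) \<or> (\<exists>H\<subseteq>R. u2 \<in> H \<and> \<rho> H \<le> 2) \<or> (\<exists>H\<subseteq>R. u1 \<in> H \<and> u2 \<in> H \<and> \<rho> H \<le> 6))"
  have "\<exists>c A. col R c A \<and> (\<forall>v\<in>R \<inter> (Q \<union> {u1, u2}). 3 \<le> card (A v))"
  proof (rule marked[OF R])
    fix H assume H: "H \<subseteq> R"
    then have HW: "H \<subseteq> W" using R by blast
    have 1: "4 \<le> \<rho> H" if "u1 \<in> H \<or> u2 \<in> H"
    proof -
      have "\<not> \<rho> H \<le> 2" using n H that by blast
      then show ?thesis using rho_even[OF HW] by presburger
    qed
    have 2: "8 \<le> \<rho> H" if "u1 \<in> H" "u2 \<in> H"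
    proof -
      have "\<not> \<rho> H \<le> 6" using n H that by blast
      then show ?thesis using rho_even[OF HW] by presburger
    qed
    show "4 * int (card (H \<inter> ({u1, u2} - Q))) \<le> \<rho> H"
    proof (cases "u1 \<in> H \<and> u2 \<in> H")
      case True
      have "card (H \<inter> ({u1, u2} - Q)) \<le> card {u1, u2}" by (intro card_mono) auto
      also have "\<dots> \<le> 2" by (simp add: card_insert_if)
      finally show ?thesis using 2 True by simp
    next
      case False
      show ?thesis
      proof (cases "u1 \<in> H \<or> u2 \<in> H")
        case True
        define u where "u = (if u1 \<in> H then u1 else u2)"
        have "card (H \<inter> ({u1, u2} - Q)) \<le> card {u}" using False by (intro card_mono) (auto simp: u_def)
        then show ?thesis using 1 True by simp
      next
        case False
        then have "H \<inter> ({u1, u2} - Q) = {}" by auto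
        then show ?thesis using rho_nonneg[OF HW] by simp
      qed
    qed
  qed (use u in auto)
  then show "\<exists>c A. col R c A \<and> 3 \<le> card (A u1) \<and> 3 \<le> card (A u2)" using u by blast
qed

lemma col_ex: "R \<subset> W \<Longrightarrow> \<exists>c A. col R c A \<and> (\<forall>u\<in>R \<inter> Q. 3 \<le> card (A u))"
  using marked[of R "{}"] by (auto intro: rho_nonneg)

lemma avail:
  assumes "col R c A" "R \<subseteq> W" "u \<in> R"
  shows "A u \<subseteq> {..<5}" "finite (A u)" "c u \<notin> A u" "c u < 5" "2 \<le> card (A u)" "u \<in> Q \<Longrightarrow> 3 \<le> card (A u)"
  using good_avail[OF assms(1) finH[OF assms(2)] assms(3)] by (auto simp: cap_def split: if_splits)

lemma step:
  assumes g: "col R c A" and R: "R \<subseteq> W" and x: "x \<in> W - R" "nb E W x \<inter> R = N" and y: "y < 5" "\<And>n. n \<in> N \<Longrightarrow> y \<in> A n"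
    and N: "card N \<le> cap Q x" "inj_on c N"
  obtains c' A' where "col (insert x R) c' A'" "\<And>n. n \<in> R \<Longrightarrow> c' n = c n" "\<And>n. n \<in> R \<Longrightarrow> A' n = A n"
    "c' x = y" "A' x = {z. z < 5 \<and> z \<noteq> y \<and> z \<notin> c ` N}"
proof -
  have "nb E R x = N" using nb_sub[OF R] x(2) by simp
  then show ?thesis using good_step[OF g sym irr _ _ y N] x(1) that by blast
qed

lemma nb2:
  assumes "a \<in> W" "deg a = 2" "v \<in> nb E W a"
  obtains u where "nb E W a = {v, u}" "u \<noteq> v" "u \<in> W" "u \<noteq> a"
proof -
  obtain u where u: "nb E W a = {v, u}" "u \<noteq> v" using card2_other[OF assms(2,3)] .
  then show ?thesis using that nb_memD[OF irr, of u W a] by auto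
qed

lemma nb_E: "v \<in> nb E W a \<Longrightarrow> (a, v) \<in> E \<and> (v, a) \<in> E \<and> v \<in> W"
  using symD[OF sym] by (auto simp: nb_def)

lemma low_degree:
  assumes v: "v \<in> W" "deg v \<le> 1"
  shows colorable
proof -
  let ?R = "W - {v}"
  obtain c A where g: "col ?R c A" using col_ex[of ?R] v by auto
  have n: "nb E W v \<inter> ?R = nb E W v" using nb_irrefl[OF irr] nb_in by fastforce
  obtain y where y: "y < 5" "\<And>n. n \<in> nb E W v \<Longrightarrow> y \<in> A n" "inj_on c (nb E W v)"
  proof (cases "nb E W v = {}")
    case True
    then show ?thesis using that[of 0] by simp
  next
    case False
    then have "deg v = 1" using v(2) finite_nb[OF fin, of E v] card_0_eq by fastforce
    then obtain u where u: "nb E W v = {u}" by (auto simp: card_1_singleton_iff)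
    then have uR: "u \<in> ?R" using nb_memD[OF irr, of u W v] by auto
    obtain y z where "y \<in> A u" using two_elements[OF avail(5)[OF g _ uR]] by auto
    then show ?thesis using that[of y] u avail(1)[OF g _ uR] by auto
  qed
  have "deg v \<le> cap Q v" using v(2) by (simp add: cap_def)
  obtain c' A' where "col (insert v ?R) c' A'"
    by (rule step[OF g _ _ n y(1,2) \<open>deg v \<le> cap Q v\<close> y(3)]) (use v(1) in auto)
  then show ?thesis using v(1) by (auto simp: insert_absorb)
qed

lemma thread:
  assumes a: "a \<in> W" "deg a = 2" "a \<notin> Q" and b: "b \<in> nb E W a" "deg b = 2"
  shows colorable
proof -
  have bW: "b \<in> W" "b \<noteq> a" using nb_memD[OF irr b(1)] by auto
  obtain u where u: "nb E W a = {b, u}" "u \<noteq> b" "u \<in> W" "u \<noteq> a" using nb2[OF a(1,2) b(1)] .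
  obtain w where w: "nb E W b = {a, w}" "w \<noteq> a" "w \<in> W" "w \<noteq> b" using nb2[OF bW(1) b(2) nb_sym[OF sym a(1) b(1)]] .
  have E: "(u, a) \<in> E" "(a, b) \<in> E" "(b, w) \<in> E" using nb_E[of u a] nb_E[of b a] nb_E[of w b] u w by auto
  have d: "distinct [u, a, b, w]" using dist[of "[u, a, b, w]"] E u w by simp
  let ?R = "W - {a, b}"
  have R: "?R \<subset> W" "?R \<subseteq> W" using a by auto
  have uR: "u \<in> ?R" "w \<in> ?R" using d u w by auto
  have "\<exists>c A. col ?R c A \<and> (3 \<le> card (A u) \<or> 3 \<le> card (A w))"
  proof (rule ccontr)
    assume n: "\<not> ?thesis"
    obtain H where H: "H \<subseteq> ?R" "u \<in> H" "\<rho> H \<le> 2" using marked1[OF R(1) uR(1)] n by blast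
    obtain K where K: "K \<subseteq> ?R" "w \<in> K" "\<rho> K \<le> 2" using marked1[OF R(1) uR(2)] n by blast
    \<comment> \<open>Nearly tight sets at both ends have weight at most 4 together;
      \<open>a\<close> adds at most 18 - 14, and \<open>b\<close>, now with two edges, at most 18 -
      28. The sum is -2.\<close>
    let ?U = "H \<union> K"
    have "\<rho> ?U \<le> 4" using union_rho[of H K] H K by force
    moreover have "\<rho> (insert a ?U) \<le> \<rho> ?U + w5 Q a - 14 * int 1"
      by (rule add_rho[of _ _ "{u}"]) (use H K u a in auto)
    moreover have "\<rho> (insert b (insert a ?U)) \<le> \<rho> (insert a ?U) + w5 Q b - 14 * int 2"
      by (rule add_rho[of _ _ "{a, w}"]) (use H K w a bW in auto)
    moreover have "0 \<le> \<rho> (insert b (insert a ?U))" using H K a bW by (intro rho_nonneg) auto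
    ultimately show False using w5_le(1)[of a] w5_le(1)[of b] by simp
  qed
  then obtain c A where g: "col ?R c A" and 3: "3 \<le> card (A u) \<or> 3 \<le> card (A w)" by blast
  note au = avail[OF g R(2) uR(1)] and aw = avail[OF g R(2) uR(2)]
  obtain y z where yz: "y \<in> A w" "y \<noteq> c u" "z \<in> A u" "z \<noteq> c w" "z \<noteq> y"
  proof (cases "3 \<le> card (A u)")
    case True
    obtain y where y: "y \<in> A w" "y \<notin> set [c u]" using pick[OF aw(2), of "[c u]"] aw(5) by auto
    obtain z where "z \<in> A u" "z \<notin> set [c w, y]" using pick[OF au(2), of "[c w, y]"] True by auto
    then show ?thesis using that[of y z] y by auto
  next
    case False
    obtain z where z: "z \<in> A u" "z \<notin> set [c w]" using pick[OF au(2), of "[c w]"] au(5) by auto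
    obtain y where "y \<in> A w" "y \<notin> set [c u, z]" using pick[OF aw(2), of "[c u, z]"] 3 False by auto
    then show ?thesis using that[of y z] z by auto
  qed
  obtain c1 A1 where g1: "col (insert b ?R) c1 A1" and 1: "\<And>n. n \<in> ?R \<Longrightarrow> c1 n = c n" "\<And>n. n \<in> ?R \<Longrightarrow> A1 n = A n"
    "c1 b = y" "A1 b = {z. z < 5 \<and> z \<noteq> y \<and> z \<notin> c ` {w}}"
    by (rule step[OF g R(2), of b "{w}" y]) (use w uR yz aw bW in \<open>auto simp: cap_def\<close>)
  have z5: "z < 5" using yz(3) au(1) by auto
  obtain c2 A2 where "col (insert a (insert b ?R)) c2 A2"
  proof (rule step[OF g1, of a "{b, u}" z])
    show "\<And>n. n \<in> {b, u} \<Longrightarrow> z \<in> A1 n" using 1(2)[OF uR(1)] 1(4) yz z5 by auto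
    show "inj_on c1 {b, u}" using 1(1)[OF uR(1)] 1(3) yz by auto
  qed (use u a bW uR z5 in \<open>auto simp: cap_def\<close>)
  moreover have "insert a (insert b ?R) = W" using a bW by auto
  ultimately show ?thesis by auto
qed

end

section \<open>Reducible forks for five colors\<close>

context sparse5
begin

definition leg :: "'a \<Rightarrow> bool" where
  "leg a \<longleftrightarrow> a \<in> W \<and> a \<notin> Q \<and> deg a = 2"

definition fork :: "'a \<Rightarrow> 'a \<Rightarrow> 'a \<Rightarrow> 'a \<Rightarrow> bool" where
  "fork x v a b \<longleftrightarrow> x \<in> W \<and> x \<notin> Q \<and> nb E W x = {v, a, b} \<and> distinct [v, a, b] \<and> leg a \<and> leg b"

lemma union_le: "A \<subseteq> W \<Longrightarrow> B \<subseteq> W \<Longrightarrow> \<rho> A \<le> m \<Longrightarrow> \<rho> B \<le> n \<Longrightarrow> \<rho> (A \<union> B) \<le> m + n"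
  using union_rho[of A B] by linarith

lemma leg_nb:
  assumes "leg a" "v \<in> nb E W a"
  obtains u where "nb E W a = {v, u}" "u \<noteq> v" "u \<in> W" "u \<noteq> a" "(a, u) \<in> E" "(u, a) \<in> E"
proof -
  obtain u where u: "nb E W a = {v, u}" "u \<noteq> v" "u \<in> W" "u \<noteq> a"
    using nb2[of a v] assms unfolding leg_def by blast
  then show ?thesis using that nb_E[of u a] by auto
qed

lemma fork_ends:
  assumes "fork x v a b"
  obtains u w where "nb E W a = {x, u}" "nb E W b = {x, w}" "u \<in> W" "w \<in> W" "nbw E [v, x, a, u]" "nbw E [v, x, b, w]"
    "nbw E [u, a, x, b, w]"
proof -
  have x: "x \<in> W" "nb E W x = {v, a, b}" "distinct [v, a, b]" "leg a" "leg b" using assms by (auto simp: fork_def)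
  have ab: "a \<in> nb E W x" "b \<in> nb E W x" "v \<in> nb E W x" using x by auto
  obtain u where u: "nb E W a = {x, u}" "u \<noteq> x" "u \<in> W" "(a, u) \<in> E" "(u, a) \<in> E"
    using leg_nb[OF x(4) nb_sym[OF sym x(1) ab(1)]] by blast
  obtain w where w: "nb E W b = {x, w}" "w \<noteq> x" "w \<in> W" "(b, w) \<in> E"
    using leg_nb[OF x(5) nb_sym[OF sym x(1) ab(2)]] by blast
  have "nbw E [v, x, a, u]" "nbw E [v, x, b, w]" "nbw E [u, a, x, b, w]"
    using nb_E[OF ab(1)] nb_E[OF ab(2)] nb_E[OF ab(3)] u w x(3) by auto
  then show ?thesis using that u w by blast
qed

lemma attach_leg:
  assumes g: "col R c A" "R \<subseteq> W" and a: "leg a" "a \<notin> R" "nb E W a = {v, u}" "v \<in> R" "u \<in> R" "c v \<noteq> c u"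
    and y: "y \<in> A v" "y \<in> A u"
  shows "\<exists>c' A'. col (insert a R) c' A' \<and> (\<forall>n\<in>R. c' n = c n \<and> A' n = A n)"
proof -
  have 5: "y < 5" using avail(1)[OF g a(4)] y(1) by auto
  have 2: "card {v, u} \<le> cap Q a" using a(1) by (simp add: leg_def cap_def card_insert_if)
  obtain c' A' where "col (insert a R) c' A'" "\<And>n. n \<in> R \<Longrightarrow> c' n = c n" "\<And>n. n \<in> R \<Longrightarrow> A' n = A n"
    by (rule step[OF g, of a "{v, u}" y]) (use a y 5 2 in \<open>auto simp: leg_def\<close>)
  then show ?thesis by blast
qed

text \<open>The center is oriented to \<open>v\<close> alone, so at its near end a leg may use any
  color but \<open>y\<close> and \<open>c v\<close>; the hypotheses leave such a color among those
  that its far end offers.\<close>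

lemma attach_fork:
  assumes g: "col R c A" "R \<subseteq> W" and f: "fork x v a b" "nb E W a = {x, u}" "nb E W b = {x, w}"
    and R: "x \<notin> R" "a \<notin> R" "b \<notin> R" "v \<in> R" "u \<in> R" "w \<in> R"
    and y: "y \<in> A v" "y \<noteq> c u" "y \<noteq> c w" "\<not> A u \<subseteq> {y, c v}" "\<not> A w \<subseteq> {y, c v}"
  shows "\<exists>c' A'. col (insert b (insert a (insert x R))) c' A' \<and> (\<forall>n\<in>R. c' n = c n \<and> A' n = A n)"
proof -
  have y5: "y < 5" using avail(1)[OF g R(4)] y(1) by auto
  have x: "x \<in> W" "nb E W x = {v, a, b}" "distinct [v, a, b]" "leg a" "leg b" using f(1) by (auto simp: fork_def)
  have xa: "x \<noteq> a" "x \<noteq> b" using nb_irrefl[OF irr, of x W] x(2) by auto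
  have W: "a \<in> W" "b \<in> W" using x(4,5) by (auto simp: leg_def)
  obtain c1 A1 where g1: "col (insert x R) c1 A1" and 1: "\<And>n. n \<in> R \<Longrightarrow> c1 n = c n" "\<And>n. n \<in> R \<Longrightarrow> A1 n = A n"
    "c1 x = y" "A1 x = {z. z < 5 \<and> z \<noteq> y \<and> z \<notin> c ` {v}}"
    by (rule step[OF g, of x "{v}" y]) (use x R y y5 in \<open>auto simp: cap_def\<close>)
  obtain p where p: "p \<in> A u" "p \<notin> {y, c v}" using y(4) by blast
  obtain q where q: "q \<in> A w" "q \<notin> {y, c v}" using y(5) by blast
  have "p < 5" "q < 5" using avail(1)[OF g R(5)] avail(1)[OF g R(6)] p q by auto
  have R1: "insert x R \<subseteq> W" using g(2) x(1) by simp
  have "\<exists>c2 A2. col (insert a (insert x R)) c2 A2 \<and> (\<forall>n\<in>insert x R. c2 n = c1 n \<and> A2 n = A1 n)"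
    using x(4) R xa f(2) 1 y p \<open>p < 5\<close> by (intro attach_leg[OF g1 R1, of a x u p]) auto
  then obtain c2 A2 where g2: "col (insert a (insert x R)) c2 A2"
    and 2: "\<And>n. n \<in> insert x R \<Longrightarrow> c2 n = c1 n" "\<And>n. n \<in> insert x R \<Longrightarrow> A2 n = A1 n" by blast
  have R2: "insert a (insert x R) \<subseteq> W" using R1 W(1) by simp
  have "\<exists>c3 A3. col (insert b (insert a (insert x R))) c3 A3 \<and> (\<forall>n\<in>insert a (insert x R). c3 n = c2 n \<and> A3 n = A2 n)"
    using x(3,5) R xa f(3) 1 2 y q \<open>q < 5\<close> by (intro attach_leg[OF g2 R2, of b x w q]) auto
  then obtain c3 A3 where g3: "col (insert b (insert a (insert x R))) c3 A3"
    and 3: "\<And>n. n \<in> insert a (insert x R) \<Longrightarrow> c3 n = c2 n" "\<And>n. n \<in> insert a (insert x R) \<Longrightarrow> A3 n = A2 n" by blast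
  have "\<forall>n\<in>R. c3 n = c n \<and> A3 n = A n" using 1 2 3 by simp
  then show ?thesis using g3 by blast
qed

text \<open>The restricted vertex \<open>t\<close> spends its only out-edge on \<open>s\<close>.
  Coloring succeeds if \<open>s\<close> offers three colors, by \<open>Z_color_root\<close>, or if
  both far ends do, since then no leg blocks. The density makes one of the two possible.\<close>

lemma root_fork:
  assumes t: "t \<in> W" "t \<in> Q" "deg t = 2" and f: "fork v t a b"
  shows colorable
proof -
  have v: "v \<in> W" "nb E W v = {t, a, b}" "distinct [t, a, b]" "leg a" "leg b" using f by (auto simp: fork_def)
  obtain u w where uw: "nb E W a = {v, u}" "nb E W b = {v, w}" "u \<in> W" "w \<in> W"
    and p: "nbw E [t, v, a, u]" "nbw E [t, v, b, w]" "nbw E [u, a, v, b, w]" using fork_ends[OF f] .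
  have tv: "t \<in> nb E W v" using v by simp
  obtain s where s: "nb E W t = {v, s}" "s \<noteq> v" "s \<in> W" "s \<noteq> t" using nb2[OF t(1,3) nb_sym[OF sym v(1) tv]] .
  have p': "nbw E [s, t, v, a, u]" "nbw E [s, t, v, b, w]" using nb_E[of s t] nb_E[OF tv] p s by auto
  have d: "distinct [s, t, v, a, u]" "distinct [s, t, v, b, w]" "distinct [u, a, v, b, w]"
    by (rule dist[OF p'(1)] dist[OF p'(2)] dist[OF p(3)], simp)+
  let ?R = "W - {t, v, a, b}"
  have R: "?R \<subset> W" "?R \<subseteq> W" using t by auto
  have W: "a \<in> W" "b \<in> W" using v by (auto simp: leg_def)
  have in_R: "s \<in> ?R" "u \<in> ?R" "w \<in> ?R" using d uw s by auto
  have finish: colorable if g: "col ?R c A" and x: "x \<in> A s" and y: "y < 5" "y \<notin> {x, c s, c u, c w}"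
    and n: "\<not> A u \<subseteq> {y, x}" "\<not> A w \<subseteq> {y, x}" for c A x y
  proof -
    obtain c1 A1 where g1: "col (insert t ?R) c1 A1" and 1: "\<And>n. n \<in> ?R \<Longrightarrow> c1 n = c n" "\<And>n. n \<in> ?R \<Longrightarrow> A1 n = A n"
      "c1 t = x" "A1 t = {z. z < 5 \<and> z \<noteq> x \<and> z \<notin> c ` {s}}"
      by (rule step[OF g R(2), of t "{s}" x]) (use avail(1)[OF g R(2) in_R(1)] s t x in_R in \<open>auto simp: cap_def\<close>)
    have "\<exists>c2 A2. col (insert b (insert a (insert v (insert t ?R)))) c2 A2 \<and> (\<forall>n\<in>insert t ?R. c2 n = c1 n \<and> A2 n = A1 n)"
      using in_R d v t y n 1 by (intro attach_fork[OF g1 _ f uw(1,2), of y]) auto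
    moreover have "insert b (insert a (insert v (insert t ?R))) = W" using t v W by auto
    ultimately show ?thesis by auto
  qed
  have "(\<exists>c A. col ?R c A \<and> 3 \<le> card (A s)) \<or> (\<exists>c A. col ?R c A \<and> 3 \<le> card (A u) \<and> 3 \<le> card (A w))"
  proof (rule ccontr)
    assume n: "\<not> ?thesis"
    obtain H where H: "H \<subseteq> ?R" "s \<in> H" "\<rho> H \<le> 2" using marked1[OF R(1) in_R(1)] n by blast
    \<comment> \<open>At most 4 from the two sets, 0 for \<open>t\<close>, 4 for the leg and -10 for
      the center with two edges.\<close>
    have no: False if K: "K \<subseteq> ?R" "z \<in> K" "\<rho> K \<le> 2" and z: "nb E W l = {v, z}" "l \<in> {a, b}" for K z l
    proof -
      let ?U = "H \<union> K"
      have "\<rho> ?U \<le> 2 + 2" by (rule union_le) (use H K R in auto)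
      moreover have "\<rho> (insert t ?U) \<le> \<rho> ?U + w5 Q t - 14 * int 1"
        by (rule add_rho[of _ _ "{s}"]) (use H K s t in auto)
      moreover have "\<rho> (insert l (insert t ?U)) \<le> \<rho> (insert t ?U) + w5 Q l - 14 * int 1"
        by (rule add_rho[of _ _ "{z}"]) (use H K z t W d in auto)
      moreover have "\<rho> (insert v (insert l (insert t ?U))) \<le> \<rho> (insert l (insert t ?U)) + w5 Q v - 14 * int 2"
        by (rule add_rho[of _ _ "{t, l}"]) (use H K v z t W d in auto)
      moreover have "0 \<le> \<rho> (insert v (insert l (insert t ?U)))" using H K t z W v by (intro rho_nonneg) auto
      ultimately show False using w5_le(1)[of l] w5_le(1)[of v] w5_le(2)[OF t(2)] by simp
    qed
    have "\<not> (\<exists>K\<subseteq>?R. u \<in> K \<and> \<rho> K \<le> 2)" using no[OF _ _ _ uw(1)] by blast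
    moreover have "\<not> (\<exists>K\<subseteq>?R. w \<in> K \<and> \<rho> K \<le> 2)" using no[OF _ _ _ uw(2)] by blast
    moreover have "\<not> (\<exists>c A. col ?R c A \<and> 3 \<le> card (A u) \<and> 3 \<le> card (A w))" using n by blast
    ultimately obtain K where K: "K \<subseteq> ?R" "u \<in> K" "w \<in> K" "\<rho> K \<le> 6" using marked2[OF R(1) in_R(2,3)] by blast
    \<comment> \<open>At most 8 from the two sets, 0 for \<open>t\<close>, 4 for each leg and -24
      for the center with three edges.\<close>
    let ?U = "H \<union> K"
    have "\<rho> ?U \<le> 2 + 6" by (rule union_le) (use H K R in auto)
    moreover have "\<rho> (insert t ?U) \<le> \<rho> ?U + w5 Q t - 14 * int 1"
      by (rule add_rho[of _ _ "{s}"]) (use H K s t in auto)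
    moreover have "\<rho> (insert a (insert t ?U)) \<le> \<rho> (insert t ?U) + w5 Q a - 14 * int 1"
      by (rule add_rho[of _ _ "{u}"]) (use H K uw t W d in auto)
    moreover have "\<rho> (insert b (insert a (insert t ?U))) \<le> \<rho> (insert a (insert t ?U)) + w5 Q b - 14 * int 1"
      by (rule add_rho[of _ _ "{w}"]) (use H K uw t W d in auto)
    moreover have "\<rho> (insert v (insert b (insert a (insert t ?U)))) \<le> \<rho> (insert b (insert a (insert t ?U))) + w5 Q v - 14 * int 3"
      by (rule add_rho[of _ _ "{t, a, b}"]) (use H K v t W d in auto)
    moreover have "0 \<le> \<rho> (insert v (insert b (insert a (insert t ?U))))" using H K t W v by (intro rho_nonneg) auto
    ultimately show False using w5_le(1)[of a] w5_le(1)[of b] w5_le(1)[of v] w5_le(2)[OF t(2)] by simp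
  qed
  then consider (s) c A where "col ?R c A" "3 \<le> card (A s)" | (uw) c A where "col ?R c A" "3 \<le> card (A u)" "3 \<le> card (A w)"
    by blast
  then show ?thesis
  proof cases
    case s
    note as = avail[OF s(1) R(2)]
    obtain x y where "x \<in> A s" "y < 5" "y \<notin> {x, c s, c u, c w}" "\<not> A u \<subseteq> {y, x}" "\<not> A w \<subseteq> {y, x}"
      using Z_color_root[OF as(5)[OF in_R(2)] as(5)[OF in_R(3)] as(3)[OF in_R(2)] as(3)[OF in_R(3)] s(2) as(3)[OF in_R(1)] as(1)[OF in_R(1)]]
      by blast
    then show ?thesis using finish[OF s(1)] by blast
  next
    case uw
    note au = avail[OF uw(1) R(2)]
    obtain x z where x: "x \<in> A s" using two_elements[OF au(5)[OF in_R(1)]] .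
    obtain y where y: "y < 5" "y \<notin> set [x, c s, c u, c w]" using pick_lt[of "[x, c s, c u, c w]" 5] by auto
    have "\<not> A u \<subseteq> {y, x}" "\<not> A w \<subseteq> {y, x}"
      using pick[OF au(2)[OF in_R(2)], of "[y, x]"] pick[OF au(2)[OF in_R(3)], of "[y, x]"] uw by auto
    then show ?thesis using finish[OF uw(1) x y(1)] y(2) by auto
  qed
qed

end

context sparse5
begin

text \<open>The configuration of \<open>PZ_color_leg\<close> and \<open>PZ_color_root\<close>: a
  restricted vertex \<open>t\<close>, next to it \<open>P\<close> with one leg, then the center
  \<open>v\<close> of a fork. It suffices that one of \<open>s\<close>, \<open>u\<close>,
  \<open>w\<close> offers three colors.\<close>

lemma root_path_fork:
  assumes t: "t \<in> W" "t \<in> Q" "deg t = 2" and P: "P \<in> W" "P \<notin> Q" "nb E W P = {t, a', v}" "distinct [t, a', v]" "leg a'"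
    and f: "fork v P a b"
  shows colorable
proof -
  have v: "v \<in> W" "nb E W v = {P, a, b}" "distinct [P, a, b]" "leg a" "leg b" using f by (auto simp: fork_def)
  obtain u w where uw: "nb E W a = {v, u}" "nb E W b = {v, w}" "u \<in> W" "w \<in> W"
    and p: "nbw E [P, v, a, u]" "nbw E [P, v, b, w]" "nbw E [u, a, v, b, w]" using fork_ends[OF f] .
  have tP: "t \<in> nb E W P" "a' \<in> nb E W P" "v \<in> nb E W P" using P by auto
  obtain s where s: "nb E W t = {P, s}" "s \<noteq> P" "s \<in> W" "s \<noteq> t" using nb2[OF t(1,3) nb_sym[OF sym P(1) tP(1)]] .
  obtain u' where u': "nb E W a' = {P, u'}" "u' \<noteq> P" "u' \<in> W" "(u', a') \<in> E" "(a', u') \<in> E"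
    using leg_nb[OF P(5) nb_sym[OF sym P(1) tP(2)]] by blast
  have p': "nbw E [s, t, P, v, a, u]" "nbw E [s, t, P, v, b, w]" "nbw E [s, t, P, a', u']"
    "nbw E [u', a', P, v, a, u]" "nbw E [u', a', P, v, b, w]"
    using nb_E[of s t] nb_E[OF tP(1)] nb_E[OF tP(2)] nb_E[OF tP(3)] p s u' P(4) by auto
  have d: "distinct [s, t, P, v, a, u]" "distinct [s, t, P, v, b, w]" "distinct [s, t, P, a', u']"
    "distinct [u', a', P, v, a, u]" "distinct [u', a', P, v, b, w]" "distinct [u, a, v, b, w]"
    by (rule dist[OF p'(1)] dist[OF p'(2)] dist[OF p'(3)] dist[OF p'(4)] dist[OF p'(5)] dist[OF p(3)], simp)+
  let ?R = "W - {t, P, a', v, a, b}"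
  have R: "?R \<subset> W" "?R \<subseteq> W" using t by auto
  have W: "a \<in> W" "b \<in> W" "a' \<in> W" "a' \<notin> Q" using v P by (auto simp: leg_def)
  have in_R: "s \<in> ?R" "u \<in> ?R" "w \<in> ?R" "u' \<in> ?R" using d uw s u' by auto
  have finish: colorable if g: "col ?R c A" and x: "x \<in> A s" and z: "z < 5" "z \<notin> {x, c s, c u'}" "\<not> A u' \<subseteq> {z, x}"
    and y: "y < 5" "y \<notin> {z, x, c u, c w}" "\<not> A u \<subseteq> {y, z}" "\<not> A w \<subseteq> {y, z}" for c A x y z
  proof -
    have x5: "x < 5" using avail(1)[OF g R(2) in_R(1)] x by auto
    obtain c1 A1 where g1: "col (insert t ?R) c1 A1" and 1: "\<And>n. n \<in> ?R \<Longrightarrow> c1 n = c n" "\<And>n. n \<in> ?R \<Longrightarrow> A1 n = A n"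
      "c1 t = x" "A1 t = {z. z < 5 \<and> z \<noteq> x \<and> z \<notin> c ` {s}}"
      by (rule step[OF g R(2), of t "{s}" x]) (use x5 s t x in_R in \<open>auto simp: cap_def\<close>)
    let ?U = "insert t ?R"
    have R1: "?U \<subseteq> W" using t by auto
    obtain c2 A2 where g2: "col (insert P ?U) c2 A2" and 2: "\<And>n. n \<in> ?U \<Longrightarrow> c2 n = c1 n" "\<And>n. n \<in> ?U \<Longrightarrow> A2 n = A1 n"
      "c2 P = z" "A2 P = {i. i < 5 \<and> i \<noteq> z \<and> i \<notin> c1 ` {t}}"
    proof (rule step[OF g1 R1, of P "{t}" z])
      show "P \<in> W - ?U" using P(1) d by auto
      show "nb E W P \<inter> ?U = {t}" using P(3) d by auto
      show "\<And>n. n \<in> {t} \<Longrightarrow> z \<in> A1 n" using 1(4) z by auto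
    qed (use z in \<open>auto simp: cap_def\<close>)
    let ?V = "insert P ?U"
    have R2: "?V \<subseteq> W" using P(1) R1 by simp
    have c2: "c2 n = c n \<and> A2 n = A n" if "n \<in> ?R" for n using 1(1,2)[OF that] 2(1,2)[of n] that by simp
    obtain i where i: "i \<in> A u'" "i \<noteq> z" "i \<noteq> x" using z(3) by blast
    have i5: "i < 5" using avail(1)[OF g R(2) in_R(4)] i(1) by auto
    have "\<exists>c3 A3. col (insert a' ?V) c3 A3 \<and> (\<forall>n\<in>?V. c3 n = c2 n \<and> A3 n = A2 n)"
    proof (rule attach_leg[OF g2 R2 P(5) _ u'(1), of i])
      show "a' \<notin> ?V" using d by auto
      show "P \<in> ?V" "u' \<in> ?V" using in_R(4) by blast+
      show "c2 P \<noteq> c2 u'" using 2(3) c2[OF in_R(4)] z(2) by simp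
      show "i \<in> A2 P" using 2(4) 1(3) i i5 by simp
      show "i \<in> A2 u'" using c2[OF in_R(4)] i(1) by simp
    qed
    then obtain c3 A3 where g3: "col (insert a' ?V) c3 A3" and 3: "\<And>n. n \<in> ?V \<Longrightarrow> c3 n = c2 n \<and> A3 n = A2 n" by blast
    have R3: "insert a' ?V \<subseteq> W" using R2 W by simp
    have c3: "c3 n = c n \<and> A3 n = A n" if "n \<in> ?R" for n using c2[OF that] 3[of n] that by simp
    have c3P: "c3 P = z" "A3 P = A2 P" using 3[of P] 2(3) by auto
    have "\<exists>c4 A4. col (insert b (insert a (insert v (insert a' ?V)))) c4 A4 \<and> (\<forall>n\<in>insert a' ?V. c4 n = c3 n \<and> A4 n = A3 n)"
    proof (rule attach_fork[OF g3 R3 f uw(1,2), of y])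
      show "v \<notin> insert a' ?V" "a \<notin> insert a' ?V" "b \<notin> insert a' ?V" using d by auto
      show "P \<in> insert a' ?V" "u \<in> insert a' ?V" "w \<in> insert a' ?V" using in_R(2,3) by blast+
      show "y \<in> A3 P" using c3P 2(4) 1(3) y by simp
    qed (use c3[OF in_R(2)] c3[OF in_R(3)] c3P y in auto)
    moreover have "insert b (insert a (insert v (insert a' ?V))) = W" using t v W P(1) by auto
    ultimately show ?thesis by auto
  qed
  have "\<exists>c A. col ?R c A \<and> (3 \<le> card (A s) \<or> 3 \<le> card (A u) \<or> 3 \<le> card (A w))"
  proof (rule ccontr)
    assume n: "\<not> ?thesis"
    obtain H where H: "H \<subseteq> ?R" "s \<in> H" "\<rho> H \<le> 2" using marked1[OF R(1) in_R(1)] n by blast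
    obtain K where K: "K \<subseteq> ?R" "u \<in> K" "\<rho> K \<le> 2" using marked1[OF R(1) in_R(2)] n by blast
    obtain L where L: "L \<subseteq> ?R" "w \<in> L" "\<rho> L \<le> 2" using marked1[OF R(1) in_R(3)] n by blast
    have "\<rho> (H \<union> K) \<le> 2 + 2" by (rule union_le) (use H K R in auto)
    then have "\<rho> (H \<union> K \<union> L) \<le> 2 + 2 + 2" by (rule union_le[rotated 2]) (use H K L R in auto)
    then obtain U where U: "U \<subseteq> ?R" "s \<in> U" "u \<in> U" "w \<in> U" and "\<rho> U \<le> 6"
      using that[of "H \<union> K \<union> L"] H K L by simp
    \<comment> \<open>From at most 6: 0 for \<open>t\<close>, 4 for each leg of the fork, and -10
      for each of \<open>v\<close> and \<open>P\<close>, so at most -6.\<close>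
    have "\<rho> (insert t U) \<le> \<rho> U + w5 Q t - 14 * int 1"
      by (rule add_rho[of _ _ "{s}"]) (use U s t in auto)
    moreover have "\<rho> (insert a (insert t U)) \<le> \<rho> (insert t U) + w5 Q a - 14 * int 1"
      by (rule add_rho[of _ _ "{u}"]) (use U uw t W d in auto)
    moreover have "\<rho> (insert b (insert a (insert t U))) \<le> \<rho> (insert a (insert t U)) + w5 Q b - 14 * int 1"
      by (rule add_rho[of _ _ "{w}"]) (use U uw t W d in auto)
    moreover have "\<rho> (insert v (insert b (insert a (insert t U)))) \<le> \<rho> (insert b (insert a (insert t U))) + w5 Q v - 14 * int 2"
      by (rule add_rho[of _ _ "{a, b}"]) (use U v t W d in auto)
    moreover have "\<rho> (insert P (insert v (insert b (insert a (insert t U))))) \<le> \<rho> (insert v (insert b (insert a (insert t U)))) + w5 Q P - 14 * int 2"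
      by (rule add_rho[of _ _ "{t, v}"]) (use U v t W d P in auto)
    moreover have "0 \<le> \<rho> (insert P (insert v (insert b (insert a (insert t U)))))" using U t W v P(1) by (intro rho_nonneg) auto
    ultimately show False using \<open>\<rho> U \<le> 6\<close> w5_le(1)[of a] w5_le(1)[of b] w5_le(1)[of v] w5_le(1)[of P] w5_le(2)[OF t(2)] by simp
  qed
  then obtain c A where g: "col ?R c A" and sz: "3 \<le> card (A s) \<or> 3 \<le> card (A u) \<or> 3 \<le> card (A w)" by blast
  note av = avail[OF g R(2)]
  have "\<exists>x\<in>A s. \<exists>z<5. z \<notin> {x, c s, c u'} \<and> \<not> A u' \<subseteq> {z, x} \<and>
    (\<exists>y<5. y \<notin> {z, x, c u, c w} \<and> \<not> A u \<subseteq> {y, z} \<and> \<not> A w \<subseteq> {y, z})"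
    using sz
  proof (elim disjE)
    assume "3 \<le> card (A s)"
    then show ?thesis
      using PZ_color_root[OF av(5)[OF in_R(4)] av(5)[OF in_R(2)] av(5)[OF in_R(3)] av(3)[OF in_R(2)] av(3)[OF in_R(3)]
        av(1)[OF in_R(2)] av(1)[OF in_R(3)] _ av(3)[OF in_R(1)] av(1)[OF in_R(1)]] by simp
  next
    assume "3 \<le> card (A u)"
    then show ?thesis
      using PZ_color_leg[OF av(5)[OF in_R(4)] _ av(5)[OF in_R(3)] av(3)[OF in_R(3)] av(5)[OF in_R(1)] av(3)[OF in_R(1)] av(1)[OF in_R(1)]] by simp
  next
    assume "3 \<le> card (A w)"
    then have "\<exists>x\<in>A s. \<exists>z<5. z \<notin> {x, c s, c u'} \<and> \<not> A u' \<subseteq> {z, x} \<and>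
      (\<exists>y<5. y \<notin> {z, x, c w, c u} \<and> \<not> A w \<subseteq> {y, z} \<and> \<not> A u \<subseteq> {y, z})"
      using PZ_color_leg[OF av(5)[OF in_R(4)] _ av(5)[OF in_R(2)] av(3)[OF in_R(2)] av(5)[OF in_R(1)] av(3)[OF in_R(1)] av(1)[OF in_R(1)]] by simp
    then show ?thesis by (simp add: conj_ac disj_ac insert_commute)
  qed
  then obtain x z y where "x \<in> A s" "z < 5" "z \<notin> {x, c s, c u'}" "\<not> A u' \<subseteq> {z, x}"
    "y < 5" "y \<notin> {z, x, c u, c w}" "\<not> A u \<subseteq> {y, z}" "\<not> A w \<subseteq> {y, z}" by blast
  then show ?thesis by (rule finish[OF g])
qed

section \<open>Three branches at a vertex of degree three\<close>

definition branch :: "'a \<Rightarrow> 'a \<Rightarrow> 'a set \<Rightarrow> 'a set \<Rightarrow> bool" where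
  "branch v x B F \<longleftrightarrow> (\<exists>u. leg x \<and> nb E W x = {v, u} \<and> u \<noteq> v \<and> B = {x} \<and> F = {u})
    \<or> (\<exists>a b u w. fork x v a b \<and> nb E W a = {x, u} \<and> nb E W b = {x, w} \<and> nbw E [v, x, a, u] \<and> nbw E [v, x, b, w]
        \<and> nbw E [u, a, x, b, w] \<and> B = {x, a, b} \<and> F = {u, w})"

lemma branch_ex:
  assumes "v \<in> W" "x \<in> nb E W v" "leg x \<or> (\<exists>a b. fork x v a b)"
  shows "\<exists>B F. branch v x B F"
  using assms(3)
proof (elim disjE exE)
  assume "leg x"
  then obtain u where "nb E W x = {v, u}" "u \<noteq> v" using leg_nb[OF _ nb_sym[OF sym assms(1,2)]] by blast
  then show ?thesis unfolding branch_def using \<open>leg x\<close> by blast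
next
  fix a b assume f: "fork x v a b"
  obtain u w where "nb E W a = {x, u}" "nb E W b = {x, w}" "u \<in> W" "w \<in> W" "nbw E [v, x, a, u]" "nbw E [v, x, b, w]"
    "nbw E [u, a, x, b, w]" using fork_ends[OF f] .
  then show ?thesis unfolding branch_def using f by blast
qed

lemma branch_walk:
  assumes "branch v x B F" "v \<in> W" "x \<in> nb E W v" "y \<in> B \<union> F"
  shows "y \<in> W \<and> (\<exists>p. nbw E (v # x # p) \<and> last (x # p) = y \<and> length p \<le> 2)"
proof -
  have vx: "(v, x) \<in> E" "x \<in> W" using nb_E[OF assms(3)] by auto
  have ex: "\<exists>p. nbw E (v # x # p) \<and> last (x # p) = y \<and> length p \<le> 2"
    if "nbw E (v # x # p)" "last (x # p) = y" "length p \<le> 2" for p using that by blast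
  show ?thesis using assms(1) unfolding branch_def
  proof (elim disjE exE conjE)
    fix u assume u: "leg x" "nb E W x = {v, u}" "u \<noteq> v" "B = {x}" "F = {u}"
    have "nbw E [v, x]" "nbw E [v, x, u]" "u \<in> W" using vx u nb_E[of u x] by auto
    moreover have "y = x \<or> y = u" using assms(4) u by auto
    ultimately show ?thesis using vx by (elim disjE) (use ex[of "[]"] ex[of "[u]"] in simp_all)
  next
    fix a b u w assume f: "fork x v a b" "nb E W a = {x, u}" "nb E W b = {x, w}" "nbw E [v, x, a, u]" "nbw E [v, x, b, w]"
      "B = {x, a, b}" "F = {u, w}"
    have "a \<in> W" "b \<in> W" "u \<in> W" "w \<in> W" using f nb_E[of u a] nb_E[of w b] by (auto simp: fork_def leg_def)
    moreover have "nbw E [v, x]" "nbw E [v, x, a]" "nbw E [v, x, b]" using f vx by auto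
    moreover have "y = x \<or> y = a \<or> y = b \<or> y = u \<or> y = w" using assms(4) f by auto
    ultimately show ?thesis using vx f(4,5)
      by (elim disjE) (use ex[of "[]"] ex[of "[a]"] ex[of "[b]"] ex[of "[a, u]"] ex[of "[b, w]"] in simp_all)
  qed
qed

lemma branch_self:
  assumes "branch v x B F"
  shows "B \<inter> F = {}" "x \<in> B"
proof -
  show "x \<in> B" using assms unfolding branch_def by auto
  show "B \<inter> F = {}" using assms unfolding branch_def
  proof (elim disjE exE conjE)
    fix u assume "nb E W x = {v, u}" "B = {x}" "F = {u}"
    then show ?thesis using nb_irrefl[OF irr, of x W] by auto
  next
    fix a b u w assume w: "nbw E [u, a, x, b, w]" and B: "B = {x, a, b}" "F = {u, w}"
    have "distinct [u, a, x, b, w]" by (rule dist[OF w]) simp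
    then show ?thesis using B by auto
  qed
qed

text \<open>Walks from \<open>v\<close> with at most four vertices in two directions join to one
  with at most seven, which is simple in girth nine.\<close>

lemma branch_disjoint:
  assumes "branch v x B F" "branch v x' B' F'" "v \<in> W" "x \<in> nb E W v" "x' \<in> nb E W v" "x \<noteq> x'"
  shows "(B \<union> F) \<inter> (B' \<union> F') = {}" "v \<notin> B \<union> F"
proof -
  have D: "distinct (rev (x # p) @ v # x' # p')"
    if "nbw E (v # x # p)" "nbw E (v # x' # p')" "length p \<le> 2" "length p' \<le> 2" for p p'
    using nbw_rev_append[OF sym that(1,2)] assms(6) that(3,4) by (intro dist) auto
  show "v \<notin> B \<union> F"
  proof
    assume "v \<in> B \<union> F"
    then obtain p where p: "nbw E (v # x # p)" "last (x # p) = v" "length p \<le> 2" using branch_walk[OF assms(1,3,4)] by blast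
    have "distinct (v # x # p)" by (rule dist[OF p(1)]) (use p(3) in simp)
    then show False using p(2) last_in_set[of "x # p"] by auto
  qed
  show "(B \<union> F) \<inter> (B' \<union> F') = {}"
  proof (rule ccontr)
    assume "\<not> ?thesis"
    then obtain y where y: "y \<in> B \<union> F" "y \<in> B' \<union> F'" by blast
    obtain p where p: "nbw E (v # x # p)" "last (x # p) = y" "length p \<le> 2" using branch_walk[OF assms(1,3,4) y(1)] by blast
    obtain p' where p': "nbw E (v # x' # p')" "last (x' # p') = y" "length p' \<le> 2" using branch_walk[OF assms(2,3,5) y(2)] by blast
    show False using D[OF p(1) p'(1) p(3) p'(3)] p(2) p'(2) last_in_set[of "x # p"] last_in_set[of "x' # p'"] by auto
  qed
qed

text \<open>Whatever is colored in addition to \<open>R0\<close>, the branch can be colored if the color of \<open>v\<close> is not \<open>bad\<close>.\<close>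

definition safe :: "'a set \<Rightarrow> ('a \<Rightarrow> nat) \<Rightarrow> ('a \<Rightarrow> nat set) \<Rightarrow> 'a \<Rightarrow> 'a set \<Rightarrow> nat \<Rightarrow> bool" where
  "safe R0 c A v B bad \<longleftrightarrow> (\<forall>R c' A'. col R c' A' \<and> R \<subseteq> W \<and> R0 \<subseteq> R \<and> v \<in> R \<and> R \<inter> B = {} \<and> (\<forall>n\<in>R0. c' n = c n \<and> A' n = A n)
    \<and> c' v \<noteq> bad \<and> A' v = {z. z < 5 \<and> z \<noteq> c' v} \<longrightarrow> (\<exists>c'' A''. col (R \<union> B) c'' A'' \<and> (\<forall>n\<in>R. c'' n = c' n \<and> A'' n = A' n)))"

lemma safeD:
  assumes "safe R0 c A v B bad" "col R c' A'" "R \<subseteq> W" "R0 \<subseteq> R" "v \<in> R" "R \<inter> B = {}"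
    "\<And>n. n \<in> R0 \<Longrightarrow> c' n = c n \<and> A' n = A n" "c' v \<noteq> bad" "A' v = {z. z < 5 \<and> z \<noteq> c' v}"
  shows "\<exists>c'' A''. col (R \<union> B) c'' A'' \<and> (\<forall>n\<in>R. c'' n = c' n \<and> A'' n = A' n)"
  using assms(1)[unfolded safe_def, rule_format, of R c' A'] assms(2-) by blast

text \<open>A branch spoils a single color of \<open>v\<close>: a leg the color of its far end, a
  fork the color provided by \<open>Z_color\<close>.\<close>

lemma branch_color:
  assumes b: "branch v x B F" and g: "col R0 c A" "R0 \<subseteq> W" "F \<subseteq> R0"
  shows "\<exists>bad. safe R0 c A v B bad"
  using b unfolding branch_def
proof (elim disjE exE conjE)
  fix u assume u: "leg x" "nb E W x = {v, u}" "u \<noteq> v" "B = {x}" "F = {u}"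
  have uR: "u \<in> R0" using g(3) u(5) by simp
  show ?thesis
  unfolding safe_def
  proof (intro exI[of _ "c u"] allI impI, elim conjE)
    fix R c' A' assume h: "col R c' A'" "R \<subseteq> W" "R0 \<subseteq> R" "v \<in> R" "R \<inter> B = {}" "\<forall>n\<in>R0. c' n = c n \<and> A' n = A n"
      "c' v \<noteq> c u" "A' v = {z. z < 5 \<and> z \<noteq> c' v}"
    obtain y where y: "y \<in> A u" "y \<notin> set [c' v]" using pick[OF avail(2)[OF g(1,2) uR], of "[c' v]"] avail(5)[OF g(1,2) uR] by auto
    have "y < 5" using y avail(1)[OF g(1,2) uR] by auto
    have "\<exists>c'' A''. col (insert x R) c'' A'' \<and> (\<forall>n\<in>R. c'' n = c' n \<and> A'' n = A' n)"
      using h uR u y \<open>y < 5\<close> by (intro attach_leg[OF h(1,2) u(1) _ u(2), of y]) auto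
    then show "\<exists>c'' A''. col (R \<union> B) c'' A'' \<and> (\<forall>n\<in>R. c'' n = c' n \<and> A'' n = A' n)" using u(4) by simp
  qed
next
  fix a b u w assume f: "fork x v a b" "nb E W a = {x, u}" "nb E W b = {x, w}" "B = {x, a, b}" "F = {u, w}"
  have R: "u \<in> R0" "w \<in> R0" using g(3) f(5) by auto
  obtain bad where bad: "\<And>i. i \<noteq> bad \<Longrightarrow> \<exists>y<5. y \<notin> {i, c u, c w} \<and> \<not> A u \<subseteq> {y, i} \<and> \<not> A w \<subseteq> {y, i}"
    using Z_color[OF avail(5)[OF g(1,2) R(1)] avail(5)[OF g(1,2) R(2)]] by blast
  show ?thesis
  unfolding safe_def
  proof (intro exI[of _ bad] allI impI, elim conjE)
    fix R c' A' assume h: "col R c' A'" "R \<subseteq> W" "R0 \<subseteq> R" "v \<in> R" "R \<inter> B = {}" "\<forall>n\<in>R0. c' n = c n \<and> A' n = A n"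
      "c' v \<noteq> bad" "A' v = {z. z < 5 \<and> z \<noteq> c' v}"
    obtain y where y: "y < 5" "y \<notin> {c' v, c u, c w}" "\<not> A u \<subseteq> {y, c' v}" "\<not> A w \<subseteq> {y, c' v}" using bad[OF h(7)] by blast
    have "\<exists>c'' A''. col (insert b (insert a (insert x R))) c'' A'' \<and> (\<forall>n\<in>R. c'' n = c' n \<and> A'' n = A' n)"
      using h R f y by (intro attach_fork[OF h(1,2) f(1-3), of y]) auto
    moreover have "insert b (insert a (insert x R)) = R \<union> B" using f(4) by auto
    ultimately show "\<exists>c'' A''. col (R \<union> B) c'' A'' \<and> (\<forall>n\<in>R. c'' n = c' n \<and> A'' n = A' n)" by simp
  qed
qed

text \<open>\<open>v\<close> is colored without out-edges, in one of the five colors that none of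
  its three branches spoils; the branches are then added one after another, oriented towards
  \<open>v\<close>.\<close>

lemma three_branches:
  assumes v: "v \<in> W" "deg v = 3" and n: "\<And>x. x \<in> nb E W v \<Longrightarrow> leg x \<or> (\<exists>a b. fork x v a b)"
  shows colorable
proof -
  obtain x1 x2 x3 where x: "nb E W v = {x1, x2, x3}" "x1 \<noteq> x2" "x1 \<noteq> x3" "x2 \<noteq> x3" using v(2) by (auto simp: card_3_iff)
  have xn: "x1 \<in> nb E W v" "x2 \<in> nb E W v" "x3 \<in> nb E W v" using x by auto
  obtain B1 F1 where b1: "branch v x1 B1 F1" using branch_ex[OF v(1) xn(1) n[OF xn(1)]] by blast
  obtain B2 F2 where b2: "branch v x2 B2 F2" using branch_ex[OF v(1) xn(2) n[OF xn(2)]] by blast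
  obtain B3 F3 where b3: "branch v x3 B3 F3" using branch_ex[OF v(1) xn(3) n[OF xn(3)]] by blast
  have d12: "(B1 \<union> F1) \<inter> (B2 \<union> F2) = {}" "v \<notin> B1 \<union> F1" using branch_disjoint[OF b1 b2 v(1) xn(1,2) x(2)] .
  have d23: "(B2 \<union> F2) \<inter> (B3 \<union> F3) = {}" "v \<notin> B2 \<union> F2" using branch_disjoint[OF b2 b3 v(1) xn(2,3) x(4)] .
  have d31: "(B3 \<union> F3) \<inter> (B1 \<union> F1) = {}" "v \<notin> B3 \<union> F3" using branch_disjoint[OF b3 b1 v(1) xn(3,1) x(3)[symmetric]] .
  have W: "B1 \<union> F1 \<subseteq> W" "B2 \<union> F2 \<subseteq> W" "B3 \<union> F3 \<subseteq> W"
    using branch_walk[OF b1 v(1) xn(1)] branch_walk[OF b2 v(1) xn(2)] branch_walk[OF b3 v(1) xn(3)] by blast+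
  let ?R = "W - insert v (B1 \<union> B2 \<union> B3)"
  have R: "?R \<subset> W" "?R \<subseteq> W" using v(1) by auto
  have sub: "F \<subseteq> W - insert v (B \<union> B' \<union> B'')"
    if "B \<union> F \<subseteq> W" "v \<notin> B \<union> F" "B \<inter> F = {}" "(B \<union> F) \<inter> (B' \<union> F') = {}" "(B'' \<union> F'') \<inter> (B \<union> F) = {}" for B F B' F' B'' F'' :: "'a set"
    using that by blast
  have "F1 \<subseteq> ?R" using sub[OF W(1) d12(2) branch_self(1)[OF b1] d12(1) d31(1)] by simp
  moreover have "F2 \<subseteq> ?R" using sub[OF W(2) d23(2) branch_self(1)[OF b2] d23(1) d12(1)] by (simp add: Un_ac)
  moreover have "F3 \<subseteq> ?R" using sub[OF W(3) d31(2) branch_self(1)[OF b3] d31(1) d23(1)] by (simp add: Un_ac)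
  ultimately have F: "F1 \<subseteq> ?R" "F2 \<subseteq> ?R" "F3 \<subseteq> ?R" .
  obtain c A where g: "col ?R c A" using col_ex[OF R(1)] by blast
  obtain bad1 where k1: "safe ?R c A v B1 bad1"
    using branch_color[OF b1 g R(2) F(1)] by blast
  obtain bad2 where k2: "safe ?R c A v B2 bad2"
    using branch_color[OF b2 g R(2) F(2)] by blast
  obtain bad3 where k3: "safe ?R c A v B3 bad3"
    using branch_color[OF b3 g R(2) F(3)] by blast
  obtain y where y: "y < 5" "y \<notin> set [bad1, bad2, bad3]" using pick_lt[of "[bad1, bad2, bad3]" 5] by auto
  have xB: "x1 \<in> B1" "x2 \<in> B2" "x3 \<in> B3" using branch_self(2)[OF b1] branch_self(2)[OF b2] branch_self(2)[OF b3] .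
  obtain c0 A0 where g0: "col (insert v ?R) c0 A0" and 0: "\<And>n. n \<in> ?R \<Longrightarrow> c0 n = c n" "\<And>n. n \<in> ?R \<Longrightarrow> A0 n = A n"
    "c0 v = y" "A0 v = {z. z < 5 \<and> z \<noteq> y \<and> z \<notin> c ` {}}"
    by (rule step[OF g R(2), of v "{}" y]) (use v x xB y in auto)
  let ?T = "insert v ?R" let ?U = "?T \<union> B1" let ?V = "?U \<union> B2"
  have BW: "B1 \<subseteq> W" "B2 \<subseteq> W" "B3 \<subseteq> W" using W by simp_all
  have BB: "B1 \<inter> B2 = {}" "B2 \<inter> B3 = {}" "B3 \<inter> B1 = {}" using d12(1) d23(1) d31(1) by blast+
  have vB: "v \<notin> B1" "v \<notin> B2" "v \<notin> B3" using d12(2) d23(2) d31(2) by simp_all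
  have s: "?T \<subseteq> W" "?U \<subseteq> W" "?V \<subseteq> W" using v(1) BW by auto
  have s': "?T \<inter> B1 = {}" "?U \<inter> B2 = {}" "?V \<inter> B3 = {}" using vB BB by auto
  have h0: "c0 n = c n \<and> A0 n = A n" if "n \<in> ?R" for n using 0 that by simp
  have v0: "c0 v = y" "A0 v = {z. z < 5 \<and> z \<noteq> y}" using 0(3,4) by auto
  have "\<exists>c1 A1. col ?U c1 A1 \<and> (\<forall>n\<in>?T. c1 n = c0 n \<and> A1 n = A0 n)"
    by (rule safeD[OF k1 g0 s(1) _ _ s'(1) h0]) (use v0 y in auto)
  then obtain c1 A1 where g1: "col ?U c1 A1" and 1: "\<And>n. n \<in> ?T \<Longrightarrow> c1 n = c0 n \<and> A1 n = A0 n" by blast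
  have h1: "c1 n = c n \<and> A1 n = A n" if "n \<in> ?R" for n using h0[OF that] 1[of n] that by simp
  have v1: "c1 v = y" "A1 v = {z. z < 5 \<and> z \<noteq> y}" using v0 1[of v] by auto
  have "\<exists>c2 A2. col ?V c2 A2 \<and> (\<forall>n\<in>?U. c2 n = c1 n \<and> A2 n = A1 n)"
    by (rule safeD[OF k2 g1 s(2) _ _ s'(2) h1]) (use v1 y in auto)
  then obtain c2 A2 where g2: "col ?V c2 A2" and 2: "\<And>n. n \<in> ?U \<Longrightarrow> c2 n = c1 n \<and> A2 n = A1 n" by blast
  have h2: "c2 n = c n \<and> A2 n = A n" if "n \<in> ?R" for n using h1[OF that] 2[of n] that by simp
  have v2: "c2 v = y" "A2 v = {z. z < 5 \<and> z \<noteq> y}" using v1 2[of v] by auto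
  have "\<exists>c3 A3. col (?V \<union> B3) c3 A3 \<and> (\<forall>n\<in>?V. c3 n = c2 n \<and> A3 n = A2 n)"
    by (rule safeD[OF k3 g2 s(3) _ _ s'(3) h2]) (use v2 y in auto)
  moreover have "?V \<union> B3 = W" using v(1) BW by auto
  ultimately show ?thesis by auto
qed

end

section \<open>Cycles\<close>

definition cnext :: "nat \<Rightarrow> nat \<Rightarrow> nat" where
  "cnext n i = (if Suc i = n then 0 else Suc i)"

definition cprev :: "nat \<Rightarrow> nat \<Rightarrow> nat" where
  "cprev n i = (if i = 0 then n - 1 else i - 1)"

lemma cnext_cprev:
  assumes "i < n" "3 \<le> n"
  shows "cnext n i < n" "cprev n i < n" "cnext n (cprev n i) = i" "cnext n i \<noteq> cprev n i"
  using assms by (auto simp: cnext_def cprev_def)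

text \<open>In a longest path both neighbors of the first vertex lie on the path, and the farther
  one must be the last vertex, as an inner vertex would have a third neighbor. So the path closes
  up.\<close>

lemma two_regular_cycle:
  assumes sym: "sym E" and irr: "irrefl E" and fin: "finite W" and ne: "W \<noteq> {}"
    and deg: "\<And>v. v \<in> W \<Longrightarrow> card (nb E W v) = 2"
  shows "\<exists>vs. distinct vs \<and> set vs \<subseteq> W \<and> 3 \<le> length vs \<and>
    (\<forall>i<length vs. nb E W (vs ! i) = {vs ! (cnext (length vs) i), vs ! (cprev (length vs) i)})"
proof -
  define P where "P vs \<longleftrightarrow> distinct vs \<and> set vs \<subseteq> W \<and> vs \<noteq> [] \<and> successively (\<lambda>x y. (x, y) \<in> E) vs" for vs
  obtain w where "w \<in> W" using ne by blast
  then have "P [w]" by (simp add: P_def)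
  moreover have "\<forall>vs. P vs \<longrightarrow> length vs < Suc (card W)"
    using fin by (auto simp: P_def less_Suc_eq_le card_mono simp flip: distinct_card)
  ultimately obtain vs where vs: "P vs" and max: "\<And>us. P us \<Longrightarrow> length us \<le> length vs"
    using ex_has_greatest_nat[of P "[w]" length] by blast
  let ?n = "length vs"
  have d: "distinct vs" "set vs \<subseteq> W" "vs \<noteq> []" using vs by (auto simp: P_def)
  have succ: "(vs ! i, vs ! Suc i) \<in> E" if "Suc i < ?n" for i
    using vs that unfolding P_def by (auto simp: successively_conv_nth)
  obtain x ys where xy: "vs = x # ys" using d(3) by (cases vs) auto
  have ext: "y \<in> set ys" if "y \<in> nb E W x" for y
  proof (rule ccontr)
    assume "y \<notin> set ys"
    moreover have "y \<in> W" "y \<noteq> x" using nb_memD[OF irr that] by auto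
    moreover have "(y, x) \<in> E" using that symD[OF sym] by (auto simp: nb_def)
    ultimately have "P (y # vs)" using vs xy by (auto simp: P_def)
    then show False using max by fastforce
  qed
  have "card (nb E W x) = 2" using deg d(2) xy by auto
  then obtain a b where ab: "nb E W x = {a, b}" "a \<noteq> b" by (auto simp: card_2_iff)
  have "{a, b} \<subseteq> set ys" using ext ab(1) by auto
  then have "card {a, b} \<le> card (set ys)" by (intro card_mono) auto
  then have n3: "3 \<le> ?n" using ab(2) card_length[of ys] xy by simp
  obtain j where j: "2 \<le> j" "j < ?n" "(vs ! 0, vs ! j) \<in> E"
  proof -
    obtain ja where ja: "ja < length ys" "ys ! ja = a" using ext[of a] ab(1) by (auto simp: in_set_conv_nth)
    obtain jb where jb: "jb < length ys" "ys ! jb = b" using ext[of b] ab(1) by (auto simp: in_set_conv_nth)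
    have "ja \<noteq> jb" using ja jb ab(2) by auto
    moreover have "(x, a) \<in> E" "(x, b) \<in> E" using ab(1) by (auto simp: nb_def)
    ultimately show ?thesis using that[of "Suc ja"] that[of "Suc jb"] ja jb xy by (cases "ja = 0") auto
  qed
  have jn: "j = ?n - 1"
  proof (rule ccontr)
    assume "j \<noteq> ?n - 1"
    then have "Suc j < ?n" using j by simp
    have "(vs ! j, vs ! (j - 1)) \<in> E" using succ[of "j - 1"] j symD[OF sym] by simp
    then have "{vs ! 0, vs ! (j - 1), vs ! Suc j} \<subseteq> nb E W (vs ! j)"
      using succ[OF \<open>Suc j < ?n\<close>] symD[OF sym j(3)] \<open>Suc j < ?n\<close> d(2,3) j by (auto simp: nb_def)
    then have "card {vs ! 0, vs ! (j - 1), vs ! Suc j} \<le> 2"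
      using deg[of "vs ! j"] d(2) j(2) card_mono[OF finite_nb[OF fin]] by (metis nth_mem subsetD)
    moreover have "card {vs ! 0, vs ! (j - 1), vs ! Suc j} = 3"
      using j \<open>Suc j < ?n\<close> d(1,3) by (auto simp: nth_eq_iff_index_eq card_insert_if)
    ultimately show False by simp
  qed
  have edge: "(vs ! i, vs ! (cnext ?n i)) \<in> E" if "i < ?n" for i
  proof (cases "Suc i < ?n")
    case True
    then show ?thesis using succ by (simp add: cnext_def)
  next
    case False
    then have "i = j" "Suc i = ?n" using that jn by simp_all
    then show ?thesis using symD[OF sym j(3)] by (simp add: cnext_def)
  qed
  have "nb E W (vs ! i) = {vs ! (cnext ?n i), vs ! (cprev ?n i)}" if i: "i < ?n" for i
  proof -
    let ?s = "cnext ?n i" and ?p = "cprev ?n i"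
    note sp = cnext_cprev[OF i n3]
    have "(vs ! ?p, vs ! i) \<in> E" using edge[OF sp(2)] sp(3) by simp
    then have "(vs ! i, vs ! ?p) \<in> E" by (rule symD[OF sym])
    then have sub: "{vs ! ?s, vs ! ?p} \<subseteq> nb E W (vs ! i)" using edge[OF i] sp d(2) by (auto simp: nb_def)
    have "card {vs ! ?s, vs ! ?p} = 2" using sp d(1) by (simp add: nth_eq_iff_index_eq)
    moreover have "card (nb E W (vs ! i)) = 2" using deg i d(2) nth_mem by blast
    ultimately show ?thesis using card_seteq[OF finite_nb[OF fin] sub] by simp
  qed
  then show ?thesis using d n3 by blast
qed

text \<open>Orienting every vertex to its successor requires any three consecutive vertices to have
  different colors. Three colors are repeated, and the at most two leftover vertices at the end get
  the colors 3 and 4.\<close>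

lemma good_cycle:
  assumes d: "distinct vs" and n: "3 \<le> length vs" and q: "\<And>v. v \<in> set vs \<Longrightarrow> 1 \<le> q v"
    and nb: "\<And>i. i < length vs \<Longrightarrow> nb E (set vs) (vs ! i) = {vs ! (cnext (length vs) i), vs ! (cprev (length vs) i)}"
  shows "\<exists>c A. good 5 E q (set vs) c A"
proof -
  let ?n = "length vs"
  define m where "m = 3 * (?n div 3)"
  have m: "m \<le> ?n" "?n < m + 3" "3 \<le> m" "m mod 3 = 0" using n by (auto simp: m_def)
  define col where "col i = (if i < m then i mod 3 else 3 + (i - m))" for i
  have col5: "col i < 5" if "i < ?n" for i using that m(2) by (auto simp: col_def)
  define ix where "ix = inv_into {..<?n} ((!) vs)"
  have ix: "ix (vs ! i) = i" if "i < ?n" for i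
    unfolding ix_def using that d by (intro inv_into_f_f) (auto intro!: inj_on_nth)
  define c where "c v = col (ix v)" for v
  define D where "D v = {vs ! (cnext ?n (ix v))}" for v
  define A where "A v = {x. x < 5 \<and> x \<noteq> c v \<and> x \<notin> c ` D v}" for v
  have c: "c (vs ! i) = col i" "D (vs ! i) = {vs ! (cnext ?n i)}" if "i < ?n" for i
    using ix[OF that] by (simp_all add: c_def D_def)
  have mod3: "i mod 3 \<noteq> Suc i mod 3" "i mod 3 \<noteq> Suc (Suc i) mod 3" for i :: nat by presburger+
  have up: "col i \<noteq> col (Suc i)" "col i \<noteq> col (Suc (Suc i))" for i
    unfolding col_def using mod3[of i] mod_less_divisor[of 3 i] by auto
  have "\<exists>k. m = 3 * k + 3" using m(3,4) by presburger
  then obtain k where k: "m = 3 * k + 3" by blast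
  have mk: "(3 * k + 2) mod 3 = 2" "(3 * k + 1) mod 3 = 1" by presburger+
  have "?n = 3 * k + 3 \<or> ?n = 3 * k + 4 \<or> ?n = 3 * k + 5" using m(1,2) k by linarith
  then have wrap: "col (?n - 1) \<noteq> col 0 \<and> col (?n - 1) \<noteq> col 1 \<and> col (?n - 2) \<noteq> col 0"
    unfolding col_def k using mk by (elim disjE) simp_all
  have consec: "col i \<noteq> col (cnext ?n i) \<and> col (cprev ?n i) \<noteq> col (cnext ?n i) \<and> col i \<noteq> col (cprev ?n i)"
    if i: "i < ?n" for i
  proof -
    consider "i = 0" | "Suc i = ?n" "i \<noteq> 0" | k where "i = Suc k" "Suc i \<noteq> ?n" by (cases i) auto
    then show ?thesis
    proof cases
      case 1
      then show ?thesis using up[of 0] wrap n by (auto simp: cnext_def cprev_def)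
    next
      case 2
      then have "i = ?n - 1" "i - 1 = ?n - 2" "i = Suc (i - 1)" by auto
      then show ?thesis using up(1)[of "i - 1"] wrap 2 by (auto simp: cnext_def cprev_def)
    next
      case 3
      then show ?thesis using up[of k] up(1)[of "Suc k"] by (auto simp: cnext_def cprev_def)
    qed
  qed
  have "star_orient E (set vs) c D" unfolding star_orient_def
  proof (intro ballI)
    fix u v assume "u \<in> set vs" and v: "v \<in> nb E (set vs) u"
    then obtain i where i: "i < ?n" "u = vs ! i" by (auto simp: in_set_conv_nth)
    let ?s = "cnext ?n i" and ?p = "cprev ?n i"
    note sp = cnext_cprev[OF i(1) n]
    have N: "nb E (set vs) u = {vs ! ?s, vs ! ?p}" using nb[OF i(1)] i(2) by simp
    have cs: "c u = col i" "c (vs ! ?s) = col ?s" "c (vs ! ?p) = col ?p" "D u = {vs ! ?s}" "D (vs ! ?p) = {u}"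
      using c[OF i(1)] c[OF sp(1)] c[OF sp(2)] sp(3) i(2) by simp_all
    have "v = vs ! ?s \<or> v = vs ! ?p" using v N by simp
    then show "c u \<noteq> c v \<and> (v \<in> D u \<or> u \<in> D v) \<and> (v \<in> D u \<longrightarrow> (\<forall>w\<in>nb E (set vs) u. w \<noteq> v \<longrightarrow> c w \<noteq> c v))"
      using consec[OF i(1)] unfolding N cs(4) by (auto simp: cs(1-3,5))
  qed
  moreover have "c u < 5 \<and> D u \<subseteq> nb E (set vs) u \<and> card (D u) \<le> q u \<and> A u = {x. x < 5 \<and> x \<noteq> c u \<and> x \<notin> c ` D u}"
    if u: "u \<in> set vs" for u
  proof -
    obtain i where i: "i < ?n" "u = vs ! i" using u by (auto simp: in_set_conv_nth)
    show ?thesis using c[OF i(1)] nb[OF i(1)] col5[OF i(1)] q[OF u] i(2) by (simp add: A_def)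
  qed
  ultimately show ?thesis unfolding good_def by blast
qed

lemma good_Un:
  assumes g: "good k E q R c A" "good k E q V c' A'" and d: "R \<inter> V = {}" "sym E" "\<And>x y. x \<in> R \<Longrightarrow> y \<in> V \<Longrightarrow> (x, y) \<notin> E"
  shows "\<exists>c A. good k E q (R \<union> V) c A"
proof -
  obtain D where so: "star_orient E R c D" and D: "\<And>u. u \<in> R \<Longrightarrow> c u < k \<and> D u \<subseteq> nb E R u \<and> card (D u) \<le> q u
      \<and> A u = {x. x < k \<and> x \<noteq> c u \<and> x \<notin> c ` D u}" using g(1) unfolding good_def by auto
  obtain D' where so': "star_orient E V c' D'" and D': "\<And>u. u \<in> V \<Longrightarrow> c' u < k \<and> D' u \<subseteq> nb E V u \<and> card (D' u) \<le> q u
      \<and> A' u = {x. x < k \<and> x \<noteq> c' u \<and> x \<notin> c' ` D' u}" using g(2) unfolding good_def by auto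
  define C where "C u = (if u \<in> R then c u else c' u)" for u
  define F where "F u = (if u \<in> R then D u else D' u)" for u
  define B where "B u = {x. x < k \<and> x \<noteq> C u \<and> x \<notin> C ` F u}" for u
  have R: "nb E (R \<union> V) u = nb E R u" if "u \<in> R" for u using d(3) that by (auto simp: nb_def)
  have V: "nb E (R \<union> V) u = nb E V u" if "u \<in> V" for u using d(3) symD[OF d(2)] that by (auto simp: nb_def)
  have CR: "C u = c u" "F u = D u" if "u \<in> R" for u using that by (simp_all add: C_def F_def)
  have CV: "C u = c' u" "F u = D' u" if "u \<in> V" for u using that d(1) by (auto simp: C_def F_def)
  have "star_orient E (R \<union> V) C F" unfolding star_orient_def
  proof (intro ballI)
    fix u v assume u: "u \<in> R \<union> V" and v: "v \<in> nb E (R \<union> V) u"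
    show "C u \<noteq> C v \<and> (v \<in> F u \<or> u \<in> F v) \<and> (v \<in> F u \<longrightarrow> (\<forall>w\<in>nb E (R \<union> V) u. w \<noteq> v \<longrightarrow> C w \<noteq> C v))"
    proof (cases "u \<in> R")
      case True
      then have "v \<in> nb E R u" using v R by simp
      then show ?thesis using so True R[OF True] CR nb_in[of _ E R u] unfolding star_orient_def by simp
    next
      case False
      then have "u \<in> V" using u by simp
      moreover have "v \<in> nb E V u" using v V[OF \<open>u \<in> V\<close>] by simp
      ultimately show ?thesis using so' V[OF \<open>u \<in> V\<close>] CV nb_in[of _ E V u] unfolding star_orient_def by simp
    qed
  qed
  moreover have "C u < k \<and> F u \<subseteq> nb E (R \<union> V) u \<and> card (F u) \<le> q u" if "u \<in> R \<union> V" for u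
  proof (cases "u \<in> R")
    case True
    then show ?thesis using D[OF True] R CR by simp
  next
    case False
    then have "u \<in> V" using that by simp
    then show ?thesis using D'[of u] V CV by simp
  qed
  ultimately have "good k E q (R \<union> V) C B" unfolding good_def B_def by blast
  then show ?thesis by blast
qed

section \<open>Discharging for five colors\<close>

context sparse5
begin

definition zed :: "'a \<Rightarrow> bool" where
  "zed w \<longleftrightarrow> w \<in> W \<and> w \<notin> Q \<and> deg w = 3 \<and> card {a \<in> nb E W w. leg a} = 2"

text \<open>Initial charges are 7 deg minus the weight: -4 at a leg, 3 at an unrestricted vertex of
  degree three. A leg collects 2 from each side; a \<open>zed\<close> vertex pays 4 to its legs and
  collects the missing 1 along its third edge.\<close>

definition g :: "'a \<Rightarrow> 'a \<Rightarrow> int" where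
  "g v w = (if leg w then 2 else if zed w \<and> \<not> leg v then 1 else 0)"

definition ch :: "'a \<Rightarrow> int" where
  "ch v = 7 * int (deg v) - w5 Q v + (\<Sum>w\<in>nb E W v. g w v) - (\<Sum>w\<in>nb E W v. g v w)"

lemma zed_fork:
  assumes "zed w" "v \<in> nb E W w" "\<not> leg v"
  shows "\<exists>a b. fork w v a b"
proof -
  have w: "w \<in> W" "w \<notin> Q" "deg w = 3" "card {a \<in> nb E W w. leg a} = 2" using assms(1) by (auto simp: zed_def)
  then obtain a b where ab: "{a \<in> nb E W w. leg a} = {a, b}" "a \<noteq> b" by (auto simp: card_2_iff)
  then have "a \<in> nb E W w" "b \<in> nb E W w" "leg a" "leg b" by blast+
  moreover have "v \<noteq> a" "v \<noteq> b" using assms(3) \<open>leg a\<close> \<open>leg b\<close> by auto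
  moreover have "{v, a, b} = nb E W w"
  proof (rule card_seteq)
    show "deg w \<le> card {v, a, b}" using w(3) \<open>v \<noteq> a\<close> \<open>v \<noteq> b\<close> ab(2) by simp
  qed (use calculation assms(2) finite_nb[OF fin] in auto)
  ultimately have "fork w v a b" using w ab(2) by (auto simp: fork_def)
  then show ?thesis by blast
qed

lemma ar_deg: "ar E W = (\<Sum>v\<in>W. deg v)"
  using ar_sum[OF fin] .

lemma sum_ch: "(\<Sum>v\<in>W. ch v) = - \<rho> W"
  unfolding ch_def rho_def using discharge[OF sym fin, of g] ar_deg
  by (simp add: sum.distrib sum_subtractf sum_distrib_left)

text \<open>The case of equality: some component is a cycle, where out-degree one suffices by
  \<open>good_cycle\<close>, and the rest is smaller.\<close>

lemma all_roots:
  assumes "W \<subseteq> Q" "W \<noteq> {}" "\<And>v. v \<in> W \<Longrightarrow> deg v = 2"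
  shows colorable
proof -
  obtain vs where vs: "distinct vs" "set vs \<subseteq> W" "3 \<le> length vs"
    and n: "\<And>i. i < length vs \<Longrightarrow> nb E W (vs ! i) = {vs ! cnext (length vs) i, vs ! cprev (length vs) i}"
    using two_regular_cycle[OF sym irr fin assms(2,3)] by blast
  have n': "nb E W (vs ! i) \<subseteq> set vs" if "i < length vs" for i
    using n[OF that] cnext_cprev[OF that vs(3)] by auto
  have "nb E (set vs) (vs ! i) = {vs ! cnext (length vs) i, vs ! cprev (length vs) i}" if "i < length vs" for i
    using n[OF that] n'[OF that] nb_sub[OF vs(2), of E "vs ! i"] by auto
  then have "\<exists>c A. col (set vs) c A" using vs(1,3) by (intro good_cycle) (auto simp: cap_def)
  then obtain c A where g1: "col (set vs) c A" by blast
  have "hd vs \<in> set vs" using vs(3) by (intro hd_in_set) auto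
  then have "W - set vs \<subset> W" using vs(2) by blast
  then obtain c' A' where g2: "col (W - set vs) c' A'" using col_ex by blast
  have "\<exists>c A. col (set vs \<union> (W - set vs)) c A"
  proof (rule good_Un[OF g1 g2 _ sym])
    fix x y assume xy: "x \<in> set vs" "y \<in> W - set vs"
    obtain i where "i < length vs" "x = vs ! i" using xy(1) by (auto simp: in_set_conv_nth)
    then show "(x, y) \<notin> E" using n'[of i] xy(2) by (auto simp: nb_def)
  qed auto
  moreover have "set vs \<union> (W - set vs) = W" using vs(2) by auto
  ultimately show ?thesis by simp
qed

text \<open>Without reducible configurations no final charge is negative, while their sum is minus
  the weight of \<open>W\<close>. So all charges vanish, which leaves legs, \<open>zed\<close>
  vertices, vertices with one leg and one \<open>zed\<close> neighbor, and restricted vertices of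
  degree two. The last have only restricted neighbors, by \<open>root_fork\<close> and
  \<open>root_path_fork\<close>; so the unrestricted vertices form a set of weight zero, against
  \<open>dense5\<close>, unless there are none.\<close>

lemma colorable: colorable
proof (rule ccontr)
  assume nc: "\<not> colorable"
  have d2: "2 \<le> deg v" if "v \<in> W" for v
  proof -
    have "\<not> deg v \<le> 1" using low_degree[OF that] nc by blast
    then show ?thesis by simp
  qed
  have d3: "3 \<le> deg b" if "leg a" "b \<in> nb E W a" for a b
    using thread[of a b] that nc d2[of b] nb_in[OF that(2)] unfolding leg_def by fastforce
  have leg2: "\<not> leg v" if "leg w" "v \<in> nb E W w" for v w using d3[OF that] by (auto simp: leg_def)
  have leg2': "\<not> leg w" if "leg v" "w \<in> nb E W v" for v w using d3[OF that] by (auto simp: leg_def)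
  have L: "(\<Sum>w\<in>nb E W v. g v w) = 2 * int (card {w \<in> nb E W v. leg w}) + int (card {w \<in> nb E W v. zed w})"
    if "\<not> leg v" for v
  proof -
    have "g v w = (if leg w then 2 else 0) + (if zed w then 1 else 0)" for w
      using that by (auto simp: g_def leg_def zed_def)
    then have "(\<Sum>w\<in>nb E W v. g v w) = (\<Sum>w\<in>nb E W v. if leg w then 2 else 0) + (\<Sum>w\<in>nb E W v. if zed w then 1 else 0)"
      by (simp add: sum.distrib)
    then show ?thesis using sum_cases[OF finite_nb[OF fin], of leg 2] sum_cases[OF finite_nb[OF fin], of zed 1] by simp
  qed
  have LZ: "card {w \<in> nb E W v. leg w} + card {w \<in> nb E W v. zed w} \<le> deg v" for v
  proof -
    have "card ({w \<in> nb E W v. leg w} \<union> {w \<in> nb E W v. zed w}) \<le> deg v"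
      by (intro card_mono finite_nb[OF fin]) auto
    moreover have "{w \<in> nb E W v. leg w} \<inter> {w \<in> nb E W v. zed w} = {}" by (auto simp: leg_def zed_def)
    ultimately show ?thesis using finite_nb[OF fin] by (simp add: card_Un_disjoint)
  qed
  have zf: "\<exists>a b. fork w v a b" if "v \<in> W" "w \<in> nb E W v" "zed w" "\<not> leg v" for v w
    using zed_fork[OF that(3) nb_sym[OF sym that(1,2)] that(4)] .
  \<comment> \<open>If all three neighbors were legs or \<open>zed\<close> vertices,
    \<open>three_branches\<close> would apply.\<close>
  have LZ3: "card {w \<in> nb E W v. leg w} + card {w \<in> nb E W v. zed w} \<le> 2" if v: "v \<in> W" "deg v = 3" for v
  proof (rule ccontr)
    assume n: "\<not> ?thesis"
    have nl: "\<not> leg v" using v by (simp add: leg_def)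
    have "card ({w \<in> nb E W v. leg w} \<union> {w \<in> nb E W v. zed w}) = card {w \<in> nb E W v. leg w} + card {w \<in> nb E W v. zed w}"
      using finite_nb[OF fin] by (intro card_Un_disjoint) (auto simp: leg_def zed_def)
    then have "deg v \<le> card {w \<in> nb E W v. leg w \<or> zed w}" using n v(2) by (simp add: Collect_disj_eq[symmetric] conj_disj_distribL)
    then have "{w \<in> nb E W v. leg w \<or> zed w} = nb E W v" using finite_nb[OF fin] by (intro card_seteq) auto
    then have "leg x \<or> (\<exists>a b. fork x v a b)" if "x \<in> nb E W v" for x using zf[OF v(1) that _ nl] that by blast
    then show False using three_branches[OF v] nc by blast
  qed
  have leg_ch: "ch v = 0" if v: "leg v" for v
  proof -
    have "g w v = 2" "g v w = 0" if "w \<in> nb E W v" for w using v leg2'[OF v that] by (auto simp: g_def)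
    then show ?thesis using v by (simp add: ch_def leg_def w5_def)
  qed
  have root2_nb: "\<not> leg w" "\<not> zed w" if t: "t \<in> W" "t \<in> Q" "deg t = 2" "w \<in> nb E W t" for t w
  proof -
    have tw: "t \<in> nb E W w" using nb_sym[OF sym t(1,4)] .
    show "\<not> leg w" using d3[of w t] tw t(3) by auto
    have nl: "\<not> leg t" using t(2) by (simp add: leg_def)
    show "\<not> zed w" using zf[OF t(1,4) _ nl] root_fork[OF t(1-3)] nc by blast
  qed
  have root2_ch: "ch t = 0" if t: "t \<in> W" "t \<in> Q" "deg t = 2" for t
  proof -
    have "g w t = 0" for w using t by (auto simp: g_def leg_def zed_def)
    moreover have "g t w = 0" if "w \<in> nb E W t" for w using root2_nb[OF t that] by (simp add: g_def)
    ultimately show ?thesis using t by (simp add: ch_def w5_def)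
  qed
  have in0: "0 \<le> (\<Sum>w\<in>nb E W v. g w v)" for v by (intro sum_nonneg) (simp add: g_def)
  \<comment> \<open>Degree at least four leaves at least 5 deg - 18; a restricted vertex of degree
    three starts with 7 and pays at most 4.\<close>
  have big_ch: "0 < ch v" if v: "v \<in> W" "3 \<le> deg v" "v \<in> Q \<or> deg v \<noteq> 3" for v
  proof -
    have nl: "\<not> leg v" using v by (auto simp: leg_def)
    show ?thesis using v(2,3) L[OF nl] LZ[of v] LZ3[OF v(1)] in0[of v] unfolding ch_def w5_def by (cases "deg v = 3") auto
  qed
  have three_ch: "0 \<le> ch v \<and> (ch v = 0 \<longrightarrow> zed v \<or> (card {w \<in> nb E W v. leg w} = 1 \<and> card {w \<in> nb E W v. zed w} = 1))"
    if v: "v \<in> W" "deg v = 3" "v \<notin> Q" for v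
  proof -
    have nl: "\<not> leg v" using v by (simp add: leg_def)
    let ?l = "card {w \<in> nb E W v. leg w}" and ?z = "card {w \<in> nb E W v. zed w}"
    have ch: "ch v = 3 + (\<Sum>w\<in>nb E W v. g w v) - 2 * int ?l - int ?z" using L[OF nl] v by (simp add: ch_def w5_def)
    show ?thesis
    proof (cases "?l = 2")
      case True
      then have z: "zed v" using v by (simp add: zed_def)
      have "{w \<in> nb E W v. leg w} \<noteq> nb E W v" using True v(2) by auto
      then obtain w where w: "w \<in> nb E W v" "\<not> leg w" by blast
      have "g w v = 1" using w z nl by (simp add: g_def)
      moreover have "0 \<le> g u v" for u by (simp add: g_def)
      ultimately have "1 \<le> (\<Sum>w\<in>nb E W v. g w v)" using member_le_sum[OF w(1), of "\<lambda>w. g w v"] finite_nb[OF fin] by simp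
      then show ?thesis using ch LZ3[OF v(1,2)] True z by simp
    next
      case False
      then show ?thesis using ch LZ3[OF v(1,2)] in0[of v] by auto
    qed
  qed
  have nonneg: "0 \<le> ch v" if v: "v \<in> W" for v
  proof -
    consider "leg v" | "v \<in> Q" "deg v = 2" | "3 \<le> deg v" "v \<in> Q \<or> deg v \<noteq> 3" | "deg v = 3" "v \<notin> Q"
      using d2[OF v] v unfolding leg_def by linarith
    then show ?thesis using leg_ch root2_ch[OF v] big_ch[OF v] three_ch[OF v] by cases auto
  qed
  have "(\<Sum>v\<in>W. ch v) \<le> 0" using sum_ch rho_nonneg[of W] by simp
  then have s0: "(\<Sum>v\<in>W. ch v) = 0" using sum_nonneg[of W ch] nonneg by fastforce
  then have zero: "ch v = 0" if "v \<in> W" for v using sum_nonneg_eq_0_iff[OF fin, of ch] nonneg that by blast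
  have kinds: "leg v \<or> zed v \<or> (v \<notin> Q \<and> deg v = 3 \<and> card {w \<in> nb E W v. leg w} = 1 \<and> card {w \<in> nb E W v. zed w} = 1)
     \<or> (v \<in> Q \<and> deg v = 2)" if v: "v \<in> W" for v
    using big_ch[OF v] three_ch[OF v] zero[OF v] d2[OF v] v unfolding leg_def by (cases "deg v = 2"; cases "v \<in> Q"; cases "deg v = 3") auto
  have Qnb: "w \<in> Q" if t: "t \<in> W" "t \<in> Q" "w \<in> nb E W t" for t w
  proof (rule ccontr)
    assume wQ: "w \<notin> Q"
    have wW: "w \<in> W" using nb_in[OF t(3)] .
    have dt: "deg t = 2" using kinds[OF t(1)] t(2) by (auto simp: leg_def zed_def)
    have tw: "t \<in> nb E W w" using nb_sym[OF sym t(1,3)] .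
    have "\<not> leg w" "\<not> zed w" using root2_nb[OF t(1,2) dt t(3)] .
    then have w3: "deg w = 3" "card {x \<in> nb E W w. leg x} = 1" "card {x \<in> nb E W w. zed x} = 1" using kinds[OF wW] wQ by auto
    obtain a where "{x \<in> nb E W w. leg x} = {a}" using w3(2) by (auto simp: card_1_singleton_iff)
    then have a: "a \<in> nb E W w" "leg a" by blast+
    obtain v where "{x \<in> nb E W w. zed x} = {v}" using w3(3) by (auto simp: card_1_singleton_iff)
    then have v: "v \<in> nb E W w" "zed v" by blast+
    have d: "distinct [t, a, v]" using t(2) a v by (auto simp: leg_def zed_def)
    have "{t, a, v} = nb E W w"
    proof (rule card_seteq)
      show "deg w \<le> card {t, a, v}" using w3(1) d by simp
    qed (use a v tw finite_nb[OF fin] in auto)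
    moreover obtain x y where "fork v w x y" using zf[OF wW v] \<open>\<not> leg w\<close> by blast
    ultimately show False using root_path_fork[OF t(1,2) dt wW wQ _ d a(2), of x y] nc by blast
  qed
  show False
  proof (cases "W \<subseteq> Q")
    case True
    have "W \<noteq> {}" using nc good_empty by blast
    moreover have "deg v = 2" if "v \<in> W" for v using kinds[OF that] True that by (auto simp: leg_def zed_def)
    ultimately show False using all_roots[OF True] nc by blast
  next
    case False
    let ?H = "W - Q"
    \<comment> \<open>No edge leaves \<open>?H\<close>, so the weight of \<open>W\<close> splits
      over \<open>?H\<close> and the restricted vertices, and the latter contribute zero.\<close>
    have "nb E ?H v = nb E W v" if "v \<in> ?H" for v
    proof -
      have "w \<notin> Q" if "w \<in> nb E W v" for w
        using Qnb[of w v] nb_sym[OF sym _ that] nb_in[OF that] \<open>v \<in> ?H\<close> by blast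
      then show ?thesis using nb_sub[of ?H W E v] nb_in[of _ E W v] by auto
    qed
    then have aH: "ar E ?H = (\<Sum>v\<in>?H. deg v)" using ar_sum[of ?H E] fin by simp
    have "\<rho> W = (\<Sum>v\<in>W. w5 Q v - 7 * int (deg v))"
      unfolding rho_def ar_deg by (simp add: sum_subtractf sum_distrib_left)
    also have "\<dots> = (\<Sum>v\<in>?H. w5 Q v - 7 * int (deg v)) + (\<Sum>v\<in>W \<inter> Q. w5 Q v - 7 * int (deg v))"
      using sum.Int_Diff[OF fin, of _ Q] by (simp add: add.commute)
    also have "(\<Sum>v\<in>W \<inter> Q. w5 Q v - 7 * int (deg v)) = 0"
    proof (rule sum.neutral, rule ballI)
      fix v assume "v \<in> W \<inter> Q"
      then show "w5 Q v - 7 * int (deg v) = 0" using kinds[of v] by (auto simp: leg_def zed_def w5_def)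
    qed
    also have "(\<Sum>v\<in>?H. w5 Q v - 7 * int (deg v)) = \<rho> ?H"
      unfolding rho_def aH by (simp add: sum_subtractf sum_distrib_left)
    finally have "\<rho> ?H = 0" using sum_ch s0 by simp
    moreover have "0 < \<rho> ?H" using dense False unfolding dense5_def by blast
    ultimately show False by simp
  qed
qed

end

lemma five_colors:
  assumes sym: "sym E" and irr: "irrefl E" and girth: "girth_ge E 9" and "finite W" "dense5 E Q W"
  shows "\<exists>c A. good 5 E (cap Q) W c A"
  using assms(4,5)
proof (induction "card W" arbitrary: W Q rule: less_induct)
  case (less W Q)
  interpret sparse5 E Q W
  proof
    fix R Q' assume R: "R \<subset> W" "dense5 E Q' R"
    show "\<exists>c A. good 5 E (cap Q') R c A"
    proof (rule less(1)[OF _ _ R(2)])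
      show "card R < card W" using R(1) less(2) by (rule psubset_card_mono[rotated])
      show "finite R" using R(1) less(2) finite_subset by blast
    qed
  qed (use sym irr girth less in auto)
  show ?case by (rule colorable)
qed

section \<open>Four colors: extending along trees\<close>

locale sparse4 =
  fixes E :: "('a \<times> 'a) set" and W :: "'a set"
  assumes sym: "sym E" and irr: "irrefl E" and fin: "finite W" and girth: "girth_ge E 13"
    and IH: "\<And>R. R \<subset> W \<Longrightarrow> \<exists>c A. good 4 E (\<lambda>_. 2) R c A"
begin

abbreviation "deg v \<equiv> card (nb E W v)"
abbreviation "col \<equiv> good 4 E (\<lambda>_. 2)"
abbreviation "colorable \<equiv> \<exists>c A. col W c A"

text \<open>Available colors are preserved along with the colors, because the relations of a branch
  are established for the coloring outside and used after other branches have been added.\<close>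

definition ext :: "'a set \<Rightarrow> ('a \<Rightarrow> nat) \<Rightarrow> ('a \<Rightarrow> nat set) \<Rightarrow> 'a set \<Rightarrow> ('a \<Rightarrow> nat) \<Rightarrow> ('a \<Rightarrow> nat set) \<Rightarrow> bool" where
  "ext R c A R' c' A' \<longleftrightarrow> col R' c' A' \<and> R \<subseteq> R' \<and> R' \<subseteq> W \<and> (\<forall>n\<in>R. c' n = c n \<and> A' n = A n)"

text \<open>
  \<open>B\<close> is the vertex set of a branch at \<open>v\<close>, entered through the neighbor \<open>x\<close> of \<open>v\<close>. It may be colored after
  \<open>v\<close>, which has color \<open>e\<close>, with the edge oriented towards \<open>v\<close> and color \<open>y\<close> on \<open>x\<close>; or before \<open>v\<close>,
  so that \<open>v\<close> can receive color \<open>e\<close> by an edge oriented towards \<open>x\<close>.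
\<close>

definition inn :: "'a set \<Rightarrow> ('a \<Rightarrow> nat) \<Rightarrow> ('a \<Rightarrow> nat set) \<Rightarrow> 'a \<Rightarrow> 'a \<Rightarrow> 'a set \<Rightarrow> nat \<Rightarrow> nat \<Rightarrow> bool" where
  "inn R0 c0 A0 v x B e y \<longleftrightarrow> x \<in> B \<and> (\<forall>R c A. ext R0 c0 A0 R c A \<and> v \<in> R \<and> R \<inter> B = {} \<and> c v = e \<and> y \<in> A v
     \<longrightarrow> (\<exists>c' A'. ext R c A (R \<union> B) c' A'))"

definition out :: "'a set \<Rightarrow> ('a \<Rightarrow> nat) \<Rightarrow> ('a \<Rightarrow> nat set) \<Rightarrow> 'a \<Rightarrow> 'a \<Rightarrow> 'a set \<Rightarrow> nat \<Rightarrow> nat \<Rightarrow> bool" where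
  "out R0 c0 A0 v x B y e \<longleftrightarrow> x \<in> R0 \<union> B \<and> (\<forall>R c A. ext R0 c0 A0 R c A \<and> v \<notin> R \<and> R \<inter> B = {}
     \<longrightarrow> (\<exists>c' A'. ext R c A (R \<union> B) c' A' \<and> c' x = y \<and> e \<in> A' x))"

lemma innD: "inn R0 c0 A0 v x B e y \<Longrightarrow> ext R0 c0 A0 R c A \<Longrightarrow> v \<in> R \<Longrightarrow> R \<inter> B = {} \<Longrightarrow> c v = e \<Longrightarrow> y \<in> A v
  \<Longrightarrow> \<exists>c' A'. ext R c A (R \<union> B) c' A'"
  unfolding inn_def by blast

lemma outD: "out R0 c0 A0 v x B y e \<Longrightarrow> ext R0 c0 A0 R c A \<Longrightarrow> v \<notin> R \<Longrightarrow> R \<inter> B = {}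
  \<Longrightarrow> \<exists>c' A'. ext R c A (R \<union> B) c' A' \<and> c' x = y \<and> e \<in> A' x"
  unfolding out_def by blast

lemma ext_eq: "ext R c A R' c' A' \<Longrightarrow> n \<in> R \<Longrightarrow> c' n = c n \<and> A' n = A n"
  unfolding ext_def by blast

lemma ext_trans:
  assumes "ext R c A R' c' A'" "ext R' c' A' R'' c'' A''"
  shows "ext R c A R'' c'' A''"
proof -
  have "R \<subseteq> R'" "R' \<subseteq> R''" using assms by (simp_all add: ext_def)
  moreover have "c'' n = c n \<and> A'' n = A n" if "n \<in> R" for n
    using ext_eq[OF assms(1) that] ext_eq[OF assms(2), of n] that \<open>R \<subseteq> R'\<close> by auto
  ultimately show ?thesis using assms(2) unfolding ext_def by auto
qed

lemma ext_refl: "col R c A \<Longrightarrow> R \<subseteq> W \<Longrightarrow> ext R c A R c A"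
  unfolding ext_def by blast

lemma avail:
  assumes "col R c A" "R \<subseteq> W" "u \<in> R"
  shows "A u \<subseteq> {..<4}" "c u \<notin> A u" "c u < 4" "A u \<noteq> {}"
  using good_avail[OF assms(1) finite_subset[OF assms(2) fin] assms(3)] by auto

lemma add_vertex:
  assumes e: "ext R0 c0 A0 R c A" and x: "x \<in> W - R" "nb E W x \<inter> R = N" "card N \<le> 2" "inj_on c N"
    and y: "y < 4" "\<And>n. n \<in> N \<Longrightarrow> y \<in> A n"
  shows "\<exists>c' A'. ext R c A (insert x R) c' A' \<and> c' x = y \<and> A' x = {z. z < 4 \<and> z \<noteq> y \<and> z \<notin> c ` N}"
proof -
  have R: "col R c A" "R \<subseteq> W" using e by (auto simp: ext_def)
  have "nb E R x = N" using nb_sub[OF R(2)] x(2) by simp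
  then obtain c' A' where "good 4 E (\<lambda>_. 2) (insert x R) c' A'" "\<forall>n\<in>R. c' n = c n \<and> A' n = A n" "c' x = y"
    "A' x = {z. z < 4 \<and> z \<noteq> y \<and> z \<notin> c ` N}"
    using good_step[OF R(1) sym irr _ _ y x(3,4)] x(1) by blast
  then show ?thesis using R(2) x(1) unfolding ext_def by blast
qed

lemma attach_ins:
  assumes "finite I" and e: "ext R0 c0 A0 R c A" "x \<in> R" "c x = y"
    and b: "\<And>w. w \<in> I \<Longrightarrow> inn R0 c0 A0 x w (B w) y (f w) \<and> f w \<in> A x \<and> R \<inter> B w = {}"
    and d: "\<And>w w'. w \<in> I \<Longrightarrow> w' \<in> I \<Longrightarrow> w \<noteq> w' \<Longrightarrow> B w \<inter> B w' = {}"
  shows "\<exists>c' A'. ext R c A (R \<union> \<Union> (B ` I)) c' A'"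
  using assms(1) b d
proof (induction I)
  case empty
  then show ?case using e ext_refl[of R c A] by (auto simp: ext_def)
next
  case (insert w I)
  have "\<exists>c' A'. ext R c A (R \<union> \<Union> (B ` I)) c' A'" using insert by simp
  then obtain c' A' where e': "ext R c A (R \<union> \<Union> (B ` I)) c' A'" by blast
  have w: "inn R0 c0 A0 x w (B w) y (f w)" "f w \<in> A x" "R \<inter> B w = {}" using insert(4)[of w] by auto
  have "B w' \<inter> B w = {}" if "w' \<in> I" for w' using insert(5)[of w' w] insert(2) that by auto
  then have "(R \<union> \<Union> (B ` I)) \<inter> B w = {}" using w(3) by blast
  then have "\<exists>c'' A''. ext (R \<union> \<Union> (B ` I)) c' A' (R \<union> \<Union> (B ` I) \<union> B w) c'' A''"
    using innD[OF w(1) ext_trans[OF e(1) e']] e(2,3) w(2) ext_eq[OF e' e(2)] by simp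
  then obtain c'' A'' where "ext (R \<union> \<Union> (B ` I)) c' A' (R \<union> \<Union> (B ` I) \<union> B w) c'' A''" by blast
  then have "ext R c A (R \<union> \<Union> (B ` I) \<union> B w) c'' A''" by (rule ext_trans[OF e'])
  moreover have "R \<union> \<Union> (B ` I) \<union> B w = R \<union> \<Union> (B ` insert w I)" by auto
  ultimately show ?case by auto
qed

lemma attach_outs:
  assumes "finite I" and e: "ext R0 c0 A0 R c A" "x \<notin> R"
    and b: "\<And>w. w \<in> I \<Longrightarrow> out R0 c0 A0 x w (B w) (f w) y \<and> x \<notin> B w \<and> R \<inter> B w = {}"
    and d: "\<And>w w'. w \<in> I \<Longrightarrow> w' \<in> I \<Longrightarrow> w \<noteq> w' \<Longrightarrow> B w \<inter> B w' = {}"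
  shows "\<exists>c' A'. ext R c A (R \<union> \<Union> (B ` I)) c' A' \<and> (\<forall>w\<in>I. c' w = f w \<and> y \<in> A' w)"
  using assms(1) b d
proof (induction I)
  case empty
  then show ?case using e ext_refl[of R c A] by (auto simp: ext_def)
next
  case (insert w I)
  have "\<exists>c' A'. ext R c A (R \<union> \<Union> (B ` I)) c' A' \<and> (\<forall>w\<in>I. c' w = f w \<and> y \<in> A' w)" using insert by simp
  then obtain c' A' where e': "ext R c A (R \<union> \<Union> (B ` I)) c' A'" "\<forall>w\<in>I. c' w = f w \<and> y \<in> A' w" by blast
  have w: "out R0 c0 A0 x w (B w) (f w) y" "x \<notin> B w" "R \<inter> B w = {}" using insert(4)[of w] by auto
  have xI: "x \<notin> B w'" if "w' \<in> I" for w' using insert(4)[of w'] that by auto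
  have "B w' \<inter> B w = {}" if "w' \<in> I" for w' using insert(5)[of w' w] insert(2) that by auto
  then have "(R \<union> \<Union> (B ` I)) \<inter> B w = {}" using w(3) by blast
  moreover have "x \<notin> R \<union> \<Union> (B ` I)" using e(2) xI by blast
  ultimately have "\<exists>c'' A''. ext (R \<union> \<Union> (B ` I)) c' A' (R \<union> \<Union> (B ` I) \<union> B w) c'' A'' \<and> c'' w = f w \<and> y \<in> A'' w"
    using outD[OF w(1) ext_trans[OF e(1) e'(1)]] by simp
  then obtain c'' A'' where e'': "ext (R \<union> \<Union> (B ` I)) c' A' (R \<union> \<Union> (B ` I) \<union> B w) c'' A''" "c'' w = f w" "y \<in> A'' w" by blast
  have "c'' w' = f w' \<and> y \<in> A'' w'" if "w' \<in> I" for w'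
  proof -
    have "w' \<in> R0 \<union> B w'" using insert(4)[of w'] that unfolding out_def by blast
    moreover have "R0 \<subseteq> R" using e(1) by (simp add: ext_def)
    ultimately have "w' \<in> R \<union> \<Union> (B ` I)" using that by blast
    then show ?thesis using ext_eq[OF e''(1)] e'(2) that by simp
  qed
  moreover have "ext R c A (R \<union> \<Union> (B ` I) \<union> B w) c'' A''" using e''(1) by (rule ext_trans[OF e'(1)])
  moreover have "R \<union> \<Union> (B ` I) \<union> B w = R \<union> \<Union> (B ` insert w I)" by auto
  ultimately show ?case using e''(2,3) by auto
qed

text \<open>
  Coloring a vertex \<open>x\<close> and the branches at it: first the branches in \<open>P\<close>, then \<open>x\<close>, with edges oriented
  towards \<open>P\<close> and the already colored neighbors \<open>V\<close>, then the branches in \<open>I\<close>.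
\<close>

lemma color_vertex:
  assumes e: "ext R0 c0 A0 R c A" "x \<in> W - R" "y < 4"
    and n: "nb E W x = V \<union> P \<union> I \<union> X" "V \<subseteq> R" "X \<inter> R = {}" "P \<inter> I = {}" "X \<inter> \<Union> (B ` (P \<union> I)) = {}"
    and V: "\<And>v. v \<in> V \<Longrightarrow> y \<in> A v" and N: "card (V \<union> P) \<le> 2" "inj_on g (V \<union> P)" "\<And>v. v \<in> V \<Longrightarrow> g v = c v"
    and P: "\<And>w. w \<in> P \<Longrightarrow> out R0 c0 A0 x w (B w) (g w) y"
    and I: "\<And>w. w \<in> I \<Longrightarrow> inn R0 c0 A0 x w (B w) y (f w) \<and> f w < 4 \<and> f w \<noteq> y \<and> f w \<notin> g ` (V \<union> P)"
    and B: "\<And>w. w \<in> P \<union> I \<Longrightarrow> x \<notin> B w \<and> R \<inter> B w = {} \<and> w \<notin> V"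
    and d: "\<And>w w'. w \<in> P \<union> I \<Longrightarrow> w' \<in> P \<union> I \<Longrightarrow> w \<noteq> w' \<Longrightarrow> B w \<inter> B w' = {}"
  shows "\<exists>c' A'. ext R c A (R \<union> insert x (\<Union> (B ` (P \<union> I)))) c' A' \<and> c' x = y \<and> A' x = {z. z < 4 \<and> z \<noteq> y \<and> z \<notin> g ` (V \<union> P)}"
proof -
  have fN: "finite (nb E W x)" using fin by simp
  have f: "finite P" "finite I" using fN unfolding n(1) by auto
  have R0: "R0 \<subseteq> R" using e(1) by (simp add: ext_def)
  have "\<exists>c1 A1. ext R c A (R \<union> \<Union> (B ` P)) c1 A1 \<and> (\<forall>w\<in>P. c1 w = g w \<and> y \<in> A1 w)"
    by (rule attach_outs[OF f(1) e(1)]) (use e(2) P B d in auto)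
  then obtain c1 A1 where e1: "ext R c A (R \<union> \<Union> (B ` P)) c1 A1" and P1: "\<And>w. w \<in> P \<Longrightarrow> c1 w = g w \<and> y \<in> A1 w" by blast
  let ?R = "R \<union> \<Union> (B ` P)"
  have V1: "c1 v = g v \<and> A1 v = A v" if "v \<in> V" for v using ext_eq[OF e1] that n(2) N(3) by auto
  have PR: "P \<subseteq> ?R"
  proof
    fix w assume w: "w \<in> P"
    then have "w \<in> R0 \<union> B w" using P unfolding out_def by blast
    then show "w \<in> ?R" using R0 w by blast
  qed
  have IB: "w \<in> B w" if "w \<in> I" for w using I[OF that] unfolding inn_def by blast
  have IR: "I \<inter> ?R = {}"
  proof (rule ccontr)
    assume "I \<inter> ?R \<noteq> {}"
    then obtain w where w: "w \<in> I" "w \<in> ?R" by blast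
    have "w \<notin> R" using B[of w] IB[OF w(1)] w(1) by blast
    then obtain w' where "w' \<in> P" "w \<in> B w'" using w(2) by blast
    then show False using d[of w w'] IB[OF w(1)] w(1) n(4) by blast
  qed
  have XR: "X \<inter> ?R = {}" using n(3,5) by blast
  have nbR: "nb E W x \<inter> ?R = V \<union> P" using n(1,2) PR IR XR by blast
  have xR: "x \<in> W - ?R" using e(2) B by blast
  have cg: "c1 n = g n" if "n \<in> V \<union> P" for n using that P1 V1 by auto
  have inj: "inj_on c1 (V \<union> P)" using N(2) inj_on_cong[of "V \<union> P" c1 g] cg by simp
  have y1: "\<And>n. n \<in> V \<union> P \<Longrightarrow> y \<in> A1 n" using V V1 P1 by auto
  obtain c2 A2 where e2: "ext ?R c1 A1 (insert x ?R) c2 A2" and 2: "c2 x = y" "A2 x = {z. z < 4 \<and> z \<noteq> y \<and> z \<notin> c1 ` (V \<union> P)}"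
    using add_vertex[OF ext_trans[OF e(1) e1] xR nbR N(1) inj e(3) y1] by blast
  have img: "c1 ` (V \<union> P) = g ` (V \<union> P)" using cg by (rule image_cong[OF refl])
  have e12: "ext R c A (insert x ?R) c2 A2" using e1 e2 by (rule ext_trans)
  have BI: "insert x ?R \<inter> B w = {}" if "w \<in> I" for w
  proof -
    have "B w' \<inter> B w = {}" if w': "w' \<in> P" for w' using d[of w' w] w' \<open>w \<in> I\<close> n(4) by auto
    moreover have "x \<notin> B w" "R \<inter> B w = {}" using B[of w] \<open>w \<in> I\<close> by auto
    ultimately show ?thesis by auto
  qed
  have I2: "inn R0 c0 A0 x w (B w) y (f w) \<and> f w \<in> A2 x \<and> insert x ?R \<inter> B w = {}" if "w \<in> I" for w
    using I[OF that] BI[OF that] unfolding 2(2) img by simp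
  have "\<exists>c3 A3. ext (insert x ?R) c2 A2 (insert x ?R \<union> \<Union> (B ` I)) c3 A3"
    by (rule attach_ins[where f = f and x = x, OF f(2) ext_trans[OF e(1) e12] _ 2(1) I2 d]) auto
  then obtain c3 A3 where e3: "ext (insert x ?R) c2 A2 (insert x ?R \<union> \<Union> (B ` I)) c3 A3" by blast
  have "ext R c A (insert x ?R \<union> \<Union> (B ` I)) c3 A3" using e12 e3 by (rule ext_trans)
  moreover have "insert x ?R \<union> \<Union> (B ` I) = R \<union> insert x (\<Union> (B ` (P \<union> I)))" by auto
  moreover have "c3 x = y" "A3 x = {z. z < 4 \<and> z \<noteq> y \<and> z \<notin> g ` (V \<union> P)}" using ext_eq[OF e3, of x] 2 img by auto
  ultimately show ?thesis by auto
qed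

end

section \<open>Disjointness and growth of branches\<close>

context sparse4
begin

text \<open>With \<open>x\<close> and its two neighbors the joined walk has at most 13 vertices, the
  longest that girth 13 keeps simple by \<open>nbw_distinct\<close>.\<close>

lemma walks_apart:
  assumes "nbw E (x # w # p)" "nbw E (x # w' # p')" "w \<noteq> w'" "length p + length p' \<le> 10"
  shows "last (w # p) \<noteq> last (w' # p')"
proof -
  have "nbw E (rev (w # p) @ x # w' # p')" using nbw_rev_append[OF sym assms(1,2)] assms(3) by simp
  then have "distinct (rev (w # p) @ x # w' # p')" by (rule nbw_distinct[OF girth irr]) (use assms(4) in simp)
  then show ?thesis using last_in_set[of "w # p"] last_in_set[of "w' # p'"] by auto
qed

text \<open>\<open>F\<close> are the ends of the branch with vertex set \<open>B\<close> of depth \<open>i\<close>.\<close>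

definition br :: "'a \<Rightarrow> 'a \<Rightarrow> nat \<Rightarrow> 'a set \<Rightarrow> 'a set \<Rightarrow> bool" where
  "br x w i B F \<longleftrightarrow> w \<in> nb E W x \<and> B \<inter> F = {} \<and> x \<notin> B \<union> F \<and> B \<union> F \<subseteq> W
     \<and> (\<forall>u\<in>B. \<exists>p. nbw E (x # w # p) \<and> last (w # p) = u \<and> length p < i)
     \<and> (\<forall>u\<in>F. \<exists>p. nbw E (x # w # p) \<and> last (w # p) = u \<and> length p \<le> i)"

text \<open>Inner vertices are strictly nearer than the depth, so depths summing to 11 keep two
  walks within the bound 10 as soon as one of them leads to an inner vertex. Ends of different
  branches may coincide.\<close>

lemma br_apart:
  assumes b: "br x w i B F" "br x w' i' B' F'" "w \<noteq> w'" "i + i' \<le> 11"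
  shows "B \<inter> B' = {}" "B \<inter> F' = {}" "F \<inter> B' = {}"
proof -
  have B: "\<exists>p. nbw E (x # w # p) \<and> last (w # p) = u \<and> length p < i" if "u \<in> B" for u using b(1) that unfolding br_def by blast
  have F: "\<exists>p. nbw E (x # w # p) \<and> last (w # p) = u \<and> length p \<le> i" if "u \<in> F" for u using b(1) that unfolding br_def by blast
  have B': "\<exists>p. nbw E (x # w' # p) \<and> last (w' # p) = u \<and> length p < i'" if "u \<in> B'" for u using b(2) that unfolding br_def by blast
  have F': "\<exists>p. nbw E (x # w' # p) \<and> last (w' # p) = u \<and> length p \<le> i'" if "u \<in> F'" for u using b(2) that unfolding br_def by blast
  have no: False if "nbw E (x # w # p)" "last (w # p) = u" "nbw E (x # w' # p')" "last (w' # p') = u" "length p + length p' \<le> 10" for p p' u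
    using walks_apart[OF that(1,3) b(3) that(5)] that(2,4) by simp
  show "B \<inter> B' = {}"
  proof (rule ccontr)
    assume "B \<inter> B' \<noteq> {}"
    then obtain u where u: "u \<in> B" "u \<in> B'" by blast
    obtain p where "nbw E (x # w # p)" "last (w # p) = u" "length p < i" using B[OF u(1)] by blast
    moreover obtain p' where "nbw E (x # w' # p')" "last (w' # p') = u" "length p' < i'" using B'[OF u(2)] by blast
    ultimately show False using no[of p u p'] b(4) by simp
  qed
  show "B \<inter> F' = {}"
  proof (rule ccontr)
    assume "B \<inter> F' \<noteq> {}"
    then obtain u where u: "u \<in> B" "u \<in> F'" by blast
    obtain p where "nbw E (x # w # p)" "last (w # p) = u" "length p < i" using B[OF u(1)] by blast
    moreover obtain p' where "nbw E (x # w' # p')" "last (w' # p') = u" "length p' \<le> i'" using F'[OF u(2)] by blast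
    ultimately show False using no[of p u p'] b(4) by simp
  qed
  show "F \<inter> B' = {}"
  proof (rule ccontr)
    assume "F \<inter> B' \<noteq> {}"
    then obtain u where u: "u \<in> F" "u \<in> B'" by blast
    obtain p where "nbw E (x # w # p)" "last (w # p) = u" "length p \<le> i" using F[OF u(1)] by blast
    moreover obtain p' where "nbw E (x # w' # p')" "last (w' # p') = u" "length p' < i'" using B'[OF u(2)] by blast
    ultimately show False using no[of p u p'] b(4) by simp
  qed
qed

lemma nb_E: "v \<in> nb E W a \<Longrightarrow> (a, v) \<in> E \<and> (v, a) \<in> E \<and> v \<in> W \<and> v \<noteq> a"
  using symD[OF sym] nb_memD[OF irr, of v W a] by (auto simp: nb_def)

lemma br_end:
  assumes "z \<in> nb E W x"
  shows "br x z 0 {} {z}"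
proof -
  have "nbw E [x, z]" "z \<in> W" "z \<noteq> x" using nb_E[OF assms] by auto
  then show ?thesis using assms unfolding br_def by (auto intro!: exI[of _ "[]"])
qed

lemma br_grow:
  assumes x: "x \<in> nb E W v" "v \<in> W" and i: "i \<le> 10"
    and b: "\<And>w. w \<in> nb E W x - {v} \<Longrightarrow> br x w (k w) (B w) (F w) \<and> k w \<le> i"
    and s: "\<And>w w'. w \<in> nb E W x - {v} \<Longrightarrow> w' \<in> nb E W x - {v} \<Longrightarrow> w \<noteq> w' \<Longrightarrow> k w + k w' \<le> 11"
  shows "br v x (Suc i) (insert x (\<Union> (B ` (nb E W x - {v})))) (\<Union> (F ` (nb E W x - {v})))"
    "v \<notin> B w \<union> F w \<or> w \<notin> nb E W x - {v}"
proof -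
  have vx: "(v, x) \<in> E" "x \<in> W" "x \<noteq> v" using nb_E[OF x(1)] by auto
  have vn: "v \<in> nb E W x" using nb_sym[OF sym x(2,1)] .
  let ?C = "nb E W x - {v}"
  have bw: "u \<in> W \<and> (\<exists>p. nbw E (v # x # w # p) \<and> last (w # p) = u \<and> length p < i)" if wu: "w \<in> ?C" "u \<in> B w" for w u
  proof -
    obtain p where p: "nbw E (x # w # p)" "last (w # p) = u" "length p < k w" using b[OF wu(1)] wu(2) unfolding br_def by blast
    have "nbw E (v # x # w # p)" using p(1) vx(1) wu(1) by auto
    moreover have "u \<in> W" using b[OF wu(1)] wu(2) unfolding br_def by blast
    moreover have "length p < i" using p(3) b[OF wu(1)] by auto
    ultimately show ?thesis using p(2) by blast
  qed
  have fw: "u \<in> W \<and> (\<exists>p. nbw E (v # x # w # p) \<and> last (w # p) = u \<and> length p \<le> i)" if wu: "w \<in> ?C" "u \<in> F w" for w u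
  proof -
    obtain p where p: "nbw E (x # w # p)" "last (w # p) = u" "length p \<le> k w" using b[OF wu(1)] wu(2) unfolding br_def by blast
    have "nbw E (v # x # w # p)" using p(1) vx(1) wu(1) by auto
    moreover have "u \<in> W" using b[OF wu(1)] wu(2) unfolding br_def by blast
    moreover have "length p \<le> i" using p(3) b[OF wu(1)] by auto
    ultimately show ?thesis using p(2) by blast
  qed
  \<comment> \<open>With \<open>v\<close>, \<open>x\<close> and \<open>w\<close> the walk has at
    most 13 vertices, which is where the bound on \<open>i\<close> comes from.\<close>
  have nv: "u \<noteq> v" if "nbw E (v # x # w # p)" "last (w # p) = u" "length p \<le> i" for u w p
  proof -
    have "distinct (v # x # w # p)" by (rule nbw_distinct[OF girth irr that(1)]) (use that(3) i in simp)
    then show ?thesis using that(2) last_in_set[of "w # p"] by auto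
  qed
  have v: "v \<notin> B w \<union> F w" if w: "w \<in> ?C" for w
  proof
    assume "v \<in> B w \<union> F w"
    then obtain p where "nbw E (v # x # w # p)" "last (w # p) = v" "length p \<le> i"
      using bw[OF w, of v] fw[OF w, of v] by (meson Un_iff less_imp_le)
    then show False using nv by blast
  qed
  then show "v \<notin> B w \<union> F w \<or> w \<notin> ?C" by blast
  have disj: "(insert x (\<Union> (B ` ?C))) \<inter> \<Union> (F ` ?C) = {}"
  proof (rule ccontr)
    assume "\<not> ?thesis"
    then obtain u w' where u: "w' \<in> ?C" "u \<in> F w'" "u = x \<or> (\<exists>w\<in>?C. u \<in> B w)" by blast
    have "x \<notin> F w'" using b[OF u(1)] unfolding br_def by blast
    then obtain w where w: "w \<in> ?C" "u \<in> B w" using u by blast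
    show False
    proof (cases "w = w'")
      case True
      then show False using b[OF u(1)] u(2) w(2) unfolding br_def by blast
    next
      case False
      then have "B w \<inter> F w' = {}" using br_apart(2)[of x w "k w" "B w" "F w" w' "k w'" "B w'" "F w'"] b[OF u(1)] b[OF w(1)] s[OF w(1) u(1)] by blast
      then show False using u(2) w(2) by blast
    qed
  qed
  have vB: "v \<notin> insert x (\<Union> (B ` ?C)) \<union> \<Union> (F ` ?C)" using v vx(3) by blast
  have sub: "insert x (\<Union> (B ` ?C)) \<union> \<Union> (F ` ?C) \<subseteq> W" using bw fw vx(2) by blast
  have wB: "\<exists>p. nbw E (v # x # p) \<and> last (x # p) = u \<and> length p < Suc i" if u: "u \<in> insert x (\<Union> (B ` ?C))" for u
  proof (cases "u = x")
    case True
    have "nbw E (v # x # [])" using vx by simp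
    then show ?thesis using True by force
  next
    case False
    then obtain w where w: "w \<in> ?C" "u \<in> B w" using u by blast
    obtain p where "nbw E (v # x # w # p)" "last (w # p) = u" "length p < i" using bw[OF w] by blast
    then have "nbw E (v # x # (w # p))" "last (x # (w # p)) = u" "length (w # p) < Suc i" by simp_all
    then show ?thesis by blast
  qed
  have wF: "\<exists>p. nbw E (v # x # p) \<and> last (x # p) = u \<and> length p \<le> Suc i" if u: "u \<in> \<Union> (F ` ?C)" for u
  proof -
    obtain w where w: "w \<in> ?C" "u \<in> F w" using u by blast
    obtain p where "nbw E (v # x # w # p)" "last (w # p) = u" "length p \<le> i" using fw[OF w] by blast
    then have "nbw E (v # x # (w # p))" "last (x # (w # p)) = u" "length (w # p) \<le> Suc i" by simp_all
    then show ?thesis by blast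
  qed
  show "br v x (Suc i) (insert x (\<Union> (B ` ?C))) (\<Union> (F ` ?C))"
    unfolding br_def by (intro conjI ballI x(1) disj vB sub wB wF)
qed

text \<open>The coloring outside the branch comes from the induction hypothesis and cannot be
  influenced, so the property must hold for all of them. It then depends only on the shape of the
  branch and can be derived from the ends upwards.\<close>

definition has :: "'a \<Rightarrow> 'a \<Rightarrow> nat \<Rightarrow> ((nat \<Rightarrow> nat \<Rightarrow> bool) \<Rightarrow> (nat \<Rightarrow> nat \<Rightarrow> bool) \<Rightarrow> bool) \<Rightarrow> bool" where
  "has v x i P \<longleftrightarrow> (\<exists>B F. br v x i B F \<and> (\<forall>R c A. col R c A \<and> R \<subseteq> W \<and> F \<subseteq> R \<and> R \<inter> B = {} \<and> v \<notin> R
     \<longrightarrow> P (inn R c A v x B) (out R c A v x B)))"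

lemma has_mono: "has v x i P \<Longrightarrow> (\<And>I D. P I D \<Longrightarrow> Q I D) \<Longrightarrow> has v x i Q"
  unfolding has_def by blast

text \<open>\<open>x\<close> is colored after \<open>v\<close> with an out-edge to \<open>v\<close>,
  so at most one of its branches may be colored earlier and receive the second out-edge. The colors
  of the later branches must avoid \<open>e\<close> and the color of that one.\<close>

lemma grow_inn:
  assumes x: "x \<in> nb E W v" "v \<in> W" and C: "nb E W x - {v} = P \<union> I" "P \<inter> I = {}" "card P \<le> 1"
    and y: "y < 4" "y \<noteq> e"
    and P: "\<And>w. w \<in> P \<Longrightarrow> out R0 c0 A0 x w (B w) (g w) y \<and> g w \<noteq> e"
    and I: "\<And>w. w \<in> I \<Longrightarrow> inn R0 c0 A0 x w (B w) y (f w) \<and> f w < 4 \<and> f w \<noteq> y \<and> f w \<noteq> e \<and> f w \<notin> g ` P"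
    and B: "\<And>w. w \<in> P \<union> I \<Longrightarrow> x \<notin> B w \<and> v \<notin> B w"
    and d: "\<And>w w'. w \<in> P \<union> I \<Longrightarrow> w' \<in> P \<union> I \<Longrightarrow> w \<noteq> w' \<Longrightarrow> B w \<inter> B w' = {}"
  shows "inn R0 c0 A0 v x (insert x (\<Union> (B ` (nb E W x - {v})))) e y"
  unfolding inn_def
proof (intro conjI allI impI, simp, elim conjE)
  fix R c A assume e: "ext R0 c0 A0 R c A" "v \<in> R" "R \<inter> insert x (\<Union> (B ` (nb E W x - {v}))) = {}" "c v = e" "y \<in> A v"
  have vx: "v \<in> nb E W x" "x \<in> W" using nb_sym[OF sym x(2,1)] nb_E[OF x(1)] by auto
  have fP: "finite P" using C(1) finite_nb[OF fin, of E x] by (metis finite_Diff finite_Un)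
  have vP: "v \<notin> P" "v \<notin> I" using C(1) by blast+
  let ?g = "g(v := e)"
  have gP: "?g ` ({v} \<union> P) = insert e (g ` P)" using vP by auto
  have inj: "inj_on ?g ({v} \<union> P)"
  proof -
    have "inj_on g P" using C(3) fP by (auto simp: inj_on_def card_le_Suc0_iff_eq)
    then show ?thesis using P vP(1) by (auto simp: inj_on_def)
  qed
  have "\<exists>c' A'. ext R c A (R \<union> insert x (\<Union> (B ` (P \<union> I)))) c' A' \<and> c' x = y \<and> A' x = {z. z < 4 \<and> z \<noteq> y \<and> z \<notin> ?g ` ({v} \<union> P)}"
  proof (rule color_vertex[where V = "{v}" and X = "{}" and g = ?g and f = f, OF e(1) _ y(1)])
    show "nb E W x = {v} \<union> P \<union> I \<union> {}" using C(1) vx(1) by blast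
    show "card ({v} \<union> P) \<le> 2" using C(3) fP vP by simp
    show "x \<in> W - R" using e(3) vx(2) by blast
    show "out R0 c0 A0 x w (B w) (?g w) y" if "w \<in> P" for w using P[OF that] vP that by auto
    show "inn R0 c0 A0 x w (B w) y (f w) \<and> f w < 4 \<and> f w \<noteq> y \<and> f w \<notin> ?g ` ({v} \<union> P)" if "w \<in> I" for w
      using I[OF that] unfolding gP by simp
    show "x \<notin> B w \<and> R \<inter> B w = {} \<and> w \<notin> {v}" if "w \<in> P \<union> I" for w using B[OF that] e(3) C(1) that by blast
  qed (use e C(2) inj d in auto)
  then show "\<exists>c' A'. ext R c A (R \<union> insert x (\<Union> (B ` (nb E W x - {v})))) c' A'" unfolding C(1) by blast
qed

text \<open>\<open>v\<close> is still uncolored and will send its edge to \<open>x\<close>, so both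
  out-edges of \<open>x\<close> may go to branches. The color \<open>e\<close> stays available at
  \<open>x\<close> if it differs from \<open>y\<close> and from their colors.\<close>

lemma grow_out:
  assumes x: "x \<in> nb E W v" "v \<in> W" and C: "nb E W x - {v} = P \<union> I" "P \<inter> I = {}" "card P \<le> 2" "inj_on g P"
    and y: "y < 4" "e < 4" "e \<noteq> y" "e \<notin> g ` P"
    and P: "\<And>w. w \<in> P \<Longrightarrow> out R0 c0 A0 x w (B w) (g w) y"
    and I: "\<And>w. w \<in> I \<Longrightarrow> inn R0 c0 A0 x w (B w) y (f w) \<and> f w < 4 \<and> f w \<noteq> y \<and> f w \<notin> g ` P"
    and B: "\<And>w. w \<in> P \<union> I \<Longrightarrow> x \<notin> B w \<and> v \<notin> B w"
    and d: "\<And>w w'. w \<in> P \<union> I \<Longrightarrow> w' \<in> P \<union> I \<Longrightarrow> w \<noteq> w' \<Longrightarrow> B w \<inter> B w' = {}"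
  shows "out R0 c0 A0 v x (insert x (\<Union> (B ` (nb E W x - {v})))) y e"
  unfolding out_def
proof (intro conjI allI impI, simp, elim conjE)
  fix R c A assume e: "ext R0 c0 A0 R c A" "v \<notin> R" "R \<inter> insert x (\<Union> (B ` (nb E W x - {v}))) = {}"
  have vx: "v \<in> nb E W x" "x \<in> W" using nb_sym[OF sym x(2,1)] nb_E[OF x(1)] by auto
  have "\<exists>c' A'. ext R c A (R \<union> insert x (\<Union> (B ` (P \<union> I)))) c' A' \<and> c' x = y \<and> A' x = {z. z < 4 \<and> z \<noteq> y \<and> z \<notin> g ` ({} \<union> P)}"
  proof (rule color_vertex[where V = "{}" and X = "{v}" and g = g and f = f, OF e(1) _ y(1)])
    show "nb E W x = {} \<union> P \<union> I \<union> {v}" using C(1) vx(1) by blast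
    show "x \<in> W - R" using e(3) vx(2) by blast
    show "inn R0 c0 A0 x w (B w) y (f w) \<and> f w < 4 \<and> f w \<noteq> y \<and> f w \<notin> g ` ({} \<union> P)" if "w \<in> I" for w
      using I[OF that] by simp
    show "x \<notin> B w \<and> R \<inter> B w = {} \<and> w \<notin> {}" if "w \<in> P \<union> I" for w using B[OF that] e(3) C(1) that by blast
  qed (use e C P B d in auto)
  then show "\<exists>c' A'. ext R c A (R \<union> insert x (\<Union> (B ` (nb E W x - {v})))) c' A' \<and> c' x = y \<and> e \<in> A' x"
    using y unfolding C(1) by force
qed

definition sums11 :: "'a set \<Rightarrow> ('a \<Rightarrow> nat) \<Rightarrow> bool" where
  "sums11 X k \<longleftrightarrow> (\<forall>x\<in>X. \<forall>x'\<in>X. x \<noteq> x' \<longrightarrow> k x + k x' \<le> 11)"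

text \<open>The general reduction for four colors: delete \<open>v\<close> with all its branches,
  color the rest, and choose from the relations alone the color of \<open>v\<close>, the at most two
  branches colored before \<open>v\<close>, and the colors of the others. The sums of depths keep
  the branches from interfering.\<close>

lemma root_color:
  assumes v: "v \<in> W" and b: "\<And>x. x \<in> nb E W v \<Longrightarrow> has v x (k x) (Q x)" and k: "sums11 (nb E W v) k"
    and sol: "\<And>J D. (\<And>x. x \<in> nb E W v \<Longrightarrow> Q x (J x) (D x)) \<Longrightarrow>
      \<exists>y P g f. y < 4 \<and> P \<subseteq> nb E W v \<and> card P \<le> 2 \<and> inj_on g P \<and> (\<forall>x\<in>P. D x (g x) y)
        \<and> (\<forall>x\<in>nb E W v - P. J x y (f x) \<and> f x < 4 \<and> f x \<noteq> y \<and> f x \<notin> g ` P)"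
  shows colorable
proof -
  let ?X = "nb E W v"
  have "\<forall>x\<in>?X. \<exists>B F. br v x (k x) B F \<and> (\<forall>R c A. col R c A \<and> R \<subseteq> W \<and> F \<subseteq> R \<and> R \<inter> B = {} \<and> v \<notin> R
     \<longrightarrow> Q x (inn R c A v x B) (out R c A v x B))" using b unfolding has_def by blast
  then obtain B where "\<forall>x\<in>?X. \<exists>F. br v x (k x) (B x) F \<and> (\<forall>R c A. col R c A \<and> R \<subseteq> W \<and> F \<subseteq> R \<and> R \<inter> B x = {} \<and> v \<notin> R
     \<longrightarrow> Q x (inn R c A v x (B x)) (out R c A v x (B x)))" by (rule bchoice[THEN exE])
  then obtain F where BF: "\<forall>x\<in>?X. br v x (k x) (B x) (F x) \<and> (\<forall>R c A. col R c A \<and> R \<subseteq> W \<and> F x \<subseteq> R \<and> R \<inter> B x = {} \<and> v \<notin> R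
     \<longrightarrow> Q x (inn R c A v x (B x)) (out R c A v x (B x)))" by (rule bchoice[THEN exE])
  have br: "br v x (k x) (B x) (F x)" if "x \<in> ?X" for x using BF that by blast
  have dj: "B x \<inter> B x' = {} \<and> B x \<inter> F x' = {}" if "x \<in> ?X" "x' \<in> ?X" "x \<noteq> x'" for x x'
    using br_apart[OF br[OF that(1)] br[OF that(2)] that(3)] k that unfolding sums11_def by blast
  let ?S = "insert v (\<Union> (B ` ?X))" let ?R = "W - ?S"
  have S: "?S \<subseteq> W" using v br unfolding br_def by blast
  have F: "F x \<subseteq> ?R" if "x \<in> ?X" for x
  proof
    fix u assume u: "u \<in> F x"
    have "u \<in> W" "u \<noteq> v" "u \<notin> B x" using br[OF that] u unfolding br_def by blast+
    moreover have "u \<notin> B x'" if "x' \<in> ?X" "x' \<noteq> x" for x' using dj[OF that(1) \<open>x \<in> ?X\<close> that(2)] u by blast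
    ultimately show "u \<in> ?R" by blast
  qed
  obtain c A where g: "col ?R c A" using IH[of ?R] v by blast
  have QX: "Q x (inn ?R c A v x (B x)) (out ?R c A v x (B x))" if "x \<in> ?X" for x
  proof -
    have "?R \<inter> B x = {}" using that by blast
    then show ?thesis using BF g F[OF that] that by blast
  qed
  have "\<exists>y P h f. y < 4 \<and> P \<subseteq> ?X \<and> card P \<le> 2 \<and> inj_on h P \<and> (\<forall>x\<in>P. out ?R c A v x (B x) (h x) y)
    \<and> (\<forall>x\<in>?X - P. inn ?R c A v x (B x) y (f x) \<and> f x < 4 \<and> f x \<noteq> y \<and> f x \<notin> h ` P)"
    by (rule sol[of "\<lambda>x. inn ?R c A v x (B x)" "\<lambda>x. out ?R c A v x (B x)"]) (rule QX)
  then obtain y P h f where y: "y < 4" "P \<subseteq> ?X" "card P \<le> 2" "inj_on h P" "\<And>x. x \<in> P \<Longrightarrow> out ?R c A v x (B x) (h x) y"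
    "\<And>x. x \<in> ?X - P \<Longrightarrow> inn ?R c A v x (B x) y (f x) \<and> f x < 4 \<and> f x \<noteq> y \<and> f x \<notin> h ` P"
    by (elim exE conjE) blast
  have PX: "P \<union> (?X - P) = ?X" using y(2) by blast
  have "\<exists>c' A'. ext ?R c A (?R \<union> insert v (\<Union> (B ` (P \<union> (?X - P))))) c' A' \<and> c' v = y \<and> A' v = {z. z < 4 \<and> z \<noteq> y \<and> z \<notin> h ` ({} \<union> P)}"
  proof (rule color_vertex[where V = "{}" and X = "{}" and g = h and f = f, OF ext_refl[OF g] _ y(1)])
    show "v \<notin> B w \<and> ?R \<inter> B w = {} \<and> w \<notin> {}" if "w \<in> P \<union> (?X - P)" for w
      using br[of w] that unfolding PX br_def by blast
    show "B w \<inter> B w' = {}" if "w \<in> P \<union> (?X - P)" "w' \<in> P \<union> (?X - P)" "w \<noteq> w'" for w w'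
      using dj that unfolding PX by blast
    show "nb E W v = {} \<union> P \<union> (?X - P) \<union> {}" using PX by blast
  qed (use y v in auto)
  moreover have "?R \<union> insert v (\<Union> (B ` (P \<union> (?X - P)))) = W" unfolding PX using S by blast
  ultimately show ?thesis unfolding ext_def by auto
qed

end

section \<open>Color relations of branches\<close>

type_synonym crel = "nat \<Rightarrow> nat \<Rightarrow> bool"

text \<open>\<open>I e y\<close>: the root of a branch may take \<open>y\<close> after the vertex it
  hangs at got color \<open>e\<close>. \<open>D y e\<close>: the root can get \<open>y\<close> first
  and then offer \<open>e\<close>. Each clause is one orientation of the edges at the new root and
  forbids repeating the color of an out-neighbor.\<close>

definition uni :: "crel \<Rightarrow> crel \<Rightarrow> crel \<Rightarrow> crel \<Rightarrow> bool" where
  "uni I D I' D' \<longleftrightarrow> (\<forall>y<4. \<forall>e<4. y \<noteq> e \<longrightarrow>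
     (\<forall>w<4. I y w \<and> w \<noteq> y \<and> w \<noteq> e \<longrightarrow> I' e y) \<and> (\<forall>w<4. D w y \<and> w \<noteq> e \<longrightarrow> I' e y) \<and>
     (\<forall>w<4. I y w \<and> w \<noteq> y \<longrightarrow> D' y e) \<and> (\<forall>w<4. D w y \<and> w \<noteq> e \<longrightarrow> D' y e))"

text \<open>The case of two branches below. Two branches colored first do not combine with an
  out-edge upwards, since the root would get out-degree three.\<close>

definition bin :: "crel \<Rightarrow> crel \<Rightarrow> crel \<Rightarrow> crel \<Rightarrow> crel \<Rightarrow> crel \<Rightarrow> bool" where
  "bin I1 D1 I2 D2 I' D' \<longleftrightarrow> (\<forall>y<4. \<forall>e<4. \<forall>a<4. \<forall>b<4. y \<noteq> e \<longrightarrow>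
     (I1 y a \<and> I2 y b \<and> a \<notin> {y, e} \<and> b \<notin> {y, e} \<longrightarrow> I' e y) \<and>
     (D1 a y \<and> I2 y b \<and> a \<noteq> e \<and> b \<notin> {y, e, a} \<longrightarrow> I' e y) \<and>
     (I1 y a \<and> D2 b y \<and> b \<noteq> e \<and> a \<notin> {y, e, b} \<longrightarrow> I' e y) \<and>
     (I1 y a \<and> I2 y b \<and> a \<noteq> y \<and> b \<noteq> y \<longrightarrow> D' y e) \<and>
     (D1 a y \<and> I2 y b \<and> a \<noteq> e \<and> b \<notin> {y, a} \<longrightarrow> D' y e) \<and>
     (I1 y a \<and> D2 b y \<and> b \<noteq> e \<and> a \<notin> {y, b} \<longrightarrow> D' y e) \<and>
     (D1 a y \<and> D2 b y \<and> a \<noteq> b \<and> a \<noteq> e \<and> b \<noteq> e \<longrightarrow> D' y e))"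

text \<open>The properties record what is guaranteed for a shape. A colored end satisfies
  \<open>Tm\<close>; one, two and three vertices of degree two in front of it give
  \<open>On\<close>, \<open>L2\<close> and \<open>SF\<close>. With \<open>Fr\<close> or
  \<open>Tw\<close> a branch can be colored after every color of the vertex it hangs at, or after
  all but one. \<open>Zd\<close> and \<open>Alt\<close> compensate a missing choice after a color by
  freedom when the branch is colored first.\<close>

definition Tm :: "crel \<Rightarrow> crel \<Rightarrow> bool" where
  "Tm I D \<longleftrightarrow> (\<exists>a<4. \<exists>c<4. a \<noteq> c \<and> D c a)"

definition On :: "crel \<Rightarrow> crel \<Rightarrow> bool" where
  "On I D \<longleftrightarrow> (\<exists>a<4. \<exists>c<4. a \<noteq> c \<and> (\<forall>e<4. e \<noteq> a \<and> e \<noteq> c \<longrightarrow> I e a))"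

definition L2 :: "crel \<Rightarrow> crel \<Rightarrow> bool" where
  "L2 I D \<longleftrightarrow> (\<exists>a<4. \<exists>c<4. a \<noteq> c \<and> (\<forall>e<4. \<forall>p<4. e \<noteq> a \<and> p \<notin> {a, c, e} \<longrightarrow> I e p)
     \<and> (\<forall>p<4. \<forall>e<4. p \<notin> {a, c} \<and> e \<noteq> p \<longrightarrow> D p e))"

definition Two :: "crel \<Rightarrow> crel \<Rightarrow> bool" where
  "Two I D \<longleftrightarrow> (\<exists>a<4. \<exists>c<4. \<forall>p<4. \<forall>e<4. p \<notin> {a, c} \<and> e \<noteq> p \<longrightarrow> D p e)"

definition SF :: "crel \<Rightarrow> crel \<Rightarrow> bool" where
  "SF I D \<longleftrightarrow> (\<forall>e<4. \<exists>s. \<forall>p<4. p \<notin> {e, s} \<longrightarrow> I e p)"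

definition Fr :: "crel \<Rightarrow> crel \<Rightarrow> bool" where
  "Fr I D \<longleftrightarrow> (\<forall>e<4. \<exists>y<4. y \<noteq> e \<and> I e y)"

definition Tw :: "crel \<Rightarrow> crel \<Rightarrow> bool" where
  "Tw I D \<longleftrightarrow> (\<exists>a. \<forall>e<4. e \<noteq> a \<longrightarrow> (\<exists>y<4. y \<noteq> e \<and> I e y))"

definition Zd :: "crel \<Rightarrow> crel \<Rightarrow> bool" where
  "Zd I D \<longleftrightarrow> (\<forall>e<4. (\<exists>y<4. y \<noteq> e \<and> I e y) \<or> (\<forall>d<4. d \<noteq> e \<longrightarrow> D d e))"

definition Alt :: "crel \<Rightarrow> crel \<Rightarrow> bool" where
  "Alt I D \<longleftrightarrow> (\<forall>e<4. \<forall>t<4. t \<noteq> e \<longrightarrow> (\<exists>y<4. y \<notin> {e, t} \<and> I e y) \<or> (\<forall>q<4. q \<notin> {e, t} \<longrightarrow> D q e))"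

lemma fresh2: "\<exists>x<4::nat. x \<notin> {a, b}" using pick_lt[of "[a, b]" 4] by auto
lemma fresh3: "\<exists>x<4::nat. x \<notin> {a, b, c}" using pick_lt[of "[a, b, c]" 4] by auto

text \<open>When no color is left outside four given ones, these are distinct; a failed choice thus
  fixes the whole picture.\<close>

lemma all4:
  assumes "\<not> (\<exists>x<4::nat. x \<notin> {a, b, c, d})"
  shows "distinct [a, b, c, d]" "\<And>x. x < 4 \<Longrightarrow> x \<in> {a, b, c, d}"
proof -
  have "{..<4} \<subseteq> set [a, b, c, d]" using assms by auto
  then have "card {..<4::nat} \<le> card (set [a, b, c, d])" by (intro card_mono) auto
  then have "length [a, b, c, d] \<le> card (set [a, b, c, d])" by simp
  then show "distinct [a, b, c, d]" using card_length[of "[a, b, c, d]"] card_distinct by (metis le_antisym)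
  show "\<And>x. x < 4 \<Longrightarrow> x \<in> {a, b, c, d}" using assms by blast
qed

lemma L2E:
  assumes "L2 I D"
  obtains a c where "a < 4" "c < 4" "a \<noteq> c" "\<forall>e<4. \<forall>p<4. e \<noteq> a \<and> p \<notin> {a, c, e} \<longrightarrow> I e p"
    "\<forall>p<4. \<forall>e<4. p \<notin> {a, c} \<and> e \<noteq> p \<longrightarrow> D p e"
  using assms unfolding L2_def by (elim exE conjE) (rule that)

lemma OnE:
  assumes "On I D"
  obtains a c where "a < 4" "c < 4" "a \<noteq> c" "\<forall>e<4. e \<noteq> a \<and> e \<noteq> c \<longrightarrow> I e a"
  using assms unfolding On_def by (elim exE conjE) (rule that)

lemma SFE:
  assumes "SF I D" "e < 4"
  obtains s where "\<And>p. p < 4 \<Longrightarrow> p \<notin> {e, s} \<Longrightarrow> I e p"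
proof -
  obtain s where "\<forall>p<4. p \<notin> {e, s} \<longrightarrow> I e p" using assms unfolding SF_def by blast
  then show ?thesis by (intro that[of s]) blast
qed

lemma FrE:
  assumes "Fr I D" "e < 4"
  obtains y where "y < 4" "y \<noteq> e" "I e y"
  using assms unfolding Fr_def by blast

lemma SF_Fr:
  assumes "SF I D"
  shows "Fr I D"
  unfolding Fr_def
proof (intro allI impI)
  fix e :: nat assume "e < 4"
  obtain s where s: "\<And>p. p < 4 \<Longrightarrow> p \<notin> {e, s} \<Longrightarrow> I e p" by (rule SFE[OF assms \<open>e < 4\<close>]) (rule that; blast)
  obtain y :: nat where "y < 4" "y \<notin> {e, s}" using fresh2 by blast
  then show "\<exists>y<4. y \<noteq> e \<and> I e y" using s[of y] by blast
qed

lemma SF_Alt: "SF I D \<Longrightarrow> Alt I D"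
  unfolding Alt_def
proof (intro allI impI disjI1)
  fix e t :: nat assume s: "SF I D" "e < 4" "t < 4" "t \<noteq> e"
  obtain s' where s': "\<And>p. p < 4 \<Longrightarrow> p \<notin> {e, s'} \<Longrightarrow> I e p" by (rule SFE[OF s(1,2)]) (rule that; blast)
  obtain y :: nat where "y < 4" "y \<notin> {e, t, s'}" using fresh3 by blast
  then have "y < 4" "y \<notin> {e, t}" "I e y" using s'[of y] by auto
  then show "\<exists>y<4. y \<notin> {e, t} \<and> I e y" by blast
qed

lemma Fr_Tw: "Fr I D \<Longrightarrow> Tw I D"
  unfolding Fr_def Tw_def by blast

lemma L2_Tw: "L2 I D \<Longrightarrow> Tw I D"
proof -
  assume "L2 I D"
  then obtain a c where I: "\<forall>e<4. \<forall>p<4. e \<noteq> a \<and> p \<notin> {a, c, e} \<longrightarrow> I e p" by (rule L2E)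
  have "\<exists>y<4. y \<noteq> e \<and> I e y" if "e < 4" "e \<noteq> a" for e
  proof -
    obtain p :: nat where "p < 4" "p \<notin> {a, c, e}" using fresh3 by blast
    then have "p < 4" "p \<noteq> e" "I e p" using I[rule_format, of e p] that by auto
    then show ?thesis by blast
  qed
  then show ?thesis unfolding Tw_def by blast
qed

lemma uni_On:
  assumes "Tm I D" "uni I D I' D'"
  shows "On I' D'"
proof -
  obtain a c where ac: "a < 4" "c < 4" "a \<noteq> c" "D c a" using assms(1) unfolding Tm_def by blast
  have "I' e a" if "e < 4" "e \<noteq> a" "e \<noteq> c" for e
    using assms(2)[unfolded uni_def, rule_format, of a e] ac that by auto
  then show ?thesis using ac(1-3) unfolding On_def by blast
qed

lemma uni_L2:
  assumes "On I D" "uni I D I' D'"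
  shows "L2 I' D'"
proof -
  obtain a c where ac: "a < 4" "c < 4" "a \<noteq> c" "\<forall>e<4. e \<noteq> a \<and> e \<noteq> c \<longrightarrow> I e a" using OnE[OF assms(1)] .
  have "I' e p" if "e < 4" "p < 4" "e \<noteq> a" "p \<notin> {a, c, e}" for e p
    using assms(2)[unfolded uni_def, rule_format, of p e] ac(1) ac(4)[rule_format, of p] that by auto
  moreover have "D' p e" if "e < 4" "p < 4" "p \<notin> {a, c}" "e \<noteq> p" for e p
    using assms(2)[unfolded uni_def, rule_format, of p e] ac(1) ac(4)[rule_format, of p] that by auto
  ultimately show ?thesis using ac(1-3) unfolding L2_def by blast
qed

lemma L2_Two: "L2 I D \<Longrightarrow> Two I D"
  unfolding L2_def Two_def by blast

lemma uni_SF: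
  assumes "Two I D" "uni I D I' D'"
  shows "SF I' D'"
  unfolding SF_def
proof (intro allI impI)
  fix e :: nat assume e: "e < 4"
  obtain a c where D: "\<And>p y. p < 4 \<Longrightarrow> y < 4 \<Longrightarrow> p \<notin> {a, c} \<Longrightarrow> y \<noteq> p \<Longrightarrow> D p y" using assms(1) unfolding Two_def by (elim exE conjE) (rule that; blast)
  obtain s :: nat where s: "s < 4" "s \<notin> {a, c, e}" using fresh3 by blast
  have "I' e y" if "y < 4" "y \<notin> {e, s}" for y
    using assms(2)[unfolded uni_def, rule_format, of y e] D[of s y] s e that by auto
  then show "\<exists>s. \<forall>p<4. p \<notin> {e, s} \<longrightarrow> I' e p" by blast
qed

lemma bin_Two:
  assumes "Fr I1 D1" "On I2 D2" "bin I1 D1 I2 D2 I' D'"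
  shows "Two I' D'"
proof -
  obtain a c where ac: "a < 4" "c < 4" "a \<noteq> c" "\<forall>e<4. e \<noteq> a \<and> e \<noteq> c \<longrightarrow> I2 e a" using OnE[OF assms(2)] .
  have "D' y e" if "y < 4" "e < 4" "y \<notin> {a, c}" "e \<noteq> y" for y e
  proof -
    obtain b where b: "b < 4" "b \<noteq> y" "I1 y b" using FrE[OF assms(1) \<open>y < 4\<close>] .
    have "I2 y a" "a \<noteq> y" using ac(4)[rule_format, of y] that by auto
    then show ?thesis using assms(3)[unfolded bin_def, rule_format, of y e b a] that ac(1) b by simp
  qed
  then show ?thesis using ac(1,2) unfolding Two_def by blast
qed

lemma bin_Tw:
  assumes "SF I1 D1" "On I2 D2" "bin I1 D1 I2 D2 I' D'"
  shows "Tw I' D'"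
proof -
  obtain a c where ac: "a < 4" "c < 4" "a \<noteq> c" "\<forall>e<4. e \<noteq> a \<and> e \<noteq> c \<longrightarrow> I2 e a" using OnE[OF assms(2)] .
  have "\<exists>y<4. y \<noteq> e \<and> I' e y" if "e < 4" "e \<noteq> a" for e
  proof -
    obtain y :: nat where y: "y < 4" "y \<notin> {a, c, e}" using fresh3 by blast
    obtain s where s: "\<And>p. p < 4 \<Longrightarrow> p \<notin> {y, s} \<Longrightarrow> I1 y p" by (rule SFE[OF assms(1) y(1)]) (rule that; blast)
    obtain p :: nat where p: "p < 4" "p \<notin> {y, s, e}" using fresh3 by blast
    have "I1 y p" "I2 y a" using s[of p] p ac(4)[rule_format, of y] y by auto
    then have "I' e y" using assms(3)[unfolded bin_def, rule_format, of y e p a] that ac(1) p y by simp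
    then show ?thesis using y by blast
  qed
  then show ?thesis unfolding Tw_def by blast
qed

lemma bin_Fr:
  assumes "SF I1 D1" "L2 I2 D2" "bin I1 D1 I2 D2 I' D'"
  shows "Fr I' D' \<and> Alt I' D'"
proof -
  obtain a c where ac: "a < 4" "c < 4" "a \<noteq> c" "\<forall>e<4. \<forall>p<4. e \<noteq> a \<and> p \<notin> {a, c, e} \<longrightarrow> I2 e p"
    "\<forall>p<4. \<forall>e<4. p \<notin> {a, c} \<and> e \<noteq> p \<longrightarrow> D2 p e" using L2E[OF assms(2)] .
  have S: "\<exists>p<4. p \<notin> {y, t} \<and> I1 y p" if y: "y < 4" for y t
  proof -
    obtain s where s: "\<And>p. p < 4 \<Longrightarrow> p \<notin> {y, s} \<Longrightarrow> I1 y p" by (rule SFE[OF assms(1) y]) (rule that; blast)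
    obtain p :: nat where "p < 4" "p \<notin> {y, s, t}" using fresh3 by blast
    then have "p < 4" "p \<notin> {y, t}" "I1 y p" using s[of p] by auto
    then show ?thesis by blast
  qed
  have "\<exists>y<4. y \<noteq> e \<and> I' e y" if e: "e < 4" for e
  proof -
    obtain b :: nat where b: "b < 4" "b \<notin> {a, c, e}" using fresh3 by blast
    obtain y :: nat where y: "y < 4" "y \<notin> {e, a, b}" using fresh3 by blast
    obtain p where p: "p < 4" "p \<notin> {y, e}" "I1 y p" using S[OF y(1)] by blast
    have "I2 y b" using ac(4)[rule_format, of y b] y b by auto
    then have "I' e y" using assms(3)[unfolded bin_def, rule_format, of y e p b] e b p y by simp
    then show ?thesis using y by blast
  qed
  \<comment> \<open>Colored first, the root can have any \<open>y\<close> and offer any other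
    \<open>e\<close>, so \<open>Alt\<close> holds by its second alternative.\<close>
  moreover have "D' y e" if y: "y < 4" "e < 4" "y \<noteq> e" for y e
  proof (cases "y = a")
    case True
    obtain b :: nat where b: "b < 4" "b \<notin> {a, c, e}" using fresh3 by blast
    obtain p where p: "p < 4" "p \<notin> {y, b}" "I1 y p" using S[OF y(1)] by blast
    have "D2 b y" using ac(5)[rule_format, of b y] y b True by auto
    then show ?thesis using assms(3)[unfolded bin_def, rule_format, of y e p b] y b p by simp
  next
    case False
    obtain b :: nat where b: "b < 4" "b \<notin> {a, c, y}" using fresh3 by blast
    obtain p where p: "p < 4" "p \<notin> {y, b}" "I1 y p" using S[OF y(1)] by blast
    have "I2 y b" using ac(4)[rule_format, of y b] y b False by auto
    then show ?thesis using assms(3)[unfolded bin_def, rule_format, of y e p b] y b p by simp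
  qed
  ultimately show ?thesis unfolding Fr_def Alt_def by blast
qed

text \<open>If the root cannot have some \<open>d\<close> and offer \<open>e\<close>, then
  \<open>d\<close> is the exceptional color of at least one leg. Coloring such legs first fails only
  if the colors are completely determined, and then a color that may follow \<open>e\<close> can be
  read off.\<close>

lemma bin_Zd:
  assumes "L2 I1 D1" "L2 I2 D2" "bin I1 D1 I2 D2 I' D'"
  shows "Zd I' D'"
  unfolding Zd_def
proof (intro allI impI)
  fix e :: nat assume e: "e < 4"
  obtain a1 c1 where h1: "a1 < 4" "c1 < 4" "a1 \<noteq> c1" "\<forall>e<4. \<forall>p<4. e \<noteq> a1 \<and> p \<notin> {a1, c1, e} \<longrightarrow> I1 e p"
    "\<forall>p<4. \<forall>e<4. p \<notin> {a1, c1} \<and> e \<noteq> p \<longrightarrow> D1 p e" using L2E[OF assms(1)] .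
  obtain a2 c2 where h2: "a2 < 4" "c2 < 4" "a2 \<noteq> c2" "\<forall>e<4. \<forall>p<4. e \<noteq> a2 \<and> p \<notin> {a2, c2, e} \<longrightarrow> I2 e p"
    "\<forall>p<4. \<forall>e<4. p \<notin> {a2, c2} \<and> e \<noteq> p \<longrightarrow> D2 p e" using L2E[OF assms(2)] .
  note B = assms(3)[unfolded bin_def, rule_format]
  show "(\<exists>y<4. y \<noteq> e \<and> I' e y) \<or> (\<forall>d<4. d \<noteq> e \<longrightarrow> D' d e)"
  proof (rule disjCI)
    assume n: "\<not> (\<forall>d<4. d \<noteq> e \<longrightarrow> D' d e)"
    then obtain d where d: "d < 4" "d \<noteq> e" "\<not> D' d e" by blast
    consider (none) "d \<noteq> a1" "d \<noteq> a2" | (one) "d = a1" "d \<noteq> a2" | (two) "d \<noteq> a1" "d = a2" | (both) "d = a1" "d = a2" by blast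
    then show "\<exists>y<4. y \<noteq> e \<and> I' e y"
    proof cases
      case none
      obtain p :: nat where p: "p < 4" "p \<notin> {a1, c1, d}" using fresh3 by blast
      obtain q :: nat where q: "q < 4" "q \<notin> {a2, c2, d}" using fresh3 by blast
      have "I1 d p" "I2 d q" using h1(4)[rule_format, of d p] h2(4)[rule_format, of d q] d(1) p q none by auto
      then show ?thesis using B[of d e p q] d e p q by simp
    next
      case one
      obtain b :: nat where b: "b < 4" "b \<notin> {a1, c1, e}" using fresh3 by blast
      have Db: "D1 b d" using h1(5)[rule_format, of b d] b d(1) one(1) by auto
      have "\<not> (\<exists>q<4. q \<notin> {a2, c2, a1, b})"
      proof
        assume "\<exists>q<4. q \<notin> {a2, c2, a1, b}"
        then obtain q where q: "q < 4" "q \<notin> {a2, c2, a1, b}" by blast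
        have "I2 d q" using h2(4)[rule_format, of d q] d(1) q one by auto
        then show False using B[of d e b q] d e b q Db one(1) by simp
      qed
      note A = all4[OF this]
      have e2: "e = a2 \<or> e = c2" using A(2)[OF e] d(2) one(1) b(2) by auto
      then show ?thesis
      proof
        assume ea: "e = a2"
        have "I1 c2 b" using h1(4)[rule_format, of c2 b] A(1) b \<open>c2 < 4\<close> by auto
        moreover have "I2 c2 b" using h2(4)[rule_format, of c2 b] A(1) b \<open>c2 < 4\<close> by auto
        ultimately have "I' e c2" using B[of c2 e b b] e b(1) \<open>c2 < 4\<close> A(1) ea by auto
        then show ?thesis using \<open>c2 < 4\<close> A(1) ea by auto
      next
        assume ec: "e = c2"
        have "I1 a2 b" using h1(4)[rule_format, of a2 b] A(1) b \<open>a2 < 4\<close> by auto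
        moreover have "D2 a1 a2" using h2(5)[rule_format, of a1 a2] A(1) h1(1) \<open>a2 < 4\<close> by auto
        ultimately have "I' e a2" using B[of a2 e b a1] e b(1) \<open>a2 < 4\<close> h1(1) A(1) ec by auto
        then show ?thesis using \<open>a2 < 4\<close> A(1) ec by auto
      qed
    next
      case two
      obtain b :: nat where b: "b < 4" "b \<notin> {a2, c2, e}" using fresh3 by blast
      have Db: "D2 b d" using h2(5)[rule_format, of b d] b d(1) two(2) by auto
      have "\<not> (\<exists>q<4. q \<notin> {a1, c1, a2, b})"
      proof
        assume "\<exists>q<4. q \<notin> {a1, c1, a2, b}"
        then obtain q where q: "q < 4" "q \<notin> {a1, c1, a2, b}" by blast
        have "I1 d q" using h1(4)[rule_format, of d q] d(1) q two by auto
        then show False using B[of d e q b] d e b q Db two(2) by simp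
      qed
      note A = all4[OF this]
      have e2: "e = a1 \<or> e = c1" using A(2)[OF e] d(2) two(2) b(2) by auto
      then show ?thesis
      proof
        assume ea: "e = a1"
        have "I2 c1 b" using h2(4)[rule_format, of c1 b] A(1) b \<open>c1 < 4\<close> by auto
        moreover have "I1 c1 b" using h1(4)[rule_format, of c1 b] A(1) b \<open>c1 < 4\<close> by auto
        ultimately have "I' e c1" using B[of c1 e b b] e b(1) \<open>c1 < 4\<close> A(1) ea by auto
        then show ?thesis using \<open>c1 < 4\<close> A(1) ea by auto
      next
        assume ec: "e = c1"
        have "I2 a1 b" using h2(4)[rule_format, of a1 b] A(1) b \<open>a1 < 4\<close> by auto
        moreover have "D1 a2 a1" using h1(5)[rule_format, of a2 a1] A(1) h2(1) \<open>a1 < 4\<close> by auto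
        ultimately have "I' e a1" using B[of a1 e a2 b] e b(1) \<open>a1 < 4\<close> h2(1) A(1) ec by auto
        then show ?thesis using \<open>a1 < 4\<close> A(1) ec by auto
      qed
    next
      case both
      obtain b :: nat where b: "b < 4" "b \<notin> {a1, c1, e}" using fresh3 by blast
      have Db: "D1 b d" using h1(5)[rule_format, of b d] b d(1) both(1) by auto
      have "\<not> (\<exists>q<4. q \<notin> {a1, c2, e, b})"
      proof
        assume "\<exists>q<4. q \<notin> {a1, c2, e, b}"
        then obtain q where q: "q < 4" "q \<notin> {a1, c2, e, b}" by blast
        have "D2 q d" using h2(5)[rule_format, of q d] d(1) q both by auto
        then show False using B[of d e b q] d e b q Db by auto
      qed
      note A = all4[OF this]
      have "I1 c2 b" "I2 c2 b" using h1(4)[rule_format, of c2 b] h2(4)[rule_format, of c2 b] A(1) b both \<open>c2 < 4\<close> by auto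
      then have "I' e c2" using B[of c2 e b b] e b(1) \<open>c2 < 4\<close> A(1) by auto
      then show ?thesis using \<open>c2 < 4\<close> A(1) by auto
    qed
  qed
qed

text \<open>A vertex with a leg of length two and a leg of length one, and the middle vertex of its third leg.\<close>

lemma bin_uni_Alt:
  assumes "L2 I1 D1" "On I2 D2" "bin I1 D1 I2 D2 I D" "uni I D I' D'"
  shows "Fr I' D' \<and> Alt I' D'"
proof -
  obtain a1 c1 where h1: "a1 < 4" "c1 < 4" "a1 \<noteq> c1" "\<forall>e<4. \<forall>p<4. e \<noteq> a1 \<and> p \<notin> {a1, c1, e} \<longrightarrow> I1 e p"
    "\<forall>p<4. \<forall>e<4. p \<notin> {a1, c1} \<and> e \<noteq> p \<longrightarrow> D1 p e" using L2E[OF assms(1)] .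
  obtain a2 c2 where h2: "a2 < 4" "c2 < 4" "a2 \<noteq> c2" "\<forall>e<4. e \<noteq> a2 \<and> e \<noteq> c2 \<longrightarrow> I2 e a2"
    using OnE[OF assms(2)] .
  note B = assms(3)[unfolded bin_def, rule_format] and U = assms(4)[unfolded uni_def, rule_format]
  have S1: "D w y" if "w < 4" "w \<notin> {a1, a2, c2}" "y < 4" "y \<noteq> w" for w y
  proof -
    obtain p :: nat where p: "p < 4" "p \<notin> {a1, c1, w}" using fresh3 by blast
    have "I1 w p" "I2 w a2" using h1(4)[rule_format, of w p] h2(4)[rule_format, of w] p that by auto
    then show ?thesis using B[of w y p a2] that p h2(1) by auto
  qed
  have S2: "D a1 y" if "a1 \<notin> {a2, c2}" "p < 4" "p \<notin> {a1, c1, a2}" "y < 4" "y \<notin> {a1, p}" for p y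
  proof -
    have "D1 p a1" "I2 a1 a2" using h1(5)[rule_format, of p a1] h2(4)[rule_format, of a1] that h1(1) by auto
    then show ?thesis using B[of a1 y p a2] that h1(1) h2(1) by auto
  qed
  have S3: "I y w" if "w < 4" "w \<notin> {a1, a2, c2}" "y < 4" "y \<noteq> w" "y \<noteq> a2" "p < 4" "p \<notin> {a1, c1, w, y}" for w y p
  proof -
    have "I1 w p" "I2 w a2" using h1(4)[rule_format, of w p] h2(4)[rule_format, of w] that by auto
    then show ?thesis using B[of w y p a2] that h2(1) by auto
  qed
  have In1: "I' e y" if "w < 4" "w \<notin> {a1, a2, c2, e}" "e < 4" "y < 4" "y \<notin> {w, e}" for e w y
    using U[of y e] S1[of w y] that by auto
  have bad: "(\<exists>y<4. y \<notin> {e, t} \<and> I' e y) \<or> (\<forall>q<4. q \<notin> {e, t} \<longrightarrow> D' q e)" if e: "e < 4" and t: "t < 4" for e t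
  proof (cases "\<exists>w<4. w \<notin> {a1, a2, c2, e}")
    case True
    then obtain w where w: "w < 4" "w \<notin> {a1, a2, c2, e}" by blast
    obtain y :: nat where y: "y < 4" "y \<notin> {w, e, t}" using fresh3 by blast
    then have "I' e y" using In1[OF w e y(1)] by auto
    then show ?thesis using y by blast
  next
    case False
    note A = all4[OF False]
    have In2: "I' e y" if "p < 4" "p \<notin> {a1, c1, a2}" "y < 4" "y \<notin> {a1, p, e}" for p y
      using U[of y e] S2[of p y] A(1) that e h1(1) by auto
    show ?thesis
    proof (cases "\<exists>p<4. \<exists>y<4. p \<notin> {a1, c1, a2} \<and> y \<notin> {a1, p, e, t}")
      case True
      then obtain p y where "p < 4" "p \<notin> {a1, c1, a2}" "y < 4" "y \<notin> {a1, p, e, t}" by blast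
      then show ?thesis using In2[of p y] by auto
    next
      \<comment> \<open>With all these choices blocked, \<open>p = c2\<close>, \<open>t = a2\<close>
        and \<open>c1 = e\<close>. In this one situation the second alternative of
        \<open>Alt\<close> is established.\<close>
      case no: False
      obtain p :: nat where p: "p < 4" "p \<notin> {a1, c1, a2}" using fresh3 by blast
      have "\<not> (\<exists>y<4. y \<notin> {a1, p, e, t})" using no p by blast
      note C = all4(1)[OF this]
      have "p = c2" using A(2)[OF p(1)] p(2) C by auto
      moreover have "t = a2" using A(2)[OF t] C \<open>p = c2\<close> by auto
      moreover have "c1 = e"
      proof (rule ccontr)
        assume "c1 \<noteq> e"
        then have "e \<notin> {a1, c1, a2}" using A(1) by auto
        moreover obtain y :: nat where "y < 4" "y \<notin> {a1, e, t}" using fresh3 by blast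
        ultimately show False using no e by blast
      qed
      have "D' q e" if q: "q < 4" "q \<notin> {e, t}" for q
      proof -
        obtain r :: nat where r: "r < 4" "r \<notin> {a1, e, q}" using fresh3 by blast
        have "I q e" using S3[of e q r] e q r A(1) \<open>t = a2\<close> \<open>c1 = e\<close> by auto
        then show ?thesis using U[of q e] q e by auto
      qed
      then show ?thesis by blast
    qed
  qed
  have "\<exists>y<4. y \<noteq> e \<and> I' e y" if e: "e < 4" for e
  proof (cases "\<exists>w<4. w \<notin> {a1, a2, c2, e}")
    case True
    then obtain w where w: "w < 4" "w \<notin> {a1, a2, c2, e}" by blast
    obtain y :: nat where "y < 4" "y \<notin> {w, e}" using fresh2 by blast
    then show ?thesis using In1[OF w e] by blast
  next
    case False
    note A = all4[OF False]
    obtain p :: nat where p: "p < 4" "p \<notin> {a1, c1, a2}" using fresh3 by blast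
    obtain y :: nat where y: "y < 4" "y \<notin> {a1, p, e}" using fresh3 by blast
    have "I' e y" using U[of y e] S2[of p y] A(1) p y e h1(1) by auto
    then show ?thesis using y by blast
  qed
  then show ?thesis using bad unfolding Fr_def Alt_def by blast
qed

section \<open>Triples of relations that can meet at a vertex\<close>

lemma sol_exI: "P y a b c \<Longrightarrow> y < (4::nat) \<Longrightarrow> a < (4::nat) \<Longrightarrow> b < (4::nat) \<Longrightarrow> c < (4::nat) \<Longrightarrow> \<exists>y<4. \<exists>a<4. \<exists>b<4. \<exists>c<4. P y a b c"
  by blast

text \<open>In each combination the first branch is colored after the vertex, so the bound of two
  out-edges is automatic.\<close>

definition sol3 :: "crel \<Rightarrow> crel \<Rightarrow> crel \<Rightarrow> crel \<Rightarrow> crel \<Rightarrow> crel \<Rightarrow> bool" where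
  "sol3 I1 D1 I2 D2 I3 D3 \<longleftrightarrow> (\<exists>y<4. \<exists>a<4. \<exists>b<4. \<exists>c<4.
     (I1 y a \<and> I2 y b \<and> I3 y c \<and> a \<noteq> y \<and> b \<noteq> y \<and> c \<noteq> y) \<or>
     (I1 y a \<and> I2 y b \<and> D3 c y \<and> a \<notin> {y, c} \<and> b \<notin> {y, c}) \<or>
     (I1 y a \<and> D2 b y \<and> I3 y c \<and> a \<notin> {y, b} \<and> c \<notin> {y, b}) \<or>
     (I1 y a \<and> D2 b y \<and> D3 c y \<and> b \<noteq> c \<and> a \<notin> {y, b, c}))"

lemma TwE:
  assumes "Tw I D"
  obtains t where "\<forall>e<4. e \<noteq> t \<longrightarrow> (\<exists>y<4. y \<noteq> e \<and> I e y)"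
  using assms unfolding Tw_def by (elim exE) (rule that)

lemma sol_OTF: "On I1 D1 \<Longrightarrow> Tw I2 D2 \<Longrightarrow> Fr I3 D3 \<Longrightarrow> sol3 I1 D1 I2 D2 I3 D3"
proof -
  assume h: "On I1 D1" "Tw I2 D2" "Fr I3 D3"
  obtain a c where 1: "a < 4" "c < 4" "a \<noteq> c" "\<forall>e<4. e \<noteq> a \<and> e \<noteq> c \<longrightarrow> I1 e a" using OnE[OF h(1)] .
  obtain t where 2: "\<forall>e<4. e \<noteq> t \<longrightarrow> (\<exists>y<4. y \<noteq> e \<and> I2 e y)" using TwE[OF h(2)] .
  obtain y :: nat where y: "y < 4" "y \<notin> {a, c, t}" using fresh3 by blast
  obtain p where p: "p < 4" "p \<noteq> y" "I2 y p" using 2[rule_format, of y] y by auto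
  obtain q where q: "q < 4" "q \<noteq> y" "I3 y q" using FrE[OF h(3) y(1)] .
  have "I1 y a" using 1(4)[rule_format, of y] y by auto
  then show ?thesis unfolding sol3_def by (intro sol_exI[of _ y a p q]) (use 1 y p q in auto)
qed

text \<open>If the third branch cannot follow the color \<open>y\<close>, it can precede it in any
  color, in particular in one different from \<open>a\<close> and \<open>b\<close>.\<close>

lemma sol_Z:
  assumes "Zd I3 D3" "y < 4" "a < 4" "b < 4" "a \<noteq> y" "b \<noteq> y" "I1 y a" "I2 y b"
  shows "sol3 I1 D1 I2 D2 I3 D3"
proof -
  consider (i) q where "q < 4" "q \<noteq> y" "I3 y q" | (o) "\<forall>d<4. d \<noteq> y \<longrightarrow> D3 d y" using assms(1,2) unfolding Zd_def by blast
  then show ?thesis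
  proof cases
    case i
    then show ?thesis unfolding sol3_def by (intro sol_exI[of _ y a b q]) (use assms in auto)
  next
    case o
    obtain d :: nat where d: "d < 4" "d \<notin> {y, a, b}" using fresh3 by blast
    then have "D3 d y" using o by auto
    then show ?thesis unfolding sol3_def by (intro sol_exI[of _ y a b d]) (use assms d in auto)
  qed
qed

lemma sol_TTZ: "Tw I1 D1 \<Longrightarrow> Tw I2 D2 \<Longrightarrow> Zd I3 D3 \<Longrightarrow> sol3 I1 D1 I2 D2 I3 D3"
proof -
  assume h: "Tw I1 D1" "Tw I2 D2" "Zd I3 D3"
  obtain t1 where 1: "\<forall>e<4. e \<noteq> t1 \<longrightarrow> (\<exists>y<4. y \<noteq> e \<and> I1 e y)" using TwE[OF h(1)] .
  obtain t2 where 2: "\<forall>e<4. e \<noteq> t2 \<longrightarrow> (\<exists>y<4. y \<noteq> e \<and> I2 e y)" using TwE[OF h(2)] .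
  obtain y :: nat where y: "y < 4" "y \<notin> {t1, t2}" using fresh2 by blast
  obtain p where p: "p < 4" "p \<noteq> y" "I1 y p" using 1[rule_format, of y] y by auto
  obtain q where q: "q < 4" "q \<noteq> y" "I2 y q" using 2[rule_format, of y] y by auto
  show ?thesis by (rule sol_Z[where y = y and a = p and b = q]) (use h(3) y p q in auto)
qed

lemma sol_OTZ: "On I1 D1 \<Longrightarrow> Tw I2 D2 \<Longrightarrow> Zd I3 D3 \<Longrightarrow> sol3 I1 D1 I2 D2 I3 D3"
proof -
  assume h: "On I1 D1" "Tw I2 D2" "Zd I3 D3"
  obtain a c where 1: "a < 4" "c < 4" "a \<noteq> c" "\<forall>e<4. e \<noteq> a \<and> e \<noteq> c \<longrightarrow> I1 e a" using OnE[OF h(1)] .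
  obtain t where 2: "\<forall>e<4. e \<noteq> t \<longrightarrow> (\<exists>y<4. y \<noteq> e \<and> I2 e y)" using TwE[OF h(2)] .
  obtain y :: nat where y: "y < 4" "y \<notin> {a, c, t}" using fresh3 by blast
  obtain p where p: "p < 4" "p \<noteq> y" "I2 y p" using 2[rule_format, of y] y by auto
  have "I1 y a" "a \<noteq> y" using 1(4)[rule_format, of y] y by auto
  then show ?thesis by (intro sol_Z[where y = y and a = a and b = p]) (use h(3) y p 1 in auto)
qed

lemma sol_FZZ: "Fr I1 D1 \<Longrightarrow> Zd I2 D2 \<Longrightarrow> Zd I3 D3 \<Longrightarrow> sol3 I1 D1 I2 D2 I3 D3"
proof -
  assume h: "Fr I1 D1" "Zd I2 D2" "Zd I3 D3"
  \<comment> \<open>The color of the vertex is arbitrary, since \<open>Fr\<close> and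
    \<open>Zd\<close> speak about every color.\<close>
  have "(0::nat) < 4" by simp
  obtain p where p: "p < 4" "p \<noteq> 0" "I1 0 p" using FrE[OF h(1) \<open>0 < 4\<close>] .
  consider (i) q where "q < 4" "q \<noteq> 0" "I2 0 q" | (o) "\<forall>d<4. d \<noteq> 0 \<longrightarrow> D2 d 0" using h(2) unfolding Zd_def by force
  then show ?thesis
  proof cases
    case i
    show ?thesis by (rule sol_Z[where y = 0 and a = p and b = q]) (use h(3) p i in auto)
  next
    case o
    consider (i) q where "q < 4" "q \<noteq> 0" "I3 0 q" | (o') "\<forall>d<4. d \<noteq> 0 \<longrightarrow> D3 d 0" using h(3) unfolding Zd_def by force
    then show ?thesis
    proof cases
      case i
      obtain d :: nat where d: "d < 4" "d \<notin> {0, p, q}" using fresh3 by blast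
      then have "D2 d 0" using o by auto
      then show ?thesis unfolding sol3_def by (intro sol_exI[of _ 0 p d q]) (use p i d in auto)
    next
      case o'
      obtain d :: nat where d: "d < 4" "d \<notin> {0, p}" using fresh2 by blast
      obtain d' :: nat where d': "d' < 4" "d' \<notin> {0, p, d}" using fresh3 by blast
      have "D2 d 0" "D3 d' 0" using o o' d d' by auto
      then show ?thesis unfolding sol3_def by (intro sol_exI[of _ 0 p d d']) (use p d d' in auto)
    qed
  qed
qed

text \<open>The vertex takes a color \<open>e\<close> offered by the colored end, whose color
  \<open>c\<close> is then forbidden to the other branches. \<open>SF\<close> excludes one further
  color \<open>s\<close>; if the second branch has to come first, it takes \<open>s\<close> when
  possible, which leaves a color to the first branch.\<close>

lemma sol_SAT: "SF I1 D1 \<Longrightarrow> Alt I2 D2 \<Longrightarrow> Tm I3 D3 \<Longrightarrow> sol3 I1 D1 I2 D2 I3 D3"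
proof -
  assume h: "SF I1 D1" "Alt I2 D2" "Tm I3 D3"
  obtain e c where e: "e < 4" "c < 4" "e \<noteq> c" "D3 c e" using h(3) unfolding Tm_def by blast
  obtain s where s: "\<And>p. p < 4 \<Longrightarrow> p \<notin> {e, s} \<Longrightarrow> I1 e p" by (rule SFE[OF h(1) e(1)]) (rule that; blast)
  consider (i) q where "q < 4" "q \<notin> {e, c}" "I2 e q" | (o) "\<forall>q<4. q \<notin> {e, c} \<longrightarrow> D2 q e"
    using h(2)[unfolded Alt_def, rule_format, of e c] e by auto
  then show ?thesis
  proof cases
    case i
    obtain p :: nat where p: "p < 4" "p \<notin> {e, s, c}" using fresh3 by blast
    then have "I1 e p" using s by auto
    then show ?thesis unfolding sol3_def by (intro sol_exI[of _ e p q c]) (use e i p in auto)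
  next
    case o
    obtain q where q: "q < 4" "q \<notin> {e, c}" "s < 4 \<Longrightarrow> s \<notin> {e, c} \<Longrightarrow> q = s"
    proof (cases "s < 4 \<and> s \<notin> {e, c}")
      case True
      then show ?thesis using that[of s] by auto
    next
      case False
      obtain q :: nat where "q < 4" "q \<notin> {e, c}" using fresh2 by blast
      then show ?thesis using that[of q] False by auto
    qed
    obtain p :: nat where p: "p < 4" "p \<notin> {e, c, q}" using fresh3 by blast
    have "p \<noteq> s" using p q(3) by auto
    then have "I1 e p" using s p by auto
    moreover have "D2 q e" using o q by auto
    ultimately show ?thesis unfolding sol3_def by (intro sol_exI[of _ e p q c]) (use e p q in auto)
  qed
qed

text \<open>A color outside \<open>a\<close>, \<open>c\<close>, \<open>a1\<close>, \<open>a2\<close>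
  serves at once. Otherwise these are all colors, and the vertex takes \<open>a1\<close> or
  \<open>a2\<close>, with the leg for which that color is exceptional colored first.\<close>

lemma sol_OLL: "On I1 D1 \<Longrightarrow> L2 I2 D2 \<Longrightarrow> L2 I3 D3 \<Longrightarrow> sol3 I1 D1 I2 D2 I3 D3"
proof -
  assume h: "On I1 D1" "L2 I2 D2" "L2 I3 D3"
  obtain a c where o: "a < 4" "c < 4" "a \<noteq> c" "\<forall>e<4. e \<noteq> a \<and> e \<noteq> c \<longrightarrow> I1 e a" using OnE[OF h(1)] .
  obtain a1 c1 where h1: "a1 < 4" "c1 < 4" "a1 \<noteq> c1" "\<forall>e<4. \<forall>p<4. e \<noteq> a1 \<and> p \<notin> {a1, c1, e} \<longrightarrow> I2 e p"
    "\<forall>p<4. \<forall>e<4. p \<notin> {a1, c1} \<and> e \<noteq> p \<longrightarrow> D2 p e" using L2E[OF h(2)] .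
  obtain a2 c2 where h2: "a2 < 4" "c2 < 4" "a2 \<noteq> c2" "\<forall>e<4. \<forall>p<4. e \<noteq> a2 \<and> p \<notin> {a2, c2, e} \<longrightarrow> I3 e p"
    "\<forall>p<4. \<forall>e<4. p \<notin> {a2, c2} \<and> e \<noteq> p \<longrightarrow> D3 p e" using L2E[OF h(3)] .
  show ?thesis
  proof (cases "\<exists>y<4. y \<notin> {a, c, a1, a2}")
    case True
    then obtain y where y: "y < 4" "y \<notin> {a, c, a1, a2}" by blast
    obtain p :: nat where p: "p < 4" "p \<notin> {a1, c1, y}" using fresh3 by blast
    obtain q :: nat where q: "q < 4" "q \<notin> {a2, c2, y}" using fresh3 by blast
    have "I1 y a" "I2 y p" "I3 y q" using o(4)[rule_format, of y] h1(4)[rule_format, of y p] h2(4)[rule_format, of y q] y p q by auto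
    then show ?thesis unfolding sol3_def by (intro sol_exI[of _ y a p q]) (use o y p q in auto)
  next
    case False
    note A = all4[OF False]
    obtain b :: nat where b: "b < 4" "b \<notin> {a1, c1, a}" using fresh3 by blast
    have I1: "I1 a1 a" "I1 a2 a" using o(4)[rule_format, of a1] o(4)[rule_format, of a2] h1(1) h2(1) A(1) by auto
    have Db: "D2 b a1" using h1(5)[rule_format, of b a1] b h1(1) by auto
    show ?thesis
    proof (cases "\<exists>q<4. q \<notin> {a2, c2, a1, b}")
      case True
      then obtain q where q: "q < 4" "q \<notin> {a2, c2, a1, b}" by blast
      have "I3 a1 q" using h2(4)[rule_format, of a1 q] h1(1) q A(1) by auto
      then show ?thesis unfolding sol3_def by (intro sol_exI[of _ a1 a b q]) (use o h1(1) I1 Db b q A(1) in auto)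
    next
      case False
      note C = all4[OF False]
      have bc: "b = c" using A(2)[OF b(1)] b(2) C(1) by auto
      have ca: "c2 = a" using A(2)[OF h2(2)] C(1) bc by auto
      have "I2 a2 b" using h1(4)[rule_format, of a2 b] h2(1) b A(1) C(1) by auto
      moreover have "D3 a1 a2" using h2(5)[rule_format, of a1 a2] h1(1) h2(1) A(1) ca by auto
      ultimately show ?thesis unfolding sol3_def
        by (intro sol_exI[of _ a2 a b a1]) (use o h1(1) h2(1) I1 b A(1) C(1) bc in auto)
    qed
  qed
qed

section \<open>Color relations realized in the graph\<close>

context sparse4
begin

lemma has_depth: "has v x i P \<Longrightarrow> i \<le> j \<Longrightarrow> has v x j P"
proof -
  assume h: "has v x i P" "i \<le> j"
  have "br v x j B F" if b: "br v x i B F" for B F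
  proof -
    have "\<exists>p. nbw E (v # x # p) \<and> last (x # p) = u \<and> length p < j" if "u \<in> B" for u
      using b that h(2) unfolding br_def by (meson less_le_trans)
    moreover have "\<exists>p. nbw E (v # x # p) \<and> last (x # p) = u \<and> length p \<le> j" if "u \<in> F" for u
      using b that h(2) unfolding br_def by (meson le_trans)
    ultimately show ?thesis using b unfolding br_def by simp
  qed
  then show ?thesis using h(1) unfolding has_def by blast
qed

text \<open>A colored neighbor is a branch of depth zero without inner vertices. Its own color and
  two out-neighbors leave at least one of four colors, which is all that \<open>Tm\<close>
  demands.\<close>

lemma has_end:
  assumes "z \<in> nb E W x"
  shows "has x z 0 Tm"
proof -
  have "Tm (inn R c A x z {}) (out R c A x z {})" if g: "col R c A" "R \<subseteq> W" "{z} \<subseteq> R" for R c A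
  proof -
    have zR: "z \<in> R" using g(3) by simp
    obtain a where a: "a \<in> A z" using avail(4)[OF g(1,2) zR] by blast
    then have "a < 4" "a \<noteq> c z" using avail(1,2)[OF g(1,2) zR] by auto
    moreover have "out R c A x z {} (c z) a" unfolding out_def
    proof (intro conjI allI impI, use zR in simp, elim conjE)
      fix R' c' A' assume e: "ext R c A R' c' A'"
      have "c' z = c z" "A' z = A z" using ext_eq[OF e zR] by auto
      moreover have "ext R' c' A' R' c' A'" using e by (intro ext_refl) (auto simp: ext_def)
      ultimately show "\<exists>c'' A''. ext R' c' A' (R' \<union> {}) c'' A'' \<and> c'' z = c z \<and> a \<in> A'' z" using a by auto
    qed
    ultimately show ?thesis using avail(3)[OF g(1,2) zR] unfolding Tm_def by blast
  qed
  then show ?thesis using br_end[OF assms] unfolding has_def by blast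
qed

lemma has_unary:
  assumes x: "x \<in> nb E W v" "v \<in> W" and n: "nb E W x = {v, w}" "w \<noteq> v" and h: "has x w i P" and i: "i \<le> 10"
    and Q: "\<And>I D I' D'. P I D \<Longrightarrow> uni I D I' D' \<Longrightarrow> Q I' D'"
  shows "has v x (Suc i) Q"
proof -
  obtain B F where b: "br x w i B F" and P: "\<And>R c A. col R c A \<Longrightarrow> R \<subseteq> W \<Longrightarrow> F \<subseteq> R \<Longrightarrow> R \<inter> B = {} \<Longrightarrow> x \<notin> R
     \<Longrightarrow> P (inn R c A x w B) (out R c A x w B)" using h unfolding has_def by blast
  have C: "nb E W x - {v} = {w}" using n by auto
  have br': "br v x (Suc i) (insert x B) F"
    using br_grow(1)[OF x i, of "\<lambda>_. i" "\<lambda>_. B" "\<lambda>_. F"] b unfolding C by simp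
  have vB: "v \<notin> B" using br_grow(2)[OF x i, of "\<lambda>_. i" "\<lambda>_. B" "\<lambda>_. F" w] b unfolding C by simp
  have xB: "x \<notin> B" using b unfolding br_def by blast
  have "Q (inn R c A v x (insert x B)) (out R c A v x (insert x B))"
    if r: "col R c A" "R \<subseteq> W" "F \<subseteq> R" "R \<inter> insert x B = {}" for R c A
  proof (rule Q)
    show "P (inn R c A x w B) (out R c A x w B)" by (rule P) (use r in auto)
    have S: "insert x (\<Union> ((\<lambda>_. B) ` (nb E W x - {v}))) = insert x B" unfolding C by simp
    show "uni (inn R c A x w B) (out R c A x w B) (inn R c A v x (insert x B)) (out R c A v x (insert x B))"
      unfolding uni_def
    proof (intro allI impI conjI, elim conjE)
      fix y e p :: nat assume "y < 4" "e < 4" "y \<noteq> e" "p < 4" "inn R c A x w B y p" "p \<noteq> y" "p \<noteq> e"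
      then show "inn R c A v x (insert x B) e y"
        using grow_inn[OF x, of "{}" "{w}" y e R c A "\<lambda>_. B" "\<lambda>_. 0" "\<lambda>_. p"] C xB vB unfolding S by simp
    next
      fix y e p :: nat assume "y < 4" "e < 4" "y \<noteq> e" "p < 4" "out R c A x w B p y \<and> p \<noteq> e"
      then show "inn R c A v x (insert x B) e y"
        using grow_inn[OF x, of "{w}" "{}" y e R c A "\<lambda>_. B" "\<lambda>_. p" "\<lambda>_. 0"] C xB vB unfolding S by simp
    next
      fix y e p :: nat assume "y < 4" "e < 4" "y \<noteq> e" "p < 4" "inn R c A x w B y p \<and> p \<noteq> y"
      then show "out R c A v x (insert x B) y e"
        using grow_out[OF x, of "{}" "{w}" "\<lambda>_. 0" y e R c A "\<lambda>_. B" "\<lambda>_. p"] C xB vB unfolding S by simp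
    next
      fix y e p :: nat assume "y < 4" "e < 4" "y \<noteq> e" "p < 4" "out R c A x w B p y \<and> p \<noteq> e"
      then show "out R c A v x (insert x B) y e"
        using grow_out[OF x, of "{w}" "{}" "\<lambda>_. p" y e R c A "\<lambda>_. B" "\<lambda>_. 0"] C xB vB unfolding S by simp
    qed
  qed
  then show ?thesis using br' unfolding has_def by blast
qed

lemma has_binary:
  assumes x: "x \<in> nb E W v" "v \<in> W" and n: "nb E W x = {v, w1, w2}" "distinct [v, w1, w2]"
    and h: "has x w1 i1 P1" "has x w2 i2 P2" and i: "i1 \<le> i" "i2 \<le> i" "i \<le> 10" "i1 + i2 \<le> 11"
    and Q: "\<And>I1 D1 I2 D2 I' D'. P1 I1 D1 \<Longrightarrow> P2 I2 D2 \<Longrightarrow> bin I1 D1 I2 D2 I' D' \<Longrightarrow> Q I' D'"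
  shows "has v x (Suc i) Q"
proof -
  obtain B1 F1 where b1: "br x w1 i1 B1 F1" and P1: "\<And>R c A. col R c A \<Longrightarrow> R \<subseteq> W \<Longrightarrow> F1 \<subseteq> R \<Longrightarrow> R \<inter> B1 = {} \<Longrightarrow> x \<notin> R
     \<Longrightarrow> P1 (inn R c A x w1 B1) (out R c A x w1 B1)" using h(1) unfolding has_def by blast
  obtain B2 F2 where b2: "br x w2 i2 B2 F2" and P2: "\<And>R c A. col R c A \<Longrightarrow> R \<subseteq> W \<Longrightarrow> F2 \<subseteq> R \<Longrightarrow> R \<inter> B2 = {} \<Longrightarrow> x \<notin> R
     \<Longrightarrow> P2 (inn R c A x w2 B2) (out R c A x w2 B2)" using h(2) unfolding has_def by blast
  have C: "nb E W x - {v} = {w1, w2}" "w1 \<noteq> w2" using n by auto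
  let ?B = "\<lambda>w. if w = w1 then B1 else B2" and ?F = "\<lambda>w. if w = w1 then F1 else F2" and ?k = "\<lambda>w. if w = w1 then i1 else i2"
  have brw: "br x w (?k w) (?B w) (?F w) \<and> ?k w \<le> i" if "w \<in> nb E W x - {v}" for w
    using that b1 b2 i C unfolding C(1) by auto
  have s: "?k w + ?k w' \<le> 11" if "w \<in> nb E W x - {v}" "w' \<in> nb E W x - {v}" "w \<noteq> w'" for w w'
    using that i(4) C(2) unfolding C(1) by auto
  have S: "insert x (\<Union> (?B ` (nb E W x - {v}))) = insert x (B1 \<union> B2)" "\<Union> (?F ` (nb E W x - {v})) = F1 \<union> F2"
    unfolding C(1) using C(2) by auto
  have br': "br v x (Suc i) (insert x (B1 \<union> B2)) (F1 \<union> F2)" using br_grow(1)[OF x i(3) brw s] unfolding S .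
  have vB: "v \<notin> B1" "v \<notin> B2" using br_grow(2)[OF x i(3) brw s, of w1] br_grow(2)[OF x i(3) brw s, of w2] C n by auto
  have xB: "x \<notin> B1" "x \<notin> B2" using b1 b2 unfolding br_def by blast+
  have B12: "B1 \<inter> B2 = {}" using br_apart(1)[OF b1 b2 C(2) i(4)] .
  have B21: "B2 \<inter> B1 = {}" using B12 by blast
  have "Q (inn R c A v x (insert x (B1 \<union> B2))) (out R c A v x (insert x (B1 \<union> B2)))"
    if r: "col R c A" "R \<subseteq> W" "F1 \<union> F2 \<subseteq> R" "R \<inter> insert x (B1 \<union> B2) = {}" for R c A
  proof (rule Q)
    show "P1 (inn R c A x w1 B1) (out R c A x w1 B1)" by (rule P1) (use r in auto)
    show "P2 (inn R c A x w2 B2) (out R c A x w2 B2)" by (rule P2) (use r in auto)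
    have nn: "w2 \<noteq> w1" using C(2) by simp
    have PI: "{} \<union> {w1, w2} = {w1, w2}" "{w1} \<union> {w2} = {w1, w2}" "{w2} \<union> {w1} = {w1, w2}" "{w1, w2} \<union> {} = {w1, w2}" by auto
    show "bin (inn R c A x w1 B1) (out R c A x w1 B1) (inn R c A x w2 B2) (out R c A x w2 B2)
      (inn R c A v x (insert x (B1 \<union> B2))) (out R c A v x (insert x (B1 \<union> B2)))"
      unfolding bin_def
    proof (intro allI impI conjI; elim conjE)
      fix y e a b :: nat assume k: "y < 4" "e < 4" "a < 4" "b < 4" "y \<noteq> e"
      let ?f = "\<lambda>w. if w = w1 then a else b"
      { assume t: "inn R c A x w1 B1 y a" "inn R c A x w2 B2 y b" "a \<notin> {y, e}" "b \<notin> {y, e}"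
        show "inn R c A v x (insert x (B1 \<union> B2)) e y"
          by (rule grow_inn[OF x, of "{}" "{w1, w2}" y e R c A ?B ?f ?f, unfolded S])
            (use k t C nn xB vB B12 B21 in \<open>auto simp: PI\<close>) }
      { assume t: "out R c A x w1 B1 a y" "inn R c A x w2 B2 y b" "a \<noteq> e" "b \<notin> {y, e, a}"
        show "inn R c A v x (insert x (B1 \<union> B2)) e y"
          by (rule grow_inn[OF x, of "{w1}" "{w2}" y e R c A ?B ?f ?f, unfolded S])
            (use k t C nn xB vB B12 B21 in \<open>auto simp: PI\<close>) }
      { assume t: "inn R c A x w1 B1 y a" "out R c A x w2 B2 b y" "b \<noteq> e" "a \<notin> {y, e, b}"
        show "inn R c A v x (insert x (B1 \<union> B2)) e y"
          by (rule grow_inn[OF x, of "{w2}" "{w1}" y e R c A ?B ?f ?f, unfolded S])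
            (use k t C nn xB vB B12 B21 in \<open>auto simp: PI\<close>) }
      { assume t: "inn R c A x w1 B1 y a" "inn R c A x w2 B2 y b" "a \<noteq> y" "b \<noteq> y"
        show "out R c A v x (insert x (B1 \<union> B2)) y e"
          by (rule grow_out[OF x, of "{}" "{w1, w2}" ?f y e R c A ?B ?f, unfolded S])
            (use k t C nn xB vB B12 B21 in \<open>auto simp: PI\<close>) }
      { assume t: "out R c A x w1 B1 a y" "inn R c A x w2 B2 y b" "a \<noteq> e" "b \<notin> {y, a}"
        show "out R c A v x (insert x (B1 \<union> B2)) y e"
          by (rule grow_out[OF x, of "{w1}" "{w2}" ?f y e R c A ?B ?f, unfolded S])
            (use k t C nn xB vB B12 B21 in \<open>auto simp: PI\<close>) }
      { assume t: "inn R c A x w1 B1 y a" "out R c A x w2 B2 b y" "b \<noteq> e" "a \<notin> {y, b}"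
        show "out R c A v x (insert x (B1 \<union> B2)) y e"
          by (rule grow_out[OF x, of "{w2}" "{w1}" ?f y e R c A ?B ?f, unfolded S])
            (use k t C nn xB vB B12 B21 in \<open>auto simp: PI\<close>) }
      { assume t: "out R c A x w1 B1 a y" "out R c A x w2 B2 b y" "a \<noteq> b" "a \<noteq> e" "b \<noteq> e"
        show "out R c A v x (insert x (B1 \<union> B2)) y e"
          by (rule grow_out[OF x, of "{w1, w2}" "{}" ?f y e R c A ?B ?f, unfolded S])
            (use k t C nn xB vB B12 B21 in \<open>auto simp: PI\<close>) }
    qed
  qed
  then show ?thesis using br' unfolding has_def by blast
qed

text \<open>All branches are colored after \<open>v\<close>. Each branch in \<open>T\<close> spoils
  one color of \<open>v\<close>, so three of them leave a color.\<close>

lemma root_in: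
  assumes v: "v \<in> W" and T: "T \<subseteq> nb E W v" "card T \<le> 3" and k: "sums11 (nb E W v) k"
    and h: "\<And>x. x \<in> T \<Longrightarrow> has v x (k x) Tw" "\<And>x. x \<in> nb E W v - T \<Longrightarrow> has v x (k x) Fr"
  shows colorable
proof (rule root_color[OF v _ k, of "\<lambda>x. if x \<in> T then Tw else Fr"])
  show "has v x (k x) (if x \<in> T then Tw else Fr)" if "x \<in> nb E W v" for x using h that by auto
  fix J D assume Q: "\<And>x. x \<in> nb E W v \<Longrightarrow> (if x \<in> T then Tw else Fr) (J x) (D x :: crel)"
  have fT: "finite T" using T(1) finite_nb[OF fin] finite_subset by blast
  have "\<forall>x\<in>T. \<exists>t. \<forall>e<4. e \<noteq> t \<longrightarrow> (\<exists>y<4. y \<noteq> e \<and> J x e y)"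
  proof
    fix x assume x: "x \<in> T"
    then have "Tw (J x) (D x)" using Q[of x] T(1) by auto
    then show "\<exists>t. \<forall>e<4. e \<noteq> t \<longrightarrow> (\<exists>y<4. y \<noteq> e \<and> J x e y)" unfolding Tw_def .
  qed
  then obtain t where t: "\<forall>x\<in>T. \<forall>e<4. e \<noteq> t x \<longrightarrow> (\<exists>y<4. y \<noteq> e \<and> J x e y)" by (rule bchoice[THEN exE])
  have "card (t ` T) < card {..<4::nat}" using card_image_le[OF fT, of t] T(2) by simp
  then have "\<not> {..<4} \<subseteq> t ` T" using card_mono[of "t ` T" "{..<4}"] fT by fastforce
  then obtain y where y: "y < 4" "y \<notin> t ` T" by blast
  have "\<forall>x\<in>nb E W v. \<exists>p. p < 4 \<and> p \<noteq> y \<and> J x y p"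
  proof
    fix x assume x: "x \<in> nb E W v"
    show "\<exists>p. p < 4 \<and> p \<noteq> y \<and> J x y p"
    proof (cases "x \<in> T")
      case True
      then show ?thesis using t y by blast
    next
      case False
      then have "Fr (J x) (D x)" using Q[OF x] by simp
      then show ?thesis using FrE[OF _ y(1)] by blast
    qed
  qed
  then obtain f where "\<forall>x\<in>nb E W v. f x < 4 \<and> f x \<noteq> y \<and> J x y (f x)" by (rule bchoice[THEN exE])
  then show "\<exists>y P g f. y < 4 \<and> P \<subseteq> nb E W v \<and> card P \<le> 2 \<and> inj_on g P \<and> (\<forall>x\<in>P. D x (g x) y)
        \<and> (\<forall>x\<in>nb E W v - P. J x y (f x) \<and> f x < 4 \<and> f x \<noteq> y \<and> f x \<notin> g ` P)"
    using y(1) by (intro exI[of _ y] exI[of _ "{}"] exI[of _ f]) auto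
qed

text \<open>\<open>v\<close> takes a color \<open>e\<close> offered by its neighbor
  \<open>z\<close>, which is treated as a colored end of color \<open>c\<close>. An
  \<open>SF\<close> branch excludes \<open>e\<close> and one more color; avoiding \<open>c\<close>
  too still leaves one of four.\<close>

lemma root_end:
  assumes v: "v \<in> W" and z: "z \<in> nb E W v" and k: "sums11 (nb E W v - {z}) k" "\<And>x. x \<in> nb E W v - {z} \<Longrightarrow> k x \<le> 11"
    and h: "\<And>x. x \<in> nb E W v - {z} \<Longrightarrow> has v x (k x) SF"
  shows colorable
proof (rule root_color[OF v, of "k(z := 0)" "\<lambda>x. if x = z then Tm else SF"])
  show "has v x ((k(z := 0)) x) (if x = z then Tm else SF)" if "x \<in> nb E W v" for x using h has_end that by auto
  show "sums11 (nb E W v) (k(z := 0))" using k unfolding sums11_def by auto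
  fix J D assume Q: "\<And>x. x \<in> nb E W v \<Longrightarrow> (if x = z then Tm else SF) (J x) (D x :: crel)"
  have "Tm (J z) (D z)" using Q[OF z] by simp
  then obtain e c where e: "e < 4" "c < 4" "e \<noteq> c" "D z c e" unfolding Tm_def by blast
  have "\<forall>x\<in>nb E W v - {z}. \<exists>p. p < 4 \<and> p \<noteq> e \<and> p \<noteq> c \<and> J x e p"
  proof
    fix x assume x: "x \<in> nb E W v - {z}"
    then have "SF (J x) (D x)" using Q[of x] by auto
    then obtain s where s: "\<And>p. p < 4 \<Longrightarrow> p \<notin> {e, s} \<Longrightarrow> J x e p" by (rule SFE[OF _ e(1)]) (rule that; blast)
    obtain p :: nat where p: "p < 4" "p \<notin> {e, s, c}" using fresh3 by blast
    then have "J x e p" using s by auto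
    then show "\<exists>p. p < 4 \<and> p \<noteq> e \<and> p \<noteq> c \<and> J x e p" using p by auto
  qed
  then obtain f where f: "\<forall>x\<in>nb E W v - {z}. f x < 4 \<and> f x \<noteq> e \<and> f x \<noteq> c \<and> J x e (f x)" by (rule bchoice[THEN exE])
  have "e < 4 \<and> {z} \<subseteq> nb E W v \<and> card {z} \<le> 2 \<and> inj_on (\<lambda>_. c) {z} \<and> (\<forall>x\<in>{z}. D x c e)
        \<and> (\<forall>x\<in>nb E W v - {z}. J x e (f x) \<and> f x < 4 \<and> f x \<noteq> e \<and> f x \<notin> (\<lambda>_. c) ` {z})"
    using e z f by auto
  then show "\<exists>y P g f. y < 4 \<and> P \<subseteq> nb E W v \<and> card P \<le> 2 \<and> inj_on g P \<and> (\<forall>x\<in>P. D x (g x) y)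
        \<and> (\<forall>x\<in>nb E W v - P. J x y (f x) \<and> f x < 4 \<and> f x \<noteq> y \<and> f x \<notin> g ` P)" by blast
qed

lemma root3:
  assumes v: "v \<in> W" and n: "nb E W v = {x1, x2, x3}" "distinct [x1, x2, x3]"
    and h: "has v x1 k1 P1" "has v x2 k2 P2" "has v x3 k3 P3" and k: "k1 + k2 \<le> 11" "k1 + k3 \<le> 11" "k2 + k3 \<le> 11"
    and sol: "\<And>I1 D1 I2 D2 I3 D3. P1 I1 D1 \<Longrightarrow> P2 I2 D2 \<Longrightarrow> P3 I3 D3 \<Longrightarrow> sol3 I1 D1 I2 D2 I3 D3"
  shows colorable
proof (rule root_color[OF v, of "\<lambda>x. if x = x1 then k1 else if x = x2 then k2 else k3" "\<lambda>x. if x = x1 then P1 else if x = x2 then P2 else P3"])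
  have d: "x1 \<noteq> x2" "x1 \<noteq> x3" "x2 \<noteq> x3" "x2 \<noteq> x1" "x3 \<noteq> x1" "x3 \<noteq> x2" using n(2) by auto
  show "has v x (if x = x1 then k1 else if x = x2 then k2 else k3) (if x = x1 then P1 else if x = x2 then P2 else P3)"
    if "x \<in> nb E W v" for x using that h d unfolding n(1) by auto
  show "sums11 (nb E W v) (\<lambda>x. if x = x1 then k1 else if x = x2 then k2 else k3)"
    using k d unfolding n(1) sums11_def by auto
  fix J D assume Q: "\<And>x. x \<in> nb E W v \<Longrightarrow> (if x = x1 then P1 else if x = x2 then P2 else P3) (J x) (D x :: crel)"
  have "P1 (J x1) (D x1)" "P2 (J x2) (D x2)" "P3 (J x3) (D x3)" using Q[of x1] Q[of x2] Q[of x3] d unfolding n(1) by auto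
  then have "sol3 (J x1) (D x1) (J x2) (D x2) (J x3) (D x3)" by (rule sol)
  then obtain y a b c where y: "y < 4" "a < 4" "b < 4" "c < 4" and alt:
     "(J x1 y a \<and> J x2 y b \<and> J x3 y c \<and> a \<noteq> y \<and> b \<noteq> y \<and> c \<noteq> y) \<or>
     (J x1 y a \<and> J x2 y b \<and> D x3 c y \<and> a \<notin> {y, c} \<and> b \<notin> {y, c}) \<or>
     (J x1 y a \<and> D x2 b y \<and> J x3 y c \<and> a \<notin> {y, b} \<and> c \<notin> {y, b}) \<or>
     (J x1 y a \<and> D x2 b y \<and> D x3 c y \<and> b \<noteq> c \<and> a \<notin> {y, b, c})" unfolding sol3_def by blast
  let ?f = "\<lambda>x. if x = x1 then a else if x = x2 then b else c"
  have ex: "\<exists>y P g f. y < 4 \<and> P \<subseteq> nb E W v \<and> card P \<le> 2 \<and> inj_on g P \<and> (\<forall>x\<in>P. D x (g x) y)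
        \<and> (\<forall>x\<in>nb E W v - P. J x y (f x) \<and> f x < 4 \<and> f x \<noteq> y \<and> f x \<notin> g ` P)"
    if "P \<subseteq> {x2, x3}" "inj_on ?f P" "\<forall>x\<in>P. D x (?f x) y" "\<forall>x\<in>{x1, x2, x3} - P. J x y (?f x) \<and> ?f x < 4 \<and> ?f x \<noteq> y \<and> ?f x \<notin> ?f ` P" for P
  proof -
    have "card P \<le> card {x2, x3}" using that(1) by (intro card_mono) auto
    then have "card P \<le> 2" using d by simp
    then show ?thesis unfolding n(1) using that y(1) by (intro exI[of _ y] exI[of _ P] exI[of _ ?f]) blast
  qed
  from alt show "\<exists>y P g f. y < 4 \<and> P \<subseteq> nb E W v \<and> card P \<le> 2 \<and> inj_on g P \<and> (\<forall>x\<in>P. D x (g x) y)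
        \<and> (\<forall>x\<in>nb E W v - P. J x y (f x) \<and> f x < 4 \<and> f x \<noteq> y \<and> f x \<notin> g ` P)"
  proof (elim disjE)
    assume "J x1 y a \<and> J x2 y b \<and> J x3 y c \<and> a \<noteq> y \<and> b \<noteq> y \<and> c \<noteq> y"
    then show ?thesis by (intro ex[of "{}"]) (use y d in auto)
  next
    assume "J x1 y a \<and> J x2 y b \<and> D x3 c y \<and> a \<notin> {y, c} \<and> b \<notin> {y, c}"
    then show ?thesis by (intro ex[of "{x3}"]) (use y d in auto)
  next
    assume "J x1 y a \<and> D x2 b y \<and> J x3 y c \<and> a \<notin> {y, b} \<and> c \<notin> {y, b}"
    then show ?thesis by (intro ex[of "{x2}"]) (use y d in auto)
  next
    assume "J x1 y a \<and> D x2 b y \<and> D x3 c y \<and> b \<noteq> c \<and> a \<notin> {y, b, c}"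
    then show ?thesis by (intro ex[of "{x2, x3}"]) (use y d in auto)
  qed
qed

end

section \<open>Four colors: discharging\<close>

locale min4 = sparse4 +
  assumes nc: "\<not> colorable"
begin

lemma deg_ge_2: "v \<in> W \<Longrightarrow> 2 \<le> deg v"
proof (rule ccontr)
  assume v: "v \<in> W" "\<not> 2 \<le> deg v"
  show False
  proof (cases "nb E W v = {}")
    case True
    then show False using root_in[OF v(1), of "{}" "\<lambda>_. 0"] nc by (simp add: sums11_def)
  next
    case False
    then have "deg v = 1" using v(2) finite_nb[OF fin, of E v] card_0_eq by fastforce
    then obtain z where z: "nb E W v = {z}" by (auto simp: card_1_singleton_iff)
    then show False using root_end[OF v(1), of z "\<lambda>_. 0"] nc by (simp add: sums11_def)
  qed
qed

definition nxt :: "'a \<Rightarrow> 'a \<Rightarrow> 'a" where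
  "nxt v x = (THE w. nb E W x = {v, w} \<and> w \<noteq> v)"

lemma nxt:
  assumes "v \<in> W" "x \<in> nb E W v" "deg x = 2"
  shows "nb E W x = {v, nxt v x}" "nxt v x \<noteq> v" "nxt v x \<in> nb E W x" "x \<in> nb E W (nxt v x)" "x \<in> W" "nxt v x \<in> W"
proof -
  have xW: "x \<in> W" using nb_in[OF assms(2)] .
  have vx: "v \<in> nb E W x" using nb_sym[OF sym assms(1,2)] .
  obtain w where w: "nb E W x = {v, w}" "w \<noteq> v" using card2_other[OF assms(3) vx] .
  have "nxt v x = w" unfolding nxt_def using w by (intro the_equality) (auto simp: doubleton_eq_iff)
  then show *: "nb E W x = {v, nxt v x}" "nxt v x \<noteq> v" "nxt v x \<in> nb E W x" using w by auto
  show "x \<in> W" "nxt v x \<in> W" "x \<in> nb E W (nxt v x)" using xW nb_in[OF *(3)] nb_sym[OF sym xW *(3)] .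
qed

text \<open>The number of consecutive vertices of degree two, starting with \<open>x\<close> and leading away from \<open>v\<close>, capped at 3.\<close>

definition len :: "'a \<Rightarrow> 'a \<Rightarrow> nat" where
  "len v x = (if deg x \<noteq> 2 then 0 else if deg (nxt v x) \<noteq> 2 then 1 else if deg (nxt x (nxt v x)) \<noteq> 2 then 2 else 3)"

lemma has_On:
  assumes "v \<in> W" "x \<in> nb E W v" "deg x = 2"
  shows "has v x 1 On"
proof -
  note n = nxt[OF assms]
  have "has v x (Suc 0) On" by (rule has_unary[OF assms(2,1) n(1,2) has_end[OF n(3)]]) (use uni_On in auto)
  then show ?thesis by simp
qed

lemma has_L2:
  assumes "v \<in> W" "x \<in> nb E W v" "deg x = 2" "deg (nxt v x) = 2"
  shows "has v x 2 L2"
proof -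
  note n = nxt[OF assms(1-3)]
  have "has x (nxt v x) 1 On" by (rule has_On[OF n(5,3) assms(4)])
  then have "has v x (Suc 1) L2" by (rule has_unary[OF assms(2,1) n(1,2)]) (use uni_L2 in auto)
  then show ?thesis by (simp add: numeral_2_eq_2)
qed

lemma has_SF:
  assumes "v \<in> W" "x \<in> nb E W v" "deg x = 2" "deg (nxt v x) = 2" "deg (nxt x (nxt v x)) = 2"
  shows "has v x 3 SF"
proof -
  note n = nxt[OF assms(1-3)]
  have "has x (nxt v x) 2 L2" by (rule has_L2[OF n(5,3) assms(4,5)])
  then have "has v x (Suc 2) SF" by (rule has_unary[OF assms(2,1) n(1,2)]) (use uni_SF[OF L2_Two] in auto)
  then show ?thesis by (simp add: numeral_3_eq_3 numeral_2_eq_2)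
qed

lemma len_cases:
  assumes "v \<in> W" "x \<in> nb E W v"
  obtains "len v x = 0" "3 \<le> deg x" | "len v x = 1" "deg x = 2" "3 \<le> deg (nxt v x)" "has v x 1 On"
    | "len v x = 2" "has v x 2 L2" "deg x = 2" | "len v x = 3" "has v x 3 SF" "has v x 2 L2" "deg x = 2"
proof (cases "deg x = 2")
  case False
  then show ?thesis using that(1) deg_ge_2[OF nb_in[OF assms(2)]] by (simp add: len_def)
next
  case x: True
  note n = nxt[OF assms x]
  show ?thesis
  proof (cases "deg (nxt v x) = 2")
    case False
    then show ?thesis using that(2) deg_ge_2[OF n(6)] x has_On[OF assms x] by (simp add: len_def)
  next
    case y: True
    show ?thesis
    proof (cases "deg (nxt x (nxt v x)) = 2")
      case False
      then show ?thesis using that(3) has_L2[OF assms x y] x y by (simp add: len_def)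
    next
      case True
      then show ?thesis using that(4) has_L2[OF assms x y] has_SF[OF assms x y True] x y by (simp add: len_def)
    qed
  qed
qed

text \<open>Otherwise \<open>root_end\<close> applies at \<open>v\<close>, with an \<open>SF\<close>
  branch on one side and the other neighbor as a colored end. So no four consecutive vertices have
  degree two, and the cap in \<open>len\<close> is harmless.\<close>

lemma no_four:
  assumes v: "v \<in> W" "deg v = 2" "x \<in> nb E W v"
  shows "len v x \<noteq> 3"
proof
  assume "len v x = 3"
  then have S: "has v x 3 SF" using len_cases[OF v(1,3)] by auto
  obtain z where z: "nb E W v = {x, z}" "z \<noteq> x" using card2_other[OF v(2,3)] .
  then have "nb E W v - {z} = {x}" by auto
  then show False using root_end[OF v(1), of z "\<lambda>_. 3"] S nc z(1) by (simp add: sums11_def)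
qed

lemma reverse0: "v \<in> W \<Longrightarrow> 3 \<le> deg v \<Longrightarrow> len x v = 0"
  by (simp add: len_def)

lemma reverse1:
  assumes "v \<in> W" "x \<in> nb E W v" "3 \<le> deg v" "deg x = 2"
  shows "nxt (nxt v x) x = v" "len (nxt v x) x = 1"
proof -
  note n = nxt[OF assms(1,2,4)]
  have "nb E W x = {nxt v x, nxt (nxt v x) x} \<and> nxt (nxt v x) x \<noteq> nxt v x" using nxt(1,2)[OF n(6,4) assms(4)] by blast
  then show *: "nxt (nxt v x) x = v" using n(1,2) by (auto simp: doubleton_eq_iff)
  show "len (nxt v x) x = 1" using * assms(3,4) by (simp add: len_def)
qed

definition tot :: "'a \<Rightarrow> nat" where
  "tot v = (\<Sum>x\<in>nb E W v. len v x)"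

text \<open>
  What \<open>v\<close> demands from the vertex at the end of the leg that starts with \<open>x\<close>: \<open>d1\<close> compensates the long legs
  of \<open>v\<close>, and \<open>d2\<close> the demand 6 that \<open>v\<close> itself meets at one of its legs.
\<close>

definition d1 :: "'a \<Rightarrow> 'a \<Rightarrow> int" where
  "d1 v x = (if deg v = 3 \<and> 4 \<le> tot v then (if len v x = 0 then 8 * int (tot v) - 28
     else if len v x = 1 \<and> (\<forall>x'\<in>nb E W v. len v x' \<noteq> 0) then 4 * int (tot v) - 14 else 0) else 0)"

text \<open>First-round demands reaching \<open>v\<close> through \<open>x\<close>, either from
  \<open>x\<close> itself or across a single vertex of degree two. They are kept apart from
  \<open>ex\<close> because \<open>d2\<close> reacts to them.\<close>

definition ex1 :: "'a \<Rightarrow> 'a \<Rightarrow> int" where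
  "ex1 v x = (if len v x = 0 then d1 x v else if len v x = 1 then d1 (nxt v x) x else 0)"

definition d2 :: "'a \<Rightarrow> 'a \<Rightarrow> int" where
  "d2 v x = (if deg v = 3 \<and> tot v = 3 \<and> (\<exists>x0\<in>nb E W v. x0 \<noteq> x \<and> len v x0 = 1 \<and> ex1 v x0 = 6
       \<and> (\<forall>x'\<in>nb E W v. x' \<noteq> x0 \<longrightarrow> ex1 v x' = 0))
     then (if len v x = 1 then 1 else if len v x = 0 then 2 else 0) else 0)"

definition dm :: "'a \<Rightarrow> 'a \<Rightarrow> int" where
  "dm v x = d1 v x + d2 v x"

definition ex :: "'a \<Rightarrow> 'a \<Rightarrow> int" where
  "ex v x = (if len v x = 0 then dm x v else if len v x = 1 then dm (nxt v x) x else 0)"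

lemma d1_nonneg: "0 \<le> d1 v x"
  by (simp add: d1_def)

lemma d2_nonneg: "0 \<le> d2 v x"
  by (simp add: d2_def)

lemma d_nonneg: "0 \<le> d1 v x" "0 \<le> d2 v x" "0 \<le> dm v x" "0 \<le> ex1 v x" "0 \<le> ex v x"
  using d1_nonneg d2_nonneg by (simp_all add: dm_def ex1_def ex_def)

lemma ex1_le: "ex1 v x \<le> ex v x"
  using d_nonneg(2) unfolding ex_def ex1_def dm_def by simp

lemma tot3:
  assumes "nb E W v = {a, b, c}" "distinct [a, b, c]"
  shows "tot v = len v a + len v b + len v c" "deg v = 3"
  using assms(2) unfolding tot_def assms(1) by simp_all

lemma three_of:
  assumes "v \<in> W" "deg v = 3" "a \<in> nb E W v"
  obtains b c where "nb E W v = {a, b, c}" "distinct [a, b, c]"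
proof -
  obtain x y z where xyz: "nb E W v = {x, y, z}" "x \<noteq> y" "x \<noteq> z" "y \<noteq> z" using assms(2) by (auto simp: card_3_iff)
  then consider "a = x" | "a = y" | "a = z" using assms(3) by auto
  then show ?thesis
  proof cases
    case 1 then show ?thesis using that[of y z] xyz by auto
  next
    case 2 then show ?thesis using that[of x z] xyz by auto
  next
    case 3 then show ?thesis using that[of x y] xyz by auto
  qed
qed

lemma red_two_SF:
  assumes "v \<in> W" "nb E W v = {a, b, c}" "distinct [a, b, c]" "len v a = 3" "len v b = 3"
  shows False
proof -
  have ab: "a \<in> nb E W v" "b \<in> nb E W v" using assms(2) by auto
  have "has v a 3 SF" "has v b 3 SF"
    using len_cases[OF assms(1) ab(1)] len_cases[OF assms(1) ab(2)] assms(4,5) by auto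
  moreover have "nb E W v - {c} = {a, b}" using assms(2,3) by auto
  ultimately show False using root_end[OF assms(1), of c "\<lambda>_. 3"] nc assms(2) by (auto simp: sums11_def)
qed

text \<open>The other two legs of \<open>x\<close> have lengths 3 and 2, 3 and 1, or 2 and 2, as 3
  and 3 is reducible. The first pair causes the demand 12, the others 4; the properties come from
  \<open>bin_Fr\<close>, \<open>bin_Tw\<close> and \<open>bin_Zd\<close>.\<close>

lemma d1_end:
  assumes v: "v \<in> W" "x \<in> nb E W v" "len v x = 0" "len x v = 0" and d: "d1 x v \<noteq> 0"
  shows "(d1 x v = 12 \<and> has v x 4 Fr \<and> has v x 4 Alt) \<or> (d1 x v = 4 \<and> (has v x 4 Tw \<or> has v x 3 Zd))"
proof -
  have x: "x \<in> W" "v \<in> nb E W x" using nb_in[OF v(2)] nb_sym[OF sym v(1,2)] .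
  have dx: "deg x = 3" "4 \<le> tot x" "d1 x v = 8 * int (tot x) - 28" using d v(4) unfolding d1_def by (auto split: if_splits)
  obtain p q where pq: "nb E W x = {v, p, q}" "distinct [v, p, q]" using three_of[OF x(1) dx(1) x(2)] .
  have s: "tot x = len x p + len x q" using tot3[OF pq] v(4) by simp
  have n: "p \<in> nb E W x" "q \<in> nb E W x" using pq by auto
  have pq': "nb E W x = {v, q, p}" "distinct [v, q, p]" "nb E W x = {p, q, v}" "distinct [p, q, v]" using pq by auto
  have F: "d1 x v = 12 \<and> has v x 4 Fr \<and> has v x 4 Alt"
    if "nb E W x = {v, p, q}" "distinct [v, p, q]" "has x p 3 SF" "has x q 2 L2" "tot x = 5" for p q
  proof -
    have "has v x (Suc 3) (\<lambda>I D. Fr I D \<and> Alt I D)"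
      by (rule has_binary[OF v(2,1) that(1-4)]) (use bin_Fr in auto)
    then have "has v x 4 (\<lambda>I D. Fr I D \<and> Alt I D)" by simp
    then show ?thesis using has_mono[of v x 4 _ Fr] has_mono[of v x 4 _ Alt] that(5) dx(3) by auto
  qed
  have T: "d1 x v = 4 \<and> has v x 4 Tw"
    if "nb E W x = {v, p, q}" "distinct [v, p, q]" "has x p 3 SF" "has x q 1 On" "tot x = 4" for p q
  proof -
    have "has v x (Suc 3) Tw" by (rule has_binary[OF v(2,1) that(1-4)]) (use bin_Tw in auto)
    then show ?thesis using that(5) dx(3) by simp
  qed
  have Z: "d1 x v = 4 \<and> has v x 3 Zd" if "has x p 2 L2" "has x q 2 L2" "tot x = 4"
  proof -
    have "has v x (Suc 2) Zd" by (rule has_binary[OF v(2,1) pq that(1,2)]) (use bin_Zd in auto)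
    then show ?thesis using that(3) dx(3) by simp
  qed
  show ?thesis
  proof (rule len_cases[OF x(1) n(1)]; rule len_cases[OF x(1) n(2)])
    assume "len x p = 3" "len x q = 3"
    then show ?thesis using red_two_SF[OF x(1) pq'(3,4)] by blast
  next
    assume "len x p = 3" "has x p 3 SF" "len x q = 2" "has x q 2 L2"
    then show ?thesis using F[OF pq] s by simp
  next
    assume "len x p = 3" "has x p 3 SF" "len x q = 1" "has x q 1 On"
    then show ?thesis using T[OF pq] s by simp
  next
    assume "len x p = 2" "has x p 2 L2" "len x q = 3" "has x q 3 SF"
    then show ?thesis using F[OF pq'(1,2)] s by simp
  next
    assume "len x p = 1" "has x p 1 On" "len x q = 3" "has x q 3 SF"
    then show ?thesis using T[OF pq'(1,2)] s by simp
  next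
    assume "len x p = 2" "has x p 2 L2" "len x q = 2" "has x q 2 L2"
    then show ?thesis using Z s by simp
  qed (use dx(2) s in simp_all)
qed

text \<open>The far vertex has a leg of length one towards \<open>v\<close> and two more legs.
  Lengths 3 and 1 cause the demand 6, lengths 2 and 1 the demand 2; longer pairs are reducible at
  the far vertex itself.\<close>

lemma d1_mid:
  assumes v: "v \<in> W" "x \<in> nb E W v" "len v x = 1" "3 \<le> deg v" and d: "d1 (nxt v x) x \<noteq> 0"
  shows "(d1 (nxt v x) x = 6 \<and> has v x 5 SF \<and> has v x 4 Fr) \<or> (d1 (nxt v x) x = 2 \<and> has v x 4 Fr \<and> has v x 4 Alt)"
proof -
  have dx: "deg x = 2" using v(3) by (auto simp: len_def split: if_splits)
  note n = nxt[OF v(1,2) dx]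
  let ?z = "nxt v x"
  have l1: "len ?z x = 1" using reverse1(2)[OF v(1,2,4) dx] .
  have dz: "deg ?z = 3" "4 \<le> tot ?z" "d1 ?z x = 4 * int (tot ?z) - 14" "\<forall>x'\<in>nb E W ?z. len ?z x' \<noteq> 0"
    using d l1 unfolding d1_def by (auto split: if_splits)
  obtain p q where pq: "nb E W ?z = {x, p, q}" "distinct [x, p, q]" using three_of[OF n(6) dz(1) n(4)] .
  have s: "tot ?z = 1 + len ?z p + len ?z q" using tot3[OF pq] l1 by simp
  have m: "p \<in> nb E W ?z" "q \<in> nb E W ?z" using pq by auto
  have nz: "len ?z p \<noteq> 0" "len ?z q \<noteq> 0" using dz(4) m by auto
  have pq': "nb E W ?z = {x, q, p}" "distinct [x, q, p]" "nb E W ?z = {p, q, x}" "distinct [p, q, x]" using pq by auto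
  have On: "has ?z x 1 On" using has_On[OF n(6,4) dx] .
  have up: "has v x (Suc i) Q" if "has x ?z i P" "i \<le> 10" "\<And>I D I' D'. P I D \<Longrightarrow> uni I D I' D' \<Longrightarrow> Q I' D'" for i P Q
    using has_unary[OF v(2,1) n(1,2) that(1,2)] that(3) by blast
  have xz: "?z \<in> nb E W x" using n(3) .
  have A: "has v x 4 (\<lambda>I D. Fr I D \<and> Alt I D)"
    if "nb E W ?z = {x, p, q}" "distinct [x, p, q]" "has ?z p 2 L2" "has ?z q 1 On" for p q
  proof -
    have "has x ?z (Suc 2) (\<lambda>I D. \<exists>I1 D1 I2 D2. L2 I1 D1 \<and> On I2 D2 \<and> bin I1 D1 I2 D2 I D)"
      by (rule has_binary[OF xz n(5) that(1-4)]) auto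
    then have "has v x (Suc (Suc 2)) (\<lambda>I D. Fr I D \<and> Alt I D)"
      by (rule up) (simp, elim exE conjE, rule bin_uni_Alt)
    then show ?thesis by (simp add: numeral_eq_Suc)
  qed
  have A2: "has v x 4 Fr \<and> has v x 4 Alt"
    if "nb E W ?z = {x, p, q}" "distinct [x, p, q]" "has ?z p 2 L2" "has ?z q 1 On" for p q
    using has_mono[OF A[OF that], of Fr] has_mono[OF A[OF that], of Alt] by blast
  have S: "has v x 5 SF"
    if "nb E W ?z = {x, p, q}" "distinct [x, p, q]" "has ?z p 3 SF" "has ?z q 1 On" for p q
  proof -
    have "has x ?z (Suc 3) Two" by (rule has_binary[OF xz n(5) that(1-4)]) (use bin_Two[OF SF_Fr] in auto)
    then have "has v x (Suc (Suc 3)) SF" by (rule up) (use uni_SF in auto)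
    then show ?thesis by (simp add: numeral_eq_Suc)
  qed
  have no21: False if "nb E W ?z = {x, p, q}" "distinct [x, p, q]" "has ?z p 2 L2" "has ?z q 3 SF" for p q
  proof -
    have colorable by (rule root3[OF n(6) that(1,2) On that(3,4)]) (use sol_OTF[OF _ L2_Tw SF_Fr] in auto)
    then show False using nc by simp
  qed
  show ?thesis
  proof (rule len_cases[OF n(6) m(1)]; rule len_cases[OF n(6) m(2)])
    assume "len ?z p = 3" "len ?z q = 3"
    then show ?thesis using red_two_SF[OF n(6) pq'(3,4)] by blast
  next
    assume "has ?z p 3 SF" "has ?z q 2 L2"
    then show ?thesis using no21[OF pq'(1,2)] by blast
  next
    assume "len ?z p = 3" "has ?z p 3 SF" "has ?z p 2 L2" "len ?z q = 1" "has ?z q 1 On"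
    \<comment> \<open>Used as a leg of length two, the long leg also gives \<open>Fr\<close> at
      depth 4 instead of 5, which keeps later sums of depths within 11.\<close>
    then show ?thesis using S[OF pq] A2[OF pq] s dz(3) by simp
  next
    assume "has ?z p 2 L2" "has ?z q 3 SF"
    then show ?thesis using no21[OF pq] by blast
  next
    assume "len ?z p = 1" "has ?z p 1 On" "len ?z q = 3" "has ?z q 3 SF" "has ?z q 2 L2"
    then show ?thesis using S[OF pq'(1,2)] A2[OF pq'(1,2)] s dz(3) by simp
  next
    assume "len ?z p = 2" "has ?z p 2 L2" "len ?z q = 2" "has ?z q 2 L2"
    have colorable by (rule root3[OF n(6) pq On \<open>has ?z p 2 L2\<close> \<open>has ?z q 2 L2\<close>]) (use sol_OLL in auto)
    then show ?thesis using nc by simp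
  next
    assume "len ?z p = 2" "has ?z p 2 L2" "len ?z q = 1" "has ?z q 1 On"
    then show ?thesis using A2[OF pq] s dz(3) by simp
  next
    assume "len ?z p = 1" "has ?z p 1 On" "len ?z q = 2" "has ?z q 2 L2"
    then show ?thesis using A2[OF pq'(1,2)] s dz(3) by simp
  qed (use dz(2) s nz in simp_all)
qed

end

section \<open>Demands arriving at a vertex\<close>

context min4
begin

text \<open>The combinations of length, demand and branch properties that occur at a vertex of
  degree at least three. Depth 6 arises only from demands passed on by \<open>d2\<close>; it can
  still be combined with depth 5 within the sum 11.\<close>

definition kd :: "'a \<Rightarrow> 'a \<Rightarrow> bool" where
  "kd v x \<longleftrightarrow>
     (len v x = 3 \<and> ex v x = 0 \<and> has v x 5 SF \<and> has v x 5 Fr) \<or>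
     (len v x = 2 \<and> ex v x = 0 \<and> has v x 2 L2 \<and> has v x 5 Tw) \<or>
     (len v x = 1 \<and> ex v x = 0 \<and> has v x 5 On) \<or>
     (len v x = 1 \<and> ex v x = 6 \<and> ex1 v x = 6 \<and> has v x 5 On \<and> has v x 5 Fr \<and> has v x 5 Alt) \<or>
     (len v x = 1 \<and> ex v x = 2 \<and> has v x 5 On \<and> has v x 5 Fr \<and> has v x 5 Alt) \<or>
     (len v x = 1 \<and> ex v x = 1 \<and> has v x 5 On \<and> has v x 6 Fr \<and> has v x 6 Alt) \<or>
     (len v x = 0 \<and> ex v x = 0) \<or>
     (len v x = 0 \<and> ex v x = 12 \<and> has v x 5 Fr \<and> has v x 5 Alt) \<or>
     (len v x = 0 \<and> ex v x = 4 \<and> has v x 5 Tw) \<or>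
     (len v x = 0 \<and> ex v x = 4 \<and> has v x 5 Zd) \<or>
     (len v x = 0 \<and> ex v x = 2 \<and> has v x 6 Fr)"

text \<open>A second-round demand presupposes a demand 6 through another leg \<open>x0\<close>. By
  \<open>d1_mid\<close> the branch at \<open>x0\<close> satisfies \<open>SF\<close>, and the two
  remaining lengths sum to 3 - 1.\<close>

lemma third_leg:
  assumes w: "w \<in> W" "x \<in> nb E W w" and d: "d2 w x \<noteq> 0"
  obtains x0 q where "nb E W w = {x, x0, q}" "distinct [x, x0, q]" "has w x0 5 SF" "has w x0 4 Fr" "len w x + len w q = 2"
    "d1 w x = 0" "deg w = 3"
proof -
  obtain x0 where x0: "deg w = 3" "tot w = 3" "x0 \<in> nb E W w" "x0 \<noteq> x" "len w x0 = 1" "ex1 w x0 = 6"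
    using d unfolding d2_def by (auto split: if_splits)
  obtain p q where pq: "nb E W w = {x, p, q}" "distinct [x, p, q]" using three_of[OF w(1) x0(1) w(2)] .
  have d1: "d1 (nxt w x0) x0 = 6" using x0(5,6) by (simp add: ex1_def)
  have "3 \<le> deg w" using x0(1) by simp
  then have H: "has w x0 5 SF" "has w x0 4 Fr" using d1_mid[OF w(1) x0(3,5)] d1 by auto
  have D: "d1 w x = 0" using x0(2) by (simp add: d1_def)
  show ?thesis
  proof (cases "x0 = p")
    case True
    then show ?thesis using that[of x0 q] pq H tot3[OF pq] x0 D by auto
  next
    case False
    then have "x0 = q" using x0(3,4) pq(1) by auto
    then have "nb E W w = {x, x0, p}" "distinct [x, x0, p]" using pq by auto
    then show ?thesis using that[of x0 p] H tot3[of w x x0 p] x0 D by auto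
  qed
qed

text \<open>First- and second-round demands of the same vertex exclude each other, as they require
  \<open>tot\<close> at least four and equal to three; so they can be treated separately.\<close>

lemma kinds:
  assumes v: "v \<in> W" "x \<in> nb E W v" "3 \<le> deg v"
  shows "kd v x"
proof (rule len_cases[OF v(1,2)])
  assume l: "len v x = 3" "has v x 3 SF"
  then have "has v x 5 SF" by (intro has_depth[OF l(2)]) simp
  moreover have "has v x 5 Fr" using has_mono[OF calculation] SF_Fr by blast
  ultimately show ?thesis using l by (simp add: kd_def ex_def)
next
  assume l: "len v x = 2" "has v x 2 L2"
  have "has v x 5 Tw" by (rule has_depth[OF has_mono[OF l(2)]]) (use L2_Tw in auto)
  then show ?thesis using l by (simp add: kd_def ex_def)
next
  assume l: "len v x = 1" "deg x = 2" "3 \<le> deg (nxt v x)" "has v x 1 On"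
  let ?z = "nxt v x"
  note n = nxt[OF v(1,2) l(2)]
  have On: "has v x 5 On" by (rule has_depth[OF l(4)]) simp
  have e: "ex v x = d1 ?z x + d2 ?z x" "ex1 v x = d1 ?z x" using l(1) by (simp_all add: ex_def ex1_def dm_def)
  show ?thesis
  proof (cases "d1 ?z x = 0")
    case False
    then have d2: "d2 ?z x = 0" unfolding d1_def d2_def by (auto split: if_splits)
    consider "d1 ?z x = 6" "has v x 5 SF" | "d1 ?z x = 2" "has v x 4 Fr" "has v x 4 Alt" using d1_mid[OF v(1,2) l(1) v(3) False] by blast
    then show ?thesis
    proof cases
      case 1
      have "has v x 5 Fr" "has v x 5 Alt" using has_mono[OF 1(2)] SF_Fr SF_Alt by blast+
      then show ?thesis using 1 l On e d2 by (simp add: kd_def)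
    next
      case 2
      have "has v x 5 Fr" "has v x 5 Alt" using has_depth[OF 2(2), of 5] has_depth[OF 2(3), of 5] by simp_all
      then show ?thesis using 2 l On e d2 by (simp add: kd_def)
    qed
  next
    case d1: True
    show ?thesis
    proof (cases "d2 ?z x = 0")
      case True
      then show ?thesis using d1 l On e by (simp add: kd_def)
    next
      case False
      have lz: "len ?z x = 1" using reverse1(2)[OF v l(2)] .
      obtain x0 q where z: "nb E W ?z = {x, x0, q}" "distinct [x, x0, q]" "has ?z x0 4 Fr" "len ?z x + len ?z q = 2"
        using third_leg[OF n(6,4) False] by blast
      have q: "q \<in> nb E W ?z" using z by auto
      have hq: "has ?z q 1 On" using len_cases[OF n(6) q] z(4) lz by auto
      have "has x ?z (Suc 4) Two" by (rule has_binary[OF n(3,5) z(1-3) hq]) (use bin_Two in auto)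
      then have "has v x (Suc (Suc 4)) SF" by (rule has_unary[OF v(2,1) n(1,2)]) (use uni_SF in auto)
      then have S: "has v x 6 SF" by (simp add: numeral_eq_Suc)
      have "has v x 6 Fr" "has v x 6 Alt" using has_mono[OF S] SF_Fr SF_Alt by blast+
      moreover have "d2 ?z x = 1" using False lz unfolding d2_def by (auto split: if_splits)
      ultimately show ?thesis using d1 l On e by (simp add: kd_def)
    qed
  qed
next
  assume l: "len v x = 0" "3 \<le> deg x"
  have x: "x \<in> W" "v \<in> nb E W x" using nb_in[OF v(2)] nb_sym[OF sym v(1,2)] .
  have r: "len x v = 0" using reverse0[OF v(1,3)] .
  have e: "ex v x = d1 x v + d2 x v" using l(1) by (simp add: ex_def dm_def)
  show ?thesis
  proof (cases "d1 x v = 0")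
    case False
    then have d2: "d2 x v = 0" unfolding d1_def d2_def by (auto split: if_splits)
    consider "d1 x v = 12" "has v x 4 Fr" "has v x 4 Alt" | "d1 x v = 4" "has v x 4 Tw" | "d1 x v = 4" "has v x 3 Zd"
      using d1_end[OF v(1,2) l(1) r False] by blast
    then show ?thesis
    proof cases
      case 1
      have "has v x 5 Fr" "has v x 5 Alt" using has_depth[OF 1(2), of 5] has_depth[OF 1(3), of 5] by simp_all
      then show ?thesis using 1 l e d2 by (simp add: kd_def)
    next
      case 2
      have "has v x 5 Tw" using has_depth[OF 2(2), of 5] by simp
      then show ?thesis using 2 l e d2 by (simp add: kd_def)
    next
      case 3
      have "has v x 5 Zd" using has_depth[OF 3(2), of 5] by simp
      then show ?thesis using 3 l e d2 by (simp add: kd_def)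
    qed
  next
    case d1: True
    show ?thesis
    proof (cases "d2 x v = 0")
      case True
      then show ?thesis using d1 l e by (simp add: kd_def)
    next
      case False
      obtain x0 q where z: "nb E W x = {v, x0, q}" "distinct [v, x0, q]" "has x x0 5 SF" "len x v + len x q = 2"
        using third_leg[OF x False] by blast
      have q: "q \<in> nb E W x" using z by auto
      have hq: "has x q 2 L2" using len_cases[OF x(1) q] z(4) r by auto
      have "has v x (Suc 5) (\<lambda>I D. Fr I D \<and> Alt I D)" by (rule has_binary[OF v(2,1) z(1-3) hq]) (use bin_Fr in auto)
      then have S: "has v x 6 (\<lambda>I D. Fr I D \<and> Alt I D)" by simp
      have "has v x 6 Fr" using has_mono[OF S] by blast
      moreover have "d2 x v = 2" using False r unfolding d2_def by (auto split: if_splits)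
      ultimately show ?thesis using d1 l e by (simp add: kd_def)
    qed
  qed
qed

text \<open>Three branches that each spoil at most one color leave a color for \<open>v\<close>;
  only one of them may have depth 6.\<close>

lemma red_TTT:
  assumes "v \<in> W" "nb E W v = {a, b, c}" "distinct [a, b, c]" "has v a 5 Tw \<or> has v a 5 Fr" "has v b 5 Tw \<or> has v b 5 Fr"
    "has v c 5 Tw \<or> has v c 6 Fr"
  shows False
proof -
  have T: "has v x i Tw" if "has v x i Fr" for x i using has_mono[OF that] Fr_Tw by blast
  have "has v a 5 Tw" "has v b 5 Tw" "has v c 6 Tw"
    using assms(4-6) T has_depth[of v c 5 Tw 6] by auto
  then have "has v x (if x = c then 6 else 5) Tw" if "x \<in> {a, b, c}" for x using that by auto
  then show False
    using root_in[OF assms(1), of "{a, b, c}" "\<lambda>x. if x = c then 6 else 5"] nc assms(2,3) by (simp add: sums11_def)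
qed

text \<open>Each implication is a solvable triple of color relations. Where only two branches are
  named, the third neighbor serves as a colored end.\<close>

lemma red3:
  assumes v: "v \<in> W" and n: "nb E W v = {a, b, c}" "distinct [a, b, c]"
  shows "has v a 5 On \<Longrightarrow> has v b 5 Tw \<or> has v b 5 Fr \<Longrightarrow> has v c 6 Fr \<or> has v c 5 Fr \<Longrightarrow> False"
    "has v a 5 Tw \<or> has v a 5 Fr \<Longrightarrow> has v b 5 Tw \<or> has v b 5 Fr \<or> has v b 6 Fr \<Longrightarrow> has v c 5 Zd \<Longrightarrow> False"
    "has v a 5 On \<Longrightarrow> has v b 5 Tw \<or> has v b 5 Fr \<or> has v b 6 Fr \<Longrightarrow> has v c 5 Zd \<Longrightarrow> False"
    "has v a 5 Fr \<or> has v a 6 Fr \<Longrightarrow> has v b 5 Zd \<Longrightarrow> has v c 5 Zd \<Longrightarrow> False"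
    "has v a 5 SF \<Longrightarrow> has v b 5 Alt \<or> has v b 6 Alt \<Longrightarrow> False"
    "has v a 5 SF \<Longrightarrow> has v b 5 SF \<Longrightarrow> False"
    "has v a 2 L2 \<Longrightarrow> has v b 2 L2 \<Longrightarrow> has v c 5 On \<Longrightarrow> False"
proof -
  have T: "has v x i Tw" if "has v x i Fr" for x i using has_mono[OF that] Fr_Tw by blast
  have T6: "has v x 6 Tw" if "has v x 5 Tw \<or> has v x 5 Fr \<or> has v x 6 Fr" for x using that T has_depth[of v x 5 Tw 6] by auto
  have T5: "has v x 5 Tw" if "has v x 5 Tw \<or> has v x 5 Fr" for x using that T by auto
  have F6: "has v x 6 Fr" if "has v x 6 Fr \<or> has v x 5 Fr" for x using that has_depth[of v x 5 Fr 6] by auto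
  have nc': "c \<in> nb E W v" using n by auto
  have perm: "nb E W v = {c, a, b}" "distinct [c, a, b]" using n by auto
  show False if h: "has v a 5 On" "has v b 5 Tw \<or> has v b 5 Fr" "has v c 6 Fr \<or> has v c 5 Fr"
  proof -
    have colorable by (rule root3[OF v n h(1) T5[OF h(2)] F6[OF h(3)]]) (use sol_OTF in auto)
    then show False using nc by simp
  qed
  show False if h: "has v a 5 Tw \<or> has v a 5 Fr" "has v b 5 Tw \<or> has v b 5 Fr \<or> has v b 6 Fr" "has v c 5 Zd"
  proof -
    have colorable by (rule root3[OF v n T5[OF h(1)] T6[OF h(2)] h(3)]) (use sol_TTZ in auto)
    then show False using nc by simp
  qed
  show False if h: "has v a 5 On" "has v b 5 Tw \<or> has v b 5 Fr \<or> has v b 6 Fr" "has v c 5 Zd"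
  proof -
    have colorable by (rule root3[OF v n h(1) T6[OF h(2)] h(3)]) (use sol_OTZ in auto)
    then show False using nc by simp
  qed
  show False if h: "has v a 5 Fr \<or> has v a 6 Fr" "has v b 5 Zd" "has v c 5 Zd"
  proof -
    have "has v a 6 Fr" using h(1) F6 by blast
    then have colorable by (rule root3[OF v n _ h(2,3)]) (use sol_FZZ in auto)
    then show False using nc by simp
  qed
  show SA: False if h: "has v a 5 SF" "has v b 5 Alt \<or> has v b 6 Alt"
  proof -
    have "has v b 6 Alt" using h(2) has_depth[of v b 5 Alt 6] by auto
    then have colorable by (rule root3[OF v n h(1) _ has_end[OF nc']]) (use sol_SAT in auto)
    then show False using nc by simp
  qed
  show False if h: "has v a 5 SF" "has v b 5 SF"
    using SA[OF h(1)] has_mono[OF h(2), of Alt] SF_Alt by blast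
  show False if h: "has v a 2 L2" "has v b 2 L2" "has v c 5 On"
  proof -
    have colorable by (rule root3[OF v perm h(3,1,2)]) (use sol_OLL in auto)
    then show False using nc by simp
  qed
qed

end

section \<open>Case analysis at a vertex of degree three\<close>

text \<open>Purely propositional. The letters will stand for branch properties, \<open>G\<close> for
  \<open>Fr\<close> at depth 6. The last three alternatives are: the budget 28 suffices; the own
  legs are too long but nothing is demanded; a lone demand 6 meets \<open>tot\<close> three. All
  others will be reducible. As one disjunction the claim can be checked for each of the 11 cubed
  cases separately.\<close>

lemma three_legs_cases:
  fixes la lb lc :: nat and ea eb ec :: int
  assumes ka: "(la = 3 \<and> ea = 0 \<and> Sa \<and> Fa) \<or> (la = 2 \<and> ea = 0 \<and> La \<and> Ta) \<or> (la = 1 \<and> ea = 0 \<and> Oa) \<or>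
      (la = 1 \<and> ea = 6 \<and> Oa \<and> Fa \<and> Aa) \<or> (la = 1 \<and> ea = 2 \<and> Oa \<and> Fa \<and> Aa) \<or> (la = 1 \<and> ea = 1 \<and> Oa \<and> Ga \<and> Aa) \<or>
      (la = 0 \<and> ea = 0) \<or> (la = 0 \<and> ea = 12 \<and> Fa \<and> Aa) \<or> (la = 0 \<and> ea = 4 \<and> Ta) \<or> (la = 0 \<and> ea = 4 \<and> Za) \<or> (la = 0 \<and> ea = 2 \<and> Ga)"
    and kb: "(lb = 3 \<and> eb = 0 \<and> Sb \<and> Fb) \<or> (lb = 2 \<and> eb = 0 \<and> Lb \<and> Tb) \<or> (lb = 1 \<and> eb = 0 \<and> Ob) \<or>
      (lb = 1 \<and> eb = 6 \<and> Ob \<and> Fb \<and> Ab) \<or> (lb = 1 \<and> eb = 2 \<and> Ob \<and> Fb \<and> Ab) \<or> (lb = 1 \<and> eb = 1 \<and> Ob \<and> Gb \<and> Ab) \<or>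
      (lb = 0 \<and> eb = 0) \<or> (lb = 0 \<and> eb = 12 \<and> Fb \<and> Ab) \<or> (lb = 0 \<and> eb = 4 \<and> Tb) \<or> (lb = 0 \<and> eb = 4 \<and> Zb) \<or> (lb = 0 \<and> eb = 2 \<and> Gb)"
    and kc: "(lc = 3 \<and> ec = 0 \<and> Sc \<and> Fc) \<or> (lc = 2 \<and> ec = 0 \<and> Lc \<and> Tc) \<or> (lc = 1 \<and> ec = 0 \<and> Oc) \<or>
      (lc = 1 \<and> ec = 6 \<and> Oc \<and> Fc \<and> Ac) \<or> (lc = 1 \<and> ec = 2 \<and> Oc \<and> Fc \<and> Ac) \<or> (lc = 1 \<and> ec = 1 \<and> Oc \<and> Gc \<and> Ac) \<or>
      (lc = 0 \<and> ec = 0) \<or> (lc = 0 \<and> ec = 12 \<and> Fc \<and> Ac) \<or> (lc = 0 \<and> ec = 4 \<and> Tc) \<or> (lc = 0 \<and> ec = 4 \<and> Zc) \<or> (lc = 0 \<and> ec = 2 \<and> Gc)"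
  shows "((Ta \<or> Fa) \<and> (Tb \<or> Fb) \<and> (Tc \<or> Gc \<or> Fc)) \<or>
    ((Ta \<or> Fa) \<and> (Tc \<or> Fc) \<and> (Tb \<or> Gb \<or> Fb)) \<or>
    ((Tb \<or> Fb) \<and> (Tc \<or> Fc) \<and> (Ta \<or> Ga \<or> Fa)) \<or>
    (Oa \<and> (Tb \<or> Fb) \<and> (Gc \<or> Fc)) \<or>
    (Oa \<and> (Tc \<or> Fc) \<and> (Gb \<or> Fb)) \<or>
    (Ob \<and> (Ta \<or> Fa) \<and> (Gc \<or> Fc)) \<or>
    (Ob \<and> (Tc \<or> Fc) \<and> (Ga \<or> Fa)) \<or>
    (Oc \<and> (Ta \<or> Fa) \<and> (Gb \<or> Fb)) \<or>
    (Oc \<and> (Tb \<or> Fb) \<and> (Ga \<or> Fa)) \<or>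
    ((Ta \<or> Fa) \<and> (Tb \<or> Fb \<or> Gb) \<and> Zc) \<or>
    ((Tb \<or> Fb) \<and> (Ta \<or> Fa \<or> Ga) \<and> Zc) \<or>
    ((Ta \<or> Fa) \<and> (Tc \<or> Fc \<or> Gc) \<and> Zb) \<or>
    ((Tc \<or> Fc) \<and> (Ta \<or> Fa \<or> Ga) \<and> Zb) \<or>
    ((Tb \<or> Fb) \<and> (Tc \<or> Fc \<or> Gc) \<and> Za) \<or>
    ((Tc \<or> Fc) \<and> (Tb \<or> Fb \<or> Gb) \<and> Za) \<or>
    (Oa \<and> (Tb \<or> Fb \<or> Gb) \<and> Zc) \<or>
    (Ob \<and> (Ta \<or> Fa \<or> Ga) \<and> Zc) \<or>
    (Oa \<and> (Tc \<or> Fc \<or> Gc) \<and> Zb) \<or>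
    (Oc \<and> (Ta \<or> Fa \<or> Ga) \<and> Zb) \<or>
    (Ob \<and> (Tc \<or> Fc \<or> Gc) \<and> Za) \<or>
    (Oc \<and> (Tb \<or> Fb \<or> Gb) \<and> Za) \<or>
    ((Fa \<or> Ga) \<and> Zb \<and> Zc) \<or>
    ((Fb \<or> Gb) \<and> Za \<and> Zc) \<or>
    ((Fc \<or> Gc) \<and> Za \<and> Zb) \<or>
    (Sa \<and> Ab) \<or>
    (Sa \<and> Ac) \<or>
    (Sb \<and> Aa) \<or>
    (Sb \<and> Ac) \<or>
    (Sc \<and> Aa) \<or>
    (Sc \<and> Ab) \<or>
    (Sa \<and> Sb) \<or>
    (Sa \<and> Sc) \<or>
    (Sb \<and> Sc) \<or>
    (La \<and> Lb \<and> Oc) \<or>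
    (La \<and> Lc \<and> Ob) \<or>
    (Lb \<and> Lc \<and> Oa) \<or>
    (la + lb + lc \<le> 3 \<and> 8 * int (la + lb + lc) + ea + eb + ec \<le> 28) \<or>
    (4 \<le> la + lb + lc \<and> ea = 0 \<and> eb = 0 \<and> ec = 0 \<and> (la = 0 \<or> lb = 0 \<or> lc = 0 \<or> (la = 1 \<and> lb = 1) \<or> (la = 1 \<and> lc = 1) \<or> (lb = 1 \<and> lc = 1))) \<or>
    (la + lb + lc = 3 \<and> ((la = 1 \<and> ea = 6 \<and> eb = 0 \<and> ec = 0) \<or> (lb = 1 \<and> eb = 6 \<and> ea = 0 \<and> ec = 0) \<or> (lc = 1 \<and> ec = 6 \<and> ea = 0 \<and> eb = 0)))"
  using ka kb kc by (elim disjE conjE; simp)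

lemma three_legs_balance:
  fixes la lb lc :: nat and ea eb ec :: int
  assumes ka: "(la = 3 \<and> ea = 0 \<and> Sa \<and> Fa) \<or> (la = 2 \<and> ea = 0 \<and> La \<and> Ta) \<or> (la = 1 \<and> ea = 0 \<and> Oa) \<or>
      (la = 1 \<and> ea = 6 \<and> Oa \<and> Fa \<and> Aa) \<or> (la = 1 \<and> ea = 2 \<and> Oa \<and> Fa \<and> Aa) \<or> (la = 1 \<and> ea = 1 \<and> Oa \<and> Ga \<and> Aa) \<or>
      (la = 0 \<and> ea = 0) \<or> (la = 0 \<and> ea = 12 \<and> Fa \<and> Aa) \<or> (la = 0 \<and> ea = 4 \<and> Ta) \<or> (la = 0 \<and> ea = 4 \<and> Za) \<or> (la = 0 \<and> ea = 2 \<and> Ga)"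
    and kb: "(lb = 3 \<and> eb = 0 \<and> Sb \<and> Fb) \<or> (lb = 2 \<and> eb = 0 \<and> Lb \<and> Tb) \<or> (lb = 1 \<and> eb = 0 \<and> Ob) \<or>
      (lb = 1 \<and> eb = 6 \<and> Ob \<and> Fb \<and> Ab) \<or> (lb = 1 \<and> eb = 2 \<and> Ob \<and> Fb \<and> Ab) \<or> (lb = 1 \<and> eb = 1 \<and> Ob \<and> Gb \<and> Ab) \<or>
      (lb = 0 \<and> eb = 0) \<or> (lb = 0 \<and> eb = 12 \<and> Fb \<and> Ab) \<or> (lb = 0 \<and> eb = 4 \<and> Tb) \<or> (lb = 0 \<and> eb = 4 \<and> Zb) \<or> (lb = 0 \<and> eb = 2 \<and> Gb)"
    and kc: "(lc = 3 \<and> ec = 0 \<and> Sc \<and> Fc) \<or> (lc = 2 \<and> ec = 0 \<and> Lc \<and> Tc) \<or> (lc = 1 \<and> ec = 0 \<and> Oc) \<or>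
      (lc = 1 \<and> ec = 6 \<and> Oc \<and> Fc \<and> Ac) \<or> (lc = 1 \<and> ec = 2 \<and> Oc \<and> Fc \<and> Ac) \<or> (lc = 1 \<and> ec = 1 \<and> Oc \<and> Gc \<and> Ac) \<or>
      (lc = 0 \<and> ec = 0) \<or> (lc = 0 \<and> ec = 12 \<and> Fc \<and> Ac) \<or> (lc = 0 \<and> ec = 4 \<and> Tc) \<or> (lc = 0 \<and> ec = 4 \<and> Zc) \<or> (lc = 0 \<and> ec = 2 \<and> Gc)"
    and TTT: "\<not> ((Ta \<or> Fa) \<and> (Tb \<or> Fb) \<and> (Tc \<or> Gc \<or> Fc))" "\<not> ((Ta \<or> Fa) \<and> (Tc \<or> Fc) \<and> (Tb \<or> Gb \<or> Fb))"
      "\<not> ((Tb \<or> Fb) \<and> (Tc \<or> Fc) \<and> (Ta \<or> Ga \<or> Fa))"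
    and OTF: "\<not> (Oa \<and> (Tb \<or> Fb) \<and> (Gc \<or> Fc))" "\<not> (Oa \<and> (Tc \<or> Fc) \<and> (Gb \<or> Fb))" "\<not> (Ob \<and> (Ta \<or> Fa) \<and> (Gc \<or> Fc))"
      "\<not> (Ob \<and> (Tc \<or> Fc) \<and> (Ga \<or> Fa))" "\<not> (Oc \<and> (Ta \<or> Fa) \<and> (Gb \<or> Fb))" "\<not> (Oc \<and> (Tb \<or> Fb) \<and> (Ga \<or> Fa))"
    and TTZ: "\<not> ((Ta \<or> Fa) \<and> (Tb \<or> Fb \<or> Gb) \<and> Zc)" "\<not> ((Tb \<or> Fb) \<and> (Ta \<or> Fa \<or> Ga) \<and> Zc)" "\<not> ((Ta \<or> Fa) \<and> (Tc \<or> Fc \<or> Gc) \<and> Zb)"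
      "\<not> ((Tc \<or> Fc) \<and> (Ta \<or> Fa \<or> Ga) \<and> Zb)" "\<not> ((Tb \<or> Fb) \<and> (Tc \<or> Fc \<or> Gc) \<and> Za)" "\<not> ((Tc \<or> Fc) \<and> (Tb \<or> Fb \<or> Gb) \<and> Za)"
    and OTZ: "\<not> (Oa \<and> (Tb \<or> Fb \<or> Gb) \<and> Zc)" "\<not> (Ob \<and> (Ta \<or> Fa \<or> Ga) \<and> Zc)" "\<not> (Oa \<and> (Tc \<or> Fc \<or> Gc) \<and> Zb)"
      "\<not> (Oc \<and> (Ta \<or> Fa \<or> Ga) \<and> Zb)" "\<not> (Ob \<and> (Tc \<or> Fc \<or> Gc) \<and> Za)" "\<not> (Oc \<and> (Tb \<or> Fb \<or> Gb) \<and> Za)"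
    and FZZ: "\<not> ((Fa \<or> Ga) \<and> Zb \<and> Zc)" "\<not> ((Fb \<or> Gb) \<and> Za \<and> Zc)" "\<not> ((Fc \<or> Gc) \<and> Za \<and> Zb)"
    and SA: "\<not> (Sa \<and> Ab)" "\<not> (Sa \<and> Ac)" "\<not> (Sb \<and> Aa)" "\<not> (Sb \<and> Ac)" "\<not> (Sc \<and> Aa)" "\<not> (Sc \<and> Ab)"
    and SS: "\<not> (Sa \<and> Sb)" "\<not> (Sa \<and> Sc)" "\<not> (Sb \<and> Sc)"
    and LLO: "\<not> (La \<and> Lb \<and> Oc)" "\<not> (La \<and> Lc \<and> Ob)" "\<not> (Lb \<and> Lc \<and> Oa)"
  shows "(la + lb + lc \<le> 3 \<and> 8 * int (la + lb + lc) + ea + eb + ec \<le> 28) \<or>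
    (4 \<le> la + lb + lc \<and> ea = 0 \<and> eb = 0 \<and> ec = 0 \<and> (la = 0 \<or> lb = 0 \<or> lc = 0 \<or> (la = 1 \<and> lb = 1) \<or> (la = 1 \<and> lc = 1) \<or> (lb = 1 \<and> lc = 1))) \<or>
    (la + lb + lc = 3 \<and> ((la = 1 \<and> ea = 6 \<and> eb = 0 \<and> ec = 0) \<or> (lb = 1 \<and> eb = 6 \<and> ea = 0 \<and> ec = 0) \<or> (lc = 1 \<and> ec = 6 \<and> ea = 0 \<and> eb = 0)))"
  using three_legs_cases[OF ka kb kc] by (simp only: TTT OTF TTZ OTZ FZZ SA SS LLO simp_thms)

context min4
begin

text \<open>A vertex of degree three has 28 units and owes 8 per vertex of its legs. The deficit is
  demanded in full from an adjacent vertex of degree at least three, or in halves across two legs of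
  length one.\<close>

lemma dm_four:
  assumes v: "v \<in> W" and n: "nb E W v = {a, b, c}" "distinct [a, b, c]" and s: "4 \<le> tot v"
    and z: "len v a = 0 \<or> (len v a = 1 \<and> len v b = 1)"
  shows "8 * int (tot v) - 28 \<le> dm v a + dm v b + dm v c"
proof -
  have t: "tot v = len v a + len v b + len v c" "deg v = 3" using tot3[OF n] .
  show ?thesis
  proof (cases "\<exists>x\<in>{a, b, c}. len v x = 0")
    case True
    then obtain x where x: "x \<in> {a, b, c}" "len v x = 0" by blast
    then have "8 * int (tot v) - 28 \<le> dm v x" using s t(2) d_nonneg(2)[of v x] by (simp add: dm_def d1_def)
    then show ?thesis using x(1) d_nonneg(3)[of v a] d_nonneg(3)[of v b] d_nonneg(3)[of v c] by auto
  next
    case False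
    then have "len v a = 1" "len v b = 1" "\<forall>x'\<in>nb E W v. len v x' \<noteq> 0" using z n(1) by auto
    then have "d1 v a = 4 * int (tot v) - 14" "d1 v b = 4 * int (tot v) - 14" using s t(2) by (simp_all add: d1_def)
    then show ?thesis using d_nonneg(2)[of v a] d_nonneg(2)[of v b] d_nonneg(3)[of v c] by (simp add: dm_def)
  qed
qed

text \<open>With \<open>tot v = 3\<close> there remain 28 - 24 = 4 units, so the demand 6 leaves a
  deficit of 2. The other legs have lengths 1 and 1, or 0 and 2, which is why \<open>d2\<close>
  demands 1 twice or 2 once.\<close>

lemma dm_three:
  assumes v: "v \<in> W" and n: "nb E W v = {a, b, c}" "distinct [a, b, c]" and s: "tot v = 3"
    and e: "len v a = 1" "ex1 v a = 6" "ex v b = 0" "ex v c = 0"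
  shows "2 \<le> dm v a + dm v b + dm v c"
proof -
  have t: "len v b + len v c = 2" "deg v = 3" using tot3[OF n] s e(1) by auto
  have "ex1 v b = 0" "ex1 v c = 0" using ex1_le[of v b] ex1_le[of v c] d_nonneg(4)[of v b] d_nonneg(4)[of v c] e(3,4) by auto
  then have "\<exists>x0\<in>nb E W v. x0 \<noteq> x \<and> len v x0 = 1 \<and> ex1 v x0 = 6 \<and> (\<forall>x'\<in>nb E W v. x' \<noteq> x0 \<longrightarrow> ex1 v x' = 0)" if "x \<noteq> a" for x
    using n e(1,2) that by auto
  then have d: "d2 v x = (if len v x = 1 then 1 else if len v x = 0 then 2 else 0)" if "x \<noteq> a" for x
    using that t(2) s unfolding d2_def by presburger
  have "b \<noteq> a" "c \<noteq> a" using n(2) by auto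
  then have "2 \<le> d2 v b + d2 v c" using d[of b] d[of c] t(1) by (auto split: if_splits)
  then show ?thesis using d_nonneg(3)[of v a] d_nonneg(1)[of v b] d_nonneg(1)[of v c] by (simp add: dm_def)
qed

text \<open>Irreducibility leaves only a sufficient budget or a deficit covered by
  \<open>dm_four\<close> or \<open>dm_three\<close>. The permuted neighbor lists supply the
  symmetric versions of each reducible configuration.\<close>

lemma balance3:
  assumes v: "v \<in> W" "deg v = 3"
  shows "(\<Sum>x\<in>nb E W v. 8 * int (len v x) + ex v x) \<le> 28 + (\<Sum>x\<in>nb E W v. dm v x)"
proof -
  obtain a b c where n: "nb E W v = {a, b, c}" "distinct [a, b, c]" using v(2) by (auto simp: card_3_iff)
  have p: "nb E W v = {a, c, b}" "distinct [a, c, b]" "nb E W v = {b, a, c}" "distinct [b, a, c]"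
    "nb E W v = {b, c, a}" "distinct [b, c, a]" "nb E W v = {c, a, b}" "distinct [c, a, b]"
    "nb E W v = {c, b, a}" "distinct [c, b, a]" using n by auto
  have t: "tot v = len v a + len v b + len v c" using tot3[OF n] by simp
  have k: "kd v a" "kd v b" "kd v c" using kinds[OF v(1)] v(2) n(1) by auto
  note R = red3[OF v(1)] and T = red_TTT[OF v(1)]
  have B: "(len v a + len v b + len v c \<le> 3 \<and> 8 * int (len v a + len v b + len v c) + ex v a + ex v b + ex v c \<le> 28) \<or>
    (4 \<le> len v a + len v b + len v c \<and> ex v a = 0 \<and> ex v b = 0 \<and> ex v c = 0 \<and>
      (len v a = 0 \<or> len v b = 0 \<or> len v c = 0 \<or> (len v a = 1 \<and> len v b = 1) \<or> (len v a = 1 \<and> len v c = 1) \<or> (len v b = 1 \<and> len v c = 1))) \<or>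
    (len v a + len v b + len v c = 3 \<and> ((len v a = 1 \<and> ex v a = 6 \<and> ex v b = 0 \<and> ex v c = 0) \<or>
      (len v b = 1 \<and> ex v b = 6 \<and> ex v a = 0 \<and> ex v c = 0) \<or> (len v c = 1 \<and> ex v c = 6 \<and> ex v a = 0 \<and> ex v b = 0)))"
    apply (rule three_legs_balance[where
      Sa = "has v a 5 SF" and Fa = "has v a 5 Fr" and La = "has v a 2 L2" and Ta = "has v a 5 Tw" and Oa = "has v a 5 On"
      and Aa = "has v a 5 Alt \<or> has v a 6 Alt" and Ga = "has v a 6 Fr" and Za = "has v a 5 Zd" and
      Sb = "has v b 5 SF" and Fb = "has v b 5 Fr" and Lb = "has v b 2 L2" and Tb = "has v b 5 Tw" and Ob = "has v b 5 On"
      and Ab = "has v b 5 Alt \<or> has v b 6 Alt" and Gb = "has v b 6 Fr" and Zb = "has v b 5 Zd" and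
      Sc = "has v c 5 SF" and Fc = "has v c 5 Fr" and Lc = "has v c 2 L2" and Tc = "has v c 5 Tw" and Oc = "has v c 5 On"
      and Ac = "has v c 5 Alt \<or> has v c 6 Alt" and Gc = "has v c 6 Fr" and Zc = "has v c 5 Zd"])
    subgoal using k(1) unfolding kd_def by (elim disjE conjE) simp_all
    subgoal using k(2) unfolding kd_def by (elim disjE conjE) simp_all
    subgoal using k(3) unfolding kd_def by (elim disjE conjE) simp_all
    subgoal using T[OF n] has_depth[of v c 5 Fr 6] by auto
    subgoal using T[OF p(1,2)] has_depth[of v b 5 Fr 6] by auto
    subgoal using T[OF p(5,6)] has_depth[of v a 5 Fr 6] by auto
    subgoal using R(1)[OF n] by blast
    subgoal using R(1)[OF p(1,2)] by blast
    subgoal using R(1)[OF p(3,4)] by blast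
    subgoal using R(1)[OF p(5,6)] by blast
    subgoal using R(1)[OF p(7,8)] by blast
    subgoal using R(1)[OF p(9,10)] by blast
    subgoal using R(2)[OF n] by blast
    subgoal using R(2)[OF p(3,4)] by blast
    subgoal using R(2)[OF p(1,2)] by blast
    subgoal using R(2)[OF p(7,8)] by blast
    subgoal using R(2)[OF p(5,6)] by blast
    subgoal using R(2)[OF p(9,10)] by blast
    subgoal using R(3)[OF n] by blast
    subgoal using R(3)[OF p(3,4)] by blast
    subgoal using R(3)[OF p(1,2)] by blast
    subgoal using R(3)[OF p(7,8)] by blast
    subgoal using R(3)[OF p(5,6)] by blast
    subgoal using R(3)[OF p(9,10)] by blast
    subgoal using R(4)[OF n] by blast
    subgoal using R(4)[OF p(3,4)] by blast
    subgoal using R(4)[OF p(7,8)] by blast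
    subgoal using R(5)[OF n] by blast
    subgoal using R(5)[OF p(1,2)] by blast
    subgoal using R(5)[OF p(3,4)] by blast
    subgoal using R(5)[OF p(5,6)] by blast
    subgoal using R(5)[OF p(7,8)] by blast
    subgoal using R(5)[OF p(9,10)] by blast
    subgoal using R(6)[OF n] by blast
    subgoal using R(6)[OF p(1,2)] by blast
    subgoal using R(6)[OF p(5,6)] by blast
    subgoal using R(7)[OF n] by blast
    subgoal using R(7)[OF p(1,2)] by blast
    subgoal using R(7)[OF p(5,6)] by blast
    done
  have e6: "ex1 v x = 6" if "kd v x" "len v x = 1" "ex v x = 6" for x using that unfolding kd_def by auto
  have S: "(\<Sum>x\<in>nb E W v. f x) = f a + f b + f c" for f :: "'a \<Rightarrow> int" unfolding n(1) using n(2) by simp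
  note nn = d_nonneg(3)[of v a] d_nonneg(3)[of v b] d_nonneg(3)[of v c]
  from B consider (low) "8 * int (tot v) + ex v a + ex v b + ex v c \<le> 28"
    | (four) "4 \<le> tot v" "ex v a = 0" "ex v b = 0" "ex v c = 0"
      "len v a = 0 \<or> len v b = 0 \<or> len v c = 0 \<or> (len v a = 1 \<and> len v b = 1) \<or> (len v a = 1 \<and> len v c = 1) \<or> (len v b = 1 \<and> len v c = 1)"
    | (ta) "tot v = 3" "len v a = 1" "ex v a = 6" "ex v b = 0" "ex v c = 0"
    | (tb) "tot v = 3" "len v b = 1" "ex v b = 6" "ex v a = 0" "ex v c = 0"
    | (tc) "tot v = 3" "len v c = 1" "ex v c = 6" "ex v a = 0" "ex v b = 0" unfolding t by blast
  then show ?thesis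
  proof cases
    case low
    then show ?thesis unfolding S using nn t by simp
  next
    case four
    have "8 * int (tot v) - 28 \<le> dm v a + dm v b + dm v c"
      using four(5) dm_four[OF v(1) n four(1)] dm_four[OF v(1) p(3,4) four(1)] dm_four[OF v(1) p(7,8) four(1)]
        dm_four[OF v(1) p(1,2) four(1)] dm_four[OF v(1) p(5,6) four(1)] by auto
    then show ?thesis unfolding S using four(2-4) t by simp
  next
    case ta
    then show ?thesis unfolding S using dm_three[OF v(1) n ta(1,2) e6[OF k(1) ta(2,3)] ta(4,5)] t by simp
  next
    case tb
    then show ?thesis unfolding S using dm_three[OF v(1) p(3,4) tb(1,2) e6[OF k(2) tb(2,3)] tb(4,5)] t by simp
  next
    case tc
    then show ?thesis unfolding S using dm_three[OF v(1) p(7,8) tc(1,2) e6[OF k(3) tc(2,3)] tc(4,5)] t by simp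
  qed
qed

end

section \<open>Final charges for four colors\<close>

context min4
begin

lemma cost:
  assumes "kd v x"
  shows "8 * int (len v x) + ex v x \<le> 24" "len v x \<noteq> 3 \<Longrightarrow> 8 * int (len v x) + ex v x \<le> 16" "len v x = 3 \<Longrightarrow> has v x 5 SF \<and> has v x 5 Fr"
    "len v x \<noteq> 3 \<Longrightarrow> 9 < 8 * int (len v x) + ex v x \<Longrightarrow> has v x 5 Tw \<or> has v x 5 Fr"
    "len v x \<noteq> 3 \<Longrightarrow> 8 < 8 * int (len v x) + ex v x \<Longrightarrow> has v x 5 Tw \<or> has v x 5 Fr \<or> has v x 6 Fr"
  using assms unfolding kd_def by (elim disjE conjE; simp)+

text \<open>At least two branches do not have length three, by \<open>root_end\<close>. These cost
  at most 16, the others at most 24, which is within 44 deg - 104 unless the degree is four and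
  exactly two have length three. The budget is then 72, and if the other two cost more than 24
  together, both satisfy \<open>Tw\<close> and \<open>root_in\<close> applies.\<close>

lemma balance4:
  assumes v: "v \<in> W" "4 \<le> deg v"
  shows "(\<Sum>x\<in>nb E W v. 8 * int (len v x) + ex v x) \<le> 44 * int (deg v) - 104"
proof -
  let ?X = "nb E W v" and ?c = "\<lambda>x. 8 * int (len v x) + ex v x"
  have k: "kd v x" if "x \<in> ?X" for x using kinds[OF v(1) that] v(2) by simp
  have fX: "finite ?X" using fin by simp
  let ?S = "{x \<in> ?X. len v x = 3}"
  have S: "has v x 5 SF" "has v x 5 Fr" if "x \<in> ?S" for x using cost(3)[OF k[of x]] that by auto
  have noS: False if "z \<in> ?X" "?X - {z} \<subseteq> ?S" for z
    using root_end[OF v(1) that(1), of "\<lambda>_. 5"] S(1) that(2) nc by (auto simp: sums11_def)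
  have fS: "finite ?S" using fX by simp
  have split: "(\<Sum>x\<in>?X. ?c x) = (\<Sum>x\<in>?S. ?c x) + (\<Sum>x\<in>?X - ?S. ?c x)"
    using sum.subset_diff[of ?S ?X ?c] fX by simp
  have s1: "(\<Sum>x\<in>?S. ?c x) \<le> int (card ?S) * 24" 
    by (rule sum_bounded_above) (use cost(1)[OF k] in blast)
  have s2: "(\<Sum>x\<in>?X - ?S. ?c x) \<le> int (card (?X - ?S)) * 16" 
    by (rule sum_bounded_above) (use cost(2)[OF k] in blast)
  have cd: "card (?X - ?S) + card ?S = deg v" using card_Diff_subset[OF fS, of ?X] card_mono[OF fX, of ?S] by simp
  have two: "2 \<le> card (?X - ?S)"
  proof (rule ccontr)
    assume "\<not> ?thesis"
    then have "card (?X - ?S) \<le> Suc 0" by simp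
    moreover have "finite (?X - ?S)" using fX by simp
    ultimately have one: "\<forall>x\<in>?X - ?S. \<forall>y\<in>?X - ?S. x = y" using card_le_Suc0_iff_eq by blast
    have "?X \<noteq> {}" using v(2) by auto
    then obtain z where "z \<in> ?X" "?X - ?S \<noteq> {} \<longrightarrow> z \<in> ?X - ?S" by blast
    then have "z \<in> ?X" "?X - {z} \<subseteq> ?S" using one by blast+
    then show False by (rule noS)
  qed
  show ?thesis
  proof (cases "deg v = 4 \<and> card ?S = 2")
    case False
    then show ?thesis using split s1 s2 cd two v(2) by auto
  next
    case True
    then have "card (?X - ?S) = 2" using cd by simp
    then obtain p q where pq: "?X - ?S = {p, q}" "p \<noteq> q" by (auto simp: card_2_iff)
    have p: "p \<in> ?X" "q \<in> ?X" "len v p \<noteq> 3" "len v q \<noteq> 3" using pq(1) by blast+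
    have "?c p + ?c q \<le> 24"
    proof (rule ccontr)
      assume n: "\<not> ?thesis"
      have T: "has v x i Tw" if "has v x i Fr" for x i using has_mono[OF that] Fr_Tw by blast
      have no: False if h: "?X - ?S = {p, q}" "p \<noteq> q" "has v p 5 Tw" "has v q 6 Tw" for p q
      proof -
        have "x \<in> ?S" if "x \<in> ?X - {p, q}" for x using that h(1) by blast
        then have "has v x (if x = q then 6 else 5) Fr" if "x \<in> ?X - {p, q}" for x using S(2)[of x] that by auto
        moreover have "has v x (if x = q then 6 else 5) Tw" if "x \<in> {p, q}" for x using h that by auto
        moreover have "{p, q} \<subseteq> ?X" using h(1) by blast
        moreover have "card {p, q} \<le> 3" using h(2) by simp
        moreover have "sums11 ?X (\<lambda>x. if x = q then 6 else 5)" by (simp add: sums11_def)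
        ultimately have colorable using root_in[OF v(1)] by blast
        then show False using nc by simp
      qed
      have c: "?c p \<le> 16" "?c q \<le> 16" using cost(2)[OF k[OF p(1)] p(3)] cost(2)[OF k[OF p(2)] p(4)] .
      have G: "has v x 6 Tw" if "x \<in> ?X" "len v x \<noteq> 3" "8 < ?c x" for x
        using cost(5)[OF k[OF that(1)] that(2,3)] T has_depth[of v x 5 Tw 6] by auto
      have H: "has v x 5 Tw" if "x \<in> ?X" "len v x \<noteq> 3" "9 < ?c x" for x
        using cost(4)[OF k[OF that(1)] that(2,3)] T by auto
      show False
      \<comment> \<open>Only one branch may have depth 6. Cost 9 belongs to depth 6, and next to a
        cost of at most 9 the other one is at least 16, which belongs to depth 5.\<close>
      proof (cases "9 < ?c p")
        case True
        then have "has v p 5 Tw" "has v q 6 Tw" using H[OF p(1,3)] G[OF p(2,4)] n c by auto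
        then show False using no[OF pq] by blast
      next
        case False
        then have "has v q 5 Tw" "has v p 6 Tw" using H[OF p(2,4)] G[OF p(1,3)] n c by auto
        moreover have "?X - ?S = {q, p}" using pq(1) by auto
        ultimately show False using no[of q p] pq(2) by blast
      qed
    qed
    then have "(\<Sum>x\<in>?X - ?S. ?c x) \<le> 24" unfolding pq(1) using pq(2) by simp
    then show ?thesis using split s1 True by simp
  qed
qed

definition mid :: "'a \<Rightarrow> bool" where
  "mid y \<longleftrightarrow> deg y = 2 \<and> (\<forall>w\<in>nb E W y. deg w = 2)"

text \<open>In the scale 44 deg - 104 a vertex of degree two lacks 16. Each end of a thread pays 8
  to its neighbor if the thread has one vertex, 16 if it has two, and 24 if it has three, where the
  neighbor passes 8 on to the middle. Demands travel along direct edges and across threads of one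
  vertex.\<close>

definition flow :: "'a \<Rightarrow> 'a \<Rightarrow> int" where
  "flow v w = (if 3 \<le> deg v then 8 * int (len v w) + ex v w else if 3 \<le> deg w then dm w v else if mid w then 8 else 0)"

lemma nxt_eq: "v \<in> W \<Longrightarrow> x \<in> nb E W v \<Longrightarrow> nb E W x = {v, w} \<Longrightarrow> w \<noteq> v \<Longrightarrow> nxt v x = w"
  unfolding nxt_def by (intro the_equality) (auto simp: doubleton_eq_iff)

lemma balance_big:
  assumes v: "v \<in> W" "3 \<le> deg v"
  shows "0 \<le> 44 * int (deg v) - 104 + (\<Sum>w\<in>nb E W v. flow w v) - (\<Sum>w\<in>nb E W v. flow v w)"
proof -
  have "flow w v = dm v w" if "w \<in> nb E W v" for w
    using reverse0[OF v, of w] v(2) by (simp add: flow_def ex_def)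
  then have i: "(\<Sum>w\<in>nb E W v. flow w v) = (\<Sum>w\<in>nb E W v. dm v w)" by simp
  have o: "(\<Sum>w\<in>nb E W v. flow v w) = (\<Sum>w\<in>nb E W v. 8 * int (len v w) + ex v w)" using v(2) by (simp add: flow_def)
  show ?thesis
  proof (cases "deg v = 3")
    case True
    then show ?thesis using balance3[OF v(1) True] unfolding i o by simp
  next
    case False
    have "0 \<le> (\<Sum>w\<in>nb E W v. dm v w)" using d_nonneg(3) by (intro sum_nonneg) auto
    then show ?thesis using balance4[OF v(1)] False v(2) unfolding i o by simp
  qed
qed

lemma balance_two:
  assumes y: "y \<in> W" "deg y = 2"
  shows "(\<Sum>w\<in>nb E W y. flow w y) - (\<Sum>w\<in>nb E W y. flow y w) = 16"
proof -
  obtain p q where pq: "nb E W y = {p, q}" "p \<noteq> q" using y(2) by (auto simp: card_2_iff)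
  have n: "p \<in> nb E W y" "q \<in> nb E W y" using pq by auto
  have W: "p \<in> W" "q \<in> W" using n nb_in by fast+
  have yn: "y \<in> nb E W p" "y \<in> nb E W q" using nb_sym[OF sym y(1)] n by auto
  have S: "(\<Sum>w\<in>nb E W y. f w) = f p + f q" for f :: "'a \<Rightarrow> int" unfolding pq(1) using pq(2) by simp
  have d: "3 \<le> deg p \<or> deg p = 2" "3 \<le> deg q \<or> deg q = 2" using deg_ge_2[OF W(1)] deg_ge_2[OF W(2)] by auto
  have x: "nxt p y = q" "nxt q y = p" using nxt_eq[OF W(1) yn(1)] nxt_eq[OF W(2) yn(2)] pq by auto
  have one: "flow p y + flow q y - flow y p - flow y q = 16"
    if pq: "nb E W y = {p, q}" "p \<noteq> q" "3 \<le> deg p" "deg q = 2" "nxt p y = q" "p \<in> W" "q \<in> W" for p q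
  proof -
    have qy: "q \<in> nb E W y" "y \<in> nb E W q" using pq nb_sym[OF sym y(1), of q] by auto
    let ?r = "nxt y q"
    have r: "nb E W q = {y, ?r}" using nxt(1)[OF y(1) qy(1) pq(4)] .
    have l: "len p y = (if deg ?r = 2 then 3 else 2)" using y(2) pq(4,5) by (simp add: len_def)
    have m: "mid q \<longleftrightarrow> deg ?r = 2" using r y(2) pq(4) by (auto simp: mid_def)
    have my: "\<not> mid y" using pq(1,3) by (auto simp: mid_def)
    \<comment> \<open>Threads of more than one vertex carry no demands.\<close>
    have "dm p y = 0" using l by (auto simp: dm_def d1_def d2_def split: if_splits)
    then show ?thesis using l m my pq(3,4) y(2) by (simp add: flow_def ex_def)
  qed
  show ?thesis unfolding S
  proof (cases "3 \<le> deg p"; cases "3 \<le> deg q")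
    assume a: "3 \<le> deg p" "3 \<le> deg q"
    have "len p y = 1" "len q y = 1" using a x y(2) by (simp_all add: len_def)
    then show "flow p y + flow q y - (flow y p + flow y q) = 16" using a x y(2) by (simp add: flow_def ex_def)
  next
    assume a: "3 \<le> deg p" "\<not> 3 \<le> deg q"
    then show "flow p y + flow q y - (flow y p + flow y q) = 16" using one[OF pq a(1) _ x(1) W] d(2) by simp
  next
    assume a: "\<not> 3 \<le> deg p" "3 \<le> deg q"
    have "nb E W y = {q, p}" using pq(1) by auto
    then show "flow p y + flow q y - (flow y p + flow y q) = 16" using one[of q p] pq(2) a x(2) W d(1) by simp
  next
    assume "\<not> 3 \<le> deg p" "\<not> 3 \<le> deg q"
    then have a: "deg p = 2" "deg q = 2" using d by auto
    have "mid y" using y(2) pq(1) a by (simp add: mid_def)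
    moreover have "\<not> mid p"
    proof
      assume "mid p"
      moreover have "nxt y p \<in> nb E W p" using nxt(3)[OF y(1) n(1) a(1)] .
      ultimately have "deg (nxt y p) = 2" by (simp add: mid_def)
      then have "len q y = 3" using y(2) x(2) a(1) by (simp add: len_def)
      then show False using no_four[OF W(2) a(2) yn(2)] by simp
    qed
    moreover have "\<not> mid q"
    proof
      assume "mid q"
      moreover have "nxt y q \<in> nb E W q" using nxt(3)[OF y(1) n(2) a(2)] .
      ultimately have "deg (nxt y q) = 2" by (simp add: mid_def)
      then have "len p y = 3" using y(2) x(1) a(2) by (simp add: len_def)
      then show False using no_four[OF W(1) a(1) yn(1)] by simp
    qed
    ultimately show "flow p y + flow q y - (flow y p + flow y q) = 16" using a y(2) by (simp add: flow_def)
  qed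
qed

lemma dense: "26 * card W \<le> 11 * ar E W"
proof -
  have "0 \<le> 44 * int (deg v) - 104 + (\<Sum>w\<in>nb E W v. flow w v) - (\<Sum>w\<in>nb E W v. flow v w)" if "v \<in> W" for v
  proof (cases "deg v = 2")
    case True
    then show ?thesis using balance_two[OF that True] by simp
  next
    case False
    then show ?thesis using balance_big[OF that] deg_ge_2[OF that] by simp
  qed
  then have "0 \<le> (\<Sum>v\<in>W. 44 * int (deg v) - 104 + (\<Sum>w\<in>nb E W v. flow w v) - (\<Sum>w\<in>nb E W v. flow v w))"
    by (rule sum_nonneg)
  also have "\<dots> = 44 * int (ar E W) - 104 * int (card W)"
    using discharge[OF sym fin, of flow] by (simp add: sum.distrib sum_subtractf ar_sum[OF fin] sum_distrib_left)
  finally show ?thesis by simp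
qed

end

lemma four_colors:
  assumes sym: "sym E" and irr: "irrefl E" and girth: "girth_ge E 13" and "finite W"
    and "\<And>H. H \<subseteq> W \<Longrightarrow> H \<noteq> {} \<Longrightarrow> 11 * ar E H < 26 * card H"
  shows "\<exists>c A. good 4 E (\<lambda>_. 2) W c A"
  using assms(4,5)
proof (induction "card W" arbitrary: W rule: less_induct)
  case (less W)
  show ?case
  proof (rule ccontr)
    assume n: "\<not> ?case"
    interpret min4 E W
    proof
      fix R assume R: "R \<subset> W"
      show "\<exists>c A. good 4 E (\<lambda>_. 2) R c A"
      proof (rule less(1))
        show "card R < card W" using R less(2) by (rule psubset_card_mono[rotated])
        show "finite R" using R less(2) finite_subset by blast
        show "11 * ar E H < 26 * card H" if "H \<subseteq> R" "H \<noteq> {}" for H using less(3)[of H] that R by auto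
      qed
    qed (use sym irr girth less(2) n in auto)
    have "W \<noteq> {}" using n good_empty by blast
    then show False using less(3)[of W] dense by simp
  qed
qed

theorem corollary3:
  fixes G :: "('a, 'b) pre_digraph"
  assumes "graph G" and "planar G"
  shows "(girth G \<ge> 13 \<longrightarrow> star_chromatic_number G \<le> 4) \<and>
         (girth G \<ge> 9 \<longrightarrow> star_chromatic_number G \<le> 5) \<and>
         (girth G \<ge> 8 \<longrightarrow> star_chromatic_number G \<le> 6)"
proof (intro conjI impI)
  note r = graph_rel[OF assms(1)]
  have bound: "star_chromatic_number G \<le> k" if ex: "\<exists>c A. good k (arcs_ends G) q (verts G) c A" for k q
  proof -
    obtain c A where "good k (arcs_ends G) q (verts G) c A" using ex by blast
    then obtain D where D: "star_orient (arcs_ends G) (verts G) c D" "\<forall>u\<in>verts G. c u < k"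
      using good_star_orient by blast
    show ?thesis by (rule star_chromatic_le[OF assms(1) D(1)]) (use D(2) in blast)
  qed
  {
    assume "13 \<le> girth G"
    then have g: "enat 13 \<le> girth G" by (simp add: numeral_eq_enat)
    have "11 * ar (arcs_ends G) H < 26 * card H" if "H \<subseteq> verts G" "H \<noteq> {}" for H
      using planar_density[OF assms g that] by linarith
    then show "star_chromatic_number G \<le> 4"
      using bound[OF four_colors[OF r(2,3) girth_list[OF assms(1) g] r(1)]] by blast
  next
    assume "9 \<le> girth G"
    then have g: "enat 9 \<le> girth G" by (simp add: numeral_eq_enat)
    have "0 < rho (w5 {}) 7 (arcs_ends G) H" if "H \<subseteq> verts G" "H \<noteq> {}" for H
    proof -
      have "7 * ar (arcs_ends G) H < 18 * card H" using planar_density[OF assms g that] by linarith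
      then have "7 * int (ar (arcs_ends G) H) < 18 * int (card H)" by linarith
      then show ?thesis by (simp add: rho_def w5_def)
    qed
    \<comment> \<open>Initially no vertex is restricted, so the strict bound yields both parts of
      \<open>dense5\<close>.\<close>
    then have "dense5 (arcs_ends G) {} (verts G)" unfolding dense5_def by (metis order_less_imp_le order_refl rho_empty)
    then show "star_chromatic_number G \<le> 5"
      by (intro bound[OF five_colors[OF r(2,3) girth_list[OF assms(1) g] r(1)]])
  next
    assume "8 \<le> girth G"
    then have g: "enat 8 \<le> girth G" by (simp add: numeral_eq_enat)
    have "3 * ar (arcs_ends G) H < 8 * card H" if "H \<subseteq> verts G" "H \<noteq> {}" for H
      using planar_density[OF assms g that] by linarith
    then show "star_chromatic_number G \<le> 6"
      using bound[OF six_colors[OF r(2,3) r(1)]] by blast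
  }
qed

end
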